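(* For $j=1,2$, let $f_j\in H^1(\mathbb{R}^3)$ be not identically zero and let $c_j\in L^\infty(\mathbb{R}^3)$ be an admissible sound speed coefficient, such that $\mathrm{supp}(f_j)\cup\mathrm{supp}(c_1-c_2)\subset\overline{\Omega}$ and $c_j$ is constant on $\mathbb{R}^3\setminus\overline{\Omega}$. Let $u_j$ be the solution of $$c_j^{-2}(x)\partial_t^2u_j+\mathcal A u_j=0\ \text{ in }\mathbb{R}_+\times\mathbb{R}^3,\qquad u_j(0,\cdot)=f_j,\quad \partial_tu_j(0,\cdot)=0 ,$$ and assume that $u_1(t,x)=u_2(t,x)$ for $t\in\mathbb{R}_+$, $x\in\partial\Omega$. Let $\delta>0$ be such that, for $j=1,2$, there is $C>0$ for which, for all $f\in H^1(\mathbb{R}^3)$, $g\in L^2(\mathbb{R}^3)$ with $\mathrm{supp}(f)\cup\mathrm{supp}(g)\subset\overline\Omega$, the solution $w$ of $c_j^{-2}\partial_t^2w+\mathcal A w=0$ in $\mathbb{R}_+\times\mathbb{R}^3$, $w(0,\cdot)=f$, $\partial_tw(0,\cdot)=g$ satisfies $$\|(w(t,\cdot),\partial_tw(t,\cdot))\|_{H^1(B_{R_0})\times L^2(B_{R_0})}\le Ce^{-\delta t}\big(\|f\|_{H^1(\mathbb{R}^3)}+\|g\|_{L^2(\mathbb{R}^3)}\big),\quad t>0.$$ Then the set $NTE(c_1,c_2,\delta)$, of those $\tau\in\mathbb C$ with $\mathrm{Im}(\tau)\in(-\delta,\delta)$ which are not eigenvalues of the transmission eigenvalues problem associated with $c_1,c_2$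 on $\Omega$, is at most a discrete set of isolated points of the strip $\{\tau\in\mathbb C:\mathrm{Im}(\tau)\in(-\delta,\delta)\}$.
   Context: Transmission eigenvalues. $\tau\in\mathbb C$ is called an eigenvalue of the transmission eigenvalues problem associated with $c_1,c_2\in L^\infty(\mathbb{R}^3)$ on $\Omega$ if there is a non-zero pair $(w_1,w_2)\in H^1(\Omega)^2$ satisfying $$\mathcal A w_1-\tau^2c_1^{-2}w_1=0\ \text{in }\Omega,\quad \mathcal A w_2-\tau^2c_2^{-2}w_2=0\ \text{in }\Omega,\quad w_1=w_2,\ \partial_{\nu_a}w_1=\partial_{\nu_a}w_2\ \text{on }\partial\Omega,$$ where $\partial_{\nu_a}v=\sum_{i,j=1}^3a_{i,j}\,\partial_{x_j}v\,\nu_i$ is the conormal derivative ($\nu$ the outward unit normal). $a=(a_{i,j})_{1\le i,j\le 3}\in C^1(\mathbb{R}^3;\mathbb{R}^{3\times3})$ is symmetric ($a_{i,j}=a_{j,i}$), satisfies $\sum_{i,j}a_{i,j}(x)\xi_i\xi_j\ge b|\xi|^2$ for all $x,\xi\in\mathbb{R}^3$ with some $b>0$, and there is $R_1>0$ with $a_{i,j}(x)=\delta_{ij}$ for $|x|>R_1$. The operator is $\mathcal A v=-\sum_{i,j=1}^3\partial_{x_i}(a_{i,j}\partial_{x_j}v)$. $\Omega\subset\mathbb{R}^3$ is a bounded connected Lipschitz domain, $B_R=\{x\in\mathbb{R}^3:|x|<R\}$, and $R_0>0$ is fixed with $\overline\Omega\subset B_{R_0}$. Solutions of the wave equation lie in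 $C^1([0,\infty);L^2(\mathbb{R}^3))\cap C([0,\infty);H^1(\mathbb{R}^3))$. Definition (admissible). A coefficient $c\in L^\infty(\mathbb{R}^3)$, constant on $\mathbb{R}^3\setminus\overline\Omega$, is called admissible if there is $r_1>0$ with $c(x)\ge r_1$ for $x\in\mathbb{R}^3$, and for every $R\ge R_0$ there exist constants $C>0$ and $\delta>0$ depending on $R,a,c,\Omega$ such that for all $f\in H^1(\mathbb{R}^3)$, $g\in L^2(\mathbb{R}^3)$ with $\mathrm{supp}(f)\cup\mathrm{supp}(g)\subset\overline\Omega$, the solution $w$ of $c^{-2}\partial_t^2w+\mathcal A w=0$ in $\mathbb{R}_+\times\mathbb{R}^3$, $w(0,\cdot)=f$, $\partial_tw(0,\cdot)=g$, satisfies $$\|(w(t,\cdot),\partial_tw(t,\cdot))\|_{H^1(B_R)\times L^2(B_R)}\le Ce^{-\delta t}\big(\|f\|_{H^1(\mathbb{R}^3)}+\|g\|_{L^2(\mathbb{R}^3)}\big),\quad t>0.$$ *)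

theory Defs
  imports "HOL-Analysis.Analysis"
begin

text \<open>
  Elements of Lebesgue and Sobolev spaces are represented by functions, to be read up to
  Lebesgue-null sets. Functions are complex-valued, since the spectral parameter is complex; the
  coefficients are real.
\<close>

subsection \<open>Smooth functions and test functions\<close>

abbreviation dir_deriv ::
  "'a::real_normed_vector \<Rightarrow> ('a \<Rightarrow> 'b::real_normed_vector) \<Rightarrow> 'a \<Rightarrow> 'b"
  where "dir_deriv v f x \<equiv> frechet_derivative f (at x) v"

fun Ck_fun :: "nat \<Rightarrow> ('a::euclidean_space \<Rightarrow> 'b::real_normed_vector) \<Rightarrow> bool"
  where
  "Ck_fun 0 f \<longleftrightarrow> continuous_on UNIV f"
| "Ck_fun (Suc k) f \<longleftrightarrow> (\<forall>x. f differentiable (at x)) \<and> (\<forall>v. Ck_fun k (dir_deriv v f))"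

definition test_fun :: "'a::euclidean_space set \<Rightarrow> ('a \<Rightarrow> complex) set"
  where "test_fun U = {\<phi>. (\<forall>k. Ck_fun k \<phi>) \<and> compact (closure {x. \<phi> x \<noteq> 0})
                          \<and> closure {x. \<phi> x \<noteq> 0} \<subseteq> U}"

subsection \<open>Lebesgue and Sobolev spaces\<close>

definition Linfty_fun :: "(real^3 \<Rightarrow> real) \<Rightarrow> bool"
  where "Linfty_fun c \<longleftrightarrow> c \<in> borel_measurable lebesgue \<and> (\<exists>M. AE x in lebesgue. \<bar>c x\<bar> \<le> M)"

definition ess_supp :: "(real^3 \<Rightarrow> 'b::zero) \<Rightarrow> (real^3) set"
  where "ess_supp f = - \<Union>{U. open U \<and> (AE x in lebesgue. x \<in> U \<longrightarrow> f x = 0)}"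

definition L2_fun :: "(real^3) set \<Rightarrow> (real^3 \<Rightarrow> complex) \<Rightarrow> bool"
  where "L2_fun U f \<longleftrightarrow> f \<in> borel_measurable (lebesgue_on U)
                        \<and> integrable (lebesgue_on U) (\<lambda>x. (cmod (f x))\<^sup>2)"

definition L2_norm :: "(real^3) set \<Rightarrow> (real^3 \<Rightarrow> complex) \<Rightarrow> real"
  where "L2_norm U f = sqrt (LINT x|lebesgue_on U. (cmod (f x))\<^sup>2)"

definition has_weak_deriv ::
  "(real^3) set \<Rightarrow> 3 \<Rightarrow> (real^3 \<Rightarrow> complex) \<Rightarrow> (real^3 \<Rightarrow> complex) \<Rightarrow> bool"
  where "has_weak_deriv U i f g \<longleftrightarrow>
    (\<forall>\<phi>\<in>test_fun U. (LINT x|lebesgue_on U. f x * dir_deriv (axis i 1) \<phi> x)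
                     = - (LINT x|lebesgue_on U. g x * \<phi> x))"

definition H1_fun :: "(real^3) set \<Rightarrow> (real^3 \<Rightarrow> complex) \<Rightarrow> bool"
  where "H1_fun U f \<longleftrightarrow> L2_fun U f \<and> (\<forall>i. \<exists>g. L2_fun U g \<and> has_weak_deriv U i f g)"

text \<open>A representative of the weak partial derivative, which is unique up to null sets.\<close>

definition weak_deriv :: "(real^3) set \<Rightarrow> 3 \<Rightarrow> (real^3 \<Rightarrow> complex) \<Rightarrow> real^3 \<Rightarrow> complex"
  where "weak_deriv U i f = (SOME g. L2_fun U g \<and> has_weak_deriv U i f g)"

definition H1_norm :: "(real^3) set \<Rightarrow> (real^3 \<Rightarrow> complex) \<Rightarrow> real"
  where "H1_norm U f = sqrt ((L2_norm U f)\<^sup>2 + (\<Sum>i\<in>UNIV. (L2_norm U (weak_deriv U i f))\<^sup>2))"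

subsection \<open>Lipschitz domains and traces\<close>

text \<open>
  Near each boundary point, the domain is the part on one side of the graph of a Lipschitz function
  of the two variables orthogonal to a unit vector \<open>e\<close>: the coordinate along \<open>e\<close> is \<open>x \<bullet> e\<close> and
  the remaining ones are given by the orthogonal projection \<open>x - (x \<bullet> e) *\<^sub>R e\<close>.
\<close>

definition lipschitz_domain :: "(real^3) set \<Rightarrow> bool"
  where "lipschitz_domain \<Omega> \<longleftrightarrow> open \<Omega> \<and> connected \<Omega> \<and> bounded \<Omega> \<and> \<Omega> \<noteq> {} \<and>
    (\<forall>p\<in>frontier \<Omega>. \<exists>U e L \<gamma>. open U \<and> p \<in> U \<and> norm e = 1 \<and>
       L-lipschitz_on {y. y \<bullet> e = 0} \<gamma> \<and>
       (\<forall>x\<in>U. x \<in> \<Omega> \<longleftrightarrow> x \<bullet> e < \<gamma> (x - (x \<bullet> e) *\<^sub>R e)))"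

text \<open>
  Two-dimensional Hausdorff measure; the factor \<open>pi / 4\<close> makes it agree with surface area.
\<close>

definition hausdorff2_pre :: "real \<Rightarrow> (real^3) set \<Rightarrow> ennreal"
  where "hausdorff2_pre d E =
    (INF S \<in> {S :: nat \<Rightarrow> (real^3) set. (\<forall>n. bounded (S n) \<and> diameter (S n) \<le> d) \<and> E \<subseteq> (\<Union>n. S n)}.
       (\<Sum>n. ennreal (pi / 4 * (diameter (S n))\<^sup>2)))"

definition surface_measure :: "(real^3) measure"
  where "surface_measure =
    measure_of UNIV (sets borel) (\<lambda>E. SUP d\<in>{0<..}. hausdorff2_pre d E)"

text \<open>
  The trace operator is the continuous extension, from the \<open>H1\<close> norm on \<open>\<Omega>\<close> to the \<open>L2\<close> norm on the
  boundary, of the restriction of smooth functions to the boundary: \<open>g\<close> is the trace of \<open>u\<close>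
  if smooth functions converge to \<open>u\<close> in \<open>\<Omega>\<close> and to \<open>g\<close> on the boundary in these norms.
\<close>

definition has_trace :: "(real^3) set \<Rightarrow> (real^3 \<Rightarrow> complex) \<Rightarrow> (real^3 \<Rightarrow> complex) \<Rightarrow> bool"
  where "has_trace \<Omega> u g \<longleftrightarrow> H1_fun \<Omega> u \<and> g \<in> borel_measurable borel \<and>
    (\<exists>\<phi> :: nat \<Rightarrow> real^3 \<Rightarrow> complex. (\<forall>n. \<phi> n \<in> test_fun UNIV) \<and>
       (\<lambda>n. H1_norm \<Omega> (\<lambda>x. \<phi> n x - u x)) \<longlonglongrightarrow> 0 \<and>
       (\<lambda>n. \<integral>\<^sup>+x\<in>frontier \<Omega>. ennreal ((cmod (\<phi> n x - g x))\<^sup>2) \<partial>surface_measure) \<longlonglongrightarrow> 0)"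

definition eq_on_boundary :: "(real^3) set \<Rightarrow> (real^3 \<Rightarrow> complex) \<Rightarrow> (real^3 \<Rightarrow> complex) \<Rightarrow> bool"
  where "eq_on_boundary \<Omega> u v \<longleftrightarrow> has_trace \<Omega> (\<lambda>x. u x - v x) (\<lambda>x. 0)"

subsection \<open>The elliptic operator and the conormal derivative\<close>

definition uniformly_elliptic :: "(real^3 \<Rightarrow> real^3^3) \<Rightarrow> bool"
  where "uniformly_elliptic a \<longleftrightarrow>
    (\<exists>b>0. \<forall>x \<xi>. (\<Sum>i\<in>UNIV. \<Sum>j\<in>UNIV. a x $ i $ j * \<xi> $ i * \<xi> $ j) \<ge> b * (norm \<xi>)\<^sup>2)"

text \<open>\<open>elliptic_eq a U v h\<close>: the equation \<open>- (\<Sum>i j. \<partial>\<^sub>i (a\<^sub>i\<^sub>j \<partial>\<^sub>j v)) = h\<close>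
  in the sense of distributions on \<open>U\<close>.\<close>

definition elliptic_eq ::
  "(real^3 \<Rightarrow> real^3^3) \<Rightarrow> (real^3) set \<Rightarrow> (real^3 \<Rightarrow> complex) \<Rightarrow> (real^3 \<Rightarrow> complex) \<Rightarrow> bool"
  where "elliptic_eq a U v h \<longleftrightarrow>
    (\<forall>\<phi>\<in>test_fun U.
       (LINT x|lebesgue_on U. (\<Sum>i\<in>UNIV. \<Sum>j\<in>UNIV.
          of_real (a x $ i $ j) * weak_deriv U j v x * dir_deriv (axis i 1) \<phi> x))
       = (LINT x|lebesgue_on U. h x * \<phi> x))"

definition elliptic_op ::
  "(real^3 \<Rightarrow> real^3^3) \<Rightarrow> (real^3) set \<Rightarrow> (real^3 \<Rightarrow> complex) \<Rightarrow> real^3 \<Rightarrow> complex"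
  where "elliptic_op a U v = (SOME h. L2_fun U h \<and> elliptic_eq a U v h)"

text \<open>
  For \<open>w\<close> in \<open>H1\<close> on \<open>\<Omega>\<close> with \<open>elliptic_op a \<Omega> w\<close> in \<open>L2\<close>, the conormal derivative
  \<open>\<Sum>i j. a\<^sub>i\<^sub>j \<partial>\<^sub>j w \<nu>\<^sub>i\<close> is an element of the dual \<open>H\<^sup>-\<^sup>1\<^sup>/\<^sup>2\<close> of the space of boundary traces. It is
  defined by Green's formula: its value on the trace of \<open>v\<close> is \<open>conormal_deriv a \<Omega> w v\<close>, which for
  smooth \<open>w\<close> is the boundary integral of \<open>(\<Sum>i j. a\<^sub>i\<^sub>j \<partial>\<^sub>j w \<nu>\<^sub>i) * v\<close> by the divergence theorem.
\<close>

definition conormal_deriv ::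
  "(real^3 \<Rightarrow> real^3^3) \<Rightarrow> (real^3) set \<Rightarrow> (real^3 \<Rightarrow> complex) \<Rightarrow> (real^3 \<Rightarrow> complex) \<Rightarrow> complex"
  where "conormal_deriv a \<Omega> w v =
    (LINT x|lebesgue_on \<Omega>. (\<Sum>i\<in>UNIV. \<Sum>j\<in>UNIV.
        of_real (a x $ i $ j) * weak_deriv \<Omega> j w x * weak_deriv \<Omega> i v x))
    - (LINT x|lebesgue_on \<Omega>. elliptic_op a \<Omega> w x * v x)"

definition transmission_eigenvalue ::
  "(real^3 \<Rightarrow> real^3^3) \<Rightarrow> (real^3) set \<Rightarrow> (real^3 \<Rightarrow> real) \<Rightarrow> (real^3 \<Rightarrow> real) \<Rightarrow> complex \<Rightarrow> bool"
  where "transmission_eigenvalue a \<Omega> c1 c2 \<tau> \<longleftrightarrow>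
    (\<exists>w1 w2. H1_fun \<Omega> w1 \<and> H1_fun \<Omega> w2 \<and>
       \<not> (AE x in lebesgue_on \<Omega>. w1 x = 0 \<and> w2 x = 0) \<and>
       elliptic_eq a \<Omega> w1 (\<lambda>x. \<tau>\<^sup>2 * of_real (inverse ((c1 x)\<^sup>2)) * w1 x) \<and>
       elliptic_eq a \<Omega> w2 (\<lambda>x. \<tau>\<^sup>2 * of_real (inverse ((c2 x)\<^sup>2)) * w2 x) \<and>
       eq_on_boundary \<Omega> w1 w2 \<and>
       (\<forall>v. H1_fun \<Omega> v \<longrightarrow> conormal_deriv a \<Omega> w1 v = conormal_deriv a \<Omega> w2 v))"

definition NTE ::
  "(real^3 \<Rightarrow> real^3^3) \<Rightarrow> (real^3) set \<Rightarrow> (real^3 \<Rightarrow> real) \<Rightarrow> (real^3 \<Rightarrow> real) \<Rightarrow> real \<Rightarrow> complex set"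
  where "NTE a \<Omega> c1 c2 \<delta> = {\<tau>. Im \<tau> \<in> {-\<delta><..<\<delta>} \<and> \<not> transmission_eigenvalue a \<Omega> c1 c2 \<tau>}"

subsection \<open>The wave equation\<close>

text \<open>
  \<open>w\<close> is the solution curve and \<open>w'\<close> its time derivative. The equation holds in the sense of
  distributions on \<open>{0<..} \<times> UNIV\<close>; since \<open>c\<close> does not depend on time, its first term is the second
  time derivative of \<open>c\<^sup>-\<^sup>2 w\<close>.
\<close>

definition wave_solution ::
  "(real^3 \<Rightarrow> real^3^3) \<Rightarrow> (real^3 \<Rightarrow> real) \<Rightarrow> (real^3 \<Rightarrow> complex) \<Rightarrow> (real^3 \<Rightarrow> complex) \<Rightarrow>
   (real \<Rightarrow> real^3 \<Rightarrow> complex) \<Rightarrow> (real \<Rightarrow> real^3 \<Rightarrow> complex) \<Rightarrow> bool"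
  where "wave_solution a c f g w w' \<longleftrightarrow>
    (\<forall>t\<ge>0. H1_fun UNIV (w t) \<and>
       ((\<lambda>s. H1_norm UNIV (\<lambda>x. w s x - w t x)) \<longlongrightarrow> 0) (at t within {0..})) \<and>
    (\<forall>t\<ge>0. L2_fun UNIV (w' t) \<and>
       ((\<lambda>s. L2_norm UNIV (\<lambda>x. w' s x - w' t x)) \<longlongrightarrow> 0) (at t within {0..}) \<and>
       ((\<lambda>s. L2_norm UNIV (\<lambda>x. (w s x - w t x) / of_real (s - t) - w' t x)) \<longlongrightarrow> 0)
         (at t within {0..})) \<and>
    (AE x in lebesgue. w 0 x = f x) \<and> (AE x in lebesgue. w' 0 x = g x) \<and>
    (\<forall>\<phi>\<in>test_fun ({0<..} \<times> UNIV).
       (LINT t|lebesgue_on {0<..}. LINT x|lebesgue.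
          of_real (inverse ((c x)\<^sup>2)) * w t x * dir_deriv (1, 0) (dir_deriv (1, 0) \<phi>) (t, x)
          + (\<Sum>i\<in>UNIV. \<Sum>j\<in>UNIV. of_real (a x $ i $ j) * weak_deriv UNIV j (w t) x
                                   * dir_deriv (0, axis i 1) \<phi> (t, x))) = 0)"

text \<open>Local energy decay on the ball of radius \<open>R\<close> with rate \<open>\<delta>\<close> and constant \<open>C\<close>, for data
  supported in the closure of \<open>\<Omega>\<close>.\<close>

definition exp_decay ::
  "(real^3 \<Rightarrow> real^3^3) \<Rightarrow> (real^3) set \<Rightarrow> (real^3 \<Rightarrow> real) \<Rightarrow> real \<Rightarrow> real \<Rightarrow> real \<Rightarrow> bool"
  where "exp_decay a \<Omega> c R C \<delta> \<longleftrightarrow>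
    (\<forall>f g w w'. H1_fun UNIV f \<longrightarrow> L2_fun UNIV g \<longrightarrow> ess_supp f \<union> ess_supp g \<subseteq> closure \<Omega> \<longrightarrow>
       wave_solution a c f g w w' \<longrightarrow>
       (\<forall>t>0. H1_norm (ball 0 R) (w t) + L2_norm (ball 0 R) (w' t)
               \<le> C * exp (- \<delta> * t) * (H1_norm UNIV f + L2_norm UNIV g)))"

definition constant_outside :: "(real^3) set \<Rightarrow> (real^3 \<Rightarrow> real) \<Rightarrow> bool"
  where "constant_outside \<Omega> c \<longleftrightarrow> (\<exists>k. AE x in lebesgue. x \<notin> closure \<Omega> \<longrightarrow> c x = k)"

definition admissible ::
  "(real^3 \<Rightarrow> real^3^3) \<Rightarrow> (real^3) set \<Rightarrow> real \<Rightarrow> (real^3 \<Rightarrow> real) \<Rightarrow> bool"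
  where "admissible a \<Omega> R0 c \<longleftrightarrow> Linfty_fun c \<and> constant_outside \<Omega> c \<and>
    (\<exists>r1>0. AE x in lebesgue. c x \<ge> r1) \<and>
    (\<forall>R\<ge>R0. \<exists>C>0. \<exists>\<delta>>0. exp_decay a \<Omega> c R C \<delta>)"

end

theory Submission
  imports Defs "HOL-Real_Asymp.Real_Asymp" "HOL-Complex_Analysis.Conformal_Mappings"
begin

text \<open>
  Let \<open>w\<^sub>j(\<tau>)\<close> be the cosine transform \<open>\<integral>\<^sub>0\<^sup>\<infinity> cos (\<tau> t) u\<^sub>j(t) dt\<close> on \<open>\<Omega>\<close>, which converges for
  \<open>\<bar>Im \<tau>\<bar> < \<delta>\<close> by the local energy decay. Since \<open>\<partial>\<^sub>tu\<^sub>j(0) = 0\<close>, integrating the wave equation twice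
  by parts in time shows \<open>Aw\<^sub>j = \<tau>\<^sup>2 c\<^sub>j\<^sup>-\<^sup>2 w\<^sub>j\<close>. Outside \<open>\<Omega>\<close> the difference \<open>u\<^sub>1 - u\<^sub>2\<close> solves a wave
  equation with zero data and zero trace, so it vanishes by an energy argument; hence the equation of the
  difference may be tested with functions in \<open>H\<^sup>1(\<Omega>)\<close>, and \<open>w\<^sub>1, w\<^sub>2\<close> have the same Dirichlet and conormal
  data. So \<open>\<tau>\<close> is a transmission eigenvalue unless \<open>w\<^sub>1(\<tau>) = w\<^sub>2(\<tau>) = 0\<close>. If such \<open>\<tau>\<close> accumulated in the
  strip, the holomorphic function \<open>w\<^sub>1\<close> would vanish identically, and injectivity of the cosine transform
  would give \<open>u\<^sub>1 = 0\<close> on \<open>\<Omega>\<close>, so \<open>f\<^sub>1 = 0\<close>.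
\<close>

text \<open>Boundary regularity enters twice. Extending a zero-trace function by zero requires that
  the integral over \<Omega> of a derivative be controlled by a boundary integral; finite Hausdorff
  measure of the boundary yields this up to a constant, and a constant is harmless since the
  boundary integrals tend to 0. Testing with every function in H1(\<Omega>) uses the Lipschitz
  graphs: the field of the difference equation, which vanishes outside \<Omega>, is mollified with
  kernels centred slightly off the origin, so that its support is pushed into \<Omega>. The velocity
  of a solution is merely in L2, so it cannot serve as a test function in the energy argument. The
  equation is therefore integrated once in time, the vanishing initial velocity fixing the constant,
  and tested with the solution itself; the energy consists of the solution and of the time integral
  of its gradient. The cosine, rather than an exponential, keeps the initial value out of the
  boundary terms: in the double integration by parts \<open>f\<^sub>j\<close> is multiplied by sin
  0.\<close>

abbreviation pd :: "3 => (real^3 => 'b::real_normed_vector) => real^3 => 'b"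
  where "pd i f == dir_deriv (axis i 1) f"

section \<open>Calculus of smooth functions\<close>

definition smooth :: "('a::euclidean_space => 'b::real_normed_vector) => bool"
  where "smooth f \<longleftrightarrow> (\<forall>k. Ck_fun k f)"

lemma Ck_fun_imp_continuous_on: "Ck_fun k f ==> continuous_on UNIV f"
  by (cases k) (auto intro!: differentiable_imp_continuous_on simp: differentiable_on_def differentiable_at_withinI)

lemma Ck_fun_SucD: "Ck_fun (Suc k) f ==> Ck_fun k f"
proof (induction k arbitrary: f)
  case 0 then show ?case using Ck_fun_imp_continuous_on by fastforce
next
  case (Suc k) then show ?case by (metis Ck_fun.simps(2))
qed

text \<open>Membership in \<open>P\<close> passes on to directional derivatives, so an induction on
  the order of differentiability goes through with the function generalised; differentiability
  supplies the continuity demanded at order 0.\<close>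

lemma smooth_coinduct:
  assumes "P f" and "\<And>f. P f ==> (\<forall>x. f differentiable (at x)) \<and> (\<forall>v. P (dir_deriv v f))"
  shows "smooth f"
proof -
  have "P f ==> Ck_fun k f" for k f
  proof (induction k arbitrary: f)
    case 0 then show ?case using assms(2)[OF 0]
      by (auto intro!: differentiable_imp_continuous_on simp: differentiable_on_def differentiable_at_withinI)
  next
    case (Suc k) then show ?case using assms(2)[of f] by auto
  qed
  with assms(1) show ?thesis by (simp add: smooth_def)
qed

lemma smooth_dir_deriv: "smooth f ==> smooth (dir_deriv v f)"
  unfolding smooth_def by (metis Ck_fun.simps(2))

lemma smooth_differentiable: "smooth f ==> f differentiable (at x)"
  unfolding smooth_def by (metis Ck_fun.simps(2))

lemma smooth_has_derivative: "smooth f ==> (f has_derivative (%v. dir_deriv v f x)) (at x)"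
  using smooth_differentiable[of f x] frechet_derivative_works by metis

lemma smooth_continuous: "smooth f ==> continuous_on S f"
  unfolding smooth_def using Ck_fun_imp_continuous_on continuous_on_subset by blast

lemma dir_derivI: "(f has_derivative f') (at x) ==> dir_deriv v f x = f' v"
  by (metis frechet_derivative_at)

lemma Ck_fun_add: "Ck_fun k f ==> Ck_fun k g ==> Ck_fun k (%x. f x + g x)"
proof (induction k arbitrary: f g)
  case 0 then show ?case by (auto intro: continuous_intros)
next
  case (Suc k)
  have "dir_deriv v (%x. f x + g x) = (%x. dir_deriv v f x + dir_deriv v g x)" for v
    using Suc.prems by (intro ext dir_derivI) (auto intro!: derivative_eq_intros simp: frechet_derivative_works[symmetric])
  with Suc show ?case by auto
qed

text \<open>A single product rule for the three products that occur: multiplication of scalars,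
  scaling by reals and the inner product. Both summands of the derivative are again products of the
  same kind, with one order of smoothness used up.\<close>

lemma Ck_fun_bilinear:
  fixes f :: "'a::euclidean_space => 'b::real_normed_vector" and g :: "'a => 'c::real_normed_vector"
    and pr :: "'b => 'c => 'd::real_normed_vector"
  assumes pr: "bounded_bilinear pr"
  shows "Ck_fun k f ==> Ck_fun k g ==> Ck_fun k (%x. pr (f x) (g x))"
proof (induction k arbitrary: f g)
  case 0 then show ?case using bounded_bilinear.continuous_on[OF pr] by auto
next
  case (Suc k)
  have d: "((%x. pr (f x) (g x)) has_derivative
      (%v. pr (f x) (dir_deriv v g x) + pr (dir_deriv v f x) (g x))) (at x)" for x
    using Suc.prems by (intro bounded_bilinear.FDERIV[OF pr]) (auto simp: frechet_derivative_works[symmetric])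
  have "dir_deriv v (%x. pr (f x) (g x)) = (%x. pr (f x) (dir_deriv v g x) + pr (dir_deriv v f x) (g x))" for v
    by (intro ext dir_derivI d)
  moreover have "Ck_fun k f" "Ck_fun k g" using Suc.prems Ck_fun_SucD by blast+
  ultimately have "Ck_fun k (dir_deriv v (%x. pr (f x) (g x)))" for v
    using Suc by (auto intro!: Ck_fun_add)
  moreover have "(%x. pr (f x) (g x)) differentiable at x" for x using d unfolding differentiable_def by blast
  ultimately show ?case by simp
qed

lemma smooth_bilinear:
  "bounded_bilinear pr ==> smooth f ==> smooth g ==> smooth (%x. pr (f x) (g x))"
  unfolding smooth_def using Ck_fun_bilinear by blast

lemma smooth_add: "smooth f ==> smooth g ==> smooth (%x. f x + g x)"
  unfolding smooth_def using Ck_fun_add by blast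

lemma smooth_mult: "smooth f ==> smooth g ==> smooth (%x. f x * g x :: 'b::real_normed_algebra)"
  by (rule smooth_bilinear[OF bounded_bilinear_mult])

lemma smooth_const: "smooth (%x. c)"
  by (rule smooth_coinduct[where P="%f. \<exists>c. f = (%x. c)"]) (auto simp: frechet_derivative_const)

lemma smooth_bounded_linear: "bounded_linear L ==> smooth L"
proof (rule smooth_coinduct[where P="%f. bounded_linear f \<or> (\<exists>c. f = (%x. c))"])
  fix f :: "'a => 'b" assume "bounded_linear f \<or> (\<exists>c. f = (%x. c))"
  then show "(\<forall>x. f differentiable (at x)) \<and> (\<forall>v. bounded_linear (dir_deriv v f) \<or> (\<exists>c. dir_deriv v f = (%x. c)))"
  proof
    assume f: "bounded_linear f"
    then have "\<And>x. (f has_derivative f) (at x)" by (simp add: bounded_linear_imp_has_derivative)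
    then show ?thesis by (metis dir_derivI differentiable_def ext)
  qed (auto simp: frechet_derivative_const)
qed auto

lemma smooth_diff: "smooth f ==> smooth g ==> smooth (%x. f x - g x)"
  using smooth_add[of f "%x. -1 *\<^sub>R g x"] smooth_bilinear[OF bounded_bilinear_scaleR smooth_const[of "-1"], of g] by auto

lemma dir_deriv_add: "smooth f ==> smooth g ==>
    dir_deriv v (%x. f x + g x) x = dir_deriv v f x + dir_deriv v g x"
  by (rule dir_derivI[OF has_derivative_add[OF smooth_has_derivative smooth_has_derivative]])

lemma dir_deriv_diff: "smooth f ==> smooth g ==>
    dir_deriv v (%x. f x - g x) x = dir_deriv v f x - dir_deriv v g x"
  by (rule dir_derivI[OF has_derivative_diff[OF smooth_has_derivative smooth_has_derivative]])

lemma dir_deriv_mult: "smooth f ==> smooth g ==>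
    dir_deriv v (%x. f x * g x :: 'b::real_normed_algebra) x = f x * dir_deriv v g x + dir_deriv v f x * g x"
  by (rule dir_derivI[OF has_derivative_mult[OF smooth_has_derivative smooth_has_derivative]])

text \<open>A fixed linear map on the left, and in the next lemma an affine substitution on the
  right, reproduce their own form under differentiation, so the induction on the order closes at
  once.\<close>

lemma smooth_compose_left:
  assumes L: "bounded_linear L" and f: "smooth f"
  shows "smooth (%x. L (f x))" and "dir_deriv v (%x. L (f x)) x = L (dir_deriv v f x)"
proof -
  have *: "((%x. L (f x)) has_derivative (%v. L (dir_deriv v f x))) (at x)" if "smooth f" for f x
    using bounded_linear.has_derivative[OF L smooth_has_derivative[OF that]] .
  have "Ck_fun k (%x. L (f x))" if "smooth f" for k and f
    using that
  proof (induction k arbitrary: f)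
    case 0
    have "continuous_on UNIV (%x. L (f x))"
      using has_derivative_continuous[OF *[OF 0]] by (simp add: continuous_at_imp_continuous_on)
    then show ?case by simp
  next
    case (Suc k)
    have "dir_deriv v (%x. L (f x)) = (%x. L (dir_deriv v f x))" for v
      by (intro ext dir_derivI[OF *[OF Suc.prems]])
    then show ?case unfolding Ck_fun.simps
      by (intro conjI allI) (rule differentiableI[OF *[OF Suc.prems]], simp only: Suc.IH[OF smooth_dir_deriv[OF Suc.prems]])
  qed
  then show "smooth (%x. L (f x))" unfolding smooth_def[of "%x. L (f x)"] using f by (intro allI)
  show "dir_deriv v (%x. L (f x)) x = L (dir_deriv v f x)" by (rule dir_derivI[OF *[OF f]])
qed

lemma smooth_compose_affine:
  fixes f :: "'b::euclidean_space => 'c::real_normed_vector" and L :: "'a::euclidean_space => 'b"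
  assumes L: "bounded_linear L" and f: "smooth f"
  shows "smooth (%x. f (L x + c))" and "dir_deriv v (%x. f (L x + c)) x = dir_deriv (L v) f (L x + c)"
proof -
  have *: "((%x. f (L x + c)) has_derivative (%v. dir_deriv (L v) f (L x + c))) (at x)"
    if "smooth f" for f :: "'b => 'c" and x
  proof -
    have "((%x. L x + c) has_derivative L) (at x)"
      using L by (auto intro!: derivative_eq_intros simp: bounded_linear_imp_has_derivative)
    from has_derivative_compose[OF this smooth_has_derivative[OF that]] show ?thesis by simp
  qed
  have "Ck_fun k (%x. f (L x + c))" if "smooth f" for k and f :: "'b => 'c"
    using that
  proof (induction k arbitrary: f)
    case 0
    have "continuous_on UNIV (%x. f (L x + c))"
      using has_derivative_continuous[OF *[OF 0]] by (simp add: continuous_at_imp_continuous_on)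
    then show ?case by simp
  next
    case (Suc k)
    have "dir_deriv v (%x. f (L x + c)) = (%x. dir_deriv (L v) f (L x + c))" for v
      by (intro ext dir_derivI[OF *[OF Suc.prems]])
    then show ?case unfolding Ck_fun.simps
      by (intro conjI allI) (rule differentiableI[OF *[OF Suc.prems]], simp only: Suc.IH[OF smooth_dir_deriv[OF Suc.prems]])
  qed
  then show "smooth (%x. f (L x + c))" unfolding smooth_def[of "%x. f (L x + c)"] using f by (intro allI)
  show "dir_deriv v (%x. f (L x + c)) x = dir_deriv (L v) f (L x + c)" by (rule dir_derivI[OF *[OF f]])
qed

text \<open>The derivative is a smooth scalar factor times a composition of the same form with
  \<open>h\<close> replaced by its derivative, so the product rule closes the induction. Bumps and
  plateaus are functions of the squared norm, hence of this form.\<close>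

lemma smooth_compose_real:
  fixes h :: "real => 'c::real_normed_vector" and q :: "'a::euclidean_space => real"
  assumes "smooth h" and q: "smooth q"
  shows "smooth (%x. h (q x))"
proof -
  have *: "((%x. h (q x)) has_derivative (%v. dir_deriv v q x *\<^sub>R dir_deriv 1 h (q x))) (at x)"
    if "smooth h" for h :: "real => 'c" and x
  proof -
    have "dir_deriv s h y = s *\<^sub>R dir_deriv 1 h y" for s y
      using linear_scale[OF has_derivative_linear[OF smooth_has_derivative[OF that]], of y s 1] by simp
    then have "(%v. dir_deriv (dir_deriv v q x) h (q x)) = (%v. dir_deriv v q x *\<^sub>R dir_deriv 1 h (q x))"
      by blast
    with has_derivative_compose[OF smooth_has_derivative[OF q] smooth_has_derivative[OF that], of x]
    show ?thesis by metis
  qed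
  have "Ck_fun k (%x. h (q x))" if "smooth h" for k and h :: "real => 'c"
    using that
  proof (induction k arbitrary: h)
    case 0
    have "continuous_on UNIV (%x. h (q x))"
      using has_derivative_continuous[OF *[OF 0]] by (simp add: continuous_at_imp_continuous_on)
    then show ?case by simp
  next
    case (Suc k)
    have "Ck_fun k (%x. dir_deriv v q x *\<^sub>R dir_deriv 1 h (q x))" for v
      using Suc.IH[OF smooth_dir_deriv[OF Suc.prems]] smooth_dir_deriv[OF q]
      by (intro Ck_fun_bilinear[OF bounded_bilinear_scaleR]) (simp_all add: smooth_def)
    moreover have "dir_deriv v (%x. h (q x)) = (%x. dir_deriv v q x *\<^sub>R dir_deriv 1 h (q x))" for v
      by (intro ext dir_derivI * Suc)
    ultimately show ?case unfolding Ck_fun.simps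
      by (intro conjI allI) (rule differentiableI[OF *[OF Suc.prems]], simp)
  qed
  with assms show ?thesis by (simp add: smooth_def)
qed

text \<open>Agreement with a smooth function on an open neighbourhood carries over to the
  derivatives on that whole neighbourhood. Needed to glue a function on \<Omega> with 0 across the
  frontier in \<open>capacity_estimate\<close>.\<close>

lemma smooth_local:
  assumes "\<And>x. \<exists>N g. open N \<and> x \<in> N \<and> smooth g \<and> (\<forall>y\<in>N. f y = g y)"
  shows "smooth f"
proof (rule smooth_coinduct[where P="%f. \<forall>x. \<exists>N g. open N \<and> x \<in> N \<and> smooth g \<and> (\<forall>y\<in>N. f y = g y)"])
  fix f :: "'a => 'b" assume f: "\<forall>x. \<exists>N g. open N \<and> x \<in> N \<and> smooth g \<and> (\<forall>y\<in>N. f y = g y)"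
  show "(\<forall>x. f differentiable (at x)) \<and>
    (\<forall>v x. \<exists>N g. open N \<and> x \<in> N \<and> smooth g \<and> (\<forall>y\<in>N. dir_deriv v f y = g y))"
  proof (intro conjI allI)
    have D: "(f has_derivative (%v. dir_deriv v g y)) (at y)" if "open N" "y \<in> N" "smooth g" "\<forall>y\<in>N. f y = g y" for N g y
      using has_derivative_transform_within_open[OF smooth_has_derivative[OF that(3)] that(1,2)] that(4) by metis
    show "f differentiable at x" for x using f D unfolding differentiable_def by blast
    fix v x
    obtain N g where N: "open N" "x \<in> N" "smooth g" "\<forall>y\<in>N. f y = g y" using f by blast
    have "\<forall>y\<in>N. dir_deriv v f y = dir_deriv v g y"
      using dir_derivI[OF D[OF N(1) _ N(3,4)]] by blast
    then show "\<exists>N g. open N \<and> x \<in> N \<and> smooth g \<and> (\<forall>y\<in>N. dir_deriv v f y = g y)"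
      using N smooth_dir_deriv by blast
  qed
qed (use assms in blast)

lemma dir_deriv_transform_open:
  assumes "open N" "x \<in> N" "smooth g" "\<And>y. y \<in> N ==> f y = g y"
  shows "dir_deriv v f x = dir_deriv v g x"
  by (rule dir_derivI) (rule has_derivative_transform_within_open[OF smooth_has_derivative[OF assms(3)] assms(1,2)], simp add: assms(4))

lemma smooth_real_antiderivative:
  fixes f :: "real => 'b::real_normed_vector"
  assumes "\<And>t. (f has_vector_derivative g t) (at t)" and "smooth g"
  shows "smooth f"
proof -
  have "dir_deriv v f = (%t. v *\<^sub>R g t)" for v
    using assms(1) by (intro ext dir_derivI) (auto simp: has_vector_derivative_def)
  moreover have "smooth (%t. v *\<^sub>R g t)" for v
    by (rule smooth_bilinear[OF bounded_bilinear_scaleR smooth_const assms(2)])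
  moreover have "f differentiable at x" for x using assms(1) differentiableI_vector by blast
  ultimately have "Ck_fun (Suc k) f" for k by (auto simp: smooth_def)
  then show ?thesis using Ck_fun_SucD by (simp add: smooth_def del: Ck_fun.simps) blast
qed

lemma frechet_derivative_zero_open:
  fixes f :: "'a::euclidean_space => 'b::real_normed_vector"
  assumes "open N" "x \<in> N" "\<And>y. y \<in> N ==> f y = 0"
  shows "dir_deriv v f x = 0"
  using dir_deriv_transform_open[OF assms(1,2) smooth_const[of 0], of f] assms(3) by (simp add: frechet_derivative_const)

subsection \<open>Test functions\<close>

lemma test_fun_iff: "\<phi> \<in> test_fun U \<longleftrightarrow>
    smooth \<phi> \<and> compact (closure {x. \<phi> x \<noteq> 0}) \<and> closure {x. \<phi> x \<noteq> 0} \<subseteq> U"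
  by (simp add: test_fun_def smooth_def)

lemma test_funI:
  assumes "smooth \<phi>" "compact K" "K \<subseteq> U" "\<And>x. x \<notin> K ==> \<phi> x = 0"
  shows "\<phi> \<in> test_fun U"
proof -
  have "closure {x. \<phi> x \<noteq> 0} \<subseteq> K"
    using assms by (intro closure_minimal compact_imp_closed) auto
  moreover from this have "compact (closure {x. \<phi> x \<noteq> 0})"
    using assms(2) by (metis closed_closure closed_Int_compact inf.absorb1)
  ultimately show ?thesis unfolding test_fun_iff using assms by blast
qed

lemma test_fun_support:
  assumes "\<phi> \<in> test_fun U"
  shows "\<exists>K. compact K \<and> K \<subseteq> U \<and> (\<forall>x. x \<notin> K --> \<phi> x = 0)"
proof (intro exI conjI allI impI)
  show "compact (closure {x. \<phi> x \<noteq> 0})" "closure {x. \<phi> x \<noteq> 0} \<subseteq> U"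
    using assms by (auto simp: test_fun_iff)
  show "\<phi> x = 0" if "x \<notin> closure {x. \<phi> x \<noteq> 0}" for x
    using that closure_subset[of "{x. \<phi> x \<noteq> 0}"] by auto
qed

lemma test_fun_smooth: "\<phi> \<in> test_fun U ==> smooth \<phi>"
  by (simp add: test_fun_iff)


lemma test_fun_UNIV: "\<phi> \<in> test_fun U ==> \<phi> \<in> test_fun UNIV"
  by (auto simp: test_fun_iff)

lemma test_fun_outside: "\<phi> \<in> test_fun U ==> x \<notin> U ==> \<phi> x = 0"
  using closure_subset[of "{x. \<phi> x \<noteq> 0}"] by (auto simp: test_fun_iff)

lemma dir_deriv_outside:
  fixes \<phi> :: "'a::euclidean_space => 'b::real_normed_vector"
  assumes "closed K" "\<And>x. x \<notin> K ==> \<phi> x = 0" "x \<notin> K" shows "dir_deriv v \<phi> x = 0"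
  by (rule frechet_derivative_zero_open[of "-K"]) (use assms in auto)

lemma test_fun_dir_deriv: assumes "\<phi> \<in> test_fun U" shows "dir_deriv v \<phi> \<in> test_fun U"
proof -
  obtain K where K: "compact K" "K \<subseteq> U" "\<And>x. x \<notin> K ==> \<phi> x = 0" using test_fun_support[OF assms] by blast
  show ?thesis
    by (rule test_funI[OF smooth_dir_deriv[OF test_fun_smooth[OF assms]] K(1,2)])
      (rule dir_deriv_outside[OF compact_imp_closed[OF K(1)] K(3)])
qed

lemma test_fun_mult_left:
  fixes \<phi> :: "'a::euclidean_space => complex"
  assumes "smooth f" "\<phi> \<in> test_fun U" shows "(%x. f x * \<phi> x) \<in> test_fun U"
proof -
  obtain K where K: "compact K" "K \<subseteq> U" "\<And>x. x \<notin> K ==> \<phi> x = 0" using test_fun_support[OF assms(2)] by blast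
  show ?thesis
    by (rule test_funI[OF smooth_mult[OF assms(1) test_fun_smooth[OF assms(2)]] K(1,2)]) (simp add: K(3))
qed

lemma test_fun_mult_right:
  fixes \<phi> :: "'a::euclidean_space => complex"
  assumes "smooth f" "\<phi> \<in> test_fun U" shows "(%x. \<phi> x * f x) \<in> test_fun U"
  using test_fun_mult_left[OF assms] by (simp add: mult.commute)

lemma test_fun_add:
  assumes "\<phi> \<in> test_fun U" "\<psi> \<in> test_fun U" shows "(%x. \<phi> x + \<psi> x) \<in> test_fun U"
proof -
  obtain K where K: "compact K" "K \<subseteq> U" "\<And>x. x \<notin> K ==> \<phi> x = 0" using test_fun_support[OF assms(1)] by blast
  obtain L where L: "compact L" "L \<subseteq> U" "\<And>x. x \<notin> L ==> \<psi> x = 0" using test_fun_support[OF assms(2)] by blast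
  show ?thesis by (rule test_funI[OF smooth_add[OF assms[THEN test_fun_smooth]] compact_Un[OF K(1) L(1)]]) (use K L in auto)
qed

lemma test_fun_compose_cnj: assumes "\<phi> \<in> test_fun U" shows "(%x. cnj (\<phi> x)) \<in> test_fun U"
proof -
  obtain K where K: "compact K" "K \<subseteq> U" "\<And>x. x \<notin> K ==> \<phi> x = 0" using test_fun_support[OF assms] by blast
  show ?thesis
    by (rule test_funI[OF smooth_compose_left(1)[OF bounded_linear_cnj test_fun_smooth[OF assms]] K(1,2)])
      (simp add: K(3))
qed

lemma test_fun_bounded:
  assumes "\<phi> \<in> test_fun U" obtains M where "M > 0" "\<And>x. norm (\<phi> x) \<le> M"
proof -
  obtain K where K: "compact K" "\<And>x. x \<notin> K ==> \<phi> x = 0" using test_fun_support[OF assms] by blast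
  have "bounded (\<phi> ` K)"
    by (intro compact_imp_bounded compact_continuous_image K smooth_continuous test_fun_smooth[OF assms])
  then obtain M where "\<And>x. x \<in> K ==> norm (\<phi> x) \<le> M" by (auto simp: bounded_iff)
  with K(2) have "norm (\<phi> x) \<le> max M 1" for x by (cases "x \<in> K") (auto simp: le_max_iff_disj)
  then show thesis using that[of "max M 1"] by auto
qed

text \<open>A convolution at \<open>x\<close> is a pairing with the reflected and translated kernel,
  so this kernel has to be an admissible test function; the reflection accounts for the sign in its
  derivative.\<close>

lemma test_fun_reflect:
  assumes "\<phi> \<in> test_fun UNIV"
  shows "(%y. \<phi> (x - y)) \<in> test_fun UNIV" and "dir_deriv v (%y. \<phi> (x - y)) y = - dir_deriv v \<phi> (x - y)"
proof -
  have L: "bounded_linear (%y::'a. - y)" by (simp add: bounded_linear_minus bounded_linear_ident)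
  note s = smooth_compose_affine[OF L test_fun_smooth[OF assms], of x]
  obtain K where K: "compact K" "\<And>x. x \<notin> K ==> \<phi> x = 0" using test_fun_support[OF assms] by blast
  show "(%y. \<phi> (x - y)) \<in> test_fun UNIV"
  proof (rule test_funI[of _ "(%z. x - z) ` K"])
    show "compact ((%z. x - z) ` K)" by (intro compact_continuous_image K continuous_intros)
    show "\<phi> (x - y) = 0" if "y \<notin> (%z. x - z) ` K" for y
      using that by (intro K(2)) (auto simp: image_iff)
  qed (use s in auto)
  have "dir_deriv (-v) \<phi> y = - dir_deriv v \<phi> y" for y
    using linear_neg[OF has_derivative_linear[OF smooth_has_derivative[OF test_fun_smooth[OF assms]]]] by blast
  then show "dir_deriv v (%y. \<phi> (x - y)) y = - dir_deriv v \<phi> (x - y)" using s(2)[of y v] by simp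
qed

subsection \<open>Bump functions and mollifiers\<close>

text \<open>The polynomial factor makes the family closed under differentiation: it contains exp
  (-1/t), extended by 0, together with all its derivatives.\<close>

definition exp_bump :: "real poly => real => real"
  where "exp_bump p t = (if t > 0 then poly p (1 / t) * exp (- (1 / t)) else 0)"

lemma poly_div_exp_tendsto_0: "((%x. poly p x * exp (- x)) \<longlongrightarrow> (0::real)) at_top"
proof -
  have "((%x. \<Sum>i\<le>degree p. coeff p i * (x ^ i / exp x)) \<longlongrightarrow> (\<Sum>i\<le>degree p. coeff p i * 0)) at_top"
    by (intro tendsto_intros tendsto_power_div_exp_0)
  moreover have "poly p x * exp (- x) = (\<Sum>i\<le>degree p. coeff p i * (x ^ i / exp x))" for x
    by (simp add: poly_altdef sum_distrib_right exp_minus divide_inverse mult.assoc)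
  ultimately show ?thesis by simp
qed

text \<open>In the variable s = 1/t the chain rule contributes the factor s^2, which is
  \<open>monom 1 2\<close>, and differentiating the exponential and the polynomial gives p - p'. At
  t = 0 the difference quotient from the right is s p(s) exp (-s), which tends to 0.\<close>

lemma exp_bump_DERIV:
  "(exp_bump p has_real_derivative exp_bump (monom 1 2 * (p - pderiv p)) t) (at t)"
proof -
  consider "t < 0" | "t = 0" | "t > 0" by linarith
  then show ?thesis
  proof cases
    case 1
    have "((%t. 0) has_real_derivative 0) (at t)" by simp
    then have "(exp_bump p has_real_derivative 0) (at t)"
      by (rule DERIV_cong_ev[THEN iffD1, rotated -1])
        (use 1 in \<open>auto simp: exp_bump_def intro!: eventually_mono[OF eventually_nhds_in_open[of "{..<0}"]]\<close>)
    with 1 show ?thesis by (simp add: exp_bump_def)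
  next
    case 3
    have "((%t. poly p (1 / t) * exp (- (1 / t))) has_real_derivative
        poly (monom 1 2 * (p - pderiv p)) (1 / t) * exp (- (1 / t))) (at t)"
      using 3 by (auto intro!: derivative_eq_intros poly_DERIV[THEN DERIV_chain2]
          simp: poly_monom algebra_simps power2_eq_square divide_simps)
    then have "(exp_bump p has_real_derivative poly (monom 1 2 * (p - pderiv p)) (1 / t) * exp (- (1 / t))) (at t)"
      by (rule DERIV_cong_ev[THEN iffD1, rotated -1])
        (use 3 in \<open>auto simp: exp_bump_def intro!: eventually_mono[OF eventually_nhds_in_open[of "{0<..}"]]\<close>)
    with 3 show ?thesis by (simp add: exp_bump_def)
  next
    case 2
    have "((%t. poly (pCons 0 p) (1 / t) * exp (- (1 / t))) \<longlongrightarrow> 0) (at_right (0::real))"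
      using filterlim_compose[OF poly_div_exp_tendsto_0[of "pCons 0 p"] filterlim_inverse_at_top_right]
      by (simp add: inverse_eq_divide)
    then have "((%t. exp_bump p t / t) \<longlongrightarrow> 0) (at_right 0)"
      by (rule Lim_transform_eventually)
        (auto simp: exp_bump_def eventually_at_filter intro!: eventually_mono[OF eventually_True])
    moreover have "((%t. exp_bump p t / t) \<longlongrightarrow> 0) (at_left 0)"
      by (rule Lim_transform_eventually[OF tendsto_const])
        (auto simp: exp_bump_def eventually_at_filter intro!: eventually_mono[OF eventually_True])
    ultimately have "((%t. exp_bump p t / t) \<longlongrightarrow> 0) (at 0)"
      using filterlim_split_at by blast
    then show ?thesis using 2 by (simp add: has_field_derivative_iff exp_bump_def)
  qed
qed

lemma smooth_exp_bump: "smooth (exp_bump p)"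
proof -
  have "Ck_fun k (exp_bump p)" for k p
  proof (induction k arbitrary: p)
    case 0 show ?case
      using DERIV_isCont[OF exp_bump_DERIV] by (simp add: continuous_at_imp_continuous_on)
  next
    case (Suc k)
    have d: "(exp_bump p has_derivative (%v. v * exp_bump (monom 1 2 * (p - pderiv p)) t)) (at t)" for t
      using exp_bump_DERIV[of p t] by (simp add: has_field_derivative_def mult.commute[of _ "exp_bump _ t"])
    have "dir_deriv v (exp_bump p) = (%t. v * exp_bump (monom 1 2 * (p - pderiv p)) t)" for v
      by (intro ext dir_derivI[OF d])
    moreover have "Ck_fun k (%t. v * exp_bump (monom 1 2 * (p - pderiv p)) t)" for v
      by (rule Ck_fun_bilinear[OF bounded_bilinear_mult _ Suc.IH]) (use smooth_const in \<open>auto simp: smooth_def\<close>)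
    ultimately show ?case unfolding Ck_fun.simps
      by (intro conjI allI) (rule differentiableI[OF d], simp)
  qed
  then show ?thesis by (simp add: smooth_def)
qed

lemma smooth_inner_self: "smooth (%x::'a::euclidean_space. c - x \<bullet> x)"
  by (rule smooth_diff[OF smooth_const smooth_bilinear[OF bounded_bilinear_inner]])
    (rule smooth_bounded_linear[OF bounded_linear_ident])+

text \<open>The centre is a parameter because near a boundary point the kernels are placed off the
  origin: convolution then shifts the support of a function as well as smoothing it.\<close>

definition mollifier :: "('a::euclidean_space => real) => 'a => real => bool"
  where "mollifier k c r \<longleftrightarrow> smooth k \<and> (\<forall>x. 0 \<le> k x) \<and> (\<forall>x. x \<notin> cball c r --> k x = 0)
    \<and> (LINT x|lebesgue. k x) = 1"

lemma borel_measurable_smooth: "smooth f ==> f \<in> borel_measurable borel"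
  by (rule borel_measurable_continuous_onI) (rule smooth_continuous)

lemma integrable_compact_support:
  fixes f :: "'a::euclidean_space => 'b::euclidean_space"
  assumes "continuous_on UNIV f" "compact K" "\<And>x. x \<notin> K ==> f x = 0"
  shows "integrable lborel f" "integrable lebesgue f"
proof -
  have "bounded (f ` K)"
    by (intro compact_imp_bounded compact_continuous_image assms continuous_on_subset[OF assms(1)]) auto
  then obtain M where M: "\<And>x. x \<in> K ==> norm (f x) \<le> M" by (auto simp: bounded_iff)
  have fin: "emeasure lborel K < \<infinity>" using emeasure_bounded_finite[OF compact_imp_bounded[OF assms(2)]] .
  have "integrable lborel (%x. M * indicator K x)"
    using fin assms(2) by (intro integrable_mult_right integrable_real_indicator) (auto simp: borel_compact)
  then show 1: "integrable lborel f"
  proof (rule Bochner_Integration.integrable_bound)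
    show "f \<in> borel_measurable lborel" using borel_measurable_continuous_onI[OF assms(1)] by simp
    show "AE x in lborel. norm (f x) \<le> norm (M * indicator K x)"
      using M assms(3) by (intro AE_I2) (force simp: indicator_def)
  qed
  show "integrable lebesgue f" using 1 by (simp add: integrable_completion)
qed

lemma mollifier_support: "mollifier k c r ==> k x \<noteq> 0 ==> dist c x \<le> r"
  unfolding mollifier_def by (metis mem_cball)

lemma mollifier_integrable: "mollifier k c r ==> integrable lebesgue k"
  by (rule integrable_compact_support[OF _ compact_cball[of c r]]) (auto simp: mollifier_def smooth_continuous)

lemma mollifier_exists:
  fixes c :: "'a::euclidean_space"
  assumes "r > 0" shows "\<exists>k. mollifier k c r"
proof -
  define q where "q x = 1 - ((1/r) *\<^sub>R x + - ((1/r) *\<^sub>R c)) \<bullet> ((1/r) *\<^sub>R x + - ((1/r) *\<^sub>R c))" for x :: 'a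
  define b where "b x = exp_bump 1 (q x)" for x
  have "smooth q"
    unfolding q_def using smooth_compose_affine(1)[OF bounded_linear_scaleR_right smooth_inner_self] .
  then have sb: "smooth b" unfolding b_def by (rule smooth_compose_real[OF smooth_exp_bump])
  have q: "q x = 1 - (dist c x / r)\<^sup>2" for x
  proof -
    have "(1/r) *\<^sub>R x + - ((1/r) *\<^sub>R c) = (1/r) *\<^sub>R (x - c)" by (simp add: scaleR_diff_right)
    then show ?thesis unfolding q_def using assms
      by (simp add: dist_norm norm_minus_commute[of c] power2_norm_eq_inner[symmetric] power_divide)
  qed
  have b0: "b x = 0" if "x \<notin> cball c r" for x
  proof -
    have "dist c x / r > 1" using that assms by simp
    then have "q x < 0" unfolding q using one_less_power[of "dist c x / r" 2] by simp
    then show ?thesis by (simp add: b_def exp_bump_def)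
  qed
  have bn: "0 \<le> b x" for x by (simp add: b_def exp_bump_def)
  \<comment> \<open>On the half ball q is at least 3/4, so 1/q is at most 4/3. The bump thus exceeds
    a positive constant on a set of positive measure, which makes the normalising integral
    positive.\<close>
  have bp: "exp (- (4/3)) \<le> b x" if "x \<in> ball c (r/2)" for x
  proof -
    have "dist c x / r \<le> 1/2" using that assms by (simp add: field_simps)
    then have "(dist c x / r)\<^sup>2 \<le> (1/2)\<^sup>2" by (intro power_mono) (use assms in auto)
    then have "3/4 \<le> q x" unfolding q by (simp add: power2_eq_square)
    then have "1 / q x \<le> 4/3" by (simp add: field_simps)
    then show ?thesis using \<open>3/4 \<le> q x\<close> by (simp add: b_def exp_bump_def)
  qed
  have ib: "integrable lebesgue b"
    by (rule integrable_compact_support[OF smooth_continuous[OF sb] compact_cball b0])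
  have "integrable lebesgue (%x. exp (- (4/3)) * indicator (ball c (r/2)) x :: real)"
    using lmeasurable_ball[of c "r/2"] unfolding lmeasurable_iff_integrable by simp
  then have "(LINT x|lebesgue. exp (- (4/3)) * indicator (ball c (r/2)) x) \<le> (LINT x|lebesgue. b x)"
    using bp bn by (intro integral_mono ib) (auto simp: indicator_def)
  moreover have "measure lebesgue (ball c (r/2)) > 0"
    using assms content_ball_pos[of "r/2" c] by (simp add: measure_completion)
  ultimately have I: "(LINT x|lebesgue. b x) > 0"
    using less_le_trans[OF mult_pos_pos[OF exp_gt_zero[of "- (4/3)"] content_ball_pos[of "r/2" c]]] assms by simp
  have "mollifier (%x. b x * inverse (LINT x|lebesgue. b x)) c r"
    unfolding mollifier_def using smooth_mult[OF sb smooth_const] bn b0 I by auto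
  then show ?thesis by blast
qed

lemma smooth_antiderivative_real:
  fixes f :: "real => 'b::euclidean_space"
  assumes "smooth f" "\<And>t. t \<notin> {a..b} ==> f t = 0" "a \<le> b"
  shows "\<exists>s. smooth s \<and> (\<forall>t. (s has_vector_derivative f t) (at t)) \<and> (\<forall>t\<le>a. s t = 0) \<and>
    (\<forall>t\<ge>b. s t = (LINT x|lebesgue. f x)) \<and> (\<forall>t. s t = integral {a - 1..t} f)"
proof (intro exI conjI allI impI)
  \<comment> \<open>Starting the integral at a - 1 instead of a makes every t \<ge> a an interior
    point, so the fundamental theorem gives a two-sided derivative; f vanishes on the added
    stretch.\<close>
  define s where "s t = integral {a - 1..t} f" for t
  have z: "s t = 0" if "t \<le> a" for t
  proof -
    have "f x = 0" if "x < a" for x using assms(2) that by auto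
    then have z: "f x = 0" if "x \<in> {a - 1..t} - {a}" for x
      using that \<open>t \<le> a\<close> by (metis DiffE atLeastAtMost_iff insertI1 order_le_less order_trans)
    have "(f has_integral 0) {a - 1..t}"
      using has_integral_spike_finite[where S="{a}" and T="{a - 1..t}" and g=f, OF _ z has_integral_0] by simp
    then show ?thesis unfolding s_def by (rule integral_unique)
  qed
  show d: "(s has_vector_derivative f t) (at t)" for t
  proof (cases "t < a")
    case True
    then have "f t = 0" using assms(2) by auto
    have "((%t. 0) has_vector_derivative f t) (at t)" using \<open>f t = 0\<close> by simp
    then show ?thesis
      by (rule has_vector_derivative_transform_within_open[of _ _ _ "{..<a}"]) (use True z in auto)
  next
    case False
    have "(s has_vector_derivative f t) (at t within {a - 1..t + 1})"
      unfolding s_def by (rule integral_has_vector_derivative) (use False assms smooth_continuous in auto)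
    then show ?thesis using False by (subst (asm) at_within_interior) auto
  qed
  show "s t = 0" if "t \<le> a" for t by (rule z[OF that])
  show "smooth s" by (rule smooth_real_antiderivative[OF d assms(1)])
  show "s t = integral {a - 1..t} f" for t by (simp add: s_def)
  show "s t = (LINT x|lebesgue. f x)" if "t \<ge> b" for t
  proof -
    have i: "integrable lebesgue f"
      by (rule integrable_compact_support[OF smooth_continuous[OF assms(1)] _ assms(2)]) auto
    have "(%x. if x \<in> {a - 1..t} then f x else 0) = f"
      using assms(2) that by fastforce
    then have "integral {a - 1..t} f = integral UNIV f"
      using integral_restrict_UNIV[of "{a - 1..t}" f] by simp
    also have "\<dots> = (LINT x|lebesgue. f x)"
      using has_integral_integral_lebesgue[OF i] by (rule integral_unique)
    finally show ?thesis unfolding s_def .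
  qed
qed

text \<open>The antiderivative of a mollifier supported in [0,1] is a smooth step from 0 to 1. It is
  evaluated at 2 - |x|^2, which is at least 1 on the unit ball and negative once |x| \<ge>
  2.\<close>

lemma plateau_exists:
  "\<exists>\<eta>::'a::euclidean_space => complex. \<eta> \<in> test_fun UNIV \<and> (\<forall>x. norm x \<le> 1 --> \<eta> x = 1) \<and>
    (\<forall>x. norm x \<ge> 2 --> \<eta> x = 0) \<and> (\<forall>x. norm (\<eta> x) \<le> 1 \<and> norm (1 - \<eta> x) \<le> 1)"
proof -
  obtain k :: "real => real" where k: "mollifier k (1/2) (1/2)" using mollifier_exists[of "1/2" "1/2::real"] by auto
  have k0: "k t = 0" if "t \<notin> {0..1}" for t
    using k that unfolding mollifier_def by (auto simp: cball_eq_atLeastAtMost)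
  obtain s where s: "smooth s" "\<And>t. (s has_vector_derivative k t) (at t)" "\<And>t. t \<le> 0 ==> s t = 0"
    "\<And>t. t \<ge> 1 ==> s t = 1"
    using smooth_antiderivative_real[of k 0 1] k k0 unfolding mollifier_def by auto
  have mono: "s x \<le> s y" if "x \<le> y" for x y
    by (rule DERIV_nonneg_imp_nondecreasing[OF that])
      (use s(2) k in \<open>auto simp: mollifier_def has_real_derivative_iff_has_vector_derivative\<close>)
  have s01: "0 \<le> s t \<and> s t \<le> 1" for t
    using mono[of "min t 0" t] mono[of t "max t 1"] s(3)[of "min t 0"] s(4)[of "max t 1"] by auto
  define \<eta> where "\<eta> x = complex_of_real (s (2 - x \<bullet> x))" for x :: 'a
  have sm: "smooth \<eta>" unfolding \<eta>_def
    by (rule smooth_compose_left(1)[OF bounded_linear_of_real smooth_compose_real[OF s(1) smooth_inner_self]])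
  have 1: "\<eta> x = 1" if "norm x \<le> 1" for x
  proof -
    have "x \<bullet> x \<le> 1" using that by (simp add: power2_norm_eq_inner[symmetric] power_le_one)
    then show ?thesis by (simp add: \<eta>_def s(4))
  qed
  have 2: "\<eta> x = 0" if "norm x \<ge> 2" for x
  proof -
    have "2 * 2 \<le> norm x * norm x" using that by (intro mult_mono) auto
    then have "x \<bullet> x \<ge> 2" by (simp add: power2_norm_eq_inner[symmetric] power2_eq_square)
    then show ?thesis by (simp add: \<eta>_def s(3))
  qed
  have "\<eta> \<in> test_fun UNIV"
    by (rule test_funI[OF sm compact_cball[of 0 2]]) (auto intro: 2)
  moreover have "norm (\<eta> x) \<le> 1 \<and> norm (1 - \<eta> x) \<le> 1" for x
  proof -
    have "1 - \<eta> x = complex_of_real (1 - s (2 - x \<bullet> x))" by (simp add: \<eta>_def)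
    then show ?thesis using s01[of "2 - x \<bullet> x"] by (simp only: \<eta>_def norm_of_real) auto
  qed
  ultimately show ?thesis using 1 2 by blast
qed

subsection \<open>Convolution with a test function\<close>

lemma smooth_dir_deriv_basis:
  fixes \<phi> :: "'a::euclidean_space => 'b::real_normed_vector"
  assumes "smooth \<phi>"
  shows "dir_deriv v \<phi> x = (\<Sum>b\<in>Basis. (v \<bullet> b) *\<^sub>R dir_deriv b \<phi> x)"
proof -
  have l: "linear (%v. dir_deriv v \<phi> x)" using has_derivative_linear[OF smooth_has_derivative[OF assms]] .
  show ?thesis
    using linear_sum[OF l, of "%b. (v \<bullet> b) *\<^sub>R b" Basis] by (simp add: euclidean_representation linear_cmul[OF l])
qed

lemma test_fun_deriv_bound:
  fixes \<phi> :: "'a::euclidean_space => complex"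
  assumes "\<phi> \<in> test_fun UNIV"
  shows "\<exists>M>0. \<forall>x v. norm (dir_deriv v \<phi> x) \<le> M * norm v"
proof -
  have "\<exists>M. \<forall>x. norm (dir_deriv b \<phi> x) \<le> M" for b
    using test_fun_bounded[OF test_fun_dir_deriv[OF assms, of b]] by metis
  then obtain M where M: "\<And>b x. norm (dir_deriv b \<phi> x) \<le> M b" by metis
  have "norm (dir_deriv v \<phi> x) \<le> (sum M Basis + 1) * norm v" for v x
  proof -
    have "norm (dir_deriv v \<phi> x) \<le> (\<Sum>b\<in>Basis. \<bar>v \<bullet> b\<bar> * norm (dir_deriv b \<phi> x))"
      unfolding smooth_dir_deriv_basis[OF test_fun_smooth[OF assms], where v=v] by (rule order_trans[OF norm_sum]) simp
    also have "\<dots> \<le> (\<Sum>b\<in>Basis. norm v * M b)"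
      by (intro sum_mono mult_mono Basis_le_norm M) auto
    also have "\<dots> \<le> (sum M Basis + 1) * norm v" by (simp add: sum_distrib_left distrib_right distrib_left mult.commute)
    finally show ?thesis .
  qed
  moreover have "sum M Basis + 1 > 0"
    using sum_nonneg[of Basis M] order_trans[OF norm_ge_zero M] by (metis add_nonneg_pos zero_less_one)
  ultimately show ?thesis by blast
qed

lemma test_fun_Lipschitz:
  fixes \<phi> :: "'a::euclidean_space => complex"
  assumes "\<phi> \<in> test_fun UNIV"
  shows "\<exists>M>0. \<forall>x y. norm (\<phi> x - \<phi> y) \<le> M * norm (x - y)"
proof -
  obtain M where M: "M > 0" "\<And>x v. norm (dir_deriv v \<phi> x) \<le> M * norm v" using test_fun_deriv_bound[OF assms] by blast
  have "norm (\<phi> x - \<phi> y) \<le> M * norm (x - y)" for x y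
    by (rule differentiable_bound[OF convex_UNIV smooth_has_derivative[OF test_fun_smooth[OF assms]]])
      (auto intro!: onorm_le M)
  with M(1) show ?thesis by blast
qed

text \<open>The derivative is itself Lipschitz, which gives a remainder quadratic in
  \<open>h\<close> and uniform in \<open>z\<close>. The uniformity is what permits differentiation
  under the convolution integral.\<close>

lemma test_fun_Taylor:
  fixes \<phi> :: "'a::euclidean_space => complex"
  assumes "\<phi> \<in> test_fun UNIV"
  shows "\<exists>M>0. \<forall>z h. norm (\<phi> (z + h) - \<phi> z - dir_deriv h \<phi> z) \<le> M * (norm h)\<^sup>2"
proof -
  obtain M where M: "\<And>b. M b > 0" "\<And>b x y. norm (dir_deriv b \<phi> x - dir_deriv b \<phi> y) \<le> M b * norm (x - y)"
    using test_fun_Lipschitz[OF test_fun_dir_deriv[OF assms]] by metis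
  define S where "S = sum M Basis + 1"
  have S: "S > 0" unfolding S_def using M(1) by (simp add: add_nonneg_pos less_imp_le sum_nonneg)
  have D: "norm (dir_deriv v \<phi> w - dir_deriv v \<phi> z) \<le> S * norm (w - z) * norm v" for v w z
  proof -
    have "norm (dir_deriv v \<phi> w - dir_deriv v \<phi> z) = norm (\<Sum>b\<in>Basis. (v \<bullet> b) *\<^sub>R (dir_deriv b \<phi> w - dir_deriv b \<phi> z))"
      unfolding smooth_dir_deriv_basis[OF test_fun_smooth[OF assms], where v=v] by (simp add: sum_subtractf scaleR_diff_right)
    also have "\<dots> \<le> (\<Sum>b\<in>Basis. \<bar>v \<bullet> b\<bar> * norm (dir_deriv b \<phi> w - dir_deriv b \<phi> z))"
      by (rule order_trans[OF norm_sum]) simp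
    also have "\<dots> \<le> (\<Sum>b\<in>Basis. norm v * (M b * norm (w - z)))"
      by (intro sum_mono mult_mono Basis_le_norm M) auto
    also have "\<dots> = sum M Basis * norm (w - z) * norm v"
      by (simp add: sum_distrib_left[symmetric] sum_distrib_right[symmetric] algebra_simps)
    also have "\<dots> \<le> S * norm (w - z) * norm v"
      unfolding S_def by (intro mult_right_mono) auto
    finally show ?thesis .
  qed
  have "norm (\<phi> (z + h) - \<phi> z - dir_deriv h \<phi> z) \<le> S * (norm h)\<^sup>2" for z h
  proof -
    have "norm (\<phi> (z + h) - \<phi> z - dir_deriv (z + h - z) \<phi> z) \<le> norm (z + h - z) * (S * norm h)"
    proof (rule differentiable_bound_linearization[where S="cball z (norm h)" and f'="%x v. dir_deriv v \<phi> x"])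
      show "z + t *\<^sub>R (z + h - z) \<in> cball z (norm h)" if "t \<in> {0..1}" for t
        using that by (auto simp: dist_norm mult_left_le_one_le)
      show "(\<phi> has_derivative (%v. dir_deriv v \<phi> x)) (at x within cball z (norm h))" for x :: 'a
        using smooth_has_derivative[OF test_fun_smooth[OF assms]] by (rule has_derivative_at_withinI)
      show "onorm ((%v. dir_deriv v \<phi> x) - (%v. dir_deriv v \<phi> z)) \<le> S * norm h" if "x \<in> cball z (norm h)" for x
        unfolding fun_diff_def
      proof (rule onorm_le)
        fix v :: 'a
        have "S * norm (x - z) * norm v \<le> S * norm h * norm v"
          using that S by (intro mult_right_mono mult_left_mono) (auto simp: dist_norm norm_minus_commute)
        then show "norm (dir_deriv v \<phi> x - dir_deriv v \<phi> z) \<le> S * norm h * norm v" using D order_trans by blast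
      qed
    qed auto
    then show ?thesis by (simp add: power2_eq_square algebra_simps)
  qed
  with S show ?thesis by blast
qed

definition locally_integrable :: "('a::euclidean_space => complex) => bool"
  where "locally_integrable F \<longleftrightarrow> F \<in> borel_measurable lebesgue \<and>
    (\<forall>r. integrable lebesgue (%x. indicator (cball 0 r) x *\<^sub>R F x))"

definition conv :: "('a::euclidean_space => complex) => ('a => complex) => 'a => complex"
  where "conv F \<phi> x = (LINT y|lebesgue. F y * \<phi> (x - y))"

text \<open>Since \<open>g (x - y)\<close> vanishes once |y| > |x| + R, only the mass of F on that
  ball contributes. The second claim is kept quantitative in the bound M of g, because it is applied
  to Taylor remainders.\<close>

lemma conv_integrable:
  assumes "locally_integrable F" "continuous_on UNIV g" "\<And>x. norm x > R ==> g x = 0" "\<And>x. norm (g x) \<le> M"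
  shows "integrable lebesgue (%y. F y * g (x - y))"
    and "norm (LINT y|lebesgue. F y * g (x - y)) \<le> M * (LINT y|lebesgue. norm (indicator (cball 0 (norm x + R)) y *\<^sub>R F y))"
proof -
  let ?I = "%y. indicator (cball 0 (norm x + R)) y *\<^sub>R F y"
  have b: "norm (F y * g (x - y)) \<le> M * norm (?I y)" for y
  proof (cases "norm y \<le> norm x + R")
    case True then show ?thesis using mult_left_mono[OF assms(4)[of "x - y"] norm_ge_zero[of "F y"]] by (simp add: norm_mult mult.commute)
  next
    case False
    then have "norm (x - y) > R" using norm_triangle_ineq2[of y x] by (simp add: norm_minus_commute)
    then show ?thesis using False by (simp add: assms(3))
  qed
  have i: "integrable lebesgue (%y. M * norm (?I y))"
    using assms(1) unfolding locally_integrable_def by (intro integrable_mult_right integrable_norm) blast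
  have "(%y. g (x - y)) \<in> borel_measurable borel"
    by (intro borel_measurable_continuous_onI continuous_on_compose2[OF assms(2)] continuous_intros) auto
  then have m: "(%y. F y * g (x - y)) \<in> borel_measurable lebesgue"
    using assms(1) unfolding locally_integrable_def
    by (intro borel_measurable_times) (auto intro: measurable_completion)
  show "integrable lebesgue (%y. F y * g (x - y))"
    by (rule Bochner_Integration.integrable_bound[OF i m]) (use b in \<open>auto intro!: AE_I2 order_trans[OF _ abs_ge_self]\<close>)
  then have "norm (LINT y|lebesgue. F y * g (x - y)) \<le> (LINT y|lebesgue. M * norm (?I y))"
    using b by (intro order_trans[OF integral_norm_bound] integral_mono integrable_norm i)
  then show "norm (LINT y|lebesgue. F y * g (x - y)) \<le> M * (LINT y|lebesgue. norm (?I y))" by simp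
qed

lemma test_fun_ball:
  assumes "\<phi> \<in> test_fun U" shows "\<exists>R>0. \<forall>x. norm x > R --> \<phi> x = 0"
proof -
  obtain K where K: "compact K" "\<And>x. x \<notin> K ==> \<phi> x = 0" using test_fun_support[OF assms] by blast
  then obtain R where "R > 0" "\<And>x. x \<in> K ==> norm x \<le> R"
    using compact_imp_bounded bounded_pos by metis
  with K show ?thesis by (intro exI[of _ R]) (auto simp: not_le[symmetric])
qed

lemma conv_has_derivative:
  assumes F: "locally_integrable F" and \<phi>: "\<phi> \<in> test_fun UNIV"
  shows "(conv F \<phi> has_derivative (%v. conv F (dir_deriv v \<phi>) x)) (at x)"
proof -
  obtain R where R: "R > 0" "\<And>x. norm x > R ==> \<phi> x = 0" using test_fun_ball[OF \<phi>] by blast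
  obtain M where M: "M > 0" "\<And>z h. norm (\<phi> (z + h) - \<phi> z - dir_deriv h \<phi> z) \<le> M * (norm h)\<^sup>2"
    using test_fun_Taylor[OF \<phi>] by blast
  have int: "integrable lebesgue (%y. F y * \<psi> (x - y))" if \<psi>: "\<psi> \<in> test_fun UNIV" for \<psi> x
  proof -
    obtain R where "R > 0" "\<And>x. norm x > R ==> \<psi> x = 0" using test_fun_ball[OF \<psi>] by blast
    moreover obtain B where "\<And>x. norm (\<psi> x) \<le> B" using test_fun_bounded[OF \<psi>] by metis
    ultimately show ?thesis by (intro conv_integrable(1)[OF F smooth_continuous[OF test_fun_smooth[OF \<psi>]]])
  qed
  note \<phi>' = test_fun_dir_deriv[OF \<phi>]
  have l: "linear (%v. dir_deriv v \<phi> z)" for z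
    using has_derivative_linear[OF smooth_has_derivative[OF test_fun_smooth[OF \<phi>]]] .
  have "linear (%v. conv F (dir_deriv v \<phi>) x)"
  proof (rule linearI)
    show "conv F (dir_deriv (v + w) \<phi>) x = conv F (dir_deriv v \<phi>) x + conv F (dir_deriv w \<phi>) x" for v w
      unfolding conv_def linear_add[OF l] using int[OF \<phi>'] by (simp add: distrib_left)
    show "conv F (dir_deriv (c *\<^sub>R v) \<phi>) x = c *\<^sub>R conv F (dir_deriv v \<phi>) x" for c v
      unfolding conv_def linear_cmul[OF l] by simp
  qed
  then have bl: "bounded_linear (%v. conv F (dir_deriv v \<phi>) x)" by (simp add: linear_conv_bounded_linear)
  \<comment> \<open>The extra 1 in the radius leaves room for increments with |h| \<le> 1: the
    Taylor remainder \<open>g\<close> below vanishes outside the ball of radius R + 1.\<close>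
  define I where "I = (LINT y|lebesgue. norm (indicator (cball 0 (norm x + (R + 1))) y *\<^sub>R F y))"
  have est: "norm (conv F \<phi> (x + h) - conv F \<phi> x - conv F (dir_deriv h \<phi>) x) \<le> M * (norm h)\<^sup>2 * I" if "norm h \<le> 1" for h
  proof -
    define g where "g z = \<phi> (z + h) - \<phi> z - dir_deriv h \<phi> z" for z
    have c: "continuous_on UNIV g" unfolding g_def
      by (intro continuous_intros continuous_on_compose2[OF smooth_continuous[OF test_fun_smooth[OF \<phi>], of UNIV]]
          smooth_continuous[OF test_fun_smooth[OF \<phi>]] smooth_continuous[OF test_fun_smooth[OF \<phi>']]) auto
    have z: "g z = 0" if "norm z > R + 1" for z
    proof -
      have "norm (z + h) > R" using that \<open>norm h \<le> 1\<close> norm_triangle_ineq4[of "z + h" h] by simp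
      moreover have "dir_deriv h \<phi> z = 0" by (rule dir_deriv_outside[of "cball 0 R"]) (use R that in auto)
      ultimately show ?thesis using R that by (simp add: g_def)
    qed
    have "conv F \<phi> (x + h) - conv F \<phi> x - conv F (dir_deriv h \<phi>) x
        = (LINT y|lebesgue. F y * \<phi> (x + h - y) - F y * \<phi> (x - y) - F y * dir_deriv h \<phi> (x - y))"
      unfolding conv_def using int[OF \<phi>] int[OF \<phi>'] by simp
    also have "\<dots> = (LINT y|lebesgue. F y * g (x - y))"
      by (simp add: g_def algebra_simps)
    finally show ?thesis
      using conv_integrable(2)[OF F c z, where M="M * (norm h)\<^sup>2" and x=x] M(2) by (simp add: g_def I_def)
  qed
  have I0: "I \<ge> 0" unfolding I_def by (intro integral_nonneg_AE) auto
  show ?thesis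
  proof (rule has_derivativeI_sandwich[of 1, OF _ bl])
    fix y assume y: "y \<noteq> x" "dist y x < 1"
    have "norm (conv F \<phi> y - conv F \<phi> x - conv F (dir_deriv (y - x) \<phi>) x) \<le> M * (norm (y - x))\<^sup>2 * I"
      using est[of "y - x"] y by (simp add: dist_norm)
    then show "norm (conv F \<phi> y - conv F \<phi> x - conv F (dir_deriv (y - x) \<phi>) x) / norm (y - x) \<le> M * I * norm (y - x)"
      using y by (simp add: divide_le_eq power2_eq_square algebra_simps)
  next
    show "((%y. M * I * norm (y - x)) \<longlongrightarrow> 0) (at x)"
      by (auto intro!: tendsto_eq_intros)
  qed auto
qed

lemma conv_smooth:
  assumes F: "locally_integrable F" and \<phi>: "\<phi> \<in> test_fun UNIV"
  shows "smooth (conv F \<phi>)" and "dir_deriv v (conv F \<phi>) x = conv F (dir_deriv v \<phi>) x"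
proof -
  have "Ck_fun k (conv F \<phi>)" if "\<phi> \<in> test_fun UNIV" for k \<phi>
    using that
  proof (induction k arbitrary: \<phi>)
    case 0 show ?case
      using has_derivative_continuous[OF conv_has_derivative[OF F 0]] by (simp add: continuous_at_imp_continuous_on)
  next
    case (Suc k)
    have "dir_deriv v (conv F \<phi>) = conv F (dir_deriv v \<phi>)" for v
      by (intro ext dir_derivI[OF conv_has_derivative[OF F Suc.prems]])
    then show ?case unfolding Ck_fun.simps
      by (intro conjI allI) (rule differentiableI[OF conv_has_derivative[OF F Suc.prems]],
          simp only: Suc.IH[OF test_fun_dir_deriv[OF Suc.prems]])
  qed
  then show "smooth (conv F \<phi>)" unfolding smooth_def[of "conv F \<phi>"] using \<phi> by (intro allI)
  show "dir_deriv v (conv F \<phi>) x = conv F (dir_deriv v \<phi>) x" by (rule dir_derivI[OF conv_has_derivative[OF F \<phi>]])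
qed

lemma lborel_integral_reflect:
  fixes f :: "'a::euclidean_space => 'b::{banach,second_countable_topology}"
  assumes [measurable]: "f \<in> borel_measurable borel"
  shows "(LINT y|lborel. f (x - y)) = (LINT y|lborel. f y)"
proof -
  have "lborel = distr lborel borel (%y. x - y)"
    using lborel_affine[of "-1" x] by (simp add: density_1)
  then have "(LINT y|lborel. f y) = (LINT y|distr lborel borel (%y. x - y). f y)" by simp
  also have "\<dots> = (LINT y|lborel. f (x - y))" by (subst integral_distr) auto
  finally show ?thesis by simp
qed

text \<open>The convolution of \<phi> with the constant 1 is a constant function, its value being
  the integral of \<phi>. Differentiating it under the integral sign produces the integral of the
  derivative, which is therefore 0.\<close>

lemma integral_dir_deriv_test_fun:
  fixes \<phi> :: "'a::euclidean_space => complex"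
  assumes \<phi>: "\<phi> \<in> test_fun UNIV"
  shows "(LINT x|lebesgue. dir_deriv v \<phi> x) = 0"
proof -
  have m: "\<psi> \<in> borel_measurable borel" if "\<psi> \<in> test_fun UNIV" for \<psi> :: "'a => complex"
    by (rule borel_measurable_smooth[OF test_fun_smooth[OF that]])
  have c: "conv (%x. 1) \<psi> x = (LINT y|lebesgue. \<psi> y)" if "\<psi> \<in> test_fun UNIV" for \<psi> :: "'a => complex" and x
  proof -
    have [measurable]: "\<psi> \<in> borel_measurable borel" using m[OF that] .
    have "conv (%x. 1) \<psi> x = (LINT y|lborel. \<psi> (x - y))"
      unfolding conv_def by (simp, subst integral_completion) auto
    also have "\<dots> = (LINT y|lebesgue. \<psi> y)" by (subst lborel_integral_reflect) (auto simp: integral_completion)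
    finally show ?thesis .
  qed
  have l: "locally_integrable (%x::'a. 1::complex)" unfolding locally_integrable_def
    using lmeasurable_cball[of "0::'a"] unfolding lmeasurable_iff_integrable by auto
  have "((%x. LINT y|lebesgue. \<phi> y) has_derivative (%v. LINT y|lebesgue. dir_deriv v \<phi> y)) (at 0)"
    using conv_has_derivative[OF l \<phi>, of 0] unfolding c[OF test_fun_dir_deriv[OF \<phi>]]
    by (simp add: c[OF \<phi>, abs_def])
  then have "(%v. LINT y|lebesgue. dir_deriv v \<phi> y) = (%v. 0)"
    using has_derivative_unique[OF _ has_derivative_const] by blast
  then show ?thesis by metis
qed

subsection \<open>The Hilbert space of square integrable functions\<close>

abbreviation is_L2 :: "(real^3 => complex) => bool" where "is_L2 f \<equiv> L2_fun UNIV f"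

lemma is_L2_iff: "is_L2 f \<longleftrightarrow> f \<in> borel_measurable lebesgue \<and> integrable lebesgue (%x. (cmod (f x))\<^sup>2)"
  by (simp add: L2_fun_def lebesgue_on_UNIV_eq)

lemma is_L2_measurable: "is_L2 f ==> f \<in> borel_measurable lebesgue"
  by (simp add: is_L2_iff)

lemma is_L2_bound:
  assumes "f \<in> borel_measurable lebesgue" "integrable lebesgue g" "AE x in lebesgue. (cmod (f x))\<^sup>2 \<le> g x"
  shows "is_L2 f"
  unfolding is_L2_iff
  by (intro conjI assms(1) Bochner_Integration.integrable_bound[OF assms(2)])
    (use assms in \<open>auto elim!: eventually_mono intro: order_trans[OF _ abs_ge_self]\<close>)

lemma is_L2_0: "is_L2 (%x. 0)" by (simp add: is_L2_iff)

lemma is_L2_add: assumes "is_L2 f" "is_L2 g" shows "is_L2 (%x. f x + g x)"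
proof (rule is_L2_bound)
  show "integrable lebesgue (%x. 2 * (cmod (f x))\<^sup>2 + 2 * (cmod (g x))\<^sup>2)"
    using assms by (simp add: is_L2_iff)
  have "(cmod (a + b))\<^sup>2 \<le> 2 * (cmod a)\<^sup>2 + 2 * (cmod b)\<^sup>2" for a b
  proof -
    have "(cmod (a + b))\<^sup>2 \<le> (cmod a + cmod b)\<^sup>2" by (intro power_mono norm_triangle_ineq) auto
    also have "\<dots> \<le> 2 * (cmod a)\<^sup>2 + 2 * (cmod b)\<^sup>2"
      using zero_le_power2[of "cmod a - cmod b"] by (simp add: power2_eq_square algebra_simps)
    finally show ?thesis .
  qed
  then show "AE x in lebesgue. (cmod (f x + g x))\<^sup>2 \<le> 2 * (cmod (f x))\<^sup>2 + 2 * (cmod (g x))\<^sup>2" by auto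
qed (use assms in \<open>auto simp: is_L2_iff\<close>)

definition ae_bounded :: "(real^3 => complex) => real => bool"
  where "ae_bounded m M \<longleftrightarrow> m \<in> borel_measurable lebesgue \<and> (AE x in lebesgue. cmod (m x) \<le> M)"

lemma is_L2_mult: assumes "ae_bounded m M" "is_L2 f" shows "is_L2 (%x. m x * f x)"
proof (rule is_L2_bound)
  show "integrable lebesgue (%x. M\<^sup>2 * (cmod (f x))\<^sup>2)" using assms(2) by (simp add: is_L2_iff)
  show "AE x in lebesgue. (cmod (m x * f x))\<^sup>2 \<le> M\<^sup>2 * (cmod (f x))\<^sup>2"
    using assms(1) unfolding ae_bounded_def
    by (auto elim!: eventually_mono simp: norm_mult power_mult_distrib intro!: mult_right_mono power_mono)
qed (use assms in \<open>auto simp: is_L2_iff ae_bounded_def\<close>)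

lemma ae_bounded_const: "ae_bounded (%x. c) (cmod c)" by (simp add: ae_bounded_def)

lemma is_L2_cmult: "is_L2 f ==> is_L2 (%x. c * f x)"
  by (rule is_L2_mult[OF ae_bounded_const])

lemma is_L2_scaleR: "is_L2 f ==> is_L2 (%x. c *\<^sub>R f x)"
  using is_L2_cmult[of f "of_real c"] by (simp add: scaleR_conv_of_real)

lemma is_L2_uminus: "is_L2 f ==> is_L2 (%x. - f x)"
  using is_L2_cmult[of f "-1"] by simp

lemma is_L2_diff: "is_L2 f ==> is_L2 g ==> is_L2 (%x. f x - g x)"
  using is_L2_add[OF _ is_L2_uminus] by simp

lemma is_L2_cnj: "is_L2 f ==> is_L2 (%x. cnj (f x))"
  by (auto simp: is_L2_iff intro!: borel_measurable_continuous_on[OF continuous_on_cnj[OF continuous_on_id]])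

lemma is_L2_norm: "is_L2 f ==> is_L2 (%x. of_real (cmod (f x)))"
  by (auto simp: is_L2_iff)

lemma is_L2_mult_integrable: assumes "is_L2 f" "is_L2 g" shows "integrable lebesgue (%x. f x * g x)"
proof (rule Bochner_Integration.integrable_bound)
  show "integrable lebesgue (%x. (cmod (f x))\<^sup>2 + (cmod (g x))\<^sup>2)"
    using assms by (simp add: is_L2_iff)
  have "cmod (a * b) \<le> (cmod a)\<^sup>2 + (cmod b)\<^sup>2" for a b
  proof -
    have "2 * (cmod a * cmod b) \<le> (cmod a)\<^sup>2 + (cmod b)\<^sup>2"
      using zero_le_power2[of "cmod a - cmod b"] by (simp add: power2_eq_square algebra_simps)
    moreover have "0 \<le> cmod a * cmod b" by simp
    ultimately show ?thesis unfolding norm_mult by linarith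
  qed
  then show "AE x in lebesgue. norm (f x * g x) \<le> norm ((cmod (f x))\<^sup>2 + (cmod (g x))\<^sup>2)" by simp
qed (use assms in \<open>auto simp: is_L2_iff\<close>)

\<comment> \<open>A type with a Hilbert space structure makes solutions into Banach-valued curves,
  to which vector derivatives, integrals and limits apply. The relation is partial, so one quotient
  both restricts to square integrable functions and identifies those equal almost
  everywhere.\<close>
quotient_type l2 = "real^3 => complex" / partial:
  "%f g. is_L2 f \<and> is_L2 g \<and> (AE x in lebesgue. f x = g x)"
proof (rule part_equivpI)
  show "\<exists>f. is_L2 f \<and> is_L2 f \<and> (AE x in lebesgue. f x = f x)" using is_L2_0 by (intro exI conjI) auto
  show "symp (%f g. is_L2 f \<and> is_L2 g \<and> (AE x in lebesgue. f x = g x))"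
    by (auto simp: symp_def elim!: eventually_mono)
  show "transp (%f g. is_L2 f \<and> is_L2 g \<and> (AE x in lebesgue. f x = g x))"
    unfolding transp_def by (auto elim: eventually_elim2)
qed

lemma rep_l2: "is_L2 (rep_l2 u)"
  using Quotient3_rep_reflp[OF Quotient3_l2, of u] by simp

lemma abs_rep_l2: "abs_l2 (rep_l2 u) = u"
  using Quotient3_abs_rep[OF Quotient3_l2] .

lemma abs_l2_eq_iff: "is_L2 f ==> is_L2 g ==> abs_l2 f = abs_l2 g \<longleftrightarrow> (AE x in lebesgue. f x = g x)"
  using Quotient3_rel[OF Quotient3_l2, of f g] by simp

lemma abs_l2_cong: "is_L2 f ==> is_L2 g ==> (AE x in lebesgue. f x = g x) ==> abs_l2 f = abs_l2 g"
  by (simp add: abs_l2_eq_iff)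


lemma l2_cases [cases type: l2]: obtains f where "is_L2 f" "u = abs_l2 f"
  using that[of "rep_l2 u"] rep_l2 abs_rep_l2 by metis

instantiation l2 :: real_vector
begin
lift_definition zero_l2 :: l2 is "%x. 0" by (simp add: is_L2_0)
lift_definition plus_l2 :: "l2 => l2 => l2" is "%f g x. f x + g x"
  by (auto intro: is_L2_add elim: eventually_elim2)
lift_definition uminus_l2 :: "l2 => l2" is "%f x. - f x"
  by (auto intro: is_L2_uminus)
lift_definition minus_l2 :: "l2 => l2 => l2" is "%f g x. f x - g x"
  by (auto intro: is_L2_diff elim: eventually_elim2)
lift_definition scaleR_l2 :: "real => l2 => l2" is "%c f x. c *\<^sub>R f x"
  by (auto intro: is_L2_scaleR elim!: eventually_mono)
instance
proof
  fix u v w :: l2 and a b :: real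
  show "u + v + w = u + (v + w)" by transfer (auto intro!: is_L2_add simp: add.assoc)
  show "u + v = v + u" by transfer (auto intro!: is_L2_add simp: add.commute)
  show "0 + u = u" by transfer auto
  show "- u + u = 0" by transfer (auto intro: is_L2_add is_L2_uminus is_L2_0)
  show "u - v = u + - v" by transfer (auto intro: is_L2_add is_L2_diff is_L2_uminus)
  show "a *\<^sub>R (u + v) = a *\<^sub>R u + a *\<^sub>R v" by transfer (auto intro!: is_L2_add is_L2_scaleR simp: scaleR_add_right)
  show "(a + b) *\<^sub>R u = a *\<^sub>R u + b *\<^sub>R u" by transfer (auto intro!: is_L2_add is_L2_scaleR simp: scaleR_add_left)
  show "a *\<^sub>R b *\<^sub>R u = (a * b) *\<^sub>R u" by transfer (auto intro!: is_L2_scaleR)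
  show "1 *\<^sub>R u = u" by transfer auto
qed
end

text \<open>There is no conjugation: the form matches the integrals in the weak formulations and is
  complex linear in both arguments, hence compatible with holomorphic dependence on \<tau>. The
  Hermitian product is recovered as \<open>pair u (cnjL v)\<close>.\<close>

lift_definition pair :: "l2 => l2 => complex" is "%f g. LINT x|lebesgue. f x * g x"
proof -
  fix f f' g g' :: "real^3 => complex"
  assume "is_L2 f \<and> is_L2 f' \<and> (AE x in lebesgue. f x = f' x)" "is_L2 g \<and> is_L2 g' \<and> (AE x in lebesgue. g x = g' x)"
  then show "(LINT x|lebesgue. f x * g x) = (LINT x|lebesgue. f' x * g' x)"
    by (intro integral_cong_AE) (auto simp: is_L2_iff elim: eventually_elim2)
qed

lift_definition cnjL :: "l2 => l2" is "%f x. cnj (f x)"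
  by (auto intro: is_L2_cnj)

lift_definition absL :: "l2 => l2" is "%f x. of_real (cmod (f x))"
  by (auto intro: is_L2_norm elim!: eventually_mono)

text \<open>The guard makes the operator total: multiplication by a function that is not essentially
  bounded may leave L2, and is given the value 0.\<close>

lift_definition mulL :: "(real^3 => complex) => l2 => l2" is "%m f x. if \<exists>M. ae_bounded m M then m x * f x else 0"
proof -
  fix m f g :: "real^3 => complex" assume *: "is_L2 f \<and> is_L2 g \<and> (AE x in lebesgue. f x = g x)"
  show "is_L2 (%x. if \<exists>M. ae_bounded m M then m x * f x else 0) \<and> is_L2 (%x. if \<exists>M. ae_bounded m M then m x * g x else 0) \<and>
    (AE x in lebesgue. (if \<exists>M. ae_bounded m M then m x * f x else 0) = (if \<exists>M. ae_bounded m M then m x * g x else 0))"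
    by (cases "\<exists>M. ae_bounded m M") (use * is_L2_mult is_L2_0 in \<open>auto elim!: eventually_mono\<close>)
qed

lemma abs_l2_simps:
  assumes "is_L2 f" "is_L2 g"
  shows "abs_l2 f + abs_l2 g = abs_l2 (%x. f x + g x)" "abs_l2 f - abs_l2 g = abs_l2 (%x. f x - g x)"
    "- abs_l2 f = abs_l2 (%x. - f x)" "c *\<^sub>R abs_l2 f = abs_l2 (%x. c *\<^sub>R f x)"
    "pair (abs_l2 f) (abs_l2 g) = (LINT x|lebesgue. f x * g x)"
    "cnjL (abs_l2 f) = abs_l2 (%x. cnj (f x))" "absL (abs_l2 f) = abs_l2 (%x. of_real (cmod (f x)))"
  using assms by (auto simp: plus_l2.abs_eq minus_l2.abs_eq uminus_l2.abs_eq scaleR_l2.abs_eq pair.abs_eq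
      cnjL.abs_eq absL.abs_eq)

lemma mulL_abs_l2:
  assumes "ae_bounded m M" "is_L2 f" shows "mulL m (abs_l2 f) = abs_l2 (%x. m x * f x)"
proof -
  have "\<exists>M. ae_bounded m M" using assms by blast
  then show ?thesis using assms(2) by (simp add: mulL.abs_eq)
qed

lemma zero_l2_eq: "0 = abs_l2 (%x. 0)" by (simp add: zero_l2_def)

lemma pair_add_left: "pair (u + v) w = pair u w + pair v w"
  by (cases u; cases v; cases w) (simp add: abs_l2_simps is_L2_add is_L2_mult_integrable distrib_right)

lemma pair_commute: "pair u v = pair v u"
  by (cases u; cases v) (simp add: abs_l2_simps mult.commute)

lemma pair_add_right: "pair w (u + v) = pair w u + pair w v"
  using pair_add_left pair_commute by metis

lemma pair_scaleR_left: "pair (c *\<^sub>R u) v = c *\<^sub>R pair u v"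
  by (cases u; cases v) (simp add: abs_l2_simps is_L2_scaleR)

lemma pair_scaleR_right: "pair u (c *\<^sub>R v) = c *\<^sub>R pair u v"
  using pair_scaleR_left pair_commute by metis



lemma cnjL_cnjL [simp]: "cnjL (cnjL u) = u"
  by (cases u) (simp add: abs_l2_simps is_L2_cnj)

lemma pair_cnjL: "pair (cnjL u) (cnjL v) = cnj (pair u v)"
  by (cases u; cases v) (simp add: abs_l2_simps is_L2_cnj flip: complex_cnj_mult)

lemma pair_cnjL_self: "is_L2 f ==> pair (abs_l2 f) (cnjL (abs_l2 f)) = of_real (LINT x|lebesgue. (cmod (f x))\<^sup>2)"
  by (simp add: abs_l2_simps is_L2_cnj complex_norm_square[symmetric] flip: of_real_power)

instantiation l2 :: real_inner
begin
definition inner_l2 :: "l2 => l2 => real" where "inner_l2 u v = Re (pair u (cnjL v))"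
definition norm_l2 :: "l2 => real" where "norm_l2 u = sqrt (inner u u)"
definition dist_l2 :: "l2 => l2 => real" where "dist_l2 u v = norm (u - v)"
definition sgn_l2 :: "l2 => l2" where "sgn_l2 u = inverse (norm u) *\<^sub>R u"
definition uniformity_l2 :: "(l2 \<times> l2) filter"
  where "uniformity_l2 = (INF e\<in>{0<..}. principal {(x, y). dist x y < e})"
definition open_l2 :: "l2 set => bool"
  where "open_l2 U = (\<forall>x\<in>U. \<forall>\<^sub>F (x', y) in uniformity. x' = x --> y \<in> U)"
instance
proof
  fix u v w :: l2 and r :: real and U :: "l2 set"
  show "dist u v = norm (u - v)" "sgn u = inverse (norm u) *\<^sub>R u" "norm u = sqrt (u \<bullet> u)"
    by (simp_all add: dist_l2_def sgn_l2_def norm_l2_def)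
  show "uniformity = (INF e\<in>{0<..}. principal {(x, y::l2). dist x y < e})" by (rule uniformity_l2_def)
  show "open U = (\<forall>x\<in>U. \<forall>\<^sub>F (x', y) in uniformity. x' = x --> y \<in> U)" by (rule open_l2_def)
  show "u \<bullet> v = v \<bullet> u"
  proof -
    have "pair v (cnjL u) = cnj (pair u (cnjL v))"
      using pair_cnjL[of u "cnjL v"] by (simp add: pair_commute)
    then show ?thesis by (simp add: inner_l2_def)
  qed
  show "(u + v) \<bullet> w = u \<bullet> w + v \<bullet> w" by (simp add: inner_l2_def pair_add_left)
  show "r *\<^sub>R u \<bullet> v = r * (u \<bullet> v)" by (simp add: inner_l2_def pair_scaleR_left)
  obtain f where f: "is_L2 f" "u = abs_l2 f" by (cases u)
  have i: "u \<bullet> u = (LINT x|lebesgue. (cmod (f x))\<^sup>2)"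
    using f by (simp add: inner_l2_def pair_cnjL_self)
  show "0 \<le> u \<bullet> u" unfolding i by (intro integral_nonneg_AE) auto
  have "u \<bullet> u = 0 \<longleftrightarrow> (AE x in lebesgue. (cmod (f x))\<^sup>2 = 0)"
    unfolding i using f by (intro integral_nonneg_eq_0_iff_AE) (auto simp: is_L2_iff)
  then show "u \<bullet> u = 0 \<longleftrightarrow> u = 0"
    using abs_l2_eq_iff[OF f(1) is_L2_0] f by (simp add: zero_l2_eq)
qed
end

lemma norm_abs_l2: assumes "is_L2 f" shows "norm (abs_l2 f) = sqrt (LINT x|lebesgue. (cmod (f x))\<^sup>2)"
  using assms by (simp add: norm_eq_sqrt_inner inner_l2_def pair_cnjL_self)

lemma norm_abs_l2_nn:
  assumes "is_L2 f" shows "(\<integral>\<^sup>+x. ennreal ((cmod (f x))\<^sup>2) \<partial>lebesgue) = ennreal ((norm (abs_l2 f))\<^sup>2)"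
  using assms by (subst nn_integral_eq_integral) (auto simp: norm_abs_l2 is_L2_iff integral_nonneg_AE)

lemma norm_cnjL [simp]: "norm (cnjL u) = norm u"
  by (cases u) (simp add: abs_l2_simps norm_abs_l2 is_L2_cnj)

lemma norm_absL [simp]: "norm (absL u) = norm u"
  by (cases u) (simp add: abs_l2_simps norm_abs_l2 is_L2_norm)

text \<open>The real inner product sees only the real part of a pairing, so Cauchy-Schwarz is
  applied to the absolute values \<open>absL u\<close> and \<open>absL v\<close>, for which the
  pairing is real.\<close>

lemma norm_pair_le: "norm (pair u v) \<le> norm u * norm v"
proof -
  obtain f where f: "is_L2 f" "u = abs_l2 f" by (cases u)
  obtain g where g: "is_L2 g" "v = abs_l2 g" by (cases v)
  have "norm (pair u v) \<le> (LINT x|lebesgue. cmod (f x * g x))"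
    using f g by (simp add: abs_l2_simps)
  also have "\<dots> = absL u \<bullet> absL v"
    using f g by (simp add: inner_l2_def abs_l2_simps is_L2_norm is_L2_cnj norm_mult flip: of_real_mult)
  also have "\<dots> \<le> norm u * norm v" using Cauchy_Schwarz_ineq2[of "absL u" "absL v"] by simp
  finally show ?thesis .
qed

lemma bounded_bilinear_pair: "bounded_bilinear pair"
  by (rule bounded_bilinear.intro)
    (auto simp: pair_add_left pair_add_right pair_scaleR_left pair_scaleR_right intro!: exI[of _ 1] norm_pair_le)

lemmas bounded_linear_pair_left = bounded_bilinear.bounded_linear_left[OF bounded_bilinear_pair]


lemma pair_eq_0_imp: "(\<And>v. pair u v = 0) ==> u = 0"
  by (metis inner_eq_zero_iff inner_l2_def zero_complex.sel(1))

lemma norm_mulL: assumes "ae_bounded m M" shows "norm (mulL m u) \<le> M * norm u"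
proof -
  obtain f where f: "is_L2 f" "u = abs_l2 f" by (cases u)
  \<comment> \<open>An essential bound cannot be negative, because the whole space is not a null
    set. The sign is needed to take M out of the square root.\<close>
  have M: "0 \<le> M"
  proof (rule ccontr)
    assume "\<not> 0 \<le> M"
    with assms have "AE x in (lebesgue :: (real^3) measure). False" unfolding ae_bounded_def
      by (auto elim!: eventually_mono dest: order_trans[OF norm_ge_zero])
    then have "ae_filter (lebesgue :: (real^3) measure) = bot" by (simp add: trivial_limit_def)
    then show False by (simp add: ae_filter_eq_bot_iff emeasure_lborel_UNIV)
  qed
  have "(LINT x|lebesgue. (cmod (m x * f x))\<^sup>2) \<le> (LINT x|lebesgue. M\<^sup>2 * (cmod (f x))\<^sup>2)"
    using f assms is_L2_mult[OF assms f(1)] unfolding ae_bounded_def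
    by (intro integral_mono_AE)
      (auto simp: is_L2_iff norm_mult power_mult_distrib elim!: eventually_mono intro!: mult_right_mono power_mono)
  then have "norm (mulL m u) \<le> sqrt (M\<^sup>2 * (LINT x|lebesgue. (cmod (f x))\<^sup>2))"
    using f assms by (simp add: mulL_abs_l2[OF assms] norm_abs_l2 is_L2_mult[OF assms])
  also have "\<dots> = M * norm u" using f M by (simp add: real_sqrt_mult norm_abs_l2)
  finally show ?thesis .
qed

lemma bounded_linear_mulL: "ae_bounded m M ==> bounded_linear (mulL m)"
proof (rule bounded_linear_intro[of _ M])
  fix u v c assume m: "ae_bounded m M"
  show "mulL m (u + v) = mulL m u + mulL m v"
    by (cases u; cases v) (simp add: mulL_abs_l2[OF m] abs_l2_simps is_L2_add is_L2_mult[OF m] distrib_left)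
  show "mulL m (c *\<^sub>R u) = c *\<^sub>R mulL m u"
    by (cases u) (simp add: mulL_abs_l2[OF m] abs_l2_simps is_L2_scaleR is_L2_mult[OF m])
  show "norm (mulL m u) \<le> norm u * M" using norm_mulL[OF m, of u] by (simp add: mult.commute)
qed

text \<open>The Riesz-Fischer argument: the partial sums \<open>s\<close> of the absolute increments
  increase and have norm at most 2, so by monotone convergence their supremum is finite almost
  everywhere, and there the series of increments converges absolutely.\<close>

lemma l2_Cauchy_AE_limit:
  fixes f :: "nat => real^3 => complex"
  assumes f: "\<And>n. is_L2 (f n)" and d: "\<And>n. norm (abs_l2 (f (Suc n)) - abs_l2 (f n)) \<le> (1/2)^n"
  shows "AE x in lebesgue. convergent (%n. f n x)"
proof -
  define s where "s n x = (\<Sum>k<n. cmod (f (Suc k) x - f k x))" for n x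
  have [measurable]: "f n \<in> borel_measurable lebesgue" for n using f by (simp add: is_L2_iff)
  have s: "is_L2 (%x. of_real (s n x)) \<and> abs_l2 (%x. of_real (s n x)) = (\<Sum>k<n. absL (abs_l2 (f (Suc k)) - abs_l2 (f k)))" for n
  proof (induction n)
    case 0 then show ?case by (simp add: s_def is_L2_0 zero_l2_eq)
  next
    case (Suc n)
    have d: "is_L2 (%x. f (Suc n) x - f n x)" using f is_L2_diff by blast
    have "(%x. complex_of_real (s (Suc n) x)) = (%x. of_real (s n x) + of_real (cmod (f (Suc n) x - f n x)))"
      by (simp add: s_def)
    moreover have "abs_l2 (%x. of_real (s n x)) + absL (abs_l2 (f (Suc n)) - abs_l2 (f n))
        = abs_l2 (%x. of_real (s n x) + of_real (cmod (f (Suc n) x - f n x)))"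
      using conjunct1[OF Suc] abs_l2_simps(2)[OF f f, of "Suc n" n] d abs_l2_simps(7)[OF d d] by (simp only: abs_l2_simps(1) is_L2_norm)
    ultimately show ?case using Suc d by (simp add: is_L2_add is_L2_norm)
  qed
  have n2: "norm (abs_l2 (%x. of_real (s n x))) \<le> 2" for n
  proof -
    have "norm (abs_l2 (%x. of_real (s n x))) \<le> (\<Sum>k<n. (1/2)^k)"
      using s[of n] d by (auto intro!: order_trans[OF norm_sum] sum_mono)
    also have "\<dots> \<le> 2" by (simp add: sum_gp_strict)
    finally show ?thesis .
  qed
  have sm: "s n x \<le> s (Suc n) x" "0 \<le> s n x" for n x by (auto simp: s_def intro: sum_nonneg)
  have [measurable]: "s n \<in> borel_measurable lebesgue" for n unfolding s_def by measurable
  have "(\<integral>\<^sup>+x. (SUP n. ennreal ((s n x)\<^sup>2)) \<partial>lebesgue) = (SUP n. \<integral>\<^sup>+x. ennreal ((s n x)\<^sup>2) \<partial>lebesgue)"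
    by (rule nn_integral_monotone_convergence_SUP)
      (auto intro!: incseq_SucI le_funI ennreal_leI power_mono sm)
  also have "\<dots> \<le> ennreal 4"
  proof (rule SUP_least)
    fix n
    have "(\<integral>\<^sup>+x. ennreal ((s n x)\<^sup>2) \<partial>lebesgue) = ennreal ((norm (abs_l2 (%x. of_real (s n x))))\<^sup>2)"
      using norm_abs_l2_nn[of "%x. of_real (s n x)"] s[of n] by simp
    also have "\<dots> \<le> ennreal (2\<^sup>2)" using n2[of n] by (intro ennreal_leI power_mono) auto
    finally show "(\<integral>\<^sup>+x. ennreal ((s n x)\<^sup>2) \<partial>lebesgue) \<le> ennreal 4" by simp
  qed
  finally have "(\<integral>\<^sup>+x. (SUP n. ennreal ((s n x)\<^sup>2)) \<partial>lebesgue) \<noteq> \<infinity>"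
    using ennreal_less_top[of 4] by (metis infinity_ennreal_def leD)
  then have "AE x in lebesgue. (SUP n. ennreal ((s n x)\<^sup>2)) \<noteq> \<infinity>"
    by (intro nn_integral_noteq_infinite) auto
  then show ?thesis
  proof (rule eventually_mono)
    fix x assume "(SUP n. ennreal ((s n x)\<^sup>2)) \<noteq> \<infinity>"
    then obtain B where B: "B \<ge> 0" "(SUP n. ennreal ((s n x)\<^sup>2)) = ennreal B"
      by (metis ennreal_cases infinity_ennreal_def)
    have "s n x \<le> sqrt B" for n
    proof -
      have "ennreal ((s n x)\<^sup>2) \<le> ennreal B" unfolding B(2)[symmetric] by (rule SUP_upper) simp
      then show ?thesis using B(1) by (simp add: real_le_rsqrt)
    qed
    then have "summable (%k. cmod (f (Suc k) x - f k x))"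
      unfolding s_def by (intro summableI_nonneg_bounded[where x="sqrt B"]) auto
    then have "summable (%k. f (Suc k) x - f k x)" by (rule summable_norm_cancel)
    then have "convergent (%n. \<Sum>k<n. f (Suc k) x - f k x)" by (simp add: summable_iff_convergent)
    then have "convergent (%n. f n x - f 0 x)" by (simp add: sum_lessThan_telescope[of "%k. f k x"])
    then have "convergent (%n. (f n x - f 0 x) + f 0 x)" by (intro convergent_add convergent_const)
    then show "convergent (%n. f n x)" by simp
  qed
qed

instance l2 :: banach
proof
  fix X :: "nat => l2" assume X: "Cauchy X"
  have "\<exists>r. strict_mono r \<and> (\<forall>n. norm (X (r (Suc n)) - X (r n)) < (1/2)^n)"
  proof -
    obtain N where N: "\<And>k m n. m \<ge> N k ==> n \<ge> N k ==> norm (X m - X n) < (1/2)^k"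
      using CauchyD[OF X, of "(1/2)^k" for k] by (metis zero_less_power zero_less_divide_1_iff zero_less_numeral)
    \<comment> \<open>Adding up the thresholds and adding k makes the indices strictly increasing,
      while r k and r (Suc k) both stay above \<open>N k\<close>.\<close>
    define r where "r k = (\<Sum>i\<le>k. N i) + k" for k
    have "r k < r (Suc k)" for k by (simp add: r_def)
    then have "strict_mono r" by (simp add: strict_mono_Suc_iff)
    moreover have "r k \<ge> N k" for k unfolding r_def using member_le_sum[of k "{..k}" N] by (simp add: trans_le_add1)
    moreover have "r (Suc k) \<ge> N k" for k unfolding r_def using member_le_sum[of k "{..Suc k}" N] by (simp add: trans_le_add1)
    ultimately show ?thesis using N by blast
  qed
  then obtain r where r: "strict_mono r" "\<And>n. norm (X (r (Suc n)) - X (r n)) < (1/2)^n" by blast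
  define f where "f n = rep_l2 (X (r n))" for n
  have f: "is_L2 (f n)" "abs_l2 (f n) = X (r n)" for n by (simp_all add: f_def rep_l2 abs_rep_l2)
  have [measurable]: "f n \<in> borel_measurable lebesgue" for n using f by (simp add: is_L2_iff)
  define g where "g x = lim (%n. f n x)" for x
  have [measurable]: "g \<in> borel_measurable lebesgue" unfolding g_def by measurable
  have "AE x in lebesgue. convergent (%n. f n x)"
    by (rule l2_Cauchy_AE_limit) (use f r in \<open>auto intro: less_imp_le\<close>)
  then have lim: "AE x in lebesgue. (%n. f n x) \<longlonglongrightarrow> g x"
    by (rule eventually_mono) (simp add: g_def convergent_LIMSEQ_iff)
  \<comment> \<open>Fatou's lemma turns closeness of X (r n) to all later members of the subsequence
    into closeness of f n to the pointwise limit g, before g is known to be square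
    integrable.\<close>
  have fatou: "(\<integral>\<^sup>+x. ennreal ((cmod (f n x - g x))\<^sup>2) \<partial>lebesgue) \<le> ennreal (e\<^sup>2)"
    if N: "\<And>m. m \<ge> N ==> norm (X (r n) - X (r m)) \<le> e" for n N e
  proof -
    have "(\<integral>\<^sup>+x. ennreal ((cmod (f n x - g x))\<^sup>2) \<partial>lebesgue)
        = (\<integral>\<^sup>+x. liminf (%m. ennreal ((cmod (f n x - f m x))\<^sup>2)) \<partial>lebesgue)"
    proof (rule nn_integral_cong_AE, rule eventually_mono[OF lim])
      fix x assume "(%m. f m x) \<longlonglongrightarrow> g x"
      then have "(%m. ennreal ((cmod (f n x - f m x))\<^sup>2)) \<longlonglongrightarrow> ennreal ((cmod (f n x - g x))\<^sup>2)"
        by (intro tendsto_intros tendsto_ennrealI)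
      then show "ennreal ((cmod (f n x - g x))\<^sup>2) = liminf (%m. ennreal ((cmod (f n x - f m x))\<^sup>2))"
        using lim_imp_Liminf sequentially_bot by metis
    qed
    also have "\<dots> \<le> liminf (%m. \<integral>\<^sup>+x. ennreal ((cmod (f n x - f m x))\<^sup>2) \<partial>lebesgue)"
      by (rule nn_integral_liminf) measurable
    also have "\<dots> = liminf (%m. ennreal ((norm (X (r n) - X (r m)))\<^sup>2))"
      using norm_abs_l2_nn[OF is_L2_diff[OF f(1) f(1)]] f by (simp add: abs_l2_simps flip: f(2))
    also have "\<dots> \<le> ennreal (e\<^sup>2)"
      by (intro Liminf_le eventually_sequentiallyI[of N] ennreal_leI power_mono N) auto
    finally show ?thesis .
  qed
  have L2: "is_L2 (%x. f n x - g x)"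
    if N: "\<And>m. m \<ge> N ==> norm (X (r n) - X (r m)) \<le> e" for n N e
    unfolding is_L2_iff using le_less_trans[OF fatou[of N n e, OF N] ennreal_less_top]
    by (auto intro!: integrableI_bounded simp: ennreal_power)
  have CX: "\<exists>N. \<forall>n\<ge>N. \<forall>m\<ge>N. norm (X (r n) - X (r m)) \<le> e" if e: "e > 0" for e
  proof -
    obtain N where N: "\<And>m n. m \<ge> N ==> n \<ge> N ==> norm (X m - X n) < e" using CauchyD[OF X e] by blast
    have "norm (X (r n) - X (r m)) < e" if "n \<ge> N" "m \<ge> N" for n m
      by (rule N) (use that seq_suble[OF r(1), of n] seq_suble[OF r(1), of m] in auto)
    then show ?thesis by (meson less_imp_le)
  qed
  obtain N where N: "\<And>m. m \<ge> N ==> norm (X (r N) - X (r m)) \<le> 1" using CX[of 1] by auto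
  have g: "is_L2 g" using is_L2_diff[OF f(1)[of N] L2[OF N]] by simp
  have "(X \<circ> r) \<longlonglongrightarrow> abs_l2 g"
  proof (rule LIMSEQ_I)
    fix e :: real assume "e > 0"
    then obtain N where N: "\<And>n m. n \<ge> N ==> m \<ge> N ==> norm (X (r n) - X (r m)) \<le> e/2" using CX[of "e/2"] by auto
    have "norm ((X \<circ> r) n - abs_l2 g) < e" if "n \<ge> N" for n
    proof -
      have "norm (X (r n) - abs_l2 g) = norm (abs_l2 (%x. f n x - g x))"
        using f g by (simp add: abs_l2_simps flip: f(2))
      moreover have "ennreal ((norm (abs_l2 (%x. f n x - g x)))\<^sup>2) \<le> ennreal ((e/2)\<^sup>2)"
        using fatou[OF N[OF that]] norm_abs_l2_nn[OF is_L2_diff[OF f(1) g]] by simp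
      then have sq: "(norm (abs_l2 (%x. f n x - g x)))\<^sup>2 \<le> (e/2)\<^sup>2" by (simp del: power_divide)
      have "norm (abs_l2 (%x. f n x - g x)) \<le> e/2" using power2_le_imp_le[OF sq] \<open>e > 0\<close> by simp
      ultimately show ?thesis using \<open>e > 0\<close> by simp
    qed
    then show "\<exists>N. \<forall>n\<ge>N. norm ((X \<circ> r) n - abs_l2 g) < e" by blast
  qed
  then have "X \<longlonglongrightarrow> abs_l2 g" using Cauchy_converges_subseq[OF X r(1)] by blast
  then show "convergent X" by (rule convergentI)
qed

text \<open>Convolution and Fubini treat f (x - z) as a function of two variables; its product
  measurability follows from Borel measurability of f. So Borel representatives are chosen wherever
  a class is mollified.\<close>

lemma l2_borel_rep: "\<exists>f. is_L2 f \<and> f \<in> borel_measurable borel \<and> u = abs_l2 f"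
proof -
  obtain f where f: "is_L2 f" "u = abs_l2 f" by (cases u)
  then have m: "(%x. Re (f x)) \<in> borel_measurable lebesgue" "(%x. Im (f x)) \<in> borel_measurable lebesgue"
    by (auto simp: is_L2_iff)
  obtain g where g: "g \<in> borel_measurable lborel" "AE x in lborel. Re (f x) = g x"
    using completion_ex_borel_measurable_real[OF m(1)] by blast
  obtain h where h: "h \<in> borel_measurable lborel" "AE x in lborel. Im (f x) = h x"
    using completion_ex_borel_measurable_real[OF m(2)] by blast
  define k where "k x = complex_of_real (g x) + \<i> * complex_of_real (h x)" for x
  have kb: "k \<in> borel_measurable borel"
    using g(1) h(1) unfolding k_def by simp
  have "AE x in lborel. f x = k x" using g(2) h(2) by eventually_elim (simp add: k_def complex_eq_iff)
  then have ae: "AE x in lebesgue. f x = k x" by (rule AE_completion)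
  have km: "k \<in> borel_measurable lebesgue" using kb by (auto intro: measurable_completion)
  have "is_L2 k"
    by (rule is_L2_bound[OF km, of "%x. (cmod (f x))\<^sup>2"]) (use f ae in \<open>auto simp: is_L2_iff elim!: eventually_mono\<close>)
  then show ?thesis using kb ae f abs_l2_cong by blast
qed

lemma l2_dominated_convergence:
  fixes f :: "nat => real^3 => complex" and w :: "real^3 => real"
  assumes w: "integrable lebesgue (%x. (w x)\<^sup>2)"
    and f: "\<And>n. f n \<in> borel_measurable lebesgue" and g: "g \<in> borel_measurable lebesgue"
    and b: "\<And>n. AE x in lebesgue. cmod (f n x) \<le> w x"
    and l: "AE x in lebesgue. (%n. f n x) \<longlonglongrightarrow> g x"
  shows "is_L2 g" "is_L2 (f n)" "(%n. abs_l2 (f n)) \<longlonglongrightarrow> abs_l2 g"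
proof -
  have sq: "a\<^sup>2 \<le> b\<^sup>2" if "0 \<le> a" "a \<le> b" for a b :: real using that by (intro power_mono) auto
  have fn: "is_L2 (f n)" for n
    by (rule is_L2_bound[OF f w]) (use b[of n] in \<open>auto elim!: eventually_mono intro: sq\<close>)
  then show "is_L2 (f n)" by simp
  have ball: "AE x in lebesgue. \<forall>n. cmod (f n x) \<le> w x" using b by (simp add: AE_all_countable)
  have bg: "AE x in lebesgue. cmod (g x) \<le> w x"
    using ball l by eventually_elim (rule LIMSEQ_le_const2[OF tendsto_norm], auto)
  show g2: "is_L2 g"
    by (rule is_L2_bound[OF g w]) (use bg in \<open>auto elim!: eventually_mono intro: sq\<close>)
  have "(%n. LINT x|lebesgue. (cmod (f n x - g x))\<^sup>2) \<longlonglongrightarrow> (LINT x|(lebesgue :: (real^3) measure). 0)"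
  proof (rule integral_dominated_convergence)
    show "integrable lebesgue (%x. 4 * (w x)\<^sup>2)" using w by simp
    show "AE x in lebesgue. (%n. (cmod (f n x - g x))\<^sup>2) \<longlonglongrightarrow> 0"
      using l by eventually_elim (auto intro!: tendsto_eq_intros)
    show "AE x in lebesgue. norm ((cmod (f n x - g x))\<^sup>2) \<le> 4 * (w x)\<^sup>2" for n
      using b[of n] bg
    proof eventually_elim
      case (elim x)
      then have "cmod (f n x - g x) \<le> 2 * w x" using norm_triangle_ineq4[of "f n x" "g x"] by linarith
      from sq[OF _ this] show ?case by (simp add: power_mult_distrib)
    qed
  qed (use f g in auto)
  then have "(%n. sqrt (LINT x|lebesgue. (cmod (f n x - g x))\<^sup>2)) \<longlonglongrightarrow> sqrt 0"
    by (intro tendsto_real_sqrt) simp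
  then have "(%n. norm (abs_l2 (f n) - abs_l2 g)) \<longlonglongrightarrow> 0"
    using fn g2 by (simp add: abs_l2_simps norm_abs_l2 is_L2_diff)
  then show "(%n. abs_l2 (f n)) \<longlonglongrightarrow> abs_l2 g"
    using LIM_zero_iff tendsto_norm_zero_iff by blast
qed

text \<open>A measurable function is an almost everywhere limit of continuous ones, but without a
  dominating function. The continuous truncations \<open>cl\<close> of the values and
  \<open>ct\<close> of the support supply one: first for the truncations of f itself, then, at a
  fixed level R, for the truncations of its continuous approximants.\<close>

lemma l2_dense_continuous:
  assumes "e > 0"
  shows "\<exists>g. continuous_on UNIV g \<and> (\<exists>R. \<forall>x. norm x > R --> g x = 0) \<and> is_L2 g \<and> norm (u - abs_l2 g) < e"
proof -
  obtain f where f: "is_L2 f" "u = abs_l2 f" by (cases u)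
  have "f measurable_on UNIV" using f(1) by (intro lebesgue_measurable_imp_measurable_on) (auto simp: is_L2_iff)
  then obtain N g where N: "negligible N" and g: "\<And>n. continuous_on UNIV (g n)"
    and gf: "\<And>x. x \<notin> N ==> (%n. g n x) \<longlonglongrightarrow> f x"
    unfolding measurable_on_def by auto
  have aeN: "AE x in lebesgue. x \<notin> N" using N by (simp add: negligible_iff_null_sets AE_not_in)
  define cl where "cl R z = z / of_real (max 1 (cmod z / R))" for R :: real and z :: complex
  define ct where "ct R x = complex_of_real (max 0 (min 1 (R + 1 - norm x)))" for R :: real and x :: "real^3"
  have clc: "continuous_on UNIV (cl R)" if "R > 0" for R
    unfolding cl_def using that by (intro continuous_intros) (auto simp: of_real_eq_0_iff max_def)
  have cl1: "cmod (cl R z) \<le> cmod z" if "R > 0" for R z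
  proof -
    have "cmod z / max 1 (cmod z / R) \<le> cmod z / 1" by (intro divide_left_mono) auto
    then show ?thesis by (simp add: cl_def norm_divide)
  qed
  have cl2: "cmod (cl R z) \<le> R" if "R > 0" for R z
    using that by (auto simp: cl_def norm_divide divide_simps max_def)
  have cl3: "cl R z = z" if "R > 0" "cmod z \<le> R" for R z
    using that by (simp add: cl_def max_def divide_le_eq)
  have chc: "continuous_on UNIV (ct R)" for R unfolding ct_def by (intro continuous_intros)
  have ch1: "cmod (ct R x) \<le> 1" for R x by (simp add: ct_def)
  have ch0: "ct R x = 0" if "norm x > R + 1" for R x using that by (simp add: ct_def)
  have ch3: "ct R x = 1" if "norm x \<le> R" for R x using that by (simp add: ct_def)
  have fm: "f \<in> borel_measurable lebesgue" using f by (simp add: is_L2_iff)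
  have clm: "(%x. cl R (h x)) \<in> borel_measurable lebesgue" if "h \<in> borel_measurable lebesgue" "R > 0" for h R
    using borel_measurable_continuous_on[OF clc[OF that(2)] that(1)] .
  have chm: "ct R \<in> borel_measurable lebesgue" for R
    using borel_measurable_continuous_onI[OF chc] by (auto intro: measurable_completion)
  have "(%n. abs_l2 (%x. ct (real (Suc n)) x * cl (real (Suc n)) (f x))) \<longlonglongrightarrow> abs_l2 f"
  proof (rule l2_dominated_convergence(3))
    show "integrable lebesgue (%x. (cmod (f x))\<^sup>2)" using f by (simp add: is_L2_iff)
    show "AE x in lebesgue. cmod (ct (real (Suc n)) x * cl (real (Suc n)) (f x)) \<le> cmod (f x)" for n
      using mult_mono[OF ch1 cl1, of "real (Suc n)"] by (intro AE_I2) (auto simp: norm_mult)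
    show "AE x in lebesgue. (%n. ct (real (Suc n)) x * cl (real (Suc n)) (f x)) \<longlonglongrightarrow> f x"
    proof (rule AE_I2, rule tendsto_eventually)
      fix x
      obtain n0 where n0: "real n0 \<ge> max (norm x) (cmod (f x))" using real_arch_simple by blast
      show "\<forall>\<^sub>F n in sequentially. ct (real (Suc n)) x * cl (real (Suc n)) (f x) = f x"
        by (rule eventually_sequentiallyI[of n0]) (use n0 in \<open>subst ch3, simp, subst cl3, auto\<close>)
    qed
  qed (intro borel_measurable_times chm clm fm | simp)+
  then obtain n where n: "norm (abs_l2 (%x. ct (real (Suc n)) x * cl (real (Suc n)) (f x)) - abs_l2 f) < e/2"
    using LIMSEQ_D[of _ "abs_l2 f" "e/2"] assms by (meson half_gt_zero order_refl)
  define R where "R = real (Suc n)"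
  have R: "R > 0" by (simp add: R_def)
  have gm: "g n \<in> borel_measurable lebesgue" for n
    using borel_measurable_continuous_onI[OF g] by (auto intro: measurable_completion)
  let ?h = "%n x. ct R x * cl R (g n x)"
  have wi: "integrable lebesgue (%x. (R * indicator (cball (0::real^3) (R + 1)) x)\<^sup>2 :: real)" (is "integrable _ ?w")
  proof -
    have "?w = (%x. R\<^sup>2 * indicator (cball 0 (R + 1)) x)" by (auto simp: indicator_def)
    then show ?thesis using lmeasurable_cball[of "0::real^3" "R+1"] unfolding lmeasurable_iff_integrable by simp
  qed
  have hb: "cmod (?h n x) \<le> R * indicator (cball 0 (R + 1)) x" for n x
    using mult_mono[OF ch1[of R x] cl2[OF R, of "g n x"]] ch0[of R x] by (auto simp: norm_mult indicator_def not_le)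
  have hl: "AE x in lebesgue. (%n. ?h n x) \<longlonglongrightarrow> ct R x * cl R (f x)"
    using aeN
  proof eventually_elim
    case (elim x)
    have "isCont (cl R) (f x)" using clc[OF R] by (simp add: continuous_on_eq_continuous_at)
    from isCont_tendsto_compose[OF this gf[OF elim]] show ?case by (intro tendsto_intros)
  qed
  note dc = l2_dominated_convergence[OF wi _ _ AE_I2[OF hb] hl]
  have "(%n. abs_l2 (?h n)) \<longlonglongrightarrow> abs_l2 (%x. ct R x * cl R (f x))"
    by (rule dc(3)) (intro borel_measurable_times chm clm fm gm R)+
  then obtain m where m: "norm (abs_l2 (?h m) - abs_l2 (%x. ct R x * cl R (f x))) < e/2"
    using LIMSEQ_D[of _ _ "e/2"] assms by (meson half_gt_zero order_refl)
  have "is_L2 (?h m)" by (rule dc(2)) (intro borel_measurable_times chm clm fm gm R)+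
  moreover have "continuous_on UNIV (?h m)"
    by (intro continuous_intros chc continuous_on_compose2[OF clc[OF R] g]) auto
  moreover have "\<forall>x. norm x > R + 1 --> ?h m x = 0" using ch0 by simp
  moreover have "norm (u - abs_l2 (?h m)) < e"
  proof -
    have "norm (abs_l2 (?h m) - u) \<le> norm (abs_l2 (?h m) - abs_l2 (%x. ct R x * cl R (f x))) + norm (abs_l2 (%x. ct R x * cl R (f x)) - abs_l2 f)"
      unfolding f(2) using norm_triangle_ineq[of "abs_l2 (?h m) - abs_l2 (%x. ct R x * cl R (f x))" "abs_l2 (%x. ct R x * cl R (f x)) - abs_l2 f"] by simp
    also have "\<dots> < e" using m n unfolding R_def by linarith
    finally show ?thesis by (simp add: norm_minus_commute)
  qed
  ultimately show ?thesis by blast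
qed

section \<open>Multiplication operators, projections to subsets and extension by zero\<close>

lemma ae_bounded_indicator: "U \<in> sets lebesgue ==> ae_bounded (indicator U) 1"
  by (auto simp: ae_bounded_def indicator_def)

lemma ae_bounded_mult: "ae_bounded m M ==> ae_bounded n N ==> ae_bounded (%x. m x * n x) (M * N)"
  unfolding ae_bounded_def by (auto elim!: eventually_elim2 simp: norm_mult intro!: mult_mono intro: order_trans[OF norm_ge_zero])

lemma mulL_mulL:
  assumes "ae_bounded m M" "ae_bounded n N" shows "mulL m (mulL n u) = mulL (%x. m x * n x) u"
  by (cases u) (simp add: mulL_abs_l2[OF assms(1)] mulL_abs_l2[OF assms(2)] mulL_abs_l2[OF ae_bounded_mult[OF assms]]
      is_L2_mult[OF assms(2)] mult.assoc)

lemma pair_mulL: assumes "ae_bounded m M" shows "pair (mulL m u) v = pair u (mulL m v)"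
  by (cases u; cases v) (simp add: mulL_abs_l2[OF assms] abs_l2_simps is_L2_mult[OF assms] mult.left_commute mult.assoc)


definition proj :: "(real^3) set => l2 => l2" where "proj U = mulL (indicator U)"

lemma proj_abs_l2:
  assumes "U \<in> sets lebesgue" "is_L2 f"
  shows "proj U (abs_l2 f) = abs_l2 (%x. if x \<in> U then f x else 0)" "is_L2 (%x. if x \<in> U then f x else 0)"
proof -
  have e: "(%x. indicator U x * f x) = (%x. if x \<in> U then f x else 0)" by (auto simp: indicator_def)
  show "proj U (abs_l2 f) = abs_l2 (%x. if x \<in> U then f x else 0)"
    unfolding proj_def mulL_abs_l2[OF ae_bounded_indicator[OF assms(1)] assms(2)] e ..
  show "is_L2 (%x. if x \<in> U then f x else 0)"
    using is_L2_mult[OF ae_bounded_indicator[OF assms(1)] assms(2)] unfolding e .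
qed

lemma bounded_linear_proj: "U \<in> sets lebesgue ==> bounded_linear (proj U)"
  unfolding proj_def by (rule bounded_linear_mulL[OF ae_bounded_indicator])

lemma proj_proj: "U \<in> sets lebesgue ==> V \<in> sets lebesgue ==> proj U (proj V u) = proj (U \<inter> V) u"
  unfolding proj_def by (simp add: mulL_mulL[OF ae_bounded_indicator ae_bounded_indicator] indicator_inter_arith[symmetric])

lemma pair_proj: "U \<in> sets lebesgue ==> pair (proj U u) v = pair u (proj U v)"
  unfolding proj_def by (rule pair_mulL[OF ae_bounded_indicator])

lemma norm_proj_le: "U \<in> sets lebesgue ==> norm (proj U u) \<le> norm u"
  unfolding proj_def using norm_mulL[OF ae_bounded_indicator, of U u] by simp

text \<open>Functions on U are embedded in the Hilbert space of the whole space by extension by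
  zero, so that all domains share one type and L2(U) becomes the range of
  \<open>proj U\<close>.\<close>

definition zext :: "(real^3) set => (real^3 => complex) => l2"
  where "zext U f = abs_l2 (%x. if x \<in> U then f x else 0)"

lemma L2_fun_iff:
  assumes "U \<in> sets lebesgue"
  shows "L2_fun U f \<longleftrightarrow> is_L2 (%x. if x \<in> U then f x else 0)"
proof -
  have e: "(%x. indicator U x *\<^sub>R (cmod (f x))\<^sup>2) = (%x. (cmod (if x \<in> U then f x else 0))\<^sup>2)"
    by (auto simp: indicator_def)
  have "U \<inter> space lebesgue \<in> sets lebesgue" using assms by simp
  from integrable_restrict_space[OF this, of "%x. (cmod (f x))\<^sup>2"] show ?thesis
    unfolding is_L2_iff unfolding L2_fun_def borel_measurable_if[OF assms] e by simp
qed

lemma zext_UNIV: "zext UNIV f = abs_l2 f" by (simp add: zext_def)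

lemma zext_pair:
  assumes "U \<in> sets lebesgue" "L2_fun U f" "L2_fun U g"
  shows "pair (zext U f) (zext U g) = (LINT x|lebesgue_on U. f x * g x)"
proof -
  have "(LINT x|lebesgue_on U. f x * g x) = (LINT x|lebesgue. indicator U x *\<^sub>R (f x * g x))"
    using assms(1) by (subst integral_restrict_space) auto
  also have "\<dots> = (LINT x|lebesgue. (if x \<in> U then f x else 0) * (if x \<in> U then g x else 0))"
    by (intro Bochner_Integration.integral_cong) (auto simp: indicator_def)
  finally show ?thesis using assms by (simp add: zext_def abs_l2_simps L2_fun_iff[OF assms(1)])
qed

lemma zext_norm:
  assumes "U \<in> sets lebesgue" "L2_fun U f"
  shows "norm (zext U f) = L2_norm U f"
proof -
  have "(LINT x|lebesgue_on U. (cmod (f x))\<^sup>2) = (LINT x|lebesgue. indicator U x *\<^sub>R (cmod (f x))\<^sup>2)"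
    using assms(1) by (subst integral_restrict_space) auto
  also have "\<dots> = (LINT x|lebesgue. (cmod (if x \<in> U then f x else 0))\<^sup>2)"
    by (intro Bochner_Integration.integral_cong) (auto simp: indicator_def)
  finally show ?thesis using assms by (simp add: zext_def L2_norm_def norm_abs_l2 L2_fun_iff[OF assms(1)])
qed

lemma zext_eq_iff:
  assumes "U \<in> sets lebesgue" "L2_fun U f" "L2_fun U g"
  shows "zext U f = zext U g \<longleftrightarrow> (AE x in lebesgue_on U. f x = g x)"
proof -
  have "zext U f = zext U g \<longleftrightarrow> (AE x in lebesgue. x \<in> U --> f x = g x)"
    using assms unfolding zext_def by (subst abs_l2_eq_iff) (auto simp: L2_fun_iff[OF assms(1)] elim!: eventually_mono)
  then show ?thesis using assms(1) by (simp add: AE_restrict_space_iff)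
qed

lemma L2_fun_subset: "L2_fun UNIV f ==> U \<in> sets lebesgue ==> L2_fun U f"
  using proj_abs_l2(2)[of U f] L2_fun_iff[of U f] by blast

lemma zext_proj: "L2_fun UNIV f ==> U \<in> sets lebesgue ==> zext U f = proj U (abs_l2 f)"
  by (simp add: zext_def proj_abs_l2)

lemma zext_diff:
  assumes "U \<in> sets lebesgue" "L2_fun U f" "L2_fun U g"
  shows "L2_fun U (%x. f x - g x)" "zext U (%x. f x - g x) = zext U f - zext U g"
proof -
  have e: "(%x. if x \<in> U then f x - g x else 0) = (%x. (if x \<in> U then f x else 0) - (if x \<in> U then g x else 0))" by auto
  have fg: "is_L2 (%x. if x \<in> U then f x else 0)" "is_L2 (%x. if x \<in> U then g x else 0)"
    using assms by (simp_all add: L2_fun_iff[OF assms(1)])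
  show "L2_fun U (%x. f x - g x)" unfolding L2_fun_iff[OF assms(1)] e by (rule is_L2_diff[OF fg])
  show "zext U (%x. f x - g x) = zext U f - zext U g" unfolding zext_def e by (simp add: abs_l2_simps fg)
qed

lemma is_L2_test_fun: assumes "\<phi> \<in> test_fun U" shows "is_L2 \<phi>"
proof -
  obtain K where K: "compact K" "\<And>x. x \<notin> K ==> \<phi> x = 0" using test_fun_support[OF assms] by blast
  have c: "continuous_on UNIV \<phi>" by (rule smooth_continuous[OF test_fun_smooth[OF assms]])
  have "integrable lebesgue (%x. (cmod (\<phi> x))\<^sup>2)"
    by (rule integrable_compact_support[OF _ K(1)]) (auto intro!: continuous_intros c simp: K(2))
  moreover have "\<phi> \<in> borel_measurable lebesgue"
    using borel_measurable_continuous_onI[OF c] by (auto intro: measurable_completion)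
  ultimately show ?thesis by (simp add: is_L2_iff)
qed

lemma zext_test_fun: assumes "\<phi> \<in> test_fun U" shows "zext U \<phi> = abs_l2 \<phi>"
proof -
  have "(%x. if x \<in> U then \<phi> x else 0) = \<phi>" using test_fun_outside[OF assms] by auto
  then show ?thesis by (simp add: zext_def)
qed

lemma L2_fun_test_fun: "\<phi> \<in> test_fun V ==> U \<in> sets lebesgue ==> L2_fun U \<phi>"
  by (rule L2_fun_subset[OF is_L2_test_fun])

lemma is_L2_indicator: assumes "bounded K" "K \<in> sets lebesgue" shows "is_L2 (indicator K)"
proof -
  have "K \<in> lmeasurable" using assms by (simp add: bounded_set_imp_lmeasurable)
  moreover have "(%x. (cmod (indicator K x))\<^sup>2) = (indicator K :: real^3 => real)" by (auto simp: indicator_def)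
  ultimately show ?thesis unfolding is_L2_iff using assms(2) by (simp add: lmeasurable_iff_integrable)
qed

lemma is_L2_locally_integrable: assumes "is_L2 f" shows "locally_integrable f"
  unfolding locally_integrable_def
proof (intro conjI allI)
  fix r
  have "integrable lebesgue (%x. indicator (cball 0 r) x * f x)"
    by (intro is_L2_mult_integrable is_L2_indicator assms) auto
  moreover have "(%x. indicator (cball 0 r) x * f x) = (%x. indicator (cball 0 r) x *\<^sub>R f x)" by (auto simp: indicator_def)
  ultimately show "integrable lebesgue (%x. indicator (cball 0 r) x *\<^sub>R f x)" by simp
qed (use assms in \<open>simp add: is_L2_iff\<close>)

subsection \<open>Translations and mollification\<close>

lemma is_L2_translate:
  assumes "is_L2 f" "f \<in> borel_measurable borel"
  shows "is_L2 (%x. f (x - c))" "norm (abs_l2 (%x. f (x - c))) = norm (abs_l2 f)"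
proof -
  have [measurable]: "f \<in> borel_measurable borel" by fact
  have d: "(lborel :: (real^3) measure) = distr lborel borel (%x. x - c)"
  proof -
    have "(+) (- c) = (%x. x - c)" by auto
    then show ?thesis using lborel_distr_plus[of "-c"] by simp
  qed
  have i: "integrable lborel (%x. (cmod (f x))\<^sup>2)"
    using assms by (subst integrable_completion[symmetric]) (auto simp: is_L2_iff)
  have "integrable lborel (%x. (cmod (f (x - c)))\<^sup>2)"
    using i by (subst (asm) d, subst (asm) integrable_distr_eq) auto
  then show L: "is_L2 (%x. f (x - c))"
    unfolding is_L2_iff by (auto simp: integrable_completion intro: measurable_completion)
  have "(LINT x|lborel. (cmod (f (x - c)))\<^sup>2) = (LINT x|lborel. (cmod (f x))\<^sup>2)"
    by (subst (2) d, subst integral_distr) auto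
  then show "norm (abs_l2 (%x. f (x - c))) = norm (abs_l2 f)"
    using L assms(1) by (simp add: norm_abs_l2 integral_completion)
qed

text \<open>For continuous functions of compact support, dominated convergence applies along every
  sequence of shifts. Translations are isometries, so the general case follows from density by
  splitting e into thirds.\<close>

lemma translate_continuous_0:
  assumes f: "is_L2 f" "f \<in> borel_measurable borel" and e: "e > 0"
  shows "\<exists>d>0. \<forall>c. norm c < d --> norm (abs_l2 (%x. f (x - c)) - abs_l2 f) < e"
proof -
  obtain g R where g: "continuous_on UNIV g" "\<And>x. norm x > R ==> g x = 0" "is_L2 g" "norm (abs_l2 f - abs_l2 g) < e/3"
    using l2_dense_continuous[of "e/3" "abs_l2 f"] e by auto
  have gb: "g \<in> borel_measurable borel" by (rule borel_measurable_continuous_onI[OF g(1)])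
  obtain M where M: "\<And>x. cmod (g x) \<le> M"
  proof -
    have "bounded (g ` cball 0 R)" by (intro compact_imp_bounded compact_continuous_image continuous_on_subset[OF g(1)]) auto
    then obtain M where "\<forall>z\<in>g ` cball 0 R. cmod z \<le> M" unfolding bounded_iff by blast
    then have "\<And>x. norm x \<le> R ==> cmod (g x) \<le> M" by auto
    then have "cmod (g x) \<le> max M 0" for x by (cases "norm x \<le> R") (auto simp: g(2) le_max_iff_disj)
    then show thesis using that by blast
  qed
  have "((%c. norm (abs_l2 (%x. g (x - c)) - abs_l2 g)) \<longlongrightarrow> 0) (at 0)"
  proof (rule tendsto_norm_zero, rule LIM_zero, subst tendsto_at_iff_sequentially, intro allI impI)
    fix c :: "nat => real^3" assume "\<forall>i. c i \<in> UNIV - {0}" and c: "c \<longlonglongrightarrow> 0"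
    then obtain B where B: "\<And>n. norm (c n) \<le> B" using convergent_imp_Bseq[of c] convergentI Bseq_def by metis
    have wi: "integrable lebesgue (%x. (M * indicator (cball (0::real^3) (R + B)) x)\<^sup>2 :: real)" (is "integrable _ ?w")
    proof -
      have "?w = (%x. M\<^sup>2 * indicator (cball 0 (R + B)) x)" by (auto simp: indicator_def)
      then show ?thesis using lmeasurable_cball[of "0::real^3" "R+B"] unfolding lmeasurable_iff_integrable by simp
    qed
    have "(%n. abs_l2 (%x. g (x - c n))) \<longlonglongrightarrow> abs_l2 g"
    proof (rule l2_dominated_convergence(3)[OF wi])
      show "AE x in lebesgue. cmod (g (x - c n)) \<le> M * indicator (cball 0 (R + B)) x" for n
      proof (rule AE_I2)
        fix x show "cmod (g (x - c n)) \<le> M * indicator (cball 0 (R + B)) x"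
        proof (cases "norm x \<le> R + B")
          case False
          then have "norm (x - c n) > R" using norm_triangle_ineq2[of x "c n"] B[of n] by linarith
          then show ?thesis using g(2) False by simp
        qed (use M in simp)
      qed
      show "AE x in lebesgue. (%n. g (x - c n)) \<longlonglongrightarrow> g x"
      proof (rule AE_I2)
        fix x
        have "isCont g x" using g(1) by (simp add: continuous_on_eq_continuous_at)
        moreover have "(%n. x - c n) \<longlonglongrightarrow> x" using tendsto_diff[OF tendsto_const c, of x] by simp
        ultimately show "(%n. g (x - c n)) \<longlonglongrightarrow> g x" by (rule isCont_tendsto_compose)
      qed
      show "(%x. g (x - c n)) \<in> borel_measurable lebesgue" for n
        using is_L2_translate(1)[OF g(3) gb] is_L2_measurable by blast
    qed (use g(3) is_L2_measurable in blast)
    then show "((%c. abs_l2 (%x. g (x - c))) \<circ> c) \<longlonglongrightarrow> abs_l2 g" by (simp add: o_def)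
  qed
  from LIM_D[OF this, of "e/3"] e obtain d where d: "d > 0"
    "\<And>c. c \<noteq> 0 ==> norm c < d ==> norm (abs_l2 (%x. g (x - c)) - abs_l2 g) < e/3"
    by auto
  have "norm (abs_l2 (%x. f (x - c)) - abs_l2 f) < e" if "norm c < d" for c
  proof -
    have 1: "norm (abs_l2 (%x. g (x - c)) - abs_l2 g) < e/3" using d(2)[OF _ that] e by (cases "c = 0") auto
    have "abs_l2 (%x. f (x - c)) - abs_l2 (%x. g (x - c)) = abs_l2 (%x. (%x. f x - g x) (x - c))"
      using is_L2_translate(1)[OF f] is_L2_translate(1)[OF g(3) gb] by (simp add: abs_l2_simps)
    also have "norm \<dots> = norm (abs_l2 (%x. f x - g x))"
      by (rule is_L2_translate(2)[OF is_L2_diff[OF f(1) g(3)]]) (use f gb in auto)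
    also have "\<dots> = norm (abs_l2 f - abs_l2 g)" using f g by (simp add: abs_l2_simps)
    finally have 2: "norm (abs_l2 (%x. f (x - c)) - abs_l2 (%x. g (x - c))) < e/3" using g(4) by simp
    have 3: "abs_l2 (%x. f (x - c)) - abs_l2 f = (abs_l2 (%x. f (x - c)) - abs_l2 (%x. g (x - c)))
      + (abs_l2 (%x. g (x - c)) - abs_l2 g) - (abs_l2 f - abs_l2 g)" by simp
    have "norm (abs_l2 (%x. f (x - c)) - abs_l2 f) \<le> norm (abs_l2 (%x. f (x - c)) - abs_l2 (%x. g (x - c)))
      + norm (abs_l2 (%x. g (x - c)) - abs_l2 g) + norm (abs_l2 f - abs_l2 g)"
      unfolding 3 by (rule order_trans[OF norm_triangle_ineq4 add_right_mono[OF norm_triangle_ineq]])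
    then show ?thesis using 1 2 g(4) by linarith
  qed
  with d(1) show ?thesis by blast
qed

text \<open>Mollification is an average of translates weighted by k; exchanging the integrals turns
  a pairing with the mollified function into an average of pairings with translates. Absolute
  integrability comes from Cauchy-Schwarz and the translation invariance of the norm.\<close>

lemma conv_Fubini:
  assumes f: "is_L2 f" "f \<in> borel_measurable borel" and p: "is_L2 p" "p \<in> borel_measurable borel"
    and k: "mollifier k c r"
  shows "integrable lebesgue (%x. p x * conv f (%z. of_real (k z)) x)"
    and "(LINT x|lebesgue. p x * conv f (%z. of_real (k z)) x) =
      (LINT z|lebesgue. of_real (k z) * pair (abs_l2 p) (abs_l2 (%x. f (x - z))))"
    and "integrable lebesgue (%z. of_real (k z) * pair (abs_l2 p) (abs_l2 (%x. f (x - z))))"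
proof -
  have kb: "k \<in> borel_measurable borel" using k borel_measurable_smooth by (auto simp: mollifier_def)
  note [measurable] = f(2) p(2) kb
  define h where "h z x = complex_of_real (k z) * (p x * f (x - z))" for z x
  have hm [measurable]: "case_prod h \<in> borel_measurable (lborel \<Otimes>\<^sub>M lborel)" unfolding h_def by measurable
  have ix: "integrable lborel (%x. p x * f (x - z))" for z
    using is_L2_mult_integrable[OF p(1) is_L2_translate(1)[OF f, of z]] by (subst (asm) integrable_completion) auto
  have k0: "0 \<le> k z" for z using k by (simp add: mollifier_def)
  have b: "(LINT x|lborel. norm (h z x)) \<le> k z * (norm (abs_l2 p) * norm (abs_l2 f))" for z
  proof -
    have "(LINT x|lborel. norm (h z x)) = k z * (LINT x|lborel. norm (p x * f (x - z)))"
      unfolding h_def using k0 by (simp add: norm_mult)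
    also have "(LINT x|lborel. norm (p x * f (x - z))) = (LINT x|lebesgue. of_real (cmod (p x)) * of_real (cmod (f (x - z))))"
      by (subst integral_completion) (auto simp: norm_mult)
    also have "complex_of_real \<dots> = pair (absL (abs_l2 p)) (absL (abs_l2 (%x. f (x - z))))"
      using p is_L2_translate(1)[OF f, of z] by (simp add: abs_l2_simps is_L2_norm flip: of_real_mult)
    then have "norm (complex_of_real (LINT x|lebesgue. of_real (cmod (p x)) * of_real (cmod (f (x - z)))))
        \<le> norm (absL (abs_l2 p)) * norm (absL (abs_l2 (%x. f (x - z))))" by (simp only: norm_pair_le)
    then have "(LINT x|lebesgue. of_real (cmod (p x)) * of_real (cmod (f (x - z)))) \<le> norm (abs_l2 p) * norm (abs_l2 f)"
      unfolding norm_of_real norm_absL is_L2_translate(2)[OF f, of z] by linarith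
    finally show ?thesis using k0[of z] by (simp add: mult_left_mono)
  qed
  have ki: "integrable lborel k" using mollifier_integrable[OF k] by (subst (asm) integrable_completion) auto
  have hi: "integrable (lborel \<Otimes>\<^sub>M lborel) (case_prod h)"
  proof (rule lborel_pair.Fubini_integrable[OF hm])
    show "integrable lborel (%z. LINT x|lborel. norm (case_prod h (z, x)))"
    proof (rule Bochner_Integration.integrable_bound)
      show "integrable lborel (%z. k z * (norm (abs_l2 p) * norm (abs_l2 f)))" using ki by simp
      show "AE z in lborel. norm (LINT x|lborel. norm (case_prod h (z, x))) \<le> norm (k z * (norm (abs_l2 p) * norm (abs_l2 f)))"
        using b k0 by (intro AE_I2) (simp add: abs_mult)
    qed measurable
    show "AE z in lborel. integrable lborel (%x. case_prod h (z, x))"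
      unfolding h_def using ix by (intro AE_I2) simp
  qed
  have inner: "p x * conv f (%z. of_real (k z)) x = (LINT z|lborel. h z x)" for x
  proof -
    have "conv f (%z. of_real (k z)) x = (LINT y|lborel. (%z. f (x - z) * of_real (k z)) (x - y))"
      unfolding conv_def by (subst integral_completion) auto
    also have "\<dots> = (LINT z|lborel. f (x - z) * of_real (k z))"
      by (rule lborel_integral_reflect) measurable
    finally show ?thesis by (simp add: h_def mult_ac flip: integral_mult_right_zero)
  qed
  have outer: "of_real (k z) * pair (abs_l2 p) (abs_l2 (%x. f (x - z))) = (LINT x|lborel. h z x)" for z
    using p is_L2_translate(1)[OF f, of z] by (simp add: h_def abs_l2_simps integral_completion)
  have ints: "integrable lborel (%x. LINT z|lborel. h z x)" "integrable lborel (%z. LINT x|lborel. h z x)"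
    using lborel_pair.integrable_snd[OF hi] lborel_pair.integrable_fst[OF hi] by simp_all
  show "integrable lebesgue (%x. p x * conv f (%z. of_real (k z)) x)"
    unfolding inner using ints(1) by (subst integrable_completion) auto
  show "integrable lebesgue (%z. of_real (k z) * pair (abs_l2 p) (abs_l2 (%x. f (x - z))))"
    unfolding outer using ints(2) by (subst integrable_completion) auto
  show "(LINT x|lebesgue. p x * conv f (%z. of_real (k z)) x) =
      (LINT z|lebesgue. of_real (k z) * pair (abs_l2 p) (abs_l2 (%x. f (x - z))))"
    unfolding inner outer using lborel_pair.Fubini_integral[OF hi] by (subst (1 2) integral_completion) auto
qed

text \<open>Paired with p, the mollified f is an average of \<open>A z\<close>, the pairing of p
  with a translate of f, over balls shrinking to the origin, and \<open>A\<close> is continuous at 0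
  because translation is. The centres only have to tend to 0, which is what the inward shifts at the
  boundary use.\<close>

lemma mollify_weak:
  assumes f: "is_L2 f" "f \<in> borel_measurable borel" and p: "is_L2 p" "p \<in> borel_measurable borel"
    and k: "\<And>n. mollifier (k n) (c n) (r n)" and c: "c \<longlonglongrightarrow> 0" and r: "r \<longlonglongrightarrow> 0"
  shows "(%n. LINT x|lebesgue. p x * conv f (%z. of_real (k n z)) x) \<longlonglongrightarrow> pair (abs_l2 p) (abs_l2 f)"
proof (rule LIMSEQ_I)
  fix e :: real assume e: "e > 0"
  define A where "A z = pair (abs_l2 p) (abs_l2 (%x. f (x - z)))" for z
  have ip: "0 < norm (abs_l2 p) + 1" by (simp add: add_nonneg_pos)
  obtain d where d: "d > 0" "\<And>z. norm z < d ==> norm (abs_l2 (%x. f (x - z)) - abs_l2 f) < e / 2 / (norm (abs_l2 p) + 1)"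
    using translate_continuous_0[OF f, of "e / 2 / (norm (abs_l2 p) + 1)"] e ip by (auto simp: zero_less_divide_iff)
  have A: "norm (A z - A 0) \<le> e/2" if "norm z < d" for z
  proof -
    have "norm (A z - A 0) = norm (pair (abs_l2 p) (abs_l2 (%x. f (x - z)) - abs_l2 f))"
      by (simp add: A_def bounded_bilinear.diff_right[OF bounded_bilinear_pair])
    also have "\<dots> \<le> (norm (abs_l2 p) + 1) * (e / 2 / (norm (abs_l2 p) + 1))"
      by (rule order_trans[OF norm_pair_le]) (intro mult_mono less_imp_le[OF d(2)[OF that]]; simp)
    also have "\<dots> = e / 2" using ip by (metis less_irrefl nonzero_mult_div_cancel_left times_divide_eq_right)
    finally show ?thesis .
  qed
  have "(%n. norm (c n) + r n) \<longlonglongrightarrow> 0" using tendsto_add[OF tendsto_norm[OF c] r] by simp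
  from LIMSEQ_D[OF this d(1)] obtain N where N': "\<forall>n\<ge>N. norm (norm (c n) + r n - 0) < d" by blast
  have N: "norm (c n) + r n < d" if "n \<ge> N" for n using N' that by fastforce
  have "norm ((LINT x|lebesgue. p x * conv f (%z. of_real (k n z)) x) - pair (abs_l2 p) (abs_l2 f)) < e" if n: "n \<ge> N" for n
  proof -
    note F = conv_Fubini[OF f p k[of n], folded A_def]
    have ki: "integrable lebesgue (%z. complex_of_real (k n z))" using mollifier_integrable[OF k[of n]] by simp
    have k1: "(LINT z|lebesgue. complex_of_real (k n z)) = 1" using k[of n] by (simp add: mollifier_def)
    have "(LINT x|lebesgue. p x * conv f (%z. of_real (k n z)) x) - A 0
        = (LINT z|lebesgue. of_real (k n z) * A z) - (LINT z|lebesgue. of_real (k n z) * A 0)"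
      using F(2) k1 by simp
    also have "\<dots> = (LINT z|lebesgue. of_real (k n z) * (A z - A 0))"
      using F(3) ki by (simp add: right_diff_distrib)
    finally have eq: "(LINT x|lebesgue. p x * conv f (%z. of_real (k n z)) x) - A 0
        = (LINT z|lebesgue. of_real (k n z) * (A z - A 0))" .
    have pt: "norm (of_real (k n z) * (A z - A 0)) \<le> k n z * (e/2)" for z
    proof (cases "k n z = 0")
      case False
      then have "dist (c n) z \<le> r n" by (rule mollifier_support[OF k])
      then have "norm z \<le> norm (c n) + r n" using norm_triangle_ineq2[of z "c n"] by (simp add: dist_norm norm_minus_commute)
      then have "norm (A z - A 0) \<le> e/2" using A N[OF n] by simp
      from mult_left_mono[OF this, of "k n z"] show ?thesis using k[of n] by (simp add: norm_mult mollifier_def)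
    qed simp
    have "norm (LINT z|lebesgue. of_real (k n z) * (A z - A 0)) \<le> (LINT z|lebesgue. k n z * (e/2))"
    proof (rule order_trans[OF integral_norm_bound], rule integral_mono)
      show "integrable lebesgue (%z. norm (of_real (k n z) * (A z - A 0)))"
        using Bochner_Integration.integrable_diff[OF F(3) integrable_mult_left[of "A 0", OF ki]]
        by (intro integrable_norm) (simp add: right_diff_distrib)
    qed (use pt mollifier_integrable[OF k[of n]] in auto)
    also have "\<dots> = e/2" using k[of n] by (simp add: mollifier_def)
    finally show ?thesis using eq e by (simp add: A_def)
  qed
  then show "\<exists>N. \<forall>n\<ge>N. norm ((LINT x|lebesgue. p x * conv f (%z. of_real (k n z)) x) - pair (abs_l2 p) (abs_l2 f)) < e" by blast
qed

subsection \<open>Weak derivatives\<close>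

text \<open>Weak differentiability for elements of \<open>l2\<close>. F and G live on the whole
  space but enter through their values on U alone, see \<open>weakly_diff_proj\<close>, so that
  functions on U and restrictions of functions on the whole space are treated alike.\<close>

definition weakly_diff :: "(real^3) set => 3 => l2 => l2 => bool"
  where "weakly_diff U i F G \<longleftrightarrow>
    (\<forall>\<phi>\<in>test_fun U. pair F (abs_l2 (pd i \<phi>)) = - pair G (abs_l2 \<phi>))"

lemma weakly_diff_proj:
  assumes "U \<in> sets lebesgue" shows "weakly_diff U i (proj U F) (proj U G) \<longleftrightarrow> weakly_diff U i F G"
proof -
  have "proj U (abs_l2 \<phi>) = abs_l2 \<phi>" if "\<phi> \<in> test_fun U" for \<phi>
    using zext_test_fun[OF that] zext_proj[OF is_L2_test_fun[OF that] assms] by simp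
  then show ?thesis using test_fun_dir_deriv unfolding weakly_diff_def pair_proj[OF assms] by metis
qed

lemma mollifier_test_fun: assumes "mollifier k c r" shows "(%x. complex_of_real (k x)) \<in> test_fun UNIV"
  by (rule test_funI[OF smooth_compose_left(1)[OF bounded_linear_of_real] compact_cball[of c r]])
    (use assms in \<open>auto simp: mollifier_def\<close>)

lemma conv_eq_pair:
  assumes "is_L2 f" "\<phi> \<in> test_fun UNIV"
  shows "conv f \<phi> x = pair (abs_l2 f) (abs_l2 (%y. \<phi> (x - y)))"
  unfolding conv_def by (simp add: abs_l2_simps assms is_L2_test_fun[OF test_fun_reflect(1)[OF assms(2)]])

text \<open>At points whose distance to the complement of U is at least r, the reflected kernels of
  small radius are test functions on U, so the mollifications of g vanish there, and their weak
  limit g does as well. Countably many r exhaust the open set U.\<close>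

theorem test_functions_separate:
  assumes U: "open U" and G: "\<And>\<phi>. \<phi> \<in> test_fun U ==> pair G (abs_l2 \<phi>) = 0"
  shows "proj U G = 0"
proof -
  obtain g where g: "is_L2 g" "g \<in> borel_measurable borel" "G = abs_l2 g" using l2_borel_rep by blast
  have "AE x in lebesgue. (\<forall>y. dist x y < r --> y \<in> U) --> g x = 0" if r: "r > 0" for r
  proof -
    define S where "S = {x. \<forall>y. dist x y < r --> y \<in> U}"
    have "- S = (\<Union>y\<in>-U. ball y r)" by (auto simp: S_def dist_commute)
    then have "open (- S)" using open_ball by (metis open_UN)
    then have Sb: "S \<in> sets borel" by (simp add: closed_def)
    then have S: "S \<in> sets lebesgue" by simp
    \<comment> \<open>Dividing by n + 2 keeps R n strictly below r, so that the closed ball of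
      radius R n about a point of S lies in U.\<close>
    define R where "R n = r / (real n + 2)" for n
    have R: "0 < R n" "R n < r" for n using r by (simp_all add: R_def divide_less_eq)
    have "\<exists>k. mollifier k (0::real^3) (R n)" for n by (rule mollifier_exists[OF R(1)])
    then obtain k where k: "\<And>n. mollifier (k n) (0::real^3) (R n)" by metis
    have Rlim: "R \<longlonglongrightarrow> 0" unfolding R_def by real_asymp
    have z: "conv g (%z. of_real (k n z)) x = 0" if "x \<in> S" for x n
    proof -
      have "(%y. complex_of_real (k n (x - y))) \<in> test_fun U"
      proof (rule test_funI[OF test_fun_smooth[OF test_fun_reflect(1)[OF mollifier_test_fun[OF k]]] compact_cball[of x "R n"]])
        show "cball x (R n) \<subseteq> U" using that R[of n] by (auto simp: S_def)
        show "complex_of_real (k n (x - y)) = 0" if "y \<notin> cball x (R n)" for y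
          using that k[of n] by (auto simp: mollifier_def dist_norm)
      qed
      then show ?thesis unfolding conv_eq_pair[OF g(1) mollifier_test_fun[OF k]] using G g(3) by simp
    qed
    have "pair (proj S G) p = 0" for p
    proof -
      obtain q where q: "is_L2 q" "q \<in> borel_measurable borel" "p = abs_l2 q" using l2_borel_rep by blast
      define q' where "q' x = (if x \<in> S then q x else 0)" for x
      have q': "is_L2 q'" "q' \<in> borel_measurable borel" "abs_l2 q' = proj S p"
        using proj_abs_l2[OF S q(1)] q Sb unfolding q'_def[abs_def] by auto
      have zz: "q' x * conv g (%z. of_real (k n z)) x = 0" for n x using z by (simp add: q'_def)
      have "(%n. 0) \<longlonglongrightarrow> pair (abs_l2 q') (abs_l2 g)"
        using mollify_weak[OF g(1,2) q'(1,2) k tendsto_const Rlim] unfolding zz by simp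
      then have "pair (abs_l2 q') (abs_l2 g) = 0" using LIMSEQ_unique[OF tendsto_const] by metis
      then show ?thesis unfolding q'(3) g(3) pair_proj[OF S] by (metis pair_commute pair_proj[OF S])
    qed
    then have "proj S G = 0" by (rule pair_eq_0_imp)
    then have "AE x in lebesgue. (if x \<in> S then g x else 0) = 0"
      unfolding g(3) using proj_abs_l2[OF S g(1)] abs_l2_eq_iff[OF _ is_L2_0] by (simp add: zero_l2_eq)
    then show ?thesis by (rule eventually_mono) (auto simp: S_def split: if_splits)
  qed
  then have "AE x in lebesgue. \<forall>n::nat. (\<forall>y. dist x y < 1 / (real n + 1) --> y \<in> U) --> g x = 0"
    unfolding AE_all_countable by simp
  then have "AE x in lebesgue. (if x \<in> U then g x else 0) = 0"
  proof (rule eventually_mono)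
    fix x assume *: "\<forall>n::nat. (\<forall>y. dist x y < 1 / (real n + 1) --> y \<in> U) --> g x = 0"
    show "(if x \<in> U then g x else 0) = 0"
    proof (cases "x \<in> U")
      case True
      then obtain e where e: "e > 0" "\<And>y. dist y x < e ==> y \<in> U" using U by (metis open_dist)
      then obtain n :: nat where "1 / (real n + 1) < e" using nat_approx_posE by (metis of_nat_Suc add.commute)
      then have "\<forall>y. dist x y < 1 / (real n + 1) --> y \<in> U" using e(2) by (metis dist_commute order.strict_trans)
      then show ?thesis using * by auto
    qed simp
  qed
  then show ?thesis
    unfolding g(3) using proj_abs_l2[OF _ g(1), of U] U abs_l2_eq_iff[OF _ is_L2_0] by (simp add: zero_l2_eq)
qed

lemma weakly_diff_unique:
  assumes "open U" "weakly_diff U i F G" "weakly_diff U i F G'" shows "proj U G = proj U G'"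
proof -
  have "proj U (G - G') = 0"
    by (rule test_functions_separate[OF assms(1)])
      (use assms(2,3) in \<open>auto simp: weakly_diff_def bounded_bilinear.diff_left[OF bounded_bilinear_pair]\<close>)
  then show ?thesis using linear_diff[OF bounded_linear.linear[OF bounded_linear_proj], of U G G'] assms(1) by simp
qed

lemma has_weak_deriv_iff:
  assumes "U \<in> sets lebesgue" "L2_fun U f" "L2_fun U g"
  shows "has_weak_deriv U i f g \<longleftrightarrow> weakly_diff U i (zext U f) (zext U g)"
  unfolding has_weak_deriv_def weakly_diff_def
proof (rule ball_cong[OF refl])
  fix \<phi> assume p: "\<phi> \<in> test_fun U"
  note p' = test_fun_dir_deriv[OF p, of "axis i 1"]
  show "((LINT x|lebesgue_on U. f x * pd i \<phi> x) = - (LINT x|lebesgue_on U. g x * \<phi> x)) =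
     (pair (zext U f) (abs_l2 (pd i \<phi>)) = - pair (zext U g) (abs_l2 \<phi>))"
    using zext_pair[OF assms(1,2) L2_fun_test_fun[OF p' assms(1)]] zext_pair[OF assms(1,3) L2_fun_test_fun[OF p assms(1)]]
    by (simp add: zext_test_fun[OF p] zext_test_fun[OF p'])
qed

lemma H1_weak_deriv:
  assumes "open U" "H1_fun U f"
  shows "L2_fun U (weak_deriv U i f)" "weakly_diff U i (zext U f) (zext U (weak_deriv U i f))"
proof -
  have U: "U \<in> sets lebesgue" using assms(1) by simp
  have "\<exists>g. L2_fun U g \<and> has_weak_deriv U i f g" using assms(2) by (simp add: H1_fun_def)
  then have *: "L2_fun U (weak_deriv U i f) \<and> has_weak_deriv U i f (weak_deriv U i f)"
    unfolding weak_deriv_def by (rule someI_ex)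
  then show "L2_fun U (weak_deriv U i f)" by simp
  then show "weakly_diff U i (zext U f) (zext U (weak_deriv U i f))"
    using * has_weak_deriv_iff[OF U, of f "weak_deriv U i f" i] assms(2) by (auto simp: H1_fun_def)
qed

lemma proj_zext: "U \<in> sets lebesgue ==> L2_fun U f ==> proj U (zext U f) = zext U f"
  unfolding zext_def by (subst proj_abs_l2(1)) (auto simp: L2_fun_iff[of U f] cong: if_cong)

text \<open>\<open>weak_deriv\<close> is an arbitrary choice of representative; uniqueness of weak
  derivatives on U identifies its class with any candidate that satisfies the defining
  identity.\<close>

lemma H1_fun_zextI:
  assumes "open U" "L2_fun U f" "\<And>i. weakly_diff U i (zext U f) (G i)"
  shows "H1_fun U f" "zext U (weak_deriv U i f) = proj U (G i)"
proof -
  have U: "U \<in> sets lebesgue" using assms(1) by simp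
  have "\<exists>g. L2_fun U g \<and> has_weak_deriv U i f g" for i
  proof -
    obtain g where g: "is_L2 g" "G i = abs_l2 g" by (cases "G i")
    have gU: "L2_fun U g" using L2_fun_subset[OF g(1) U] .
    have "weakly_diff U i (proj U (zext U f)) (proj U (G i))" using assms(3) weakly_diff_proj[OF U] by blast
    then have "weakly_diff U i (zext U f) (zext U g)"
      using proj_zext[OF U assms(2)] zext_proj[OF g(1) U] g(2) by simp
    then show ?thesis using has_weak_deriv_iff[OF U assms(2) gU] gU by blast
  qed
  then show H: "H1_fun U f" using assms(2) by (simp add: H1_fun_def)
  show "zext U (weak_deriv U i f) = proj U (G i)"
    using weakly_diff_unique[OF assms(1) H1_weak_deriv(2)[OF assms(1) H] assms(3)]
      proj_zext[OF U H1_weak_deriv(1)[OF assms(1) H]] by simp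
qed

lemma weakly_diff_test_fun:
  assumes "\<phi> \<in> test_fun UNIV"
  shows "weakly_diff U i (abs_l2 \<phi>) (abs_l2 (pd i \<phi>))"
  unfolding weakly_diff_def
proof
  fix \<psi> assume p: "\<psi> \<in> test_fun U"
  let ?d = "%\<phi>. pd i \<phi>"
  have s: "smooth \<phi>" "smooth \<psi>" using assms p test_fun_smooth by blast+
  have L: "is_L2 \<phi>" "is_L2 \<psi>" "is_L2 (?d \<phi>)" "is_L2 (?d \<psi>)"
    using is_L2_test_fun test_fun_dir_deriv assms p by blast+
  have "(LINT x|lebesgue. ?d (%x. \<phi> x * \<psi> x) x) = 0"
    by (rule integral_dir_deriv_test_fun[OF test_fun_mult_right[OF s(2) assms]])
  then have "(LINT x|lebesgue. \<phi> x * ?d \<psi> x) + (LINT x|lebesgue. ?d \<phi> x * \<psi> x) = 0"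
    unfolding dir_deriv_mult[OF s] using is_L2_mult_integrable[OF L(1,4)] is_L2_mult_integrable[OF L(3,2)] by simp
  then show "pair (abs_l2 \<phi>) (abs_l2 (?d \<psi>)) = - pair (abs_l2 (?d \<phi>)) (abs_l2 \<psi>)"
    using L by (simp add: abs_l2_simps add_eq_0_iff)
qed

lemma test_fun_ae_bounded: assumes "\<phi> \<in> test_fun U" shows "\<exists>M. ae_bounded \<phi> M"
proof -
  obtain M where "\<And>x. cmod (\<phi> x) \<le> M" using test_fun_bounded[OF assms] by metis
  then show ?thesis using is_L2_measurable[OF is_L2_test_fun[OF assms]] unfolding ae_bounded_def by auto
qed

subsection \<open>Testing a divergence identity with Sobolev functions\<close>

text \<open>This is h = div F on the whole space in the sense of distributions.\<close>

definition weak_div :: "l2 => (3 => l2) => bool"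
  where "weak_div h F \<longleftrightarrow> (\<forall>\<phi>\<in>test_fun UNIV.
    pair h (abs_l2 \<phi>) + (\<Sum>i\<in>UNIV. pair (F i) (abs_l2 (pd i \<phi>))) = 0)"

text \<open>
  Instead of approximating the Sobolev function \<open>v\<close>, which lives on \<open>U\<close> only, the field is mollified:
  \<open>ct\<close> times the mollified field is an admissible test field for the weak derivatives of \<open>v\<close>.
\<close>

lemma weak_div_test_cutoff:
  fixes f :: "3 => real^3 => complex"
  assumes eq: "weak_div h (%i. abs_l2 (f i))" and f: "\<And>i. is_L2 (f i)" "\<And>i. f i \<in> borel_measurable borel"
    and v: "\<And>i. weakly_diff U i v (V i)" and ct: "ct \<in> test_fun UNIV"
    and k: "\<And>n. mollifier (k n) (c n) (r n)" and c: "c \<longlonglongrightarrow> 0" and r: "r \<longlonglongrightarrow> 0"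
    and U: "\<And>n i. (%x. ct x * conv (f i) (%z. of_real (k n z)) x) \<in> test_fun U"
  shows "pair (mulL ct h) v + (\<Sum>i\<in>UNIV. pair (mulL ct (abs_l2 (f i))) (V i)
    + pair (mulL (pd i ct) (abs_l2 (f i))) v) = 0"
proof -
  let ?d = "%i \<phi>. pd i \<phi>"
  let ?K = "%n z. complex_of_real (k n z)"
  obtain h0 where h0: "is_L2 h0" "h0 \<in> borel_measurable borel" "h = abs_l2 h0" using l2_borel_rep by blast
  obtain v0 where v0: "is_L2 v0" "v0 \<in> borel_measurable borel" "v = abs_l2 v0" using l2_borel_rep by blast
  have "\<exists>w. is_L2 w \<and> w \<in> borel_measurable borel \<and> V i = abs_l2 w" for i using l2_borel_rep by blast
  then obtain w where w: "\<And>i. is_L2 (w i)" "\<And>i. w i \<in> borel_measurable borel" "\<And>i. V i = abs_l2 (w i)" by metis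
  note K = mollifier_test_fun[OF k]
  note li = is_L2_locally_integrable
  have ctb: "ct \<in> borel_measurable borel" "?d i ct \<in> borel_measurable borel" for i
    using borel_measurable_smooth test_fun_smooth test_fun_dir_deriv ct by blast+
  obtain M where M: "ae_bounded ct M" using test_fun_ae_bounded[OF ct] by blast
  have "\<forall>i. \<exists>N. ae_bounded (?d i ct) N" using test_fun_ae_bounded[OF test_fun_dir_deriv[OF ct]] by blast
  from choice[OF this] obtain N where N: "\<And>i. ae_bounded (?d i ct) (N i)" by blast
  \<comment> \<open>Tested with the reflected kernel, the distributional identity becomes pointwise:
    the mollified h is the classical divergence of the mollified field.\<close>
  have div: "conv h0 (?K n) x = (\<Sum>i\<in>UNIV. conv (f i) (?d i (?K n)) x)" for n x
  proof -
    have "pair h (abs_l2 (%y. ?K n (x - y))) + (\<Sum>i\<in>UNIV. pair (abs_l2 (f i)) (abs_l2 (?d i (%y. ?K n (x - y))))) = 0"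
      using eq test_fun_reflect(1)[OF K[of n], of x] unfolding weak_div_def by blast
    moreover have "pair (abs_l2 (f i)) (abs_l2 (?d i (%y. ?K n (x - y)))) = - conv (f i) (?d i (?K n)) x" for i
    proof -
      have t: "is_L2 (%y. ?d i (?K n) (x - y))" by (rule is_L2_test_fun[OF test_fun_reflect(1)[OF test_fun_dir_deriv[OF K]]])
      have "?d i (%y. ?K n (x - y)) = (%y. - ?d i (?K n) (x - y))" by (rule ext) (rule test_fun_reflect(2)[OF K])
      then have "abs_l2 (?d i (%y. ?K n (x - y))) = - abs_l2 (%y. ?d i (?K n) (x - y))" using t by (simp add: abs_l2_simps)
      then show ?thesis
        by (simp add: conv_eq_pair[OF f(1) test_fun_dir_deriv[OF K]] bounded_bilinear.minus_right[OF bounded_bilinear_pair])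
    qed
    ultimately show ?thesis using conv_eq_pair[OF h0(1) K] h0(3) by (simp add: sum_negf)
  qed
  \<comment> \<open>The weak derivatives of v are applied to \<open>ct\<close> times the mollified
    field. The product rule splits off the derivative of \<open>ct\<close>, and the remaining
    divergence is replaced by the mollified h.\<close>
  have main: "(LINT x|lebesgue. (v0 x * ct x) * conv h0 (?K n) x)
     + (\<Sum>i\<in>UNIV. (LINT x|lebesgue. (w i x * ct x) * conv (f i) (?K n) x)
        + (LINT x|lebesgue. (v0 x * ?d i ct x) * conv (f i) (?K n) x)) = 0" for n
  proof -
    have s: "smooth (conv (f i) (?K n))" "smooth (conv (f i) (?d i (?K n)))" for i
      using conv_smooth(1)[OF li[OF f(1)]] K test_fun_dir_deriv by blast+
    have t1: "is_L2 (%x. ct x * conv (f i) (?d i (?K n)) x)" for i by (rule is_L2_test_fun[OF test_fun_mult_right[OF s(2) ct]])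
    have t2: "is_L2 (%x. ?d i ct x * conv (f i) (?K n) x)" for i
      by (rule is_L2_test_fun[OF test_fun_mult_right[OF s(1) test_fun_dir_deriv[OF ct]]])
    have t3: "is_L2 (%x. ct x * conv (f i) (?K n) x)" for i by (rule is_L2_test_fun[OF U])
    have t4: "is_L2 (%x. ct x * conv h0 (?K n) x)"
      by (rule is_L2_test_fun[OF test_fun_mult_right[OF conv_smooth(1)[OF li[OF h0(1)] K] ct]])
    have "pair v (abs_l2 (%x. ct x * conv (f i) (?d i (?K n)) x)) + pair v (abs_l2 (%x. ?d i ct x * conv (f i) (?K n) x))
        = - pair (V i) (abs_l2 (%x. ct x * conv (f i) (?K n) x))" for i
    proof -
      have deq: "?d i (%x. ct x * conv (f i) (?K n) x) = (%x. ct x * conv (f i) (?d i (?K n)) x + ?d i ct x * conv (f i) (?K n) x)"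
        by (rule ext) (simp add: dir_deriv_mult[OF test_fun_smooth[OF ct] s(1)] conv_smooth(2)[OF li[OF f(1)] K])
      have "pair v (abs_l2 (?d i (%x. ct x * conv (f i) (?K n) x))) = - pair (V i) (abs_l2 (%x. ct x * conv (f i) (?K n) x))"
        using v[of i] U[of i n] unfolding weakly_diff_def by blast
      then have "pair v (abs_l2 (%x. ct x * conv (f i) (?d i (?K n)) x + ?d i ct x * conv (f i) (?K n) x))
        = - pair (V i) (abs_l2 (%x. ct x * conv (f i) (?K n) x))"
        unfolding deq .
      then show ?thesis by (simp add: abs_l2_simps(1)[OF t1 t2, symmetric] pair_add_right)
    qed
    then have "pair v (abs_l2 (%x. ct x * conv (f i) (?d i (?K n)) x))
        = - pair (V i) (abs_l2 (%x. ct x * conv (f i) (?K n) x)) - pair v (abs_l2 (%x. ?d i ct x * conv (f i) (?K n) x))" for i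
      unfolding eq_diff_eq by blast
    then have e: "(\<Sum>i\<in>UNIV. pair v (abs_l2 (%x. ct x * conv (f i) (?d i (?K n)) x))) =
      - (\<Sum>i\<in>UNIV. pair (V i) (abs_l2 (%x. ct x * conv (f i) (?K n) x)) + pair v (abs_l2 (%x. ?d i ct x * conv (f i) (?K n) x)))"
      by (simp only: sum_subtractf sum_negf sum.distrib) simp
    have "(\<Sum>i\<in>UNIV. pair v (abs_l2 (%x. ct x * conv (f i) (?d i (?K n)) x)))
        = (\<Sum>i\<in>UNIV. (LINT x|lebesgue. v0 x * (ct x * conv (f i) (?d i (?K n)) x)))"
      unfolding v0(3) by (simp add: abs_l2_simps v0(1) t1)
    also have "\<dots> = (LINT x|lebesgue. (\<Sum>i\<in>UNIV. v0 x * (ct x * conv (f i) (?d i (?K n)) x)))"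
      by (rule Bochner_Integration.integral_sum[symmetric]) (rule is_L2_mult_integrable[OF v0(1) t1])
    also have "\<dots> = (LINT x|lebesgue. (v0 x * ct x) * conv h0 (?K n) x)"
      unfolding div by (simp add: sum_distrib_left mult.assoc)
    finally show ?thesis using e t2 t3 by (simp add: w v0 abs_l2_simps mult.assoc eq_neg_iff_add_eq_0)
  qed
  have L: "is_L2 (%x. p x * ct x)" "(%x. p x * ct x) \<in> borel_measurable borel" "abs_l2 (%x. p x * ct x) = mulL ct (abs_l2 p)"
    if "is_L2 p" "p \<in> borel_measurable borel" for p
    using is_L2_mult[OF M that(1)] mulL_abs_l2[OF M that(1)] that(2) ctb(1) by (simp_all add: mult.commute[of "ct _"])
  have L': "is_L2 (%x. p x * ?d i ct x)" "(%x. p x * ?d i ct x) \<in> borel_measurable borel" "abs_l2 (%x. p x * ?d i ct x) = mulL (?d i ct) (abs_l2 p)"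
    if "is_L2 p" "p \<in> borel_measurable borel" for p i
    using is_L2_mult[OF N that(1)] mulL_abs_l2[OF N that(1)] that(2) ctb(2) by (simp_all add: mult.commute[of "?d _ ct _"])
  note lim = mollify_weak[OF _ _ _ _ k c r]
  have L0: "(%n. (LINT x|lebesgue. (v0 x * ct x) * conv h0 (?K n) x)
     + (\<Sum>i\<in>UNIV. (LINT x|lebesgue. (w i x * ct x) * conv (f i) (?K n) x)
        + (LINT x|lebesgue. (v0 x * ?d i ct x) * conv (f i) (?K n) x))) \<longlonglongrightarrow>
     pair (mulL ct v) h + (\<Sum>i\<in>UNIV. pair (mulL ct (V i)) (abs_l2 (f i)) + pair (mulL (?d i ct) v) (abs_l2 (f i)))"
    unfolding v0(3) h0(3) w(3) L(3)[OF v0(1,2), symmetric] L(3)[OF w(1,2), symmetric] L'(3)[OF v0(1,2), symmetric]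
    by (intro tendsto_add tendsto_sum lim h0 f L L' v0 w)
  have "0 = pair (mulL ct v) h + (\<Sum>i\<in>UNIV. pair (mulL ct (V i)) (abs_l2 (f i)) + pair (mulL (?d i ct) v) (abs_l2 (f i)))"
    by (rule LIMSEQ_unique[OF tendsto_const L0[unfolded main]])
  then show ?thesis by (simp add: pair_mulL[OF M] pair_mulL[OF N] pair_commute[of v] pair_commute[of "V _"])
qed

text \<open>One plateau function is translated and rescaled, so the gradient bound C / r has a
  constant independent of centre and radius; the estimates over coverings by balls of different
  sizes depend on that uniformity.\<close>

lemma cutoff_exists:
  "\<exists>C>0. \<forall>(p::'a::euclidean_space) r. r > 0 --> (\<exists>\<eta>\<in>test_fun UNIV.
    (\<forall>x. dist p x \<le> r --> \<eta> x = 1) \<and> (\<forall>x. dist p x \<ge> 2 * r --> \<eta> x = 0) \<and>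
    (\<forall>x. norm (\<eta> x) \<le> 1 \<and> norm (1 - \<eta> x) \<le> 1) \<and>
    (\<forall>x v. norm (dir_deriv v \<eta> x) \<le> C / r * norm v))"
proof -
  obtain \<eta> :: "'a => complex" where \<eta>: "\<eta> \<in> test_fun UNIV" "\<And>x. norm x \<le> 1 ==> \<eta> x = 1"
    "\<And>x. norm x \<ge> 2 ==> \<eta> x = 0" "\<And>x. norm (\<eta> x) \<le> 1 \<and> norm (1 - \<eta> x) \<le> 1"
    using plateau_exists by blast
  obtain C where C: "C > 0" "\<And>x v. norm (dir_deriv v \<eta> x) \<le> C * norm v" using test_fun_deriv_bound[OF \<eta>(1)] by blast
  have "\<exists>\<eta>\<in>test_fun UNIV. (\<forall>x. dist p x \<le> r --> \<eta> x = 1) \<and> (\<forall>x. dist p x \<ge> 2 * r --> \<eta> x = 0) \<and>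
    (\<forall>x. norm (\<eta> x) \<le> 1 \<and> norm (1 - \<eta> x) \<le> 1) \<and> (\<forall>x v. norm (dir_deriv v \<eta> x) \<le> C / r * norm v)"
    if r: "r > 0" for p :: 'a and r
  proof -
    define g where "g x = \<eta> ((1/r) *\<^sub>R x + - ((1/r) *\<^sub>R p))" for x
    have n: "norm ((1/r) *\<^sub>R x + - ((1/r) *\<^sub>R p)) = dist p x / r" for x
    proof -
      have "(1/r) *\<^sub>R x + - ((1/r) *\<^sub>R p) = (1/r) *\<^sub>R (x - p)" by (simp add: scaleR_diff_right)
      then show ?thesis using r by (simp add: dist_norm norm_minus_commute)
    qed
    note s = smooth_compose_affine[OF bounded_linear_scaleR_right test_fun_smooth[OF \<eta>(1)], of "1/r" "- ((1/r) *\<^sub>R p)", folded g_def]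
    have 0: "g x = 0" if "dist p x \<ge> 2 * r" for x
      unfolding g_def by (rule \<eta>(3), unfold n) (use that r in \<open>simp add: field_simps\<close>)
    have "g \<in> test_fun UNIV"
      by (rule test_funI[of _ "cball p (2 * r)"]) (use 0 s(1) in \<open>auto simp: g_def[abs_def]\<close>)
    moreover have "g x = 1" if "dist p x \<le> r" for x
      unfolding g_def by (rule \<eta>(2), unfold n) (use that r in \<open>simp add: field_simps\<close>)
    moreover have "norm (dir_deriv v g x) \<le> C / r * norm v" for v x
    proof -
      have "dir_deriv v g x = dir_deriv ((1/r) *\<^sub>R v) \<eta> ((1/r) *\<^sub>R x + - ((1/r) *\<^sub>R p))"
        using s(2)[of x v] by (simp add: g_def[abs_def])
      then show ?thesis using C(2)[where v="(1/r) *\<^sub>R v" and x="(1/r) *\<^sub>R x + - ((1/r) *\<^sub>R p)"] r by simp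
    qed
    moreover have "norm (g x) \<le> 1 \<and> norm (1 - g x) \<le> 1" for x unfolding g_def by (rule \<eta>(4))
    ultimately show ?thesis using 0 by blast
  qed
  with C(1) show ?thesis by blast
qed

lemma mulL_add: "ae_bounded m M ==> ae_bounded n N ==> mulL (%x. m x + n x) u = mulL m u + mulL n u"
proof -
  assume m: "ae_bounded m M" and n: "ae_bounded n N"
  have mn: "ae_bounded (%x. m x + n x) (M + N)" using m n unfolding ae_bounded_def
    by (auto elim!: eventually_elim2 intro: order_trans[OF norm_triangle_ineq add_mono])
  show ?thesis
    by (cases u) (simp add: mulL_abs_l2[OF m] mulL_abs_l2[OF n] mulL_abs_l2[OF mn] abs_l2_simps is_L2_mult[OF m] is_L2_mult[OF n] distrib_right)
qed

lemma mulL_zero: "mulL (%x. 0) u = 0"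
  using ae_bounded_const[of 0] by (cases u) (simp add: mulL_abs_l2[OF ae_bounded_const] zero_l2_eq)

lemma mulL_one: "mulL (%x. 1) u = u"
  by (cases u) (simp add: mulL_abs_l2[OF ae_bounded_const])

lemma mollifier_sequence_0:
  "\<exists>k. \<forall>n. mollifier (k n) (0::'a::euclidean_space) (1 / (real n + 1))"
  using mollifier_exists[of "1 / (real n + 1)" "0::'a" for n] by (intro choice allI) auto

text \<open>The identity obtained by testing with \<open>ct * v\<close>, where V stands for the
  gradient of v. It is additive in the cutoff, so its vanishing can be localised.\<close>

definition cutoff_form :: "l2 => (3 => l2) => l2 => (3 => l2) => (real^3 => complex) => complex"
  where "cutoff_form h F v V ct = pair (mulL ct h) v
    + (\<Sum>i\<in>UNIV. pair (mulL ct (F i)) (V i) + pair (mulL (pd i ct) (F i)) v)"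

lemma cutoff_form_add:
  assumes "f \<in> test_fun UNIV" "g \<in> test_fun UNIV"
  shows "cutoff_form h F v V (%x. f x + g x) = cutoff_form h F v V f + cutoff_form h F v V g"
proof -
  have m: "mulL (%x. f x + g x) u = mulL f u + mulL g u" if "f \<in> test_fun UNIV" "g \<in> test_fun UNIV" for f g u
    using test_fun_ae_bounded[OF that(1)] test_fun_ae_bounded[OF that(2)] mulL_add by blast
  have d: "pd i (%x. f x + g x) = (%x. pd i f x + pd i g x)" for i
    using dir_deriv_add[OF test_fun_smooth test_fun_smooth] assms by blast
  show ?thesis
    unfolding cutoff_form_def d m[OF assms] m[OF test_fun_dir_deriv[OF assms(1)] test_fun_dir_deriv[OF assms(2)]]
    by (simp add: pair_add_left sum.distrib algebra_simps)
qed

text \<open>On the whole space every cutoff is admissible. Cutoffs of radius n + 1 tend to 1 while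
  their gradients are bounded by C / (n + 1), so the term with the derivative of the cutoff
  disappears in the limit.\<close>

lemma weak_div_test_UNIV:
  assumes eq: "weak_div h F" and v: "\<And>i. weakly_diff UNIV i v (V i)"
  shows "pair h v + (\<Sum>i\<in>UNIV. pair (F i) (V i)) = 0"
proof -
  obtain k where k: "\<And>n. mollifier (k n) (0::real^3) (1 / (real n + 1))" using mollifier_sequence_0 by blast
  have rl: "(%n. 1 / (real n + 1)) \<longlonglongrightarrow> 0" by real_asymp
  have "\<exists>f. is_L2 f \<and> f \<in> borel_measurable borel \<and> F i = abs_l2 f" for i using l2_borel_rep by blast
  then obtain f where f: "\<And>i. is_L2 (f i)" "\<And>i. f i \<in> borel_measurable borel" "\<And>i. F i = abs_l2 (f i)" by metis
  have F: "F = (%i. abs_l2 (f i))" using f(3) by blast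
  have z: "cutoff_form h F v V ct = 0" if ct: "ct \<in> test_fun UNIV" for ct
    unfolding cutoff_form_def F
    by (rule weak_div_test_cutoff[OF eq[unfolded F] f(1,2) v ct k tendsto_const rl])
      (rule test_fun_mult_right[OF conv_smooth(1)[OF is_L2_locally_integrable[OF f(1)] mollifier_test_fun[OF k]] ct])
  obtain C where C: "C > 0" "\<And>(p::real^3) r. r > 0 ==> (\<exists>\<eta>\<in>test_fun UNIV.
    (\<forall>x. dist p x \<le> r --> \<eta> x = 1) \<and> (\<forall>x. dist p x \<ge> 2 * r --> \<eta> x = 0) \<and>
    (\<forall>x. norm (\<eta> x) \<le> 1 \<and> norm (1 - \<eta> x) \<le> 1) \<and> (\<forall>x v. norm (dir_deriv v \<eta> x) \<le> C / r * norm v))"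
    using cutoff_exists by blast
  have "\<forall>n. \<exists>\<eta>. \<eta> \<in> test_fun UNIV \<and> (\<forall>x::real^3. norm x \<le> real n + 1 --> \<eta> x = 1) \<and>
    (\<forall>x. norm (\<eta> x) \<le> 1) \<and> (\<forall>x v. norm (dir_deriv v \<eta> x) \<le> C / (real n + 1) * norm v)"
  proof
    fix n
    have "real n + 1 > 0" by simp
    from C(2)[OF this, of 0] show "\<exists>\<eta>. \<eta> \<in> test_fun UNIV \<and> (\<forall>x::real^3. norm x \<le> real n + 1 --> \<eta> x = 1) \<and>
    (\<forall>x. norm (\<eta> x) \<le> 1) \<and> (\<forall>x v. norm (dir_deriv v \<eta> x) \<le> C / (real n + 1) * norm v)"
      unfolding dist_0_norm by blast
  qed
  from choice[OF this] obtain ct where ct0: "\<forall>n. ct n \<in> test_fun UNIV \<and> (\<forall>x::real^3. norm x \<le> real n + 1 --> ct n x = 1) \<and>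
    (\<forall>x. norm (ct n x) \<le> 1) \<and> (\<forall>x v. norm (dir_deriv v (ct n) x) \<le> C / (real n + 1) * norm v)" by (elim exE)
  have ct: "\<And>n. ct n \<in> test_fun UNIV" "\<And>n x. norm x \<le> real n + 1 ==> ct n x = 1"
    "\<And>n x. norm (ct n x) \<le> 1" "\<And>n x v. norm (dir_deriv v (ct n) x) \<le> C / (real n + 1) * norm v"
    using ct0 by simp_all
  have b1: "ae_bounded (ct n) 1" for n
    using ct is_L2_measurable[OF is_L2_test_fun[OF ct(1)]] by (auto simp: ae_bounded_def)
  have b2: "ae_bounded (pd i (ct n)) (C / (real n + 1))" for n i
    using ct(4)[where v="axis i 1" and n=n] is_L2_measurable[OF is_L2_test_fun[OF test_fun_dir_deriv[OF ct(1)]]]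
    by (auto simp: ae_bounded_def norm_axis_1)
  have l1: "(%n. mulL (ct n) u) \<longlonglongrightarrow> u" for u
  proof -
    obtain g where g: "is_L2 g" "u = abs_l2 g" by (cases u)
    show ?thesis unfolding g(2) mulL_abs_l2[OF b1 g(1)]
    proof (rule l2_dominated_convergence(3))
      show "integrable lebesgue (%x. (cmod (g x))\<^sup>2)" using g by (simp add: is_L2_iff)
      show "AE x in lebesgue. cmod (ct n x * g x) \<le> cmod (g x)" for n
        using ct(3) by (auto simp: norm_mult mult_left_le_one_le)
      show "AE x in lebesgue. (%n. ct n x * g x) \<longlonglongrightarrow> g x"
      proof (rule AE_I2, rule tendsto_eventually)
        fix x :: "real^3"
        obtain n0 where n0: "real n0 \<ge> norm x" using real_arch_simple by blast
        show "\<forall>\<^sub>F n in sequentially. ct n x * g x = g x"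
          by (rule eventually_sequentiallyI[of n0]) (use n0 in \<open>simp add: ct(2)\<close>)
      qed
    qed (use is_L2_measurable[OF is_L2_mult[OF b1 g(1)]] is_L2_measurable[OF g(1)] in auto)
  qed
  have l2: "(%n. mulL (pd i (ct n)) u) \<longlonglongrightarrow> 0" for i u
  proof (rule Lim_null_comparison)
    show "\<forall>\<^sub>F n in sequentially. norm (mulL (pd i (ct n)) u) \<le> C / (real n + 1) * norm u"
      using norm_mulL[OF b2] by (intro always_eventually allI)
    show "(%n. C / (real n + 1) * norm u) \<longlonglongrightarrow> 0" by real_asymp
  qed
  note tp = bounded_bilinear.tendsto[OF bounded_bilinear_pair _ tendsto_const]
  have "(%n. cutoff_form h F v V (ct n)) \<longlonglongrightarrow> pair h v + (\<Sum>i\<in>UNIV. pair (F i) (V i) + pair 0 v)"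
    unfolding cutoff_form_def by (intro tendsto_add tendsto_sum tp l1 l2)
  then have "(%n. 0) \<longlonglongrightarrow> pair h v + (\<Sum>i\<in>UNIV. pair (F i) (V i) + pair 0 v)" unfolding z[OF ct(1)] .
  from LIMSEQ_unique[OF tendsto_const this] show ?thesis
    by (simp add: bounded_bilinear.zero_left[OF bounded_bilinear_pair])
qed

subsection \<open>Lipschitz domains\<close>

lemma lipschitz_closure_below:
  assumes U: "open U" and lip: "L-lipschitz_on {y. y \<bullet> e = 0} g" and e: "norm e = 1"
    and \<Omega>: "\<And>x. x \<in> U ==> x \<in> \<Omega> \<longleftrightarrow> x \<bullet> e < g (x - (x \<bullet> e) *\<^sub>R e)"
    and x: "x \<in> closure \<Omega>" "x \<in> U"
  shows "x \<bullet> e \<le> g (x - (x \<bullet> e) *\<^sub>R e)"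
proof (rule ccontr)
  have ee: "e \<bullet> e = 1" using e by (simp add: norm_eq_1)
  define G where "G x = x \<bullet> e - g (x - (x \<bullet> e) *\<^sub>R e)" for x
  have "continuous_on UNIV (%x. g (x - (x \<bullet> e) *\<^sub>R e))"
    by (rule continuous_on_compose2[OF lipschitz_on_continuous_on[OF lip]])
      (auto intro!: continuous_intros simp: inner_diff_left ee)
  then have c: "continuous_on UNIV G" unfolding G_def by (intro continuous_intros)
  assume "\<not> x \<bullet> e \<le> g (x - (x \<bullet> e) *\<^sub>R e)"
  then have "x \<in> U \<inter> G -` {0<..}" using x by (simp add: G_def)
  moreover have "open (U \<inter> G -` {0<..})" using U c by (intro open_Int open_vimage) auto
  ultimately obtain y where "y \<in> \<Omega>" "y \<in> U \<inter> G -` {0<..}" using x(1) by (meson closure_iff_nhds_not_empty disjoint_iff order_refl)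
  then show False using \<Omega>[of y] by (simp add: G_def)
qed

lemma norm_orthogonal_le:
  fixes e b :: "'a::real_inner" assumes "norm e = 1" shows "norm (b - (b \<bullet> e) *\<^sub>R e) \<le> norm b"
proof (rule power2_le_imp_le)
  have ee: "e \<bullet> e = 1" using assms by (simp add: norm_eq_1)
  have "(norm (b - (b \<bullet> e) *\<^sub>R e))\<^sup>2 = (norm b)\<^sup>2 - (b \<bullet> e)\<^sup>2"
    unfolding power2_norm_eq_inner by (simp add: inner_diff_left inner_diff_right ee inner_commute[of e b] power2_eq_square)
  then show "(norm (b - (b \<bullet> e) *\<^sub>R e))\<^sup>2 \<le> (norm b)\<^sup>2" by simp
qed simp

text \<open>Moving a point of the closure by roughly \<open>- s *\<^sub>R e\<close> takes it into the domain.\<close>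

lemma lipschitz_shift_inside:
  fixes e :: "'a::real_inner"
  assumes lip: "L-lipschitz_on {y. y \<bullet> e = 0} g" and e: "norm e = 1"
    and y: "y \<bullet> e \<le> g (y - (y \<bullet> e) *\<^sub>R e)"
    and s: "s > 0" and z: "dist (- (s *\<^sub>R e)) z \<le> s * (1 / (2 * (1 + L)))"
  shows "(y + z) \<bullet> e < g (y + z - ((y + z) \<bullet> e) *\<^sub>R e)"
proof -
  have ee: "e \<bullet> e = 1" using e by (simp add: norm_eq_1)
  have L: "L \<ge> 0" using lip by (rule lipschitz_on_nonneg)
  \<comment> \<open>Let b be the deviation of z from - s e. The graph height changes by at most L
    |b| and the vertical coordinate by at most |b| - s; with (1 + L) \<theta> = 1/2 a net gain of s
    / 2 remains.\<close>
  define \<theta> where "\<theta> = 1 / (2 * (1 + L))"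
  have th: "\<theta> > 0" "(1 + L) * \<theta> = 1/2" using L by (simp_all add: \<theta>_def field_simps)
  define b where "b = z + s *\<^sub>R e"
  have b: "norm b \<le> s * \<theta>" using z by (simp add: b_def \<theta>_def dist_norm norm_minus_commute[of "- (s *\<^sub>R e)"])
  have zb: "z = b - s *\<^sub>R e" by (simp add: b_def)
  have be: "b \<bullet> e \<le> s * \<theta>" using Cauchy_Schwarz_ineq2[of b e] b e by simp
  let ?P = "%x. x - (x \<bullet> e) *\<^sub>R e"
  have P: "?P (y + z) = ?P y + ?P b" by (simp add: zb inner_add_left inner_diff_left ee algebra_simps)
  have "dist (g (?P y)) (g (?P (y + z))) \<le> L * dist (?P y) (?P (y + z))"
    by (rule lipschitz_onD[OF lip]) (simp_all add: inner_diff_left ee)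
  also have "dist (?P y) (?P (y + z)) = norm (?P b)"
  proof -
    have "dist u (u + w) = norm w" for u w :: 'a by (simp add: dist_norm)
    then show ?thesis unfolding P .
  qed
  also have "L * norm (?P b) \<le> L * (s * \<theta>)"
    using norm_orthogonal_le[OF e, of b] b L by (intro mult_left_mono) auto
  finally have "g (?P y) \<le> g (?P (y + z)) + L * (s * \<theta>)" by (simp add: dist_real_def)
  moreover have "(y + z) \<bullet> e = y \<bullet> e + b \<bullet> e - s" by (simp add: zb inner_add_left inner_diff_left ee)
  moreover have "L * (s * \<theta>) + s * \<theta> = s / 2"
  proof -
    have "L * (s * \<theta>) + s * \<theta> = s * ((1 + L) * \<theta>)" by (simp add: algebra_simps)
    then show ?thesis using th(2) by simp
  qed
  ultimately show ?thesis using y be s by linarith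
qed

lemma conv_mollifier_nonzero:
  assumes "mollifier k c r" "\<And>y. y \<notin> A ==> f y = 0" "conv f (%z. of_real (k z)) x \<noteq> 0"
  shows "\<exists>y\<in>A. dist c (x - y) \<le> r"
proof (rule ccontr)
  assume n: "\<not> (\<exists>y\<in>A. dist c (x - y) \<le> r)"
  have "f y * of_real (k (x - y)) = 0" for y
    using assms(2)[of y] mollifier_support[OF assms(1), of "x - y"] n by (cases "y \<in> A") auto
  then have "(%y. f y * complex_of_real (k (x - y))) = (%y. 0)" by (rule ext)
  then show False using assms(3) by (simp add: conv_def)
qed

text \<open>The field lives on \<Omega>, but mollifying it spreads its support across the boundary,
  where v is not differentiable. Near a boundary point the kernels are therefore centred at - s e,
  with e the direction of the local graph, which moves the closure of \<Omega> into \<Omega>. The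
  local results are glued through the additivity of \<open>cutoff_form\<close>.\<close>

lemma weak_div_test_Lipschitz:
  assumes \<Omega>: "lipschitz_domain \<Omega>" and eq: "weak_div h F"
    and supp: "proj \<Omega> h = h" "\<And>i. proj \<Omega> (F i) = F i"
    and v: "\<And>i. weakly_diff \<Omega> i v (V i)"
  shows "pair h v + (\<Sum>i\<in>UNIV. pair (F i) (V i)) = 0"
proof -
  have op: "open \<Omega>" and bd: "bounded \<Omega>" using \<Omega> by (auto simp: lipschitz_domain_def)
  then have meas: "\<Omega> \<in> sets lebesgue" "\<Omega> \<in> sets borel" by auto
  let ?\<Lambda> = "cutoff_form h F v V"
  have "\<exists>f. is_L2 f \<and> f \<in> borel_measurable borel \<and> (\<forall>y. y \<notin> \<Omega> --> f y = 0) \<and> F i = abs_l2 f" for i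
  proof -
    obtain f where f: "is_L2 f" "f \<in> borel_measurable borel" "F i = abs_l2 f" using l2_borel_rep by blast
    show ?thesis
      by (rule exI[of _ "%x. if x \<in> \<Omega> then f x else 0"])
        (use f meas proj_abs_l2[OF meas(1) f(1)] supp(2)[of i] in auto)
  qed
  then obtain f where f: "\<And>i. is_L2 (f i)" "\<And>i. f i \<in> borel_measurable borel" "\<And>i y. y \<notin> \<Omega> ==> f i y = 0" "\<And>i. F i = abs_l2 (f i)" by metis
  have F: "F = (%i. abs_l2 (f i))" using f(4) by blast
  \<comment> \<open>Condition \<open>sh\<close> says that a point of the closure, displaced by a
    vector in the support of the kernel, lies in \<Omega> whenever it lands in S. With S carrying
    the support of \<open>ct\<close>, the product of cutoff and mollified field then has compact
    support in \<Omega>.\<close>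
  have gen: "?\<Lambda> ct = 0" if ct: "ct \<in> test_fun UNIV" and k: "\<And>n. mollifier (k n) (c n) (r n)"
    and c: "c \<longlonglongrightarrow> 0" and r: "r \<longlonglongrightarrow> 0" and S: "compact S" "\<And>x. x \<notin> S ==> ct x = 0"
    and sh: "\<And>n y z. y \<in> closure \<Omega> ==> dist (c n) z \<le> r n ==> y + z \<in> S ==> y + z \<in> \<Omega>" for ct k c r S
    unfolding cutoff_form_def F
  proof (rule weak_div_test_cutoff[OF eq[unfolded F] f(1,2) v ct k c r])
    fix n i
    let ?K = "S \<inter> (\<Union>y\<in>closure \<Omega>. \<Union>z\<in>cball (c n) (r n). {y + z})"
    show "(%x. ct x * conv (f i) (%z. of_real (k n z)) x) \<in> test_fun \<Omega>"
    proof (rule test_funI)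
      show "smooth (%x. ct x * conv (f i) (%z. of_real (k n z)) x)"
        by (rule smooth_mult[OF test_fun_smooth[OF ct] conv_smooth(1)[OF is_L2_locally_integrable[OF f(1)] mollifier_test_fun[OF k]]])
      show "compact ?K"
        by (intro compact_Int_closed S closed_compact_sums[of "closure \<Omega>" "cball (c n) (r n)", simplified] closed_closure compact_cball)
      show "?K \<subseteq> \<Omega>" using sh[of _ n] by (auto simp: mem_cball)
      show "ct x * conv (f i) (%z. of_real (k n z)) x = 0" if "x \<notin> ?K" for x
      proof (rule ccontr)
        assume "ct x * conv (f i) (%z. of_real (k n z)) x \<noteq> 0"
        then have nz: "ct x \<noteq> 0" "conv (f i) (%z. of_real (k n z)) x \<noteq> 0" by auto
        obtain y where y: "y \<in> \<Omega>" "dist (c n) (x - y) \<le> r n"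
          using conv_mollifier_nonzero[OF k f(3) nz(2)] by blast
        have "x \<in> S" using S(2) nz(1) by metis
        moreover have "y \<in> closure \<Omega>" "x - y \<in> cball (c n) (r n)" "x = y + (x - y)"
          using y closure_subset by auto
        ultimately have "x \<in> ?K" by blast
        then show False using that by blast
      qed
    qed
  qed
  have loc: "\<exists>\<rho>>0. \<forall>ct\<in>test_fun UNIV. (\<forall>x. dist p x \<ge> \<rho> --> ct x = 0) --> ?\<Lambda> ct = 0" if p: "p \<in> closure \<Omega>" for p
  proof (cases "p \<in> \<Omega>")
    case True
    then obtain \<rho> where \<rho>: "\<rho> > 0" "cball p \<rho> \<subseteq> \<Omega>" using op open_contains_cball by blast
    obtain k where k: "\<And>n. mollifier (k n) (0::real^3) (1 / (real n + 1))" using mollifier_sequence_0 by blast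
    have rl: "(%n. 1 / (real n + 1)) \<longlonglongrightarrow> 0" by real_asymp
    have "?\<Lambda> ct = 0" if ct: "ct \<in> test_fun UNIV" "\<forall>x. dist p x \<ge> \<rho> --> ct x = 0" for ct
      by (rule gen[OF ct(1) k tendsto_const rl compact_cball[of p \<rho>]]) (use ct(2) \<rho> in auto)
    with \<rho>(1) show ?thesis by blast
  next
    case False
    then have "p \<in> frontier \<Omega>" using p op by (simp add: frontier_def interior_open)
    then obtain U e L g where U: "open U" "p \<in> U" and e: "norm e = 1" and lip: "L-lipschitz_on {y. y \<bullet> e = 0} g"
      and g: "\<And>x. x \<in> U ==> x \<in> \<Omega> \<longleftrightarrow> x \<bullet> e < g (x - (x \<bullet> e) *\<^sub>R e)"
      using \<Omega> unfolding lipschitz_domain_def by blast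
    have L: "L \<ge> 0" using lip by (rule lipschitz_on_nonneg)
    obtain d where d: "d > 0" "cball p d \<subseteq> U" using U open_contains_cball by blast
    \<comment> \<open>Displacements have length at most \<rho>, since s n \<le> \<rho>/2 and t n
      \<le> s n. A point whose displaced image is within \<rho> of p is itself within d of p, where
      the graph description of \<Omega> is valid.\<close>
    define \<rho> where "\<rho> = d / 2"
    define s where "s n = \<rho> / 2 / (real n + 1)" for n
    have s: "0 < s n" "s n \<le> \<rho> / 2" for n using d(1) by (simp_all add: s_def \<rho>_def field_simps)
    define t where "t n = s n * (1 / (2 * (1 + L)))" for n
    have t: "0 < t n" "t n \<le> s n" for n using s(1)[of n] L by (simp_all add: t_def field_simps)
    have "\<forall>n. \<exists>k. mollifier k (- (s n *\<^sub>R e)) (t n)" using mollifier_exists[OF t(1)] by blast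
    from choice[OF this] obtain k where k: "\<And>n. mollifier (k n) (- (s n *\<^sub>R e)) (t n)" by blast
    have s0: "s \<longlonglongrightarrow> 0" unfolding s_def by real_asymp
    have c0: "(%n. - (s n *\<^sub>R e)) \<longlonglongrightarrow> 0" using tendsto_minus[OF tendsto_scaleR[OF s0 tendsto_const[of e]]] by simp
    have t0: "t \<longlonglongrightarrow> 0" unfolding t_def by (rule tendsto_mult_left_zero[OF s0])
    have "?\<Lambda> ct = 0" if ct: "ct \<in> test_fun UNIV" "\<forall>x. dist p x \<ge> \<rho> --> ct x = 0" for ct
    proof (rule gen[OF ct(1) k c0 t0 compact_cball[of p \<rho>]])
      show "ct x = 0" if "x \<notin> cball p \<rho>" for x using ct(2) that by auto
      fix n y z assume y: "y \<in> closure \<Omega>" and z: "dist (- (s n *\<^sub>R e)) z \<le> t n" and yz: "y + z \<in> cball p \<rho>"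
      have "norm z \<le> norm (- (s n *\<^sub>R e)) + dist (- (s n *\<^sub>R e)) z"
        using norm_triangle_ineq2[of z "- (s n *\<^sub>R e)"] by (simp add: dist_norm norm_minus_commute)
      then have nz: "norm z \<le> \<rho>" using z t(2)[of n] s[of n] e by simp
      have "dist p y \<le> dist p (y + z) + norm z" using dist_triangle[of p y "y + z"] by (simp add: dist_norm)
      then have "y \<in> cball p d" using nz yz by (simp add: \<rho>_def)
      then have "y \<in> U" using d(2) by blast
      then have "y \<bullet> e \<le> g (y - (y \<bullet> e) *\<^sub>R e)" using lipschitz_closure_below[OF U(1) lip e g y] by blast
      from lipschitz_shift_inside[OF lip e this s(1) z[unfolded t_def]]
      have "(y + z) \<bullet> e < g (y + z - ((y + z) \<bullet> e) *\<^sub>R e)" .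
      moreover have "y + z \<in> U" using yz d by (auto simp: \<rho>_def)
      ultimately show "y + z \<in> \<Omega>" using g by blast
    qed
    moreover have "\<rho> > 0" using d(1) by (simp add: \<rho>_def)
    ultimately show ?thesis by blast
  qed
  then obtain \<rho> where \<rho>: "\<And>p. p \<in> closure \<Omega> ==> \<rho> p > 0"
    "\<And>p ct. p \<in> closure \<Omega> ==> ct \<in> test_fun UNIV ==> (\<forall>x. dist p x \<ge> \<rho> p --> ct x = 0) ==> ?\<Lambda> ct = 0"
    by metis
  have cut: "\<exists>\<eta>\<in>test_fun UNIV. (\<forall>x. dist p x \<le> r --> \<eta> x = 1) \<and> (\<forall>x. dist p x \<ge> 2 * r --> \<eta> x = 0)"
    if "r > 0" for p :: "real^3" and r using cutoff_exists that by blast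
  \<comment> \<open>Multiplication by 1 - \<eta> removes one ball at a time from the cutoff. The
    removed part is supported near p, where the form vanishes, so its value is unchanged.\<close>
  have step: "\<exists>ct'\<in>test_fun UNIV. ?\<Lambda> ct' = ?\<Lambda> ct \<and> (\<forall>x. (\<exists>p\<in>D. dist p x \<le> \<rho> p / 2) --> ct' x = 0)"
    if "finite D" "D \<subseteq> closure \<Omega>" "ct \<in> test_fun UNIV" for D ct
    using that
  proof (induction D)
    case empty then show ?case by blast
  next
    case (insert p D)
    then obtain ct' where ct': "ct' \<in> test_fun UNIV" "?\<Lambda> ct' = ?\<Lambda> ct" "\<And>x. (\<exists>p\<in>D. dist p x \<le> \<rho> p / 2) ==> ct' x = 0" by blast
    have pp: "p \<in> closure \<Omega>" using insert.prems by blast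
    then obtain \<eta> where \<eta>: "\<eta> \<in> test_fun UNIV" "\<And>x. dist p x \<le> \<rho> p / 2 ==> \<eta> x = 1" "\<And>x. dist p x \<ge> \<rho> p ==> \<eta> x = 0"
      using cut[of "\<rho> p / 2" p] \<rho>(1)[OF pp] by auto
    have 1: "(%x. ct' x * \<eta> x) \<in> test_fun UNIV" "(%x. ct' x * (1 - \<eta> x)) \<in> test_fun UNIV"
      by (rule test_fun_mult_right[OF _ ct'(1)] smooth_diff smooth_const test_fun_smooth[OF \<eta>(1)])+
    have "?\<Lambda> (%x. ct' x * \<eta> x + ct' x * (1 - \<eta> x)) = ?\<Lambda> (%x. ct' x * \<eta> x) + ?\<Lambda> (%x. ct' x * (1 - \<eta> x))"
      by (rule cutoff_form_add[OF 1])
    moreover have "?\<Lambda> (%x. ct' x * \<eta> x) = 0" by (rule \<rho>(2)[OF pp 1(1)]) (simp add: \<eta>(3))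
    moreover have "(%x. ct' x * \<eta> x + ct' x * (1 - \<eta> x)) = ct'" by (simp add: algebra_simps)
    ultimately have "?\<Lambda> (%x. ct' x * (1 - \<eta> x)) = ?\<Lambda> ct" using ct'(2) by simp
    then show ?case using 1(2) ct'(3) \<eta>(2) by (intro bexI[OF _ 1(2)]) auto
  qed
  obtain D where D: "D \<subseteq> closure \<Omega>" "finite D" "closure \<Omega> \<subseteq> (\<Union>p\<in>D. ball p (\<rho> p / 2))"
    by (rule compactE_image[of "closure \<Omega>" "closure \<Omega>" "%p. ball p (\<rho> p / 2)"]) (use bd \<rho>(1) in \<open>auto simp: compact_closure\<close>)
  obtain R where R: "R > 0" "\<And>x. x \<in> \<Omega> ==> norm x \<le> R" using bd bounded_pos by metis
  obtain ct :: "real^3 => complex" where ct0: "ct \<in> test_fun UNIV" "\<forall>x. norm x \<le> R --> ct x = 1"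
    using cut[OF R(1), of 0] unfolding dist_0_norm by blast
  have ct: "ct \<in> test_fun UNIV" "\<And>x. norm x \<le> R ==> ct x = 1" using ct0 by auto
  obtain ct' where ct': "ct' \<in> test_fun UNIV" "?\<Lambda> ct' = ?\<Lambda> ct" "\<And>x. (\<exists>p\<in>D. dist p x \<le> \<rho> p / 2) ==> ct' x = 0"
    using step[OF D(2,1) ct(1)] by blast
  have mul0: "mulL m (proj \<Omega> u) = 0" if bm: "\<exists>M. ae_bounded m M" and m0: "\<And>x. x \<in> \<Omega> ==> m x = 0" for m u
  proof -
    obtain M where M: "ae_bounded m M" using bm by blast
    have "(%x. m x * indicator \<Omega> x) = (%x. 0)" using m0 by (intro ext) (auto simp: indicator_def)
    then show ?thesis unfolding proj_def mulL_mulL[OF M ae_bounded_indicator[OF meas(1)]] by (simp add: mulL_zero)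
  qed
  have mul1: "mulL ct (proj \<Omega> u) = proj \<Omega> u" for u
  proof -
    obtain M where M: "ae_bounded ct M" using test_fun_ae_bounded[OF ct(1)] by blast
    have "(%x. ct x * indicator \<Omega> x) = indicator \<Omega>" using ct(2) R(2) by (intro ext) (auto simp: indicator_def)
    then show ?thesis unfolding proj_def mulL_mulL[OF M ae_bounded_indicator[OF meas(1)]] by simp
  qed
  \<comment> \<open>After all balls of the covering have been removed the cutoff vanishes on
    \<Omega>, where h and F live, so the form is 0. For the original cutoff, equal to 1 on \<Omega>,
    the form is the asserted expression.\<close>
  have z: "ct' x = 0" if "x \<in> \<Omega>" for x
    by (rule ct'(3)) (use that D(3) closure_subset[of \<Omega>] in force)
  have z': "dir_deriv u ct' x = 0" if "x \<in> \<Omega>" for x u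
    by (rule frechet_derivative_zero_open[OF op that z])
  have z1: "dir_deriv u ct x = 0" if "x \<in> \<Omega>" for x u
    using dir_deriv_transform_open[OF op that smooth_const[of 1], of ct u] ct(2) R(2) by (simp add: frechet_derivative_const)
  note tb = test_fun_ae_bounded test_fun_ae_bounded[OF test_fun_dir_deriv]
  have Z: "mulL ct' h = 0" "mulL ct' (F i) = 0" "mulL (pd i ct') (F i) = 0" "mulL (pd i ct) (F i) = 0" for i
    using mul0[OF tb(1)[OF ct'(1)] z, of h] mul0[OF tb(1)[OF ct'(1)] z, of "F i"] mul0[OF tb(2)[OF ct'(1)] z', of "axis i 1" "F i"]
      mul0[OF tb(2)[OF ct(1)] z1, of "axis i 1" "F i"] supp by simp_all
  note p0 = bounded_bilinear.zero_left[OF bounded_bilinear_pair]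
  have "?\<Lambda> ct' = 0" unfolding cutoff_form_def Z by (simp add: p0)
  moreover have "?\<Lambda> ct = pair h v + (\<Sum>i\<in>UNIV. pair (F i) (V i))"
    unfolding cutoff_form_def Z using mul1[of h] mul1[of "F _"] by (simp add: supp p0)
  ultimately show ?thesis using ct'(2) by simp
qed

subsection \<open>The two-dimensional Hausdorff measure\<close>

text \<open>\<open>measure_of\<close> yields the intended values only once the set function is known
  to be a measure on the Borel sets, so the outer measure is first studied as a plain function of
  sets.\<close>

definition haus2 :: "(real^3) set => ennreal"
  where "haus2 E = (SUP d\<in>{0<..}. hausdorff2_pre d E)"

abbreviation qsize :: "(real^3) set => ennreal" where "qsize S \<equiv> ennreal (pi / 4 * (diameter S)\<^sup>2)"

lemma hausdorff2_pre_le: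
  assumes "\<And>n. bounded (S n)" "\<And>n. diameter (S n) \<le> d" "E \<subseteq> (\<Union>n. S n)"
  shows "hausdorff2_pre d E \<le> (\<Sum>n. qsize (S n))"
  unfolding hausdorff2_pre_def by (rule INF_lower) (use assms in auto)

lemma hausdorff2_pre_mono: "A \<subseteq> B ==> hausdorff2_pre d A \<le> hausdorff2_pre d B"
  unfolding hausdorff2_pre_def by (rule INF_superset_mono) auto

lemma hausdorff2_pre_antimono: "d \<le> d' ==> hausdorff2_pre d' A \<le> hausdorff2_pre d A"
  unfolding hausdorff2_pre_def by (rule INF_superset_mono) (auto intro: order_trans)

lemma hausdorff2_pre_empty: "d > 0 ==> hausdorff2_pre d {} = 0"
  using hausdorff2_pre_le[of "%_. {}" d "{}"] by (simp add: diameter_empty)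

lemma hausdorff2_pre_approx:
  assumes "hausdorff2_pre d E < c"
  shows "\<exists>S. (\<forall>n. bounded (S n) \<and> diameter (S n) \<le> d) \<and> E \<subseteq> (\<Union>n. S n) \<and> (\<Sum>n. qsize (S n)) < c"
  using assms unfolding hausdorff2_pre_def by (auto simp: INF_less_iff)

lemma hausdorff2_pre_countable_subadditive:
  assumes "d > 0" shows "hausdorff2_pre d (\<Union>n. A n) \<le> (\<Sum>n. hausdorff2_pre d (A n))"
proof (rule ennreal_le_epsilon)
  fix e :: real assume e: "0 < e" and fin: "(\<Sum>n. hausdorff2_pre d (A n)) < top"
  have "\<exists>S. (\<forall>k. bounded (S k) \<and> diameter (S k) \<le> d) \<and> A n \<subseteq> (\<Union>k. S k) \<and>
     (\<Sum>k. qsize (S k)) < hausdorff2_pre d (A n) + ennreal (e * (1/2)^Suc n)" for n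
  proof (rule hausdorff2_pre_approx)
    have "hausdorff2_pre d (A n) < top" using fin ennreal_suminf_lessD by blast
    then show "hausdorff2_pre d (A n) < hausdorff2_pre d (A n) + ennreal (e * (1/2)^Suc n)"
      using e by simp
  qed
  then obtain S where S: "\<And>n k. bounded (S n k)" "\<And>n k. diameter (S n k) \<le> d" "\<And>n. A n \<subseteq> (\<Union>k. S n k)"
    "\<And>n. (\<Sum>k. qsize (S n k)) < hausdorff2_pre d (A n) + ennreal (e * (1/2)^Suc n)" by metis
  define T where "T m = (case prod_decode m of (n, k) => S n k)" for m
  have "(\<Union>n. A n) \<subseteq> (\<Union>m. T m)"
  proof
    fix x assume "x \<in> (\<Union>n. A n)"
    then obtain n k where "x \<in> S n k" using S(3) by blast
    then have "x \<in> T (prod_encode (n, k))" by (simp add: T_def)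
    then show "x \<in> (\<Union>m. T m)" by blast
  qed
  then have "hausdorff2_pre d (\<Union>n. A n) \<le> (\<Sum>m. qsize (T m))"
    by (intro hausdorff2_pre_le) (auto simp: T_def S split: prod.split)
  also have "\<dots> = (\<Sum>n. \<Sum>k. qsize (S n k))"
  proof -
    have e: "qsize (T m) = (%(n, k). qsize (S n k)) (prod_decode m)" for m
      by (auto simp: T_def split: prod.split)
    show ?thesis unfolding e by (rule suminf_ennreal_2dimen) simp
  qed
  also have "\<dots> \<le> (\<Sum>n. hausdorff2_pre d (A n) + ennreal (e * (1/2)^Suc n))"
    by (intro suminf_le less_imp_le S(4) summableI)
  also have "\<dots> = (\<Sum>n. hausdorff2_pre d (A n)) + (\<Sum>n. ennreal (e * (1/2)^Suc n))"
    by (intro suminf_add[symmetric] summableI)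
  also have "(\<Sum>n. ennreal (e * (1/2)^Suc n)) = ennreal e"
  proof (rule suminf_ennreal_eq)
    show "(%n. e * (1/2)^Suc n) sums e" using sums_mult[OF power_half_series, of e] by simp
  qed (use e in simp)
  finally show "hausdorff2_pre d (\<Union>n. A n) \<le> (\<Sum>n. hausdorff2_pre d (A n)) + ennreal e" .
qed

lemma haus2_mono: "A \<subseteq> B ==> haus2 A \<le> haus2 B"
  unfolding haus2_def by (intro SUP_mono) (auto intro: hausdorff2_pre_mono)

lemma hausdorff2_pre_le_haus2: "d > 0 ==> hausdorff2_pre d A \<le> haus2 A"
  unfolding haus2_def by (rule SUP_upper) simp

lemma haus2_empty: "haus2 {} = 0"
proof -
  have "(SUP d\<in>{0<..}. hausdorff2_pre d {}) = (SUP d\<in>{0::real<..}. 0)"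
    by (intro SUP_cong) (auto simp: hausdorff2_pre_empty)
  then show ?thesis by (simp add: haus2_def)
qed

lemma haus2_countable_subadditive: "haus2 (\<Union>n. A n) \<le> (\<Sum>n. haus2 (A n))"
  unfolding haus2_def[of "\<Union>n. A n"]
proof (rule SUP_least)
  fix d :: real assume "d \<in> {0<..}"
  then have d: "d > 0" by simp
  show "hausdorff2_pre d (\<Union>n. A n) \<le> (\<Sum>n. haus2 (A n))"
    by (rule order_trans[OF hausdorff2_pre_countable_subadditive[OF d]])
      (intro suminf_le summableI hausdorff2_pre_le_haus2 d)
qed

lemma haus2_Un: "haus2 (A \<union> B) \<le> haus2 A + haus2 B"
proof -
  have "A \<union> B = (\<Union>n. binaryset A B n)" by (simp add: UN_binaryset_eq)
  moreover have "(\<Sum>n. haus2 (binaryset A B n)) = haus2 A + haus2 B"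
    using suminf_binaryset_eq[of haus2 A B] haus2_empty by simp
  ultimately show ?thesis using haus2_countable_subadditive[of "binaryset A B"] by simp
qed

text \<open>A covering set of diameter below e meets at most one of the two sets, so any fine enough
  covering of the union splits into coverings of the parts.\<close>

lemma haus2_separated:
  assumes e: "e > 0" and sep: "\<And>a b. a \<in> A ==> b \<in> B ==> e \<le> dist a b"
  shows "haus2 A + haus2 B \<le> haus2 (A \<union> B)"
proof -
  have small: "hausdorff2_pre d A + hausdorff2_pre d B \<le> hausdorff2_pre d (A \<union> B)" if d: "d < e" for d
    unfolding hausdorff2_pre_def[of d "A \<union> B"]
  proof (rule INF_greatest)
    fix S :: "nat => (real^3) set" assume "S \<in> {S. (\<forall>n. bounded (S n) \<and> diameter (S n) \<le> d) \<and> A \<union> B \<subseteq> (\<Union>n. S n)}"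
    then have S: "\<And>n. bounded (S n)" "\<And>n. diameter (S n) \<le> d" "A \<union> B \<subseteq> (\<Union>n. S n :: (real^3) set)" by auto
    define SA where "SA n = (if S n \<inter> A = {} then {} else S n)" for n
    define SB where "SB n = (if S n \<inter> B = {} then {} else S n)" for n
    have d0: "0 \<le> d" using S(2)[of 0] diameter_ge_0[OF S(1)[of 0]] by linarith
    have disj: "S n \<inter> A = {} \<or> S n \<inter> B = {}" for n
    proof (rule ccontr)
      assume "\<not> (S n \<inter> A = {} \<or> S n \<inter> B = {})"
      then obtain a b where "a \<in> S n" "a \<in> A" "b \<in> S n" "b \<in> B" by blast
      then have "e \<le> diameter (S n)" using sep[of a b] diameter_bounded_bound[OF S(1)] order_trans by blast
      then show False using S(2)[of n] d by simp
    qed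
    have "A \<subseteq> (\<Union>n. SA n)"
    proof
      fix x assume x: "x \<in> A"
      then obtain n where "x \<in> S n" using S(3) by blast
      with x have "x \<in> SA n" by (auto simp: SA_def)
      then show "x \<in> (\<Union>n. SA n)" by blast
    qed
    then have "hausdorff2_pre d A \<le> (\<Sum>n. qsize (SA n))"
      by (rule hausdorff2_pre_le[rotated 2]) (use S d0 in \<open>auto simp: SA_def diameter_empty\<close>)
    moreover have "B \<subseteq> (\<Union>n. SB n)"
    proof
      fix x assume x: "x \<in> B"
      then obtain n where "x \<in> S n" using S(3) by blast
      with x have "x \<in> SB n" by (auto simp: SB_def)
      then show "x \<in> (\<Union>n. SB n)" by blast
    qed
    then have "hausdorff2_pre d B \<le> (\<Sum>n. qsize (SB n))"
      by (rule hausdorff2_pre_le[rotated 2]) (use S d0 in \<open>auto simp: SB_def diameter_empty\<close>)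
    ultimately have "hausdorff2_pre d A + hausdorff2_pre d B \<le> (\<Sum>n. qsize (SA n)) + (\<Sum>n. qsize (SB n))"
      by (rule add_mono)
    also have "\<dots> = (\<Sum>n. qsize (SA n) + qsize (SB n))" by (intro suminf_add summableI)
    also have "\<dots> \<le> (\<Sum>n. qsize (S n))"
    proof (intro suminf_le summableI)
      fix n show "qsize (SA n) + qsize (SB n) \<le> qsize (S n)"
        using disj[of n] by (auto simp: SA_def SB_def diameter_empty)
    qed
    finally show "hausdorff2_pre d A + hausdorff2_pre d B \<le> (\<Sum>n. qsize (S n))" .
  qed
  have "hausdorff2_pre d A + hausdorff2_pre d' B \<le> haus2 (A \<union> B)" if "d > 0" "d' > 0" for d d'
  proof -
    define c where "c = min (min d d') (e/2)"
    have c: "c > 0" "c < e" "c \<le> d" "c \<le> d'" using that e by (auto simp: c_def)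
    have "hausdorff2_pre d A + hausdorff2_pre d' B \<le> hausdorff2_pre c A + hausdorff2_pre c B"
      by (intro add_mono hausdorff2_pre_antimono c)
    also have "\<dots> \<le> hausdorff2_pre c (A \<union> B)" by (rule small[OF c(2)])
    also have "\<dots> \<le> haus2 (A \<union> B)" by (rule hausdorff2_pre_le_haus2[OF c(1)])
    finally show ?thesis .
  qed
  then have 1: "haus2 A + hausdorff2_pre d' B \<le> haus2 (A \<union> B)" if "d' > 0" for d'
    unfolding haus2_def[of A] using that by (subst ennreal_SUP_add_left[symmetric]) (auto intro!: SUP_least)
  show ?thesis
    unfolding haus2_def[of B] by (subst ennreal_SUP_add_right) (auto intro!: SUP_least 1)
qed

text \<open>Only rings whose indices differ by at least two are separated. The rings of even index
  and those of odd index therefore each add up to at most \<open>haus2 T\<close>, which explains the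
  factor 2.\<close>

lemma haus2_rings_finite:
  fixes R :: "nat => (real^3) set"
  assumes sep: "\<And>j k. j + 2 \<le> k ==> \<exists>e>0. \<forall>a\<in>R j. \<forall>b\<in>R k. e \<le> dist a b"
    and sub: "\<And>k. R k \<subseteq> T"
  shows "(\<Sum>k<n. haus2 (R k)) \<le> 2 * haus2 T"
proof -
  have par: "(\<Sum>k<n. haus2 (R (2 * k + c))) \<le> haus2 (\<Union>k<n. R (2 * k + c))" for n c
  proof (induction n)
    case 0 then show ?case by (simp add: haus2_empty)
  next
    case (Suc n)
    have "\<forall>k<n. \<exists>e>0. \<forall>a\<in>R (2 * k + c). \<forall>b\<in>R (2 * n + c). e \<le> dist a b"
      by (intro allI impI sep) auto
    then obtain e where e: "\<And>k. k < n ==> e k > 0" "\<And>k a b. k < n ==> a \<in> R (2 * k + c) ==> b \<in> R (2 * n + c) ==> e k \<le> dist a b" by metis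
    define e' where "e' = Min (insert 1 (e ` {..<n}))"
    have "e' > 0" unfolding e'_def using e(1) by (subst Min_gr_iff) auto
    moreover have "e' \<le> e k" if "k < n" for k unfolding e'_def by (rule Min_le) (use that in auto)
    ultimately have "haus2 (\<Union>k<n. R (2 * k + c)) + haus2 (R (2 * n + c)) \<le> haus2 ((\<Union>k<n. R (2 * k + c)) \<union> R (2 * n + c))"
      by (intro haus2_separated[of e']) (auto intro: order_trans e(2))
    moreover have "(\<Union>k<Suc n. R (2 * k + c)) = (\<Union>k<n. R (2 * k + c)) \<union> R (2 * n + c)"
      by (auto simp: less_Suc_eq)
    ultimately show ?case using order_trans[OF add_right_mono[OF Suc]] by simp
  qed
  have "(\<Sum>k<n. haus2 (R k)) \<le> (\<Sum>k<2 * n. haus2 (R k))" by (intro sum_mono2) auto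
  also have "\<dots> = (\<Sum>k<n. haus2 (R (2 * k + 0))) + (\<Sum>k<n. haus2 (R (2 * k + 1)))"
    by (induction n) (auto simp: algebra_simps)
  also have "\<dots> \<le> haus2 T + haus2 T"
    by (intro add_mono order_trans[OF par] haus2_mono) (use sub in auto)
  finally show ?thesis by (simp add: mult_2)
qed

text \<open>The criterion for metric outer measures. The part \<open>A n\<close> of T at distance at
  least 1 / (n + 1) from C is separated from C, hence additive with the part inside C. The rest of T
  - C lies in the rings from index n on, whose measures form the tail of a convergent
  series.\<close>

lemma haus2_Caratheodory_closed:
  assumes C: "closed C" shows "haus2 (T \<inter> C) + haus2 (T - C) \<le> haus2 T"
proof (cases "haus2 T = top \<or> C = {}")
  case True then show ?thesis using haus2_empty by auto
next
  case False
  then have fin: "haus2 T < top" and ne: "C \<noteq> {}" by (auto simp: less_top)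
  define A where "A n = {x \<in> T. 1 / (real n + 1) \<le> infdist x C}" for n
  define R where "R n = {x \<in> T. 1 / (real n + 2) \<le> infdist x C \<and> infdist x C < 1 / (real n + 1)}" for n
  have sep: "\<exists>e>0. \<forall>a\<in>R j. \<forall>b\<in>R k. e \<le> dist a b" if "j + 2 \<le> k" for j k
  proof (intro exI conjI ballI)
    have jk: "real j + 2 \<le> real k" using that by linarith
    have "1 / (real k + 1) < 1 / (real j + 2)" by (rule divide_strict_left_mono) (use jk in auto)
    then show "1 / (real j + 2) - 1 / (real k + 1) > 0" by simp
    fix a b assume "a \<in> R j" "b \<in> R k"
    then have "1 / (real j + 2) \<le> infdist a C" "infdist b C < 1 / (real k + 1)" by (auto simp: R_def)
    moreover have "infdist a C \<le> infdist b C + dist a b" by (rule infdist_triangle)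
    ultimately show "1 / (real j + 2) - 1 / (real k + 1) \<le> dist a b" by linarith
  qed
  have "(\<Sum>k<n. haus2 (R k)) \<le> 2 * haus2 T" for n
    by (rule haus2_rings_finite[OF sep]) (auto simp: R_def)
  then have "(\<Sum>k. haus2 (R k)) \<le> 2 * haus2 T" by (intro suminf_le_const summableI)
  then have sfin: "(\<Sum>k. haus2 (R k)) < top" using fin by (simp add: ennreal_mult_less_top order_le_less_trans)
  have tail: "(%n. \<Sum>k. haus2 (R (k + n))) \<longlonglongrightarrow> 0"
  proof -
    have "\<And>k. haus2 (R k) \<noteq> top" using ennreal_suminf_lessD[OF sfin] by (auto simp: less_top)
    define r where "r k = enn2real (haus2 (R k))" for k
    have r: "haus2 (R k) = ennreal (r k)" "0 \<le> r k" for k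
      using \<open>\<And>k. haus2 (R k) \<noteq> top\<close> by (auto simp: r_def less_top)
    have sr: "summable r" using sfin r by (intro summable_suminf_not_top) auto
    have "(\<Sum>k. haus2 (R (k + n))) = ennreal (\<Sum>k. r (k + n))" for n
      unfolding r(1) using r(2) sr by (intro suminf_ennreal2) (auto simp: summable_iff_shift)
    moreover have "(%n. \<Sum>k. r (k + n)) \<longlonglongrightarrow> 0" by (rule suminf_exist_split2[OF sr])
    ultimately show ?thesis using tendsto_ennrealI by fastforce
  qed
  have "haus2 (T \<inter> C) + haus2 (T - C) \<le> haus2 T + (\<Sum>k. haus2 (R (k + n)))" for n
  proof -
    have "T - C \<subseteq> A n \<union> (\<Union>k. R (k + n))"
    proof
      fix x assume x: "x \<in> T - C"
      then have pos: "infdist x C > 0" using C ne infdist_nonneg[of x C] in_closed_iff_infdist_zero[OF C ne, of x] by auto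
      show "x \<in> A n \<union> (\<Union>k. R (k + n))"
      proof (cases "1 / (real n + 1) \<le> infdist x C")
        case True then show ?thesis using x by (simp add: A_def)
      next
        case False
        obtain m0 where "1 / (real m0 + 2) \<le> infdist x C"
        proof -
          obtain m where "1 / real (Suc m) < infdist x C" using nat_approx_posE[OF pos] by blast
          moreover have "1 / (real m + 2) \<le> 1 / real (Suc m)" by (simp add: field_simps)
          ultimately show thesis using that[of m] by linarith
        qed
        then have ex: "\<exists>m. 1 / (real m + 2) \<le> infdist x C" by blast
        \<comment> \<open>The least admissible index picks the ring. Minimality bounds the distance
          from above, except for m = n, where the bound comes from x not lying in
          \<open>A n\<close>.\<close>
        define m where "m = (LEAST m. 1 / (real m + 2) \<le> infdist x C)"
        have m: "1 / (real m + 2) \<le> infdist x C" unfolding m_def using LeastI_ex[OF ex] .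
        have "m \<ge> n"
        proof (rule ccontr)
          assume "\<not> m \<ge> n"
          then have "1 / (real n + 1) \<le> 1 / (real m + 2)" by (intro divide_left_mono) auto
          with m False show False by linarith
        qed
        moreover have "infdist x C < 1 / (real m + 1)"
        proof (cases "m = n")
          case True then show ?thesis using False by simp
        next
          case False
          then obtain m' where m': "m = Suc m'" using \<open>m \<ge> n\<close> by (cases m) auto
          then have "\<not> 1 / (real m' + 2) \<le> infdist x C" using not_less_Least[of m' "%m. 1 / (real m + 2) \<le> infdist x C"] m_def by auto
          then show ?thesis using m' by (simp add: add.commute)
        qed
        ultimately have "x \<in> R ((m - n) + n)" using m x by (simp add: R_def)
        then show ?thesis by blast
      qed
    qed
    then have "haus2 (T - C) \<le> haus2 (A n) + haus2 (\<Union>k. R (k + n))"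
      by (rule order_trans[OF haus2_mono haus2_Un])
    also have "\<dots> \<le> haus2 (A n) + (\<Sum>k. haus2 (R (k + n)))"
      by (intro add_left_mono haus2_countable_subadditive)
    finally have "haus2 (T \<inter> C) + haus2 (T - C) \<le> haus2 (T \<inter> C) + haus2 (A n) + (\<Sum>k. haus2 (R (k + n)))"
      by (simp add: add.assoc add_left_mono)
    also have "haus2 (T \<inter> C) + haus2 (A n) \<le> haus2 (T \<inter> C \<union> A n)"
    proof (rule haus2_separated)
      show "1 / (real n + 1) > 0" by simp
      fix a b assume "a \<in> T \<inter> C" "b \<in> A n"
      then have "1 / (real n + 1) \<le> infdist b C" "infdist b C \<le> dist b a" by (auto simp: A_def intro: infdist_le)
      then show "1 / (real n + 1) \<le> dist a b" by (simp add: dist_commute)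
    qed
    also have "\<dots> \<le> haus2 T" by (rule haus2_mono) (auto simp: A_def)
    finally show ?thesis by (simp add: add_right_mono)
  qed
  moreover have "(%n. haus2 T + (\<Sum>k. haus2 (R (k + n)))) \<longlonglongrightarrow> haus2 T + 0"
    by (intro tendsto_add tendsto_const tail)
  ultimately show ?thesis using LIMSEQ_le_const[of "%n. haus2 T + (\<Sum>k. haus2 (R (k + n)))"] by auto
qed

lemma measure_space_haus2: "measure_space UNIV (sets borel) haus2"
proof -
  interpret P: sigma_algebra UNIV "Pow (UNIV :: (real^3) set)" by (rule sigma_algebra_Pow)
  have o: "outer_measure_space (Pow UNIV) haus2"
    unfolding outer_measure_space_def positive_def increasing_def countably_subadditive_def
    using haus2_empty haus2_mono haus2_countable_subadditive by auto
  have ms: "measure_space UNIV (lambda_system UNIV (Pow UNIV) haus2) haus2" by (rule P.caratheodory_lemma[OF o])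
  then have sa: "sigma_algebra UNIV (lambda_system UNIV (Pow UNIV) haus2)" by (simp add: measure_space_def)
  have cl: "C \<in> lambda_system UNIV (Pow UNIV) haus2" if "closed C" for C
  proof -
    have "haus2 (C \<inter> T) + haus2 ((UNIV - C) \<inter> T) = haus2 T" for T
    proof (rule antisym)
      have e: "C \<inter> T = T \<inter> C" "(UNIV - C) \<inter> T = T - C" by auto
      show "haus2 (C \<inter> T) + haus2 ((UNIV - C) \<inter> T) \<le> haus2 T" unfolding e by (rule haus2_Caratheodory_closed[OF that])
      show "haus2 T \<le> haus2 (C \<inter> T) + haus2 ((UNIV - C) \<inter> T)"
        by (rule order_trans[OF haus2_mono haus2_Un]) auto
    qed
    then show ?thesis by (simp add: lambda_system_def)
  qed
  have "sets borel = sigma_sets UNIV (Collect closed :: (real^3) set set)" by (simp add: borel_eq_closed)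
  also have "\<dots> \<subseteq> lambda_system UNIV (Pow UNIV) haus2"
    by (rule sigma_algebra.sigma_sets_subset[OF sa]) (use cl in auto)
  finally have "sets borel \<subseteq> lambda_system UNIV (Pow UNIV) haus2" .
  then show ?thesis
    using measure_down[OF ms] sets.sigma_algebra_axioms[of borel] by (metis space_borel)
qed

lemma sets_surface_measure [simp, measurable_cong]: "sets surface_measure = sets borel"
  unfolding surface_measure_def using sets.sigma_sets_eq[of "borel :: (real^3) measure"] by (subst sets_measure_of) simp_all

lemma space_surface_measure [simp]: "space surface_measure = UNIV"
  unfolding surface_measure_def by (simp add: space_measure_of_conv)

lemma emeasure_surface_measure: "E \<in> sets borel ==> emeasure surface_measure E = haus2 E"
proof (rule emeasure_measure_of[OF surface_measure_def[folded haus2_def]])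
  show "positive (sets surface_measure) haus2" "countably_additive (sets surface_measure) haus2"
    using measure_space_haus2 by (simp_all add: measure_space_def)
qed auto

lemma hausdorff2_pre_finite_cover:
  assumes "finite I" "\<And>i. i \<in> I ==> bounded (S i) \<and> diameter (S i) \<le> d" "A \<subseteq> (\<Union>i\<in>I. S i)" "0 \<le> d"
  shows "hausdorff2_pre d A \<le> (\<Sum>i\<in>I. qsize (S i))"
proof -
  obtain h where h: "bij_betw h {..<card I} I"
    using ex_bij_betw_nat_finite[OF assms(1)] by (auto simp: atLeast0LessThan)
  define T where "T n = (if n < card I then S (h n) else {})" for n
  have hI: "h n \<in> I" if "n < card I" for n using h that by (auto simp: bij_betw_def)
  have "A \<subseteq> (\<Union>n. T n)"
  proof
    fix x assume "x \<in> A"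
    then obtain i where i: "i \<in> I" "x \<in> S i" using assms(3) by blast
    then obtain n where "n < card I" "h n = i" using h unfolding bij_betw_def by (metis imageE lessThan_iff)
    then have "x \<in> T n" using i by (simp add: T_def)
    then show "x \<in> (\<Union>n. T n)" by blast
  qed
  then have "hausdorff2_pre d A \<le> (\<Sum>n. qsize (T n))"
    by (rule hausdorff2_pre_le[rotated 2]) (use assms(2,4) hI in \<open>auto simp: T_def diameter_empty\<close>)
  also have "\<dots> = (\<Sum>n<card I. qsize (T n))"
    by (rule suminf_finite) (auto simp: T_def diameter_empty)
  also have "\<dots> = (\<Sum>n<card I. qsize (S (h n)))" by (intro sum.cong) (auto simp: T_def)
  also have "\<dots> = (\<Sum>i\<in>I. qsize (S i))" by (rule sum.reindex_bij_betw[OF h])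
  finally show ?thesis .
qed

text \<open>Cells of a square grid of mesh 1 / N in the coordinates \<alpha>, \<beta> have diameter
  at most 2 C / N, and at most (N (2 B + 3))^2 cells occur. The sum of the squared diameters is thus
  bounded independently of N, while N can be taken large enough for any prescribed fineness
  d.\<close>

lemma haus2_chart_finite:
  fixes \<alpha> \<beta> :: "real^3 => real"
  assumes C: "0 \<le> C" and B: "0 \<le> B" "\<And>x. x \<in> A ==> \<bar>\<alpha> x\<bar> \<le> B" "\<And>x. x \<in> A ==> \<bar>\<beta> x\<bar> \<le> B"
    and chart: "\<And>x y. x \<in> A ==> y \<in> A ==> dist x y \<le> C * (\<bar>\<alpha> x - \<alpha> y\<bar> + \<bar>\<beta> x - \<beta> y\<bar>)"
  shows "haus2 A < top"
proof -
  have "hausdorff2_pre d A \<le> ennreal (pi * C\<^sup>2 * (2 * B + 3)\<^sup>2)" if d: "d > 0" for d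
  proof -
    obtain n :: nat where n: "2 * C / d < real n" using reals_Archimedean2 by blast
    define N where "N = real (Suc n)"
    have N: "N \<ge> 1" "2 * C / N \<le> d" using n d by (simp_all add: N_def field_simps)
    define M where "M = \<lceil>N * B\<rceil>"
    have "0 \<le> N * B" using N(1) B(1) by simp
    then have M0: "0 \<le> M" unfolding M_def by linarith
    define I where "I = {-M..M} \<times> {-M..M}"
    define S where "S = (%(k, l). {x \<in> A. \<lfloor>N * \<alpha> x\<rfloor> = k \<and> \<lfloor>N * \<beta> x\<rfloor> = l})"
    have fl: "\<bar>u - v\<bar> \<le> 1 / N" if "\<lfloor>N * u\<rfloor> = \<lfloor>N * v\<rfloor>" for u v
    proof -
      have "\<bar>N * u - N * v\<bar> \<le> 1" using that by linarith
      then have "N * \<bar>u - v\<bar> \<le> 1" using N(1) by (simp add: abs_mult flip: right_diff_distrib)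
      then show ?thesis using N(1) by (simp add: field_simps)
    qed
    have dS: "dist x y \<le> 2 * C / N" if "x \<in> S i" "y \<in> S i" for x y i
    proof -
      have "dist x y \<le> C * (\<bar>\<alpha> x - \<alpha> y\<bar> + \<bar>\<beta> x - \<beta> y\<bar>)"
        using that by (intro chart) (auto simp: S_def split: prod.splits)
      also have "\<dots> \<le> C * (1 / N + 1 / N)"
        using that by (intro mult_left_mono add_mono fl C) (auto simp: S_def split: prod.splits)
      finally show ?thesis by (simp add: mult.commute)
    qed
    have CN: "0 \<le> 2 * C / N" using C N(1) by simp
    have diam: "diameter (S i) \<le> 2 * C / N" for i
      by (rule diameter_le) (use CN dS in \<open>auto simp: dist_norm\<close>)
    have bd: "bounded (S i)" for i unfolding bounded_two_points using dS by blast
    have mem: "\<lfloor>N * u\<rfloor> \<in> {-M..M}" if "\<bar>u\<bar> \<le> B" for u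
    proof -
      have "\<bar>N * u\<bar> \<le> N * B" using that N(1) by (simp add: abs_mult mult_left_mono)
      moreover have "N * B \<le> of_int M" by (simp add: M_def)
      ultimately have "- of_int M \<le> N * u" "N * u \<le> of_int M" by linarith+
      then show ?thesis by (auto simp: le_floor_iff floor_le_iff)
    qed
    have cov: "A \<subseteq> (\<Union>i\<in>I. S i)"
    proof
      fix x assume x: "x \<in> A"
      have "(\<lfloor>N * \<alpha> x\<rfloor>, \<lfloor>N * \<beta> x\<rfloor>) \<in> I" using mem[OF B(2)[OF x]] mem[OF B(3)[OF x]] by (simp add: I_def)
      moreover have "x \<in> S (\<lfloor>N * \<alpha> x\<rfloor>, \<lfloor>N * \<beta> x\<rfloor>)" using x by (simp add: S_def)
      ultimately show "x \<in> (\<Union>i\<in>I. S i)" by blast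
    qed
    have "hausdorff2_pre d A \<le> (\<Sum>i\<in>I. qsize (S i))"
      by (rule hausdorff2_pre_finite_cover[OF _ _ cov]) (use d bd order_trans[OF diam N(2)] in \<open>auto simp: I_def\<close>)
    also have "\<dots> \<le> (\<Sum>i\<in>I. ennreal (pi / 4 * (2 * C / N)\<^sup>2))"
      using diam diameter_ge_0[OF bd] by (intro sum_mono ennreal_leI mult_left_mono power_mono) auto
    also have "\<dots> = ennreal (real (card I) * (pi / 4 * (2 * C / N)\<^sup>2))"
      by (subst ennreal_mult'') (auto simp: ennreal_of_nat_eq_real_of_nat)
    also have "\<dots> \<le> ennreal (pi * C\<^sup>2 * (2 * B + 3)\<^sup>2)"
    proof (rule ennreal_leI)
      have "real_of_int M \<le> N * B + 1" unfolding M_def by linarith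
      then have "real_of_int (2 * M + 1) \<le> N * (2 * B + 3)" using N(1) by (simp add: algebra_simps)
      then have "(real_of_int (2 * M + 1))\<^sup>2 \<le> (N * (2 * B + 3))\<^sup>2" using M0 by (intro power_mono) auto
      moreover have "real (card I) = (real_of_int (2 * M + 1))\<^sup>2" using M0 by (simp add: I_def card_cartesian_product power2_eq_square)
      ultimately have "real (card I) * (pi / 4 * (2 * C / N)\<^sup>2) \<le> (N * (2 * B + 3))\<^sup>2 * (pi / 4 * (2 * C / N)\<^sup>2)"
        by (intro mult_right_mono) auto
      also have "\<dots> = pi * C\<^sup>2 * (2 * B + 3)\<^sup>2" using N(1) by (simp add: power_mult_distrib power_divide)
      finally show "real (card I) * (pi / 4 * (2 * C / N)\<^sup>2) \<le> pi * C\<^sup>2 * (2 * B + 3)\<^sup>2" .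
    qed
    finally show ?thesis .
  qed
  then have "haus2 A \<le> ennreal (pi * C\<^sup>2 * (2 * B + 3)\<^sup>2)" unfolding haus2_def by (intro SUP_least) auto
  then show ?thesis using ennreal_less_top le_less_trans by blast
qed

text \<open>Some component of the unit vector e is at least 1/2 in absolute value, since three
  squares below 1/4 do not add up to 1. Orthogonality then bounds the same component of w by twice
  the sum of the other two, and with these it makes the constant 3.\<close>

lemma orthogonal_complement_coordinates:
  fixes e :: "real^3" assumes "norm e = 1"
  shows "\<exists>i j. \<forall>w. w \<bullet> e = 0 --> norm w \<le> 3 * (\<bar>w $ i\<bar> + \<bar>w $ j\<bar>)"
proof -
  have n: "e $ 1 * e $ 1 + e $ 2 * e $ 2 + e $ 3 * e $ 3 = 1"
    using assms by (simp add: norm_eq_1 inner_vec_def sum_3)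
  have c1: "\<bar>e $ i\<bar> \<le> 1" for i using component_le_norm_cart[of e i] assms by simp
  have inn: "w \<bullet> e = w $ 1 * e $ 1 + w $ 2 * e $ 2 + w $ 3 * e $ 3" for w by (simp add: inner_vec_def sum_3)
  have nw: "norm w \<le> \<bar>w $ 1\<bar> + \<bar>w $ 2\<bar> + \<bar>w $ 3\<bar>" for w :: "real^3" using norm_le_l1_cart[of w] by (simp add: sum_3)
  have key: "\<bar>a\<bar> \<le> 2 * (\<bar>b\<bar> + \<bar>c\<bar>)" if "1/2 \<le> \<bar>x\<bar>" "a * x + b * y + c * z = 0" "\<bar>y\<bar> \<le> 1" "\<bar>z\<bar> \<le> 1" for a b c x y z :: real
  proof -
    have "\<bar>a\<bar> * (1/2) \<le> \<bar>a\<bar> * \<bar>x\<bar>" using that(1) by (intro mult_left_mono) auto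
    also have "\<dots> = \<bar>b * y + c * z\<bar>" using that(2) by (simp add: abs_mult[symmetric])
    also have "\<dots> \<le> \<bar>b\<bar> * \<bar>y\<bar> + \<bar>c\<bar> * \<bar>z\<bar>" by (rule order_trans[OF abs_triangle_ineq]) (simp add: abs_mult)
    also have "\<dots> \<le> \<bar>b\<bar> * 1 + \<bar>c\<bar> * 1" using that by (intro add_mono mult_left_mono) auto
    finally show ?thesis by simp
  qed
  have sq: "x * x < 1/4" if "\<bar>x\<bar> < 1/2" for x :: real
    using mult_strict_mono'[OF that that] by (simp add: abs_mult[symmetric])
  consider "1/2 \<le> \<bar>e $ 1\<bar>" | "1/2 \<le> \<bar>e $ 2\<bar>" | "1/2 \<le> \<bar>e $ 3\<bar>"
    using n sq[of "e $ 1"] sq[of "e $ 2"] sq[of "e $ 3"] by linarith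
  then show ?thesis
  proof cases
    case 1
    have "norm w \<le> 3 * (\<bar>w $ 2\<bar> + \<bar>w $ 3\<bar>)" if "w \<bullet> e = 0" for w
      using key[OF 1, of "w $ 1" "w $ 2" "e $ 2" "w $ 3" "e $ 3"] c1 that nw[of w] by (simp add: inn)
    then show ?thesis by blast
  next
    case 2
    have "norm w \<le> 3 * (\<bar>w $ 1\<bar> + \<bar>w $ 3\<bar>)" if "w \<bullet> e = 0" for w
      using key[OF 2, of "w $ 2" "w $ 1" "e $ 1" "w $ 3" "e $ 3"] c1 that nw[of w] by (simp add: inn algebra_simps)
    then show ?thesis by blast
  next
    case 3
    have "norm w \<le> 3 * (\<bar>w $ 1\<bar> + \<bar>w $ 2\<bar>)" if "w \<bullet> e = 0" for w
      using key[OF 3, of "w $ 3" "w $ 1" "e $ 1" "w $ 2" "e $ 2"] c1 that nw[of w] by (simp add: inn algebra_simps)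
    then show ?thesis by blast
  qed
qed

text \<open>Near each of its points the frontier lies on a Lipschitz graph over the plane orthogonal
  to e, and two components of the projection to that plane serve as coordinates. Compactness leaves
  finitely many such pieces.\<close>

lemma frontier_haus2_finite:
  assumes \<Omega>: "lipschitz_domain \<Omega>" shows "haus2 (frontier \<Omega>) < top"
proof -
  have op: "open \<Omega>" and bd: "bounded \<Omega>" using \<Omega> by (auto simp: lipschitz_domain_def)
  have "\<exists>r>0. haus2 (frontier \<Omega> \<inter> ball p r) < top" if p: "p \<in> frontier \<Omega>" for p
  proof -
    obtain U e L g where U: "open U" "p \<in> U" and e: "norm e = 1" and lip: "L-lipschitz_on {y. y \<bullet> e = 0} g"
      and g: "\<And>x. x \<in> U ==> x \<in> \<Omega> \<longleftrightarrow> x \<bullet> e < g (x - (x \<bullet> e) *\<^sub>R e)"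
      using \<Omega> p unfolding lipschitz_domain_def by blast
    have ee: "e \<bullet> e = 1" using e by (simp add: norm_eq_1)
    have L: "L \<ge> 0" using lip by (rule lipschitz_on_nonneg)
    obtain r where r: "r > 0" "ball p r \<subseteq> U" using U open_contains_ball by blast
    obtain i j where ij: "\<And>w. w \<bullet> e = 0 ==> norm w \<le> 3 * (\<bar>w $ i\<bar> + \<bar>w $ j\<bar>)"
      using orthogonal_complement_coordinates[OF e] by blast
    let ?P = "%x. x - (x \<bullet> e) *\<^sub>R e"
    let ?A = "frontier \<Omega> \<inter> ball p r"
    have gr: "x \<bullet> e = g (?P x)" if "x \<in> ?A" for x
    proof (rule antisym)
      have xU: "x \<in> U" using that r by blast
      show "x \<bullet> e \<le> g (?P x)"
        using lipschitz_closure_below[OF U(1) lip e g _ xU] that by (auto simp: frontier_def)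
      have "x \<notin> \<Omega>" using that op by (auto simp: frontier_def interior_open)
      then show "g (?P x) \<le> x \<bullet> e" using g[OF xU] by simp
    qed
    have Pe: "?P x \<bullet> e = 0" for x by (simp add: inner_diff_left ee)
    have "haus2 ?A < top"
    proof (rule haus2_chart_finite[where \<alpha>="%x. ?P x $ i" and \<beta>="%x. ?P x $ j" and C="3 * (1 + L)" and B="norm p + r"])
      fix x assume "x \<in> ?A"
      then have "norm x \<le> norm p + r" using norm_triangle_ineq2[of x p] by (auto simp: dist_norm norm_minus_commute)
      then have P: "norm (?P x) \<le> norm p + r" using norm_orthogonal_le[OF e, of x] by linarith
      show "\<bar>?P x $ i\<bar> \<le> norm p + r" by (rule order_trans[OF component_le_norm_cart P])
      show "\<bar>?P x $ j\<bar> \<le> norm p + r" by (rule order_trans[OF component_le_norm_cart P])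
    next
      fix x y assume xy: "x \<in> ?A" "y \<in> ?A"
      have 1: "\<bar>x \<bullet> e - y \<bullet> e\<bar> \<le> L * norm (?P x - ?P y)"
        using lipschitz_onD[OF lip, of "?P x" "?P y"] Pe gr[OF xy(1)] gr[OF xy(2)] by (simp add: dist_norm)
      have "x - y = (?P x - ?P y) + (x \<bullet> e - y \<bullet> e) *\<^sub>R e" by (simp add: scaleR_diff_left)
      then have "norm (x - y) = norm ((?P x - ?P y) + (x \<bullet> e - y \<bullet> e) *\<^sub>R e)" by (rule arg_cong[where f=norm])
      also have "\<dots> \<le> norm (?P x - ?P y) + norm ((x \<bullet> e - y \<bullet> e) *\<^sub>R e)" by (rule norm_triangle_ineq)
      also have "norm ((x \<bullet> e - y \<bullet> e) *\<^sub>R e) = \<bar>x \<bullet> e - y \<bullet> e\<bar>" using e by simp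
      also have "norm (?P x - ?P y) + \<bar>x \<bullet> e - y \<bullet> e\<bar> \<le> (1 + L) * norm (?P x - ?P y)"
        unfolding distrib_right mult_1_left by (rule add_left_mono[OF 1])
      also have "\<dots> \<le> (1 + L) * (3 * (\<bar>(?P x - ?P y) $ i\<bar> + \<bar>(?P x - ?P y) $ j\<bar>))"
      proof (rule mult_left_mono)
        have "(?P x - ?P y) \<bullet> e = 0" using Pe[of x] Pe[of y] by (simp only: inner_diff_left)
        then show "norm (?P x - ?P y) \<le> 3 * (\<bar>(?P x - ?P y) $ i\<bar> + \<bar>(?P x - ?P y) $ j\<bar>)" by (rule ij)
      qed (use L in simp)
      finally show "dist x y \<le> 3 * (1 + L) * (\<bar>?P x $ i - ?P y $ i\<bar> + \<bar>?P x $ j - ?P y $ j\<bar>)"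
        by (simp only: dist_norm vector_minus_component mult_ac)
    qed (use L r in auto)
    then show ?thesis using r(1) by blast
  qed
  then obtain r where r: "\<And>p. p \<in> frontier \<Omega> ==> r p > 0 \<and> haus2 (frontier \<Omega> \<inter> ball p (r p)) < top" by metis
  obtain D where D: "D \<subseteq> frontier \<Omega>" "finite D" "frontier \<Omega> \<subseteq> (\<Union>p\<in>D. ball p (r p))"
    by (rule compactE_image[of "frontier \<Omega>" "frontier \<Omega>" "%p. ball p (r p)"])
      (use bd r in \<open>auto simp: compact_frontier_bounded\<close>)
  have "haus2 (\<Union>p\<in>D'. frontier \<Omega> \<inter> ball p (r p)) < top" if "finite D'" "D' \<subseteq> D" for D'
    using that
  proof (induction D')
    case empty then show ?case by (simp add: haus2_empty)
  next
    case (insert p D')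
    have "haus2 (\<Union>p\<in>insert p D'. frontier \<Omega> \<inter> ball p (r p)) \<le> haus2 (frontier \<Omega> \<inter> ball p (r p)) + haus2 (\<Union>p\<in>D'. frontier \<Omega> \<inter> ball p (r p))"
      using haus2_Un by simp
    also have "\<dots> < top" using insert r D(1) by (auto simp: ennreal_add_less_top)
    finally show ?case .
  qed
  from this[OF D(2)] have "haus2 (\<Union>p\<in>D. frontier \<Omega> \<inter> ball p (r p)) < top" by simp
  moreover have "frontier \<Omega> \<subseteq> (\<Union>p\<in>D. frontier \<Omega> \<inter> ball p (r p))" using D(3) by blast
  ultimately show ?thesis using haus2_mono le_less_trans by blast
qed

lemma emeasure_lborel_cball3: "0 \<le> r ==> emeasure lborel (cball (p::real^3) r) = ennreal (unit_ball_vol 3 * r ^ 3)"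
  by (subst emeasure_cball) auto

text \<open>A set of diameter q \<le> d lies in a ball of volume proportional to q^3 \<le> d q^2, so
  the volume of K is at most a multiple of d times its finite two-dimensional measure, for every
  d.\<close>

lemma haus2_finite_null:
  assumes K: "closed K" and fin: "haus2 K < top" shows "K \<in> null_sets lborel"
proof -
  define c where "c = unit_ball_vol (3::real)"
  have c: "c \<ge> 0" by (simp add: c_def)
  have small: "emeasure lborel K \<le> ennreal (c * d * 4 / pi) * (haus2 K + 1)" if d: "d > 0" for d
  proof -
    have "hausdorff2_pre d K < haus2 K + 1"
    proof (rule le_less_trans[OF hausdorff2_pre_le_haus2[OF d, of K]])
      have "haus2 K + 0 < haus2 K + 1" using fin unfolding ennreal_add_left_cancel_less by (simp add: less_top[symmetric])
      then show "haus2 K < haus2 K + 1" by simp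
    qed
    then obtain S where S: "\<And>n. bounded (S n)" "\<And>n. diameter (S n) \<le> d" "K \<subseteq> (\<Union>n. S n)" "(\<Sum>n. qsize (S n)) < haus2 K + 1"
      using hausdorff2_pre_approx by metis
    define p where "p n = (SOME x. x \<in> S n)" for n
    have sub: "S n \<subseteq> cball (p n) (diameter (S n))" for n
    proof
      fix x assume x: "x \<in> S n"
      then have "p n \<in> S n" unfolding p_def by (rule someI)
      then show "x \<in> cball (p n) (diameter (S n))" using diameter_bounded_bound[OF S(1) _ x] by simp
    qed
    have "K \<subseteq> (\<Union>n. cball (p n) (diameter (S n)))"
      by (rule order_trans[OF S(3)]) (rule UN_mono[OF subset_refl sub])
    then have "emeasure lborel K \<le> emeasure lborel (\<Union>n. cball (p n) (diameter (S n)))"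
      by (rule emeasure_mono) auto
    also have "\<dots> \<le> (\<Sum>n. emeasure lborel (cball (p n) (diameter (S n))))"
      by (rule emeasure_subadditive_countably) auto
    also have "\<dots> \<le> (\<Sum>n. ennreal (c * d * 4 / pi) * qsize (S n))"
    proof (intro suminf_le summableI)
      fix n
      have d0: "0 \<le> diameter (S n)" by (rule diameter_ge_0[OF S(1)])
      have "c * diameter (S n) ^ 3 = (c * (diameter (S n))\<^sup>2) * diameter (S n)" by (simp add: power2_eq_square power3_eq_cube)
      also have "\<dots> \<le> (c * (diameter (S n))\<^sup>2) * d" using c by (intro mult_left_mono S) auto
      also have "\<dots> = (c * d * 4 / pi) * (pi / 4 * (diameter (S n))\<^sup>2)" by simp
      finally show "emeasure lborel (cball (p n) (diameter (S n))) \<le> ennreal (c * d * 4 / pi) * qsize (S n)"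
        using d0 c d by (simp add: emeasure_lborel_cball3 c_def[symmetric] ennreal_mult'[symmetric] ennreal_leI)
    qed
    also have "\<dots> = ennreal (c * d * 4 / pi) * (\<Sum>n. qsize (S n))" by (rule ennreal_suminf_cmult)
    also have "\<dots> \<le> ennreal (c * d * 4 / pi) * (haus2 K + 1)" by (rule mult_left_mono[OF less_imp_le[OF S(4)]]) simp
    finally show ?thesis .
  qed
  have le: "emeasure lborel K \<le> ennreal (c * (1 / (real n + 1)) * 4 / pi) * (haus2 K + 1)" for n by (rule small) simp
  obtain h where h: "h \<ge> 0" "haus2 K + 1 = ennreal h" using fin
    by (metis ennreal_cases ennreal_add_eq_top ennreal_one_neq_top less_irrefl)
  have "(%n. ennreal (c * (1 / (real n + 1)) * 4 / pi * h)) \<longlonglongrightarrow> ennreal 0"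
    by (rule tendsto_ennrealI) real_asymp
  moreover have "emeasure lborel K \<le> ennreal (c * (1 / (real n + 1)) * 4 / pi * h)" for n
    unfolding ennreal_mult''[OF h(1)] h(2)[symmetric] by (rule le)
  ultimately have "emeasure lborel K \<le> 0" using LIMSEQ_le_const by fastforce
  then show ?thesis using K by (auto simp: null_sets_def)
qed

text \<open>Covering sets are replaced by balls about points of E. The increments t n, whose squares
  sum to at most \<eta>/2, keep the radii positive even for sets of diameter 0. Squaring a sum of
  two terms costs a factor 2, and 2 \<le> 3 pi / 4 converts it into the factor 3 in front of
  h.\<close>

lemma haus2_ball_cover:
  assumes h: "haus2 E = ennreal h" "0 \<le> h" and \<eta>: "\<eta> > 0" and d: "d > 0"
  shows "\<exists>(N::nat set) p r. (\<forall>n\<in>N. p n \<in> E \<and> 0 < r n \<and> r n \<le> d) \<and> E \<subseteq> (\<Union>n\<in>N. ball (p n) (r n)) \<and>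
    (\<forall>F. finite F --> F \<subseteq> N --> (\<Sum>n\<in>F. (r n)\<^sup>2) \<le> 3 * h + 2 * \<eta>)"
proof -
  have "hausdorff2_pre (d/2) E < ennreal (h + \<eta> / 3)"
    using hausdorff2_pre_le_haus2[of "d/2" E] d h \<eta> by (simp add: le_less_trans ennreal_lessI)
  then obtain S where S: "\<And>n. bounded (S n)" "\<And>n. diameter (S n) \<le> d/2" "E \<subseteq> (\<Union>n. S n)"
    "(\<Sum>n. qsize (S n)) < ennreal (h + \<eta> / 3)" using hausdorff2_pre_approx by metis
  define N where "N = {n. S n \<inter> E \<noteq> {}}"
  have "\<forall>n. \<exists>x. n \<in> N --> x \<in> S n \<inter> E" by (auto simp: N_def)
  from choice[OF this] obtain p where p: "\<And>n. n \<in> N ==> p n \<in> S n \<inter> E" by blast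
  define t where "t n = min (d/2) (sqrt (\<eta> / 4 * (1/2)^n))" for n
  have t: "0 < t n" "t n \<le> d/2" "(t n)\<^sup>2 \<le> \<eta> / 4 * (1/2)^n" for n
  proof -
    show t0: "0 < t n" "t n \<le> d/2" using d \<eta> by (auto simp: t_def)
    have "(t n)\<^sup>2 \<le> (sqrt (\<eta> / 4 * (1/2)^n))\<^sup>2" using t0 by (intro power_mono) (auto simp: t_def)
    then show "(t n)\<^sup>2 \<le> \<eta> / 4 * (1/2)^n" using \<eta> by simp
  qed
  define r where "r n = diameter (S n) + t n" for n
  have d0: "0 \<le> diameter (S n)" for n by (rule diameter_ge_0[OF S(1)])
  have c1: "E \<subseteq> (\<Union>n\<in>N. ball (p n) (r n))"
  proof
    fix x assume x: "x \<in> E"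
    then obtain n where n: "x \<in> S n" using S(3) by blast
    then have nN: "n \<in> N" using x by (auto simp: N_def)
    have "dist (p n) x \<le> diameter (S n)" using diameter_bounded_bound[OF S(1) _ n] p[OF nN] by blast
    then have "x \<in> ball (p n) (r n)" using t(1)[of n] by (simp add: r_def)
    then show "x \<in> (\<Union>n\<in>N. ball (p n) (r n))" using nN by blast
  qed
  have c2: "(\<Sum>n\<in>F. (r n)\<^sup>2) \<le> 3 * h + 2 * \<eta>" if F: "finite F" for F
  proof -
    have "ennreal (\<Sum>n\<in>F. pi / 4 * (diameter (S n))\<^sup>2) = (\<Sum>n\<in>F. qsize (S n))" by (intro sum_ennreal[symmetric]) auto
    also have "\<dots> \<le> (\<Sum>n. qsize (S n))" by (intro sum_le_suminf summableI F) auto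
    also have "\<dots> \<le> ennreal (h + \<eta> / 3)" using S(4) by simp
    finally have 1: "(\<Sum>n\<in>F. pi / 4 * (diameter (S n))\<^sup>2) \<le> h + \<eta> / 3"
      by (subst (asm) ennreal_le_iff) (use h(2) \<eta> in auto)
    have 2: "(\<Sum>n\<in>F. (t n)\<^sup>2) \<le> \<eta> / 2"
    proof -
      have "(\<Sum>n\<in>F. (t n)\<^sup>2) \<le> (\<Sum>n\<in>F. \<eta> / 4 * (1/2)^n)" by (intro sum_mono t)
      also have "\<dots> = \<eta> / 4 * (\<Sum>n\<in>F. (1/2)^n)" by (simp add: sum_distrib_left)
      also have "\<dots> \<le> \<eta> / 4 * (\<Sum>n. (1/2)^n)"
        using \<eta> by (intro mult_left_mono sum_le_suminf F) (auto simp: summable_geometric_iff)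
      also have "(\<Sum>n. (1/2)^n) = (2::real)" using suminf_geometric[of "1/2::real"] by simp
      finally show ?thesis by simp
    qed
    have "(r n)\<^sup>2 \<le> 2 * (diameter (S n))\<^sup>2 + 2 * (t n)\<^sup>2" for n
      using zero_le_power2[of "diameter (S n) - t n"] by (simp add: r_def power2_eq_square algebra_simps)
    then have "(\<Sum>n\<in>F. (r n)\<^sup>2) \<le> (\<Sum>n\<in>F. 2 * (diameter (S n))\<^sup>2 + 2 * (t n)\<^sup>2)" by (intro sum_mono)
    also have "\<dots> = 2 * (\<Sum>n\<in>F. (diameter (S n))\<^sup>2) + 2 * (\<Sum>n\<in>F. (t n)\<^sup>2)" by (simp add: sum.distrib sum_distrib_left)
    also have "2 * (\<Sum>n\<in>F. (diameter (S n))\<^sup>2) \<le> 3 * (\<Sum>n\<in>F. pi / 4 * (diameter (S n))\<^sup>2)"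
    proof -
      have "(\<Sum>n\<in>F. (diameter (S n))\<^sup>2) * 2 \<le> (\<Sum>n\<in>F. (diameter (S n))\<^sup>2) * (3 * (pi / 4))"
        using pi_gt3 by (intro mult_left_mono sum_nonneg) auto
      moreover have "(\<Sum>n\<in>F. pi / 4 * (diameter (S n))\<^sup>2) = pi / 4 * (\<Sum>n\<in>F. (diameter (S n))\<^sup>2)"
        by (rule sum_distrib_left[symmetric])
      ultimately show ?thesis by (simp only: mult_ac)
    qed
    finally show ?thesis using 1 2 by simp
  qed
  have c3: "\<forall>n\<in>N. p n \<in> E \<and> 0 < r n \<and> r n \<le> d"
    using p t d0 S(2) by (auto simp: r_def add_nonneg_pos intro: add_mono[of _ "d/2" _ "d/2", simplified])
  show ?thesis by (rule exI[of _ N], rule exI[of _ p], rule exI[of _ r]) (use c1 c2 c3 in blast)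
qed

subsection \<open>Boundary traces and extension by zero\<close>

definition cutoff_const :: "real => bool"
  where "cutoff_const C \<longleftrightarrow> C > 0 \<and> (\<forall>(p::real^3) r. r > 0 --> (\<exists>\<eta>\<in>test_fun UNIV.
    (\<forall>x. dist p x \<le> r --> \<eta> x = 1) \<and> (\<forall>x. dist p x \<ge> 2 * r --> \<eta> x = 0) \<and>
    (\<forall>x. norm (\<eta> x) \<le> 1 \<and> norm (1 - \<eta> x) \<le> 1) \<and>
    (\<forall>x v. norm (dir_deriv v \<eta> x) \<le> C / r * norm v)))"

lemma cutoff_constD:
  fixes p :: "real^3"
  assumes "cutoff_const C" "r > 0"
  shows "\<exists>\<eta>\<in>test_fun UNIV.
    (\<forall>x. dist p x \<le> r --> \<eta> x = 1) \<and> (\<forall>x. dist p x \<ge> 2 * r --> \<eta> x = 0) \<and>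
    (\<forall>x. norm (\<eta> x) \<le> 1 \<and> norm (1 - \<eta> x) \<le> 1) \<and> (\<forall>x v. norm (dir_deriv v \<eta> x) \<le> C / r * norm v)"
  using conjunct2[OF assms(1)[unfolded cutoff_const_def], rule_format, OF assms(2)] .

text \<open>The product of the factors 1 - \<eta> over all balls. Since every factor is bounded by
  1, both 1 - \<zeta> and the derivative of \<zeta> are bounded by sums over the balls, however much
  these overlap.\<close>

lemma cutoff_product_exists:
  fixes p :: "'j => real^3" and r :: "'j => real"
  assumes C: "cutoff_const C"
    and "finite I" "\<forall>j\<in>I. r j > 0" and v: "norm v = 1"
  shows "\<exists>\<zeta>. smooth \<zeta> \<and> (\<forall>x. cmod (\<zeta> x) \<le> 1) \<and> (\<forall>j\<in>I. \<forall>x. dist (p j) x \<le> r j --> \<zeta> x = 0) \<and>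
    (\<forall>x. cmod (1 - \<zeta> x) \<le> (\<Sum>j\<in>I. indicator (cball (p j) (2 * r j)) x)) \<and>
    (\<forall>x. cmod (dir_deriv v \<zeta> x) \<le> (\<Sum>j\<in>I. C / r j * indicator (cball (p j) (2 * r j)) x))"
  using assms(2,3)
proof (induction I)
  case empty
  show ?case by (rule exI[of _ "%x. 1"]) (simp add: smooth_const frechet_derivative_const)
next
  case (insert j I)
  then obtain \<zeta> where z: "smooth \<zeta>" "\<And>x. cmod (\<zeta> x) \<le> 1" "\<And>i x. i \<in> I ==> dist (p i) x \<le> r i ==> \<zeta> x = 0"
    "\<And>x. cmod (1 - \<zeta> x) \<le> (\<Sum>j\<in>I. indicator (cball (p j) (2 * r j)) x)"
    "\<And>x. cmod (dir_deriv v \<zeta> x) \<le> (\<Sum>j\<in>I. C / r j * indicator (cball (p j) (2 * r j)) x)" by blast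
  have rj: "r j > 0" using insert.prems by blast
  from cutoff_constD[OF C this, of "p j"] obtain \<eta> where e: "\<eta> \<in> test_fun UNIV" "\<forall>x. dist (p j) x \<le> r j --> \<eta> x = 1"
    "\<forall>x. dist (p j) x \<ge> 2 * r j --> \<eta> x = 0" "\<forall>x. norm (\<eta> x) \<le> 1 \<and> norm (1 - \<eta> x) \<le> 1"
    "\<forall>x v. norm (dir_deriv v \<eta> x) \<le> C / r j * norm v" by blast
  let ?i = "%j x. indicator (cball (p j) (2 * r j)) x :: real"
  have eb: "cmod (\<eta> x) \<le> ?i j x" for x using e(3,4) by (auto simp: indicator_def)
  have db: "cmod (dir_deriv v \<eta> x) \<le> C / r j * ?i j x" for x
  proof (cases "dist (p j) x \<le> 2 * r j")
    case True then show ?thesis using e(5) v by (metis indicator_simps(1) mem_cball mult.right_neutral)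
  next
    case False
    have "dir_deriv v \<eta> x = 0" by (rule dir_deriv_outside[of "cball (p j) (2 * r j)"]) (use e(3) False in auto)
    then show ?thesis using False by simp
  qed
  have s: "smooth (%x. 1 - \<eta> x)" by (rule smooth_diff[OF smooth_const test_fun_smooth[OF e(1)]])
  define \<xi> where "\<xi> x = \<zeta> x * (1 - \<eta> x)" for x
  have "smooth \<xi>" unfolding \<xi>_def by (rule smooth_mult[OF z(1) s])
  moreover have "cmod (\<xi> x) \<le> 1" for x
    using mult_mono[OF z(2)[of x], of "norm (1 - \<eta> x)" 1] e(4) by (simp add: \<xi>_def norm_mult)
  moreover have "\<forall>i\<in>insert j I. \<forall>x. dist (p i) x \<le> r i --> \<xi> x = 0"
    using z(3) e(2) by (auto simp: \<xi>_def)
  moreover have "cmod (1 - \<xi> x) \<le> (\<Sum>j\<in>insert j I. ?i j x)" for x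
  proof -
    have eq: "1 - \<xi> x = (1 - \<zeta> x) + \<zeta> x * \<eta> x" by (simp add: \<xi>_def algebra_simps)
    have "cmod (1 - \<xi> x) \<le> cmod (1 - \<zeta> x) + cmod (\<zeta> x) * cmod (\<eta> x)"
      unfolding eq norm_mult[symmetric] by (rule norm_triangle_ineq)
    also have "\<dots> \<le> (\<Sum>j\<in>I. ?i j x) + 1 * ?i j x" by (intro add_mono z mult_mono eb) auto
    finally show ?thesis using insert.hyps by simp
  qed
  moreover have "cmod (dir_deriv v \<xi> x) \<le> (\<Sum>j\<in>insert j I. C / r j * ?i j x)" for x
  proof -
    have "dir_deriv v (%x. 1 - \<eta> x) x = - dir_deriv v \<eta> x"
      using dir_deriv_diff[OF smooth_const[of 1] test_fun_smooth[OF e(1)], where v=v and x=x] by (simp add: frechet_derivative_const)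
    then have eq: "dir_deriv v \<xi> x = \<zeta> x * (- dir_deriv v \<eta> x) + dir_deriv v \<zeta> x * (1 - \<eta> x)"
      unfolding \<xi>_def using dir_deriv_mult[OF z(1) s, where v=v and x=x] by simp
    have "cmod (dir_deriv v \<xi> x) \<le> cmod (\<zeta> x) * cmod (dir_deriv v \<eta> x) + cmod (dir_deriv v \<zeta> x) * cmod (1 - \<eta> x)"
      unfolding eq by (rule order_trans[OF norm_triangle_ineq]) (simp add: norm_mult)
    also have "\<dots> \<le> 1 * (C / r j * ?i j x) + (\<Sum>j\<in>I. C / r j * ?i j x) * 1"
      using e(4) order_trans[OF norm_ge_zero z(5)[of x]] by (intro add_mono mult_mono z db) simp_all
    finally show ?thesis using insert.hyps by simp
  qed
  ultimately show ?case by blast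
qed

text \<open>With \<zeta> vanishing near the frontier, \<zeta> g restricted to \<Omega> and continued
  by 0 is a test function, and its derivative has integral 0. What remains is the error made by
  inserting \<zeta>, which lives on the doubled balls; doubling the radius gives the factor 8 in
  their volume.\<close>

lemma capacity_estimate:
  fixes p :: "'j => real^3" and r a :: "'j => real"
  assumes \<Omega>: "open \<Omega>" "bounded \<Omega>" and g: "g \<in> test_fun UNIV" and v: "norm v = 1"
    and C: "cutoff_const C"
    and I: "finite I" "\<forall>j\<in>I. r j > 0" and cov: "frontier \<Omega> \<subseteq> (\<Union>j\<in>I. ball (p j) (r j))"
    and a: "\<And>j x. j \<in> I ==> dist (p j) x \<le> 2 * r j ==> cmod (g x) \<le> a j"
    and G: "\<And>x. cmod (dir_deriv v g x) \<le> G"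
  shows "cmod (LINT x|lebesgue. indicator \<Omega> x * dir_deriv v g x)
    \<le> (\<Sum>j\<in>I. (G + C / r j * a j) * (8 * unit_ball_vol 3 * r j ^ 3))"
proof -
  obtain \<zeta> where z: "smooth \<zeta>" "\<And>x. cmod (\<zeta> x) \<le> 1" "\<And>i x. i \<in> I ==> dist (p i) x \<le> r i ==> \<zeta> x = 0"
    "\<And>x. cmod (1 - \<zeta> x) \<le> (\<Sum>j\<in>I. indicator (cball (p j) (2 * r j)) x)"
    "\<And>x. cmod (dir_deriv v \<zeta> x) \<le> (\<Sum>j\<in>I. C / r j * indicator (cball (p j) (2 * r j)) x)"
    using cutoff_product_exists[OF C I v, where p=p] by blast
  have C0: "C > 0" using C by (simp add: cutoff_const_def)
  let ?i = "%j x. indicator (cball (p j) (2 * r j)) x :: real"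
  define Z where "Z x = \<zeta> x * g x" for x
  have sZ: "smooth Z" unfolding Z_def by (rule smooth_mult[OF z(1) test_fun_smooth[OF g]])
  have dZ: "dir_deriv v Z x = \<zeta> x * dir_deriv v g x + dir_deriv v \<zeta> x * g x" for x
    unfolding Z_def by (rule dir_deriv_mult[OF z(1) test_fun_smooth[OF g]])
  define Z1 where "Z1 x = (if x \<in> \<Omega> then Z x else 0)" for x
  \<comment> \<open>A frontier point lies in one of the balls, on which \<zeta> vanishes. Locally
    the truncated function is therefore either Z or 0, which carries smoothness across the
    frontier.\<close>
  have loc: "\<exists>N. open N \<and> x \<in> N \<and> ((x \<in> \<Omega> \<and> (\<forall>y\<in>N. Z1 y = Z y)) \<or> (x \<notin> \<Omega> \<and> (\<forall>y\<in>N. Z1 y = 0)))" for x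
  proof -
    consider "x \<in> \<Omega>" | "x \<notin> closure \<Omega>" | "x \<in> frontier \<Omega>" "x \<notin> \<Omega>"
      using \<Omega>(1) by (auto simp: frontier_def interior_open)
    then show ?thesis
    proof cases
      case 1 then show ?thesis using \<Omega>(1) by (intro exI[of _ \<Omega>]) (auto simp: Z1_def)
    next
      case 2 then show ?thesis using closure_subset[of \<Omega>] by (intro exI[of _ "- closure \<Omega>"]) (auto simp: Z1_def)
    next
      case 3
      then obtain j where "j \<in> I" "x \<in> ball (p j) (r j)" using cov by blast
      then show ?thesis using 3 z(3)[of j] by (intro exI[of _ "ball (p j) (r j)"]) (auto simp: Z1_def Z_def)
    qed
  qed
  have "smooth Z1"
  proof (rule smooth_local)
    fix x show "\<exists>N g. open N \<and> x \<in> N \<and> smooth g \<and> (\<forall>y\<in>N. Z1 y = g y)"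
      using loc[of x] sZ smooth_const[of 0] by metis
  qed
  then have t: "Z1 \<in> test_fun UNIV"
    by (rule test_funI[of _ "closure \<Omega>"]) (use \<Omega>(2) closure_subset[of \<Omega>] in \<open>auto simp: Z1_def\<close>)
  have dZ1: "dir_deriv v Z1 x = indicator \<Omega> x * dir_deriv v Z x" for x
  proof -
    obtain N where N: "open N" "x \<in> N" "(x \<in> \<Omega> \<and> (\<forall>y\<in>N. Z1 y = Z y)) \<or> (x \<notin> \<Omega> \<and> (\<forall>y\<in>N. Z1 y = 0))" using loc by blast
    from N(3) show ?thesis
    proof
      assume *: "x \<in> \<Omega> \<and> (\<forall>y\<in>N. Z1 y = Z y)"
      have "dir_deriv v Z1 x = dir_deriv v Z x" by (rule dir_deriv_transform_open[OF N(1,2) sZ]) (use * in blast)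
      then show ?thesis using * by simp
    next
      assume *: "x \<notin> \<Omega> \<and> (\<forall>y\<in>N. Z1 y = 0)"
      have "dir_deriv v Z1 x = 0" by (rule frechet_derivative_zero_open[OF N(1,2)]) (use * in blast)
      then show ?thesis using * by simp
    qed
  qed
  let ?w = "%x. indicator \<Omega> x * ((1 - \<zeta> x) * dir_deriv v g x - dir_deriv v \<zeta> x * g x)"
  have int1: "integrable lebesgue (dir_deriv v Z1)"
    by (rule integrable_compact_support[OF smooth_continuous[OF test_fun_smooth[OF test_fun_dir_deriv[OF t]]], of "closure \<Omega>"])
      (use \<Omega>(2) closure_subset[of \<Omega>] in \<open>auto simp: dZ1 indicator_def\<close>)
  have \<Omega>m: "\<Omega> \<in> sets lebesgue" using \<Omega>(1) by simp
  have int2: "integrable lebesgue (%x. indicator \<Omega> x * dir_deriv v g x)"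
    by (rule is_L2_mult_integrable[OF is_L2_indicator[OF \<Omega>(2) \<Omega>m] is_L2_test_fun[OF test_fun_dir_deriv[OF g]]])
  have weq: "?w x = indicator \<Omega> x * dir_deriv v g x - dir_deriv v Z1 x" for x
    unfolding dZ1 dZ by (simp add: algebra_simps)
  have ieq: "(LINT x|lebesgue. indicator \<Omega> x * dir_deriv v g x) = (LINT x|lebesgue. ?w x)"
    unfolding weq using int1 int2 integral_dir_deriv_test_fun[OF t] by simp
  have iw: "integrable lebesgue ?w" unfolding weq using int1 int2 by simp
  have wb: "cmod (?w x) \<le> (\<Sum>j\<in>I. (G + C / r j * a j) * ?i j x)" for x
  proof -
    have "cmod (?w x) \<le> cmod ((1 - \<zeta> x) * dir_deriv v g x - dir_deriv v \<zeta> x * g x)"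
      by (auto simp: indicator_def)
    also have "\<dots> \<le> cmod (1 - \<zeta> x) * cmod (dir_deriv v g x) + cmod (dir_deriv v \<zeta> x) * cmod (g x)"
      by (rule order_trans[OF norm_triangle_ineq4]) (simp add: norm_mult)
    also have "\<dots> \<le> (\<Sum>j\<in>I. ?i j x) * G + (\<Sum>j\<in>I. C / r j * ?i j x) * cmod (g x)"
      using G[of x] order_trans[OF norm_ge_zero z(5)[of x]] order_trans[OF norm_ge_zero z(4)[of x]]
      by (intro add_mono mult_mono z order_refl) simp_all
    also have "\<dots> = (\<Sum>j\<in>I. ?i j x * G + C / r j * ?i j x * cmod (g x))"
      by (simp add: sum_distrib_right sum.distrib)
    also have "\<dots> \<le> (\<Sum>j\<in>I. (G + C / r j * a j) * ?i j x)"
    proof (rule sum_mono)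
      fix j assume j: "j \<in> I"
      show "?i j x * G + C / r j * ?i j x * cmod (g x) \<le> (G + C / r j * a j) * ?i j x"
      proof (cases "dist (p j) x \<le> 2 * r j")
        case True
        have "C / r j * cmod (g x) \<le> C / r j * a j" using a[OF j True] C0 I(2) j by (intro mult_left_mono) auto
        then show ?thesis using True by simp
      qed simp
    qed
    finally show ?thesis .
  qed
  have ib: "integrable lebesgue (%x. ?i j x)" for j
    using lmeasurable_cball[of "p j" "2 * r j"] unfolding lmeasurable_iff_integrable by simp
  have "cmod (LINT x|lebesgue. ?w x) \<le> (LINT x|lebesgue. (\<Sum>j\<in>I. (G + C / r j * a j) * ?i j x))"
    by (rule order_trans[OF integral_norm_bound], rule integral_mono)
      (use iw wb ib in \<open>auto intro!: Bochner_Integration.integrable_sum integrable_mult_right\<close>)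
  also have "\<dots> = (\<Sum>j\<in>I. (G + C / r j * a j) * measure lebesgue (cball (p j) (2 * r j)))"
    using ib by (simp add: Bochner_Integration.integral_sum)
  also have "\<dots> = (\<Sum>j\<in>I. (G + C / r j * a j) * (8 * unit_ball_vol 3 * r j ^ 3))"
  proof (rule sum.cong[OF refl])
    fix j assume "j \<in> I"
    then have "0 \<le> 2 * r j" using I(2) by auto
    then have "measure lebesgue (cball (p j) (2 * r j)) = 8 * unit_ball_vol 3 * r j ^ 3"
      by (simp add: measure_def emeasure_lborel_cball3 power_mult_distrib)
    then show "(G + C / r j * a j) * measure lebesgue (cball (p j) (2 * r j)) = (G + C / r j * a j) * (8 * unit_ball_vol 3 * r j ^ 3)" by simp
  qed
  finally show ?thesis unfolding ieq .
qed

lemma le_of_le_add_mult_eps: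
  fixes X A B :: real
  assumes "\<And>e. 0 < e ==> e \<le> 1 ==> X \<le> A + B * e" shows "X \<le> A"
proof -
  have "(%n. A + B * (1 / (real n + 1))) \<longlonglongrightarrow> A" by real_asymp
  moreover have "X \<le> A + B * (1 / (real n + 1))" for n by (rule assms) auto
  ultimately show ?thesis using LIMSEQ_le_const by blast
qed

text \<open>
  The divergence theorem as an inequality; for it to hold up to a constant it suffices that the
  boundary has finite Hausdorff measure, since a neighbourhood of the boundary can be cut off
  along a covering by small balls of almost minimal total size.
\<close>

lemma boundary_integral_bound:
  assumes \<Omega>: "open \<Omega>" "bounded \<Omega>" and fin: "haus2 (frontier \<Omega>) < top"
  shows "\<exists>C>0. \<forall>g\<in>test_fun UNIV. \<forall>v J. norm v = 1 --> 0 \<le> J -->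
    (\<integral>\<^sup>+x\<in>frontier \<Omega>. ennreal (cmod (g x)) \<partial>surface_measure) \<le> ennreal J -->
    cmod (LINT x|lebesgue. indicator \<Omega> x * dir_deriv v g x) \<le> C * J"
proof -
  define K where "K = frontier \<Omega>"
  have K: "closed K" "compact K" using \<Omega>(2) by (auto simp: K_def compact_frontier_bounded)
  then have Kb: "K \<in> sets borel" by auto
  obtain C where C': "cutoff_const C" using cutoff_exists[where 'a="real^3"] unfolding cutoff_const_def by blast
  then have C: "C > 0" by (simp add: cutoff_const_def)
  define V where "V = 8 * unit_ball_vol (3::real)"
  have V: "V > 0" by (simp add: V_def)
  obtain h where h: "0 \<le> h" "haus2 K = ennreal h" using fin unfolding K_def by (cases "haus2 (frontier \<Omega>)") auto
  have main: "cmod (LINT x|lebesgue. indicator \<Omega> x * dir_deriv v g x) \<le> V * C * (3 * J)"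
    if g: "g \<in> test_fun UNIV" and v: "norm v = 1" and J: "0 \<le> J"
    "(\<integral>\<^sup>+x\<in>K. ennreal (cmod (g x)) \<partial>surface_measure) \<le> ennreal J" for g v J
  proof -
    obtain M where M: "M > 0" "\<And>x. cmod (g x) \<le> M" using test_fun_bounded[OF g] by metis
    obtain G where G: "G > 0" "\<And>x v. cmod (dir_deriv v g x) \<le> G * norm v" using test_fun_deriv_bound[OF g] by blast
    obtain L where L: "L > 0" "\<And>x y. cmod (g x - g y) \<le> L * norm (x - y)" using test_fun_Lipschitz[OF g] by blast
    have gb [measurable]: "g \<in> borel_measurable borel" by (rule borel_measurable_smooth[OF test_fun_smooth[OF g]])
    have "cmod (LINT x|lebesgue. indicator \<Omega> x * dir_deriv v g x)
      \<le> V * C * (3 * J) + (V * G * (3 * h + 2) + V * C * (6 * h + 2)) * e" if e: "0 < e" "e \<le> 1" for e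
    proof -
      \<comment> \<open>Radii up to d keep the oscillation of g between a centre and its doubled
        ball below e, by the Lipschitz constant L; d \<le> e makes the term with G small.\<close>
      define d where "d = min e (e / (2 * L))"
      have d: "0 < d" "d \<le> e" "L * (2 * d) \<le> e" using e L(1) by (auto simp: d_def field_simps min_def)
      obtain P :: nat where P: "M / e < real P" using reals_Archimedean2 by blast
      then have P0: "P > 0" using M(1) e by (metis divide_pos_pos gr0I less_asym of_nat_0)
      \<comment> \<open>The frontier is cut into layers on which |g| lies in a window of height e,
        and each layer is covered on its own. On the balls of layer m, |g| is at most (m + 2) e, so
        the weighted covering sums reproduce the boundary integral of |g| up to a multiple of
        e.\<close>
      define E where "E m = {x \<in> K. real m * e \<le> cmod (g x) \<and> cmod (g x) < (real m + 1) * e}" for m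
      have Eb: "E m \<in> sets borel" for m unfolding E_def using Kb by measurable
      have EK: "E m \<subseteq> K" for m by (auto simp: E_def)
      have KE: "K \<subseteq> (\<Union>m<P. E m)"
      proof
        fix x assume x: "x \<in> K"
        define m where "m = nat \<lfloor>cmod (g x) / e\<rfloor>"
        have q: "0 \<le> cmod (g x) / e" using e by simp
        then have m: "real m \<le> cmod (g x) / e" "cmod (g x) / e < real m + 1" unfolding m_def by linarith+
        have "cmod (g x) / e \<le> M / e" using M(2) e by (intro divide_right_mono) auto
        then have "m < P" using m P by linarith
        moreover have "x \<in> E m" using x m e by (simp add: E_def field_simps)
        ultimately show "x \<in> (\<Union>m<P. E m)" by blast
      qed
      have disj: "m = m'" if "x \<in> E m" "x \<in> E m'" for x m m'
      proof -
        have "real m * e < (real m' + 1) * e" "real m' * e < (real m + 1) * e" using that by (auto simp: E_def)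
        then have "real m < real m' + 1" "real m' < real m + 1" using e by (simp_all add: mult_less_cancel_right)
        then show ?thesis by linarith
      qed
      have "haus2 (E m) < top" for m using haus2_mono[OF EK] h(2) by (metis ennreal_less_top le_less_trans)
      then have "\<exists>c\<ge>0. haus2 (E m) = ennreal c" for m by (metis ennreal_cases less_irrefl)
      then obtain hm where hm: "\<And>m. 0 \<le> hm m" "\<And>m. haus2 (E m) = ennreal (hm m)" by metis
      have em: "emeasure surface_measure (E m) = ennreal (hm m)" for m using emeasure_surface_measure[OF Eb] hm by simp
      have ind: "(\<Sum>m<P. ennreal (c m) * indicator (E m) x) \<le> ennreal b * indicator K x"
        if c: "\<And>m. m < P ==> x \<in> E m ==> c m \<le> b" for c b x
      proof (cases "\<exists>m<P. x \<in> E m")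
        case True
        then obtain m where m: "m < P" "x \<in> E m" by blast
        have "(\<Sum>m<P. ennreal (c m) * indicator (E m) x) = (\<Sum>k<P. if k = m then ennreal (c m) else 0)"
        proof (rule sum.cong[OF refl])
          fix k
          have "x \<in> E k \<longleftrightarrow> k = m" using disj[OF _ m(2)] m(2) by blast
          then show "ennreal (c k) * indicator (E k) x = (if k = m then ennreal (c m) else 0)"
            using m(2) by (cases "k = m") simp_all
        qed
        also have "\<dots> = ennreal (c m)" using m by simp
        finally have eq: "(\<Sum>m<P. ennreal (c m) * indicator (E m) x) = ennreal (c m)" .
        have xK: "x \<in> K" using m(2) EK by blast
        show ?thesis unfolding eq using xK ennreal_leI[OF c[OF m]] by simp
      next
        case False
        then have "(\<Sum>m<P. ennreal (c m) * indicator (E m) x) = 0" by (intro sum.neutral) auto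
        then show ?thesis by simp
      qed
      have sumint: "(\<Sum>m<P. ennreal (c m) * ennreal (hm m)) = (\<integral>\<^sup>+x. (\<Sum>m<P. ennreal (c m) * indicator (E m) x) \<partial>surface_measure)" for c
        using Eb by (subst nn_integral_sum) (auto simp: nn_integral_cmult_indicator em)
      have s1: "(\<Sum>m<P. hm m) \<le> h"
      proof -
        have "ennreal (\<Sum>m<P. hm m) = (\<Sum>m<P. ennreal 1 * ennreal (hm m))" using hm(1) by (simp add: sum_ennreal)
        also have "\<dots> \<le> (\<integral>\<^sup>+x. ennreal 1 * indicator K x \<partial>surface_measure)"
          unfolding sumint by (intro nn_integral_mono ind) auto
        also have "\<dots> = ennreal h" using Kb h emeasure_surface_measure[OF Kb] by simp
        finally show ?thesis using h(1) by (simp add: ennreal_le_iff)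
      qed
      have s2: "(\<Sum>m<P. real m * e * hm m) \<le> J"
      proof -
        have "ennreal (\<Sum>m<P. real m * e * hm m) = (\<Sum>m<P. ennreal (real m * e) * ennreal (hm m))"
          using hm(1) e by (subst sum_ennreal[symmetric]) (auto simp: ennreal_mult)
        also have "\<dots> \<le> (\<integral>\<^sup>+x\<in>K. ennreal (cmod (g x)) \<partial>surface_measure)"
          unfolding sumint by (intro nn_integral_mono ind) (auto simp: E_def)
        also have "\<dots> \<le> ennreal J" by (rule J(2))
        finally show ?thesis using J(1) by (simp add: ennreal_le_iff)
      qed
      \<comment> \<open>The covering error 2 \<eta> occurs in P layers with weight at most (P + 2)
        e; this choice makes the total at most 2 e.\<close>
      define \<eta> where "\<eta> = 1 / (real P * (real P + 2))"
      have \<eta>: "\<eta> > 0" using P0 by (simp add: \<eta>_def)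
      have "\<forall>m. \<exists>(N::nat set) p r. (\<forall>n\<in>N. p n \<in> E m \<and> 0 < r n \<and> r n \<le> d) \<and> E m \<subseteq> (\<Union>n\<in>N. ball (p n) (r n)) \<and>
        (\<forall>F. finite F --> F \<subseteq> N --> (\<Sum>n\<in>F. (r n)\<^sup>2) \<le> 3 * hm m + 2 * \<eta>)"
        by (rule allI) (rule haus2_ball_cover[OF hm(2) hm(1) \<eta> d(1)])
      from choice[OF this] obtain N :: "nat => nat set" where "\<forall>m. \<exists>p r. (\<forall>n\<in>N m. p n \<in> E m \<and> 0 < r n \<and> r n \<le> d) \<and> E m \<subseteq> (\<Union>n\<in>N m. ball (p n) (r n)) \<and>
        (\<forall>F. finite F --> F \<subseteq> N m --> (\<Sum>n\<in>F. (r n)\<^sup>2) \<le> 3 * hm m + 2 * \<eta>)" by (elim exE)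
      from choice[OF this] obtain p where "\<forall>m. \<exists>r. (\<forall>n\<in>N m. p m n \<in> E m \<and> 0 < r n \<and> r n \<le> d) \<and> E m \<subseteq> (\<Union>n\<in>N m. ball (p m n) (r n)) \<and>
        (\<forall>F. finite F --> F \<subseteq> N m --> (\<Sum>n\<in>F. (r n)\<^sup>2) \<le> 3 * hm m + 2 * \<eta>)" by (elim exE)
      from choice[OF this] obtain r where pr: "\<forall>m. (\<forall>n\<in>N m. p m n \<in> E m \<and> 0 < r m n \<and> r m n \<le> d) \<and> E m \<subseteq> (\<Union>n\<in>N m. ball (p m n) (r m n)) \<and>
        (\<forall>F. finite F --> F \<subseteq> N m --> (\<Sum>n\<in>F. (r m n)\<^sup>2) \<le> 3 * hm m + 2 * \<eta>)" by (elim exE)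
      have pr1: "p m n \<in> E m" "0 < r m n" "r m n \<le> d" if "n \<in> N m" for m n
        using bspec[OF conjunct1[OF spec[OF pr, of m]] that] by simp_all
      have pr2: "E m \<subseteq> (\<Union>n\<in>N m. ball (p m n) (r m n))" for m
        using conjunct1[OF conjunct2[OF spec[OF pr, of m]]] .
      have pr3: "(\<Sum>n\<in>F. (r m n)\<^sup>2) \<le> 3 * hm m + 2 * \<eta>" if "finite F" "F \<subseteq> N m" for m F
        using conjunct2[OF conjunct2[OF spec[OF pr, of m]]] that by simp
      define B where "B = (%(m, n). ball (p m n) (r m n))"
      have cover: "K \<subseteq> (\<Union>i\<in>Sigma {..<P} N. B i)"
      proof
        fix x assume "x \<in> K"
        then obtain m where m: "m < P" "x \<in> E m" using KE by blast
        then obtain n where "n \<in> N m" "x \<in> ball (p m n) (r m n)" using pr2[of m] by blast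
        then show "x \<in> (\<Union>i\<in>Sigma {..<P} N. B i)" using m by (intro UN_I[of "(m, n)"]) (auto simp: B_def)
      qed
      obtain I where I: "I \<subseteq> Sigma {..<P} N" "finite I" "K \<subseteq> (\<Union>i\<in>I. B i)"
        by (rule compactE_image[OF K(2) _ cover]) (auto simp: B_def)
      define S where "S m = {n. (m, n) \<in> I}" for m
      have S: "finite (S m)" "S m \<subseteq> N m" for m
      proof -
        have "S m \<subseteq> snd ` I" by (force simp: S_def)
        then show "finite (S m)" using I(2) finite_surj by blast
        show "S m \<subseteq> N m" using I(1) by (auto simp: S_def)
      qed
      have IS: "I = Sigma {..<P} S" using I(1) by (auto simp: S_def)
      have r2: "(\<Sum>n\<in>S m. (r m n)\<^sup>2) \<le> 3 * hm m + 2 * \<eta>" for m by (rule pr3[OF S])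
      let ?p = "%i. p (fst i) (snd i)" and ?r = "%i. r (fst i) (snd i)" and ?a = "%i. (real (fst i) + 2) * e"
      have rp: "?r i > 0" "?r i \<le> d" "?p i \<in> E (fst i)" if "i \<in> I" for i
      proof -
        have "snd i \<in> N (fst i)" using that I(1) by auto
        then show "?r i > 0" "?r i \<le> d" "?p i \<in> E (fst i)" using pr1 by blast+
      qed
      have "cmod (LINT x|lebesgue. indicator \<Omega> x * dir_deriv v g x) \<le> (\<Sum>i\<in>I. (G + C / ?r i * ?a i) * (8 * unit_ball_vol 3 * ?r i ^ 3))"
      proof (rule capacity_estimate[OF \<Omega> g v C' I(2), where p="?p"])
        show "frontier \<Omega> \<subseteq> (\<Union>j\<in>I. ball (?p j) (?r j))" using I(3) by (simp add: K_def B_def case_prod_beta)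
        show "cmod (dir_deriv v g x) \<le> G" for x using G(2)[of x v] v by simp
        fix i x assume i: "i \<in> I" and x: "dist (?p i) x \<le> 2 * ?r i"
        have "cmod (g x) \<le> cmod (g (?p i)) + cmod (g x - g (?p i))" using norm_triangle_ineq[of "g (?p i)" "g x - g (?p i)"] by simp
        also have "cmod (g x - g (?p i)) \<le> L * norm (x - ?p i)" by (rule L(2))
        also have "L * norm (x - ?p i) \<le> L * (2 * d)" using x rp[OF i] L(1) by (intro mult_left_mono) (auto simp: dist_norm norm_minus_commute)
        also have "\<dots> \<le> e" by (rule d(3))
        also have "cmod (g (?p i)) \<le> (real (fst i) + 1) * e" using rp(3)[OF i] by (simp add: E_def)
        finally show "cmod (g x) \<le> ?a i" by (simp add: algebra_simps)
      qed (use rp in auto)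
      \<comment> \<open>Since r^3 \<le> d r^2, the contribution of the derivative of g carries the
        small factor d. The contribution of the gradient of the cutoff is C a r^2 without a small
        factor, and it is this one that becomes the boundary integral.\<close>
      also have "\<dots> \<le> (\<Sum>i\<in>I. V * G * d * (?r i)\<^sup>2 + V * C * (?a i * (?r i)\<^sup>2))"
      proof (rule sum_mono)
        fix i assume i: "i \<in> I"
        have "(G + C / ?r i * ?a i) * (8 * unit_ball_vol 3 * ?r i ^ 3) = V * G * (?r i * (?r i)\<^sup>2) + V * C * (?a i * (?r i)\<^sup>2)"
          using rp(1)[OF i] by (simp add: V_def power2_eq_square power3_eq_cube field_simps)
        also have "V * G * (?r i * (?r i)\<^sup>2) \<le> V * G * (d * (?r i)\<^sup>2)"
          using rp[OF i] V G(1) by (intro mult_left_mono mult_right_mono) auto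
        finally show "(G + C / ?r i * ?a i) * (8 * unit_ball_vol 3 * ?r i ^ 3) \<le> V * G * d * (?r i)\<^sup>2 + V * C * (?a i * (?r i)\<^sup>2)"
          by (simp add: mult.assoc)
      qed
      also have "\<dots> = V * G * d * (\<Sum>m<P. \<Sum>n\<in>S m. (r m n)\<^sup>2) + V * C * (\<Sum>m<P. (real m + 2) * e * (\<Sum>n\<in>S m. (r m n)\<^sup>2))"
      proof -
        have T: "(\<Sum>i\<in>I. F (fst i) (snd i)) = (\<Sum>m<P. \<Sum>n\<in>S m. F m n)" for F :: "nat => nat => real"
          unfolding IS using S(1) by (subst sum.Sigma) (simp_all add: case_prod_beta)
        have "(\<Sum>i\<in>I. V * G * d * (?r i)\<^sup>2 + V * C * (?a i * (?r i)\<^sup>2)) = V * G * d * (\<Sum>i\<in>I. (?r i)\<^sup>2) + V * C * (\<Sum>i\<in>I. ?a i * (?r i)\<^sup>2)"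
          by (simp only: sum.distrib sum_distrib_left)
        then show ?thesis unfolding T[of "%m n. (r m n)\<^sup>2"] T[of "%m n. (real m + 2) * e * (r m n)\<^sup>2"] sum_distrib_left[symmetric] .
      qed
      also have "\<dots> \<le> V * G * d * (\<Sum>m<P. 3 * hm m + 2 * \<eta>) + V * C * (\<Sum>m<P. (real m + 2) * e * (3 * hm m + 2 * \<eta>))"
        using V G(1) C d(1) e by (intro add_mono mult_left_mono sum_mono r2) auto
      also have "\<dots> \<le> V * G * e * (3 * h + 2) + V * C * (3 * J + (6 * h + 2) * e)"
      proof (intro add_mono mult_mono)
        have pe: "real P * \<eta> = 1 / (real P + 2)" using P0 by (simp add: \<eta>_def)
        then have P\<eta>: "real P * \<eta> \<le> 1" by simp
        have pe2: "(\<Sum>m<P. (real P + 2) * e * 2 * \<eta>) = 2 * e"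
        proof -
          have "(\<Sum>m<P. (real P + 2) * e * 2 * \<eta>) = 2 * e * ((real P * \<eta>) * (real P + 2))" by simp
          also have "\<dots> = 2 * e" unfolding pe by simp
          finally show ?thesis .
        qed
        have "(\<Sum>m<P. 3 * hm m + 2 * \<eta>) = 3 * (\<Sum>m<P. hm m) + 2 * (real P * \<eta>)" by (simp add: sum.distrib sum_distrib_left)
        then show "(\<Sum>m<P. 3 * hm m + 2 * \<eta>) \<le> 3 * h + 2" using s1 P\<eta> by linarith
        have "(\<Sum>m<P. (real m + 2) * e * (3 * hm m + 2 * \<eta>)) = 3 * (\<Sum>m<P. real m * e * hm m) + 6 * e * (\<Sum>m<P. hm m) + (\<Sum>m<P. (real m + 2) * e * 2 * \<eta>)"
          by (simp only: sum_distrib_left sum.distrib[symmetric]) (rule sum.cong[OF refl], simp add: algebra_simps)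
        also have "(\<Sum>m<P. (real m + 2) * e * 2 * \<eta>) \<le> (\<Sum>m<P. (real P + 2) * e * 2 * \<eta>)"
          using e \<eta> by (intro sum_mono mult_right_mono) auto
        also have "\<dots> = 2 * e" by (rule pe2)
        also have "6 * e * (\<Sum>m<P. hm m) \<le> 6 * e * h" using s1 e by (intro mult_left_mono) auto
        finally show "(\<Sum>m<P. (real m + 2) * e * (3 * hm m + 2 * \<eta>)) \<le> 3 * J + (6 * h + 2) * e"
          using s2 by (simp add: algebra_simps)
      qed (use V G(1) C d e hm(1) \<eta> in \<open>auto intro!: sum_nonneg mult_nonneg_nonneg add_nonneg_nonneg\<close>)
      finally show ?thesis by (simp add: algebra_simps)
    qed
    then show ?thesis by (rule le_of_le_add_mult_eps)
  qed
  show ?thesis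
    by (rule exI[of _ "V * C * 3"]) (use main V C(1) in \<open>auto simp: K_def mult.assoc\<close>)
qed

section \<open>Functions with zero trace\<close>

lemma measurable_boundary_density:
  assumes [measurable]: "\<phi> \<in> borel_measurable borel"
  shows "(%x. ennreal ((cmod (\<phi> x))\<^sup>2) * indicator (frontier \<Omega>) x) \<in> borel_measurable surface_measure"
proof -
  have [measurable]: "frontier \<Omega> \<in> sets borel" by simp
  show ?thesis unfolding measurable_cong_sets[OF sets_surface_measure refl] by measurable
qed

text \<open>As a type, \<open>l2\<close> is a real vector space; complex scalars act through
  constant multipliers.\<close>

definition cscale :: "complex => l2 => l2" where "cscale c = mulL (%x. c)"

lemma cscale_abs_l2: "is_L2 f ==> cscale c (abs_l2 f) = abs_l2 (%x. c * f x)"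
  unfolding cscale_def by (rule mulL_abs_l2[OF ae_bounded_const])

lemma norm_cscale_le: "norm (cscale c u) \<le> cmod c * norm u"
  unfolding cscale_def by (rule norm_mulL[OF ae_bounded_const])

lemma bounded_linear_cscale: "bounded_linear (cscale c)"
  unfolding cscale_def by (rule bounded_linear_mulL[OF ae_bounded_const])

lemma pair_cscale: "pair (cscale c u) v = c * pair u v" "pair u (cscale c v) = c * pair u v"
proof -
  show *: "pair (cscale c u) v = c * pair u v" for u v
    by (cases u; cases v) (simp add: cscale_abs_l2 abs_l2_simps is_L2_cmult mult.assoc)
  show "pair u (cscale c v) = c * pair u v" using *[of v u] pair_commute by metis
qed

lemma mulL_cscale: "ae_bounded m M ==> mulL m (cscale c u) = cscale c (mulL m u)"
  unfolding cscale_def by (simp add: mulL_mulL[OF _ ae_bounded_const] mulL_mulL[OF ae_bounded_const] mult.commute)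

definition bdry_L2 :: "(real^3) set => (real^3 => complex) => ennreal"
  where "bdry_L2 \<Omega> \<phi> = (\<integral>\<^sup>+x\<in>frontier \<Omega>. ennreal ((cmod (\<phi> x))\<^sup>2) \<partial>surface_measure)"

text \<open>A function is recorded together with its gradient, both extended by zero, as one point
  of a Banach space. In this form the vanishing of the trace defines a closed complex subspace, so
  it survives time integrals and limits; \<open>has_trace_0_iff\<close> connects it with
  \<open>has_trace\<close>.\<close>

definition zero_trace :: "(real^3) set => l2 \<times> (l2^3) => bool"
  where "zero_trace \<Omega> u \<longleftrightarrow> (\<forall>e>0. \<exists>\<phi>\<in>test_fun UNIV. norm (zext \<Omega> \<phi> - fst u) < e \<and>
    (\<forall>i. norm (zext \<Omega> (pd i \<phi>) - snd u $ i) < e) \<and> bdry_L2 \<Omega> \<phi> < ennreal e)"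

lemma zero_traceD:
  assumes "zero_trace \<Omega> u"
  shows "\<exists>\<phi>. (\<forall>n. \<phi> n \<in> test_fun UNIV) \<and> (%n. zext \<Omega> (\<phi> n)) \<longlonglongrightarrow> fst u \<and>
    (\<forall>i. (%n. zext \<Omega> (pd i (\<phi> n))) \<longlonglongrightarrow> snd u $ i) \<and> (%n. bdry_L2 \<Omega> (\<phi> n)) \<longlonglongrightarrow> 0"
proof -
  have "\<forall>n. \<exists>\<phi>. \<phi> \<in> test_fun UNIV \<and> norm (zext \<Omega> \<phi> - fst u) < 1 / (real n + 1) \<and>
    (\<forall>i. norm (zext \<Omega> (pd i \<phi>) - snd u $ i) < 1 / (real n + 1)) \<and> bdry_L2 \<Omega> \<phi> < ennreal (1 / (real n + 1))"
  proof
    fix n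
    have "1 / (real n + 1) > 0" by simp
    from assms[unfolded zero_trace_def, rule_format, OF this]
    show "\<exists>\<phi>. \<phi> \<in> test_fun UNIV \<and> norm (zext \<Omega> \<phi> - fst u) < 1 / (real n + 1) \<and>
    (\<forall>i. norm (zext \<Omega> (pd i \<phi>) - snd u $ i) < 1 / (real n + 1)) \<and> bdry_L2 \<Omega> \<phi> < ennreal (1 / (real n + 1))"
      unfolding bex_simps by (simp add: Bex_def)
  qed
  from choice[OF this] obtain \<phi> where \<phi>: "\<forall>n. \<phi> n \<in> test_fun UNIV \<and> norm (zext \<Omega> (\<phi> n) - fst u) < 1 / (real n + 1) \<and>
    (\<forall>i. norm (zext \<Omega> (pd i (\<phi> n)) - snd u $ i) < 1 / (real n + 1)) \<and> bdry_L2 \<Omega> (\<phi> n) < ennreal (1 / (real n + 1))"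
    by (elim exE)
  have rl: "(%n. 1 / (real n + 1)) \<longlonglongrightarrow> 0" by real_asymp
  have lim: "X \<longlonglongrightarrow> x" if "\<And>n. norm (X n - x) < 1 / (real n + 1)" for X :: "nat => l2" and x
  proof -
    have "(%n. X n - x) \<longlonglongrightarrow> 0"
      by (rule Lim_null_comparison[OF _ rl]) (use that in \<open>auto intro: always_eventually less_imp_le\<close>)
    then show ?thesis by (rule LIM_zero_cancel)
  qed
  show ?thesis
  proof (intro exI[of _ \<phi>] conjI allI)
    show "\<phi> n \<in> test_fun UNIV" for n using \<phi> by simp
    show "(%n. zext \<Omega> (\<phi> n)) \<longlonglongrightarrow> fst u" by (rule lim) (use \<phi> in simp)
    show "(%n. zext \<Omega> (pd i (\<phi> n))) \<longlonglongrightarrow> snd u $ i" for i by (rule lim) (use \<phi> in simp)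
    have "(%n. ennreal (1 / (real n + 1))) \<longlonglongrightarrow> ennreal 0" by (rule tendsto_ennrealI[OF rl])
    then have rl': "(%n. ennreal (1 / (real n + 1))) \<longlonglongrightarrow> 0" by simp
    show "(%n. bdry_L2 \<Omega> (\<phi> n)) \<longlonglongrightarrow> 0"
    proof (rule tendsto_sandwich[OF _ _ tendsto_const rl'])
      show "\<forall>\<^sub>F n in sequentially. bdry_L2 \<Omega> (\<phi> n) \<le> ennreal (1 / (real n + 1))"
        using \<phi> by (intro always_eventually allI) (simp add: less_imp_le)
    qed simp
  qed
qed

lemma zero_traceI:
  assumes \<phi>: "\<And>n. \<phi> n \<in> test_fun UNIV" and 1: "(%n. zext \<Omega> (\<phi> n)) \<longlonglongrightarrow> fst u"
    and 2: "\<And>i. (%n. zext \<Omega> (pd i (\<phi> n))) \<longlonglongrightarrow> snd u $ i" and 3: "(%n. bdry_L2 \<Omega> (\<phi> n)) \<longlonglongrightarrow> 0"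
  shows "zero_trace \<Omega> u"
  unfolding zero_trace_def
proof (intro allI impI)
  fix e :: real assume e: "e > 0"
  have "\<forall>\<^sub>F n in sequentially. norm (zext \<Omega> (\<phi> n) - fst u) < e" using tendstoD[OF 1 e] by (simp add: dist_norm)
  moreover have "\<forall>\<^sub>F n in sequentially. \<forall>i. norm (zext \<Omega> (pd i (\<phi> n)) - snd u $ i) < e"
    using tendstoD[OF 2 e] by (intro eventually_all_finite) (simp add: dist_norm)
  moreover have "\<forall>\<^sub>F n in sequentially. bdry_L2 \<Omega> (\<phi> n) < ennreal e" using order_tendstoD(2)[OF 3] e by simp
  ultimately have "\<forall>\<^sub>F n in sequentially. norm (zext \<Omega> (\<phi> n) - fst u) < e \<and>
    (\<forall>i. norm (zext \<Omega> (pd i (\<phi> n)) - snd u $ i) < e) \<and> bdry_L2 \<Omega> (\<phi> n) < ennreal e"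
    by eventually_elim blast
  then obtain n where "norm (zext \<Omega> (\<phi> n) - fst u) < e \<and>
    (\<forall>i. norm (zext \<Omega> (pd i (\<phi> n)) - snd u $ i) < e) \<and> bdry_L2 \<Omega> (\<phi> n) < ennreal e"
    using eventually_happens'[OF sequentially_bot] by blast
  then show "\<exists>\<phi>\<in>test_fun UNIV. norm (zext \<Omega> \<phi> - fst u) < e \<and>
    (\<forall>i. norm (zext \<Omega> (pd i \<phi>) - snd u $ i) < e) \<and> bdry_L2 \<Omega> \<phi> < ennreal e"
    by (rule bexI[OF _ \<phi>])
qed

text \<open>For the approximating test functions the defect in the integration by parts over
  \<Omega> is the integral of a derivative of \<phi> \<psi>, which
  \<open>boundary_integral_bound\<close> controls by the boundary integral of |\<phi> \<psi>|. The
  latter tends to 0 because the boundary has finite measure.\<close>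

theorem zero_trace_extension:
  assumes \<Omega>: "open \<Omega>" "bounded \<Omega>" and fin: "haus2 (frontier \<Omega>) < top" and u: "zero_trace \<Omega> u"
  shows "weakly_diff UNIV i (fst u) (snd u $ i)"
proof -
  obtain \<phi> where \<phi>0: "(\<forall>n. \<phi> n \<in> test_fun UNIV) \<and> (%n. zext \<Omega> (\<phi> n)) \<longlonglongrightarrow> fst u \<and>
    (\<forall>i. (%n. zext \<Omega> (pd i (\<phi> n))) \<longlonglongrightarrow> snd u $ i) \<and> (%n. bdry_L2 \<Omega> (\<phi> n)) \<longlonglongrightarrow> 0"
    using zero_traceD[OF u] by (elim exE)
  then have \<phi>: "\<And>n. \<phi> n \<in> test_fun UNIV" "(%n. zext \<Omega> (\<phi> n)) \<longlonglongrightarrow> fst u"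
    "\<And>i. (%n. zext \<Omega> (pd i (\<phi> n))) \<longlonglongrightarrow> snd u $ i" "(%n. bdry_L2 \<Omega> (\<phi> n)) \<longlonglongrightarrow> 0" by simp_all
  let ?d = "%\<phi>. pd i \<phi>"
  define K where "K = frontier \<Omega>"
  have Kb: "K \<in> sets borel" by (simp add: K_def)
  obtain h where h: "0 \<le> h" "haus2 K = ennreal h" using fin unfolding K_def by (cases "haus2 (frontier \<Omega>)") auto
  obtain C where C: "C > 0" "\<forall>g\<in>test_fun UNIV. \<forall>v J. norm v = 1 --> 0 \<le> J -->
    (\<integral>\<^sup>+x\<in>frontier \<Omega>. ennreal (cmod (g x)) \<partial>surface_measure) \<le> ennreal J -->
    cmod (LINT x|lebesgue. indicator \<Omega> x * dir_deriv v g x) \<le> C * J"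
    using boundary_integral_bound[OF \<Omega> fin] by (elim exE conjE)
  have \<Omega>m: "\<Omega> \<in> sets lebesgue" using \<Omega>(1) by simp
  show ?thesis unfolding weakly_diff_def
  proof
    fix \<psi> :: "real^3 => complex" assume \<psi>: "\<psi> \<in> test_fun UNIV"
    obtain M where M: "M > 0" "\<And>x. cmod (\<psi> x) \<le> M" using test_fun_bounded[OF \<psi>] by metis
    define X where "X n = pair (zext \<Omega> (\<phi> n)) (abs_l2 (?d \<psi>)) + pair (zext \<Omega> (?d (\<phi> n))) (abs_l2 \<psi>)" for n
    define Y where "Y = pair (fst u) (abs_l2 (?d \<psi>)) + pair (snd u $ i) (abs_l2 \<psi>)"
    have XY: "X \<longlonglongrightarrow> Y" unfolding X_def Y_def
      by (intro tendsto_add bounded_linear.tendsto[OF bounded_linear_pair_left] \<phi>)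
    have Xn: "X n = (LINT x|lebesgue. indicator \<Omega> x * ?d (%x. \<phi> n x * \<psi> x) x)" for n
    proof -
      note t = \<phi>(1)[of n] test_fun_dir_deriv[OF \<phi>(1)[of n], of "axis i 1"] \<psi> test_fun_dir_deriv[OF \<psi>, of "axis i 1"]
      have z: "zext \<Omega> f = abs_l2 (%x. indicator \<Omega> x * f x)" "is_L2 (%x. indicator \<Omega> x * f x)" if "f \<in> test_fun UNIV" for f
      proof -
        show "is_L2 (%x. indicator \<Omega> x * f x)"
          by (rule is_L2_mult[OF ae_bounded_indicator[OF \<Omega>m] is_L2_test_fun[OF that]])
        show "zext \<Omega> f = abs_l2 (%x. indicator \<Omega> x * f x)"
          unfolding zext_def by (rule arg_cong[where f=abs_l2]) (auto simp: indicator_def)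
      qed
      have "X n = (LINT x|lebesgue. (indicator \<Omega> x * \<phi> n x) * ?d \<psi> x) + (LINT x|lebesgue. (indicator \<Omega> x * ?d (\<phi> n) x) * \<psi> x)"
        unfolding X_def z(1)[OF t(1)] z(1)[OF t(2)] using z(2)[OF t(1)] z(2)[OF t(2)] is_L2_test_fun[OF t(3)] is_L2_test_fun[OF t(4)]
        by (simp add: abs_l2_simps)
      also have "\<dots> = (LINT x|lebesgue. (indicator \<Omega> x * \<phi> n x) * ?d \<psi> x + (indicator \<Omega> x * ?d (\<phi> n) x) * \<psi> x)"
        by (rule Bochner_Integration.integral_add[symmetric])
          (rule is_L2_mult_integrable[OF z(2) is_L2_test_fun], rule t, rule t)+
      finally show ?thesis
        unfolding dir_deriv_mult[OF test_fun_smooth[OF t(1)] test_fun_smooth[OF t(3)]] by (simp add: algebra_simps)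
    qed
    have "cmod Y \<le> 0 + C * (M * (h + 1)) * t" if t: "0 < t" "t \<le> 1" for t
    proof -
      \<comment> \<open>Passage from the L2 to the L1 norm on the boundary: pointwise |\<phi>| \<le>
        t + |\<phi>|^2 / t, and once the integral of |\<phi>|^2 is below t^2 both terms contribute a
        multiple of t.\<close>
      have "\<forall>\<^sub>F n in sequentially. bdry_L2 \<Omega> (\<phi> n) < ennreal (t * t)"
        using order_tendstoD(2)[OF \<phi>(4)] t by simp
      then have "\<forall>\<^sub>F n in sequentially. cmod (X n) \<le> C * (M * (h + 1)) * t"
      proof eventually_elim
        case (elim n)
        have [measurable]: "\<phi> n \<in> borel_measurable borel" by (rule borel_measurable_smooth[OF test_fun_smooth[OF \<phi>(1)]])
        have "(\<integral>\<^sup>+x\<in>K. ennreal (cmod (\<phi> n x * \<psi> x)) \<partial>surface_measure)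
          \<le> (\<integral>\<^sup>+x. ennreal (M * t) * indicator K x + ennreal (M / t) * (ennreal ((cmod (\<phi> n x))\<^sup>2) * indicator K x) \<partial>surface_measure)"
        proof (rule nn_integral_mono)
          fix x
          have "0 \<le> (cmod (\<phi> n x) - t)\<^sup>2" "0 \<le> cmod (\<phi> n x) * t" using t by simp_all
          then have "cmod (\<phi> n x) * t \<le> t * t + (cmod (\<phi> n x))\<^sup>2" by (simp add: power2_eq_square algebra_simps)
          also have "\<dots> = (t + (cmod (\<phi> n x))\<^sup>2 / t) * t" using t by (simp add: algebra_simps)
          finally have "cmod (\<phi> n x) * t \<le> (t + (cmod (\<phi> n x))\<^sup>2 / t) * t" .
          then have "cmod (\<phi> n x) \<le> t + (cmod (\<phi> n x))\<^sup>2 / t" using t(1) by (rule mult_right_le_imp_le)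
          then have "cmod (\<phi> n x * \<psi> x) \<le> (t + (cmod (\<phi> n x))\<^sup>2 / t) * M"
            unfolding norm_mult using M t by (intro mult_mono) auto
          also have "\<dots> = M * t + M / t * (cmod (\<phi> n x))\<^sup>2" by (simp add: algebra_simps)
          finally have "ennreal (cmod (\<phi> n x * \<psi> x)) \<le> ennreal (M * t) + ennreal (M / t) * ennreal ((cmod (\<phi> n x))\<^sup>2)"
            using M t by (simp add: ennreal_mult'[symmetric] ennreal_plus[symmetric] del: ennreal_plus)
          then show "ennreal (cmod (\<phi> n x * \<psi> x)) * indicator K x \<le> ennreal (M * t) * indicator K x + ennreal (M / t) * (ennreal ((cmod (\<phi> n x))\<^sup>2) * indicator K x)"
            by (auto simp: indicator_def)
        qed
        also have "\<dots> = ennreal (M * t) * haus2 K + ennreal (M / t) * bdry_L2 \<Omega> (\<phi> n)"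
          using measurable_boundary_density[of "\<phi> n" \<Omega>] borel_measurable_times_ennreal[OF borel_measurable_const borel_measurable_indicator, of "frontier \<Omega>" surface_measure "ennreal (M * t)"] Kb
          by (simp add: nn_integral_add nn_integral_cmult nn_integral_cmult_indicator emeasure_surface_measure bdry_L2_def K_def)
        also have "\<dots> \<le> ennreal (M * t) * ennreal h + ennreal (M / t) * ennreal (t * t)"
          unfolding h(2) by (intro add_mono mult_left_mono order_refl less_imp_le[OF elim]) auto
        also have "\<dots> = ennreal (M * t * h + M / t * (t * t))"
          using M t h(1) by (simp add: ennreal_mult'[symmetric])
        also have "M * t * h + M / t * (t * t) = M * (h + 1) * t" using t by (simp add: algebra_simps)
        finally have J: "(\<integral>\<^sup>+x\<in>frontier \<Omega>. ennreal (cmod (\<phi> n x * \<psi> x)) \<partial>surface_measure) \<le> ennreal (M * (h + 1) * t)" by (simp add: K_def)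
        have "cmod (X n) \<le> C * (M * (h + 1) * t)" unfolding Xn
        proof (rule C(2)[rule_format, OF _ _ _ J])
          show "(%x. \<phi> n x * \<psi> x) \<in> test_fun UNIV" by (rule test_fun_mult_right[OF test_fun_smooth[OF \<psi>] \<phi>(1)])
          show "0 \<le> M * (h + 1) * t" using M t h(1) by simp
        qed (simp add: norm_axis_1)
        then show ?case by (simp add: mult.assoc)
      qed
      then have "cmod Y \<le> C * (M * (h + 1)) * t"
        using tendsto_upperbound[OF tendsto_norm[OF XY]] by simp
      then show ?thesis by simp
    qed
    then have "cmod Y \<le> 0" by (rule le_of_le_add_mult_eps)
    then show "pair (fst u) (abs_l2 (?d \<psi>)) = - pair (snd u $ i) (abs_l2 \<psi>)"
      by (simp add: Y_def add_eq_0_iff)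
  qed
qed

lemma zext_test_fun_UNIV: "\<phi> \<in> test_fun UNIV ==> \<Omega> \<in> sets lebesgue ==> zext \<Omega> \<phi> = proj \<Omega> (abs_l2 \<phi>)"
  by (rule zext_proj[OF is_L2_test_fun])

lemma zero_trace_0: "zero_trace \<Omega> 0"
  unfolding zero_trace_def
proof (intro allI impI bexI[of _ "%x. 0"] conjI)
  fix e :: real assume e: "e > 0"
  have z: "zext \<Omega> (%x. 0) = 0" by (simp add: zext_def zero_l2_eq)
  then show "norm (zext \<Omega> (%x. 0) - fst 0) < e" using e by simp
  show "norm (zext \<Omega> (pd i (%x. 0)) - snd 0 $ i) < e" for i
    using e by (simp add: frechet_derivative_const z)
  show "bdry_L2 \<Omega> (%x. 0) < ennreal e" using e by (simp add: bdry_L2_def)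
qed (rule test_funI[OF smooth_const, of "{}"], auto)

lemma zero_trace_add:
  assumes \<Omega>: "open \<Omega>" and u: "zero_trace \<Omega> u" and v: "zero_trace \<Omega> v"
  shows "zero_trace \<Omega> (u + v)"
  unfolding zero_trace_def
proof (intro allI impI)
  fix e :: real assume e: "e > 0"
  have \<Omega>m: "\<Omega> \<in> sets lebesgue" using \<Omega> by simp
  \<comment> \<open>Bounding |\<phi> + \<psi>|^2 by 2 |\<phi>|^2 + 2 |\<psi>|^2 doubles each
    boundary term, hence the quarter.\<close>
  have e4: "e / 4 > 0" using e by simp
  obtain \<phi> where p: "\<phi> \<in> test_fun UNIV" "norm (zext \<Omega> \<phi> - fst u) < e/4"
    "\<forall>i. norm (zext \<Omega> (pd i \<phi>) - snd u $ i) < e/4" "bdry_L2 \<Omega> \<phi> < ennreal (e/4)"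
    using u[unfolded zero_trace_def, rule_format, OF e4] by (elim bexE conjE)
  obtain \<psi> where q: "\<psi> \<in> test_fun UNIV" "norm (zext \<Omega> \<psi> - fst v) < e/4"
    "\<forall>i. norm (zext \<Omega> (pd i \<psi>) - snd v $ i) < e/4" "bdry_L2 \<Omega> \<psi> < ennreal (e/4)"
    using v[unfolded zero_trace_def, rule_format, OF e4] by (elim bexE conjE)
  have za: "zext \<Omega> (%x. f x + g x) = zext \<Omega> f + zext \<Omega> g" if f: "f \<in> test_fun UNIV" and g: "g \<in> test_fun UNIV" for f g
    unfolding zext_test_fun_UNIV[OF f \<Omega>m] zext_test_fun_UNIV[OF g \<Omega>m] zext_test_fun_UNIV[OF test_fun_add[OF f g] \<Omega>m]
    using linear_add[OF bounded_linear.linear[OF bounded_linear_proj[OF \<Omega>m]]] is_L2_test_fun[OF f] is_L2_test_fun[OF g]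
    by (simp add: abs_l2_simps flip: linear_add[OF bounded_linear.linear[OF bounded_linear_proj[OF \<Omega>m]]])
  have tri: "norm (a + b - (c + d)) < e" if "norm (a - c) < e/4" "norm (b - d) < e/4" for a b c d :: l2
    using norm_triangle_ineq[of "a - c" "b - d"] that e by (simp add: algebra_simps)
  have d: "pd i (%x. \<phi> x + \<psi> x) = (%x. pd i \<phi> x + pd i \<psi> x)" for i
    by (rule ext) (rule dir_deriv_add[OF test_fun_smooth[OF p(1)] test_fun_smooth[OF q(1)]])
  have [measurable]: "\<phi> \<in> borel_measurable borel" "\<psi> \<in> borel_measurable borel"
    using borel_measurable_smooth test_fun_smooth p(1) q(1) by blast+
  have Kb: "frontier \<Omega> \<in> sets borel" by simp
  have "bdry_L2 \<Omega> (%x. \<phi> x + \<psi> x) \<le> (\<integral>\<^sup>+x. 2 * (ennreal ((cmod (\<phi> x))\<^sup>2) * indicator (frontier \<Omega>) x) + 2 * (ennreal ((cmod (\<psi> x))\<^sup>2) * indicator (frontier \<Omega>) x) \<partial>surface_measure)"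
    unfolding bdry_L2_def
  proof (rule nn_integral_mono)
    fix x
    have "(cmod (\<phi> x + \<psi> x))\<^sup>2 \<le> (cmod (\<phi> x) + cmod (\<psi> x))\<^sup>2" by (intro power_mono norm_triangle_ineq) auto
    also have "\<dots> \<le> 2 * (cmod (\<phi> x))\<^sup>2 + 2 * (cmod (\<psi> x))\<^sup>2"
      using zero_le_power2[of "cmod (\<phi> x) - cmod (\<psi> x)"] by (simp add: power2_eq_square algebra_simps)
    finally have "ennreal ((cmod (\<phi> x + \<psi> x))\<^sup>2) \<le> ennreal (2 * (cmod (\<phi> x))\<^sup>2 + 2 * (cmod (\<psi> x))\<^sup>2)" by (rule ennreal_leI)
    also have "\<dots> = 2 * ennreal ((cmod (\<phi> x))\<^sup>2) + 2 * ennreal ((cmod (\<psi> x))\<^sup>2)" by (simp add: ennreal_mult)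
    finally show "ennreal ((cmod (\<phi> x + \<psi> x))\<^sup>2) * indicator (frontier \<Omega>) x \<le>
      2 * (ennreal ((cmod (\<phi> x))\<^sup>2) * indicator (frontier \<Omega>) x) + 2 * (ennreal ((cmod (\<psi> x))\<^sup>2) * indicator (frontier \<Omega>) x)"
      by (auto simp: indicator_def)
  qed
  also have "\<dots> = 2 * bdry_L2 \<Omega> \<phi> + 2 * bdry_L2 \<Omega> \<psi>"
    using measurable_boundary_density[of \<phi> \<Omega>] measurable_boundary_density[of \<psi> \<Omega>]
    by (simp add: nn_integral_add nn_integral_cmult bdry_L2_def)
  also have "\<dots> < ennreal (e/2) + ennreal (e/2)"
  proof -
    have "2 * b < ennreal (e/2)" if b: "b < ennreal (e/4)" for b
    proof -
      obtain c where c: "0 \<le> c" "b = ennreal c" using b by (cases b) auto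
      then have "2 * b = ennreal (2 * c)" by (simp add: ennreal_mult)
      then show ?thesis using b c e by (simp add: ennreal_less_iff)
    qed
    from this[OF p(4)] this[OF q(4)] show ?thesis using e by (metis add_mono_ennreal ennreal_plus less_eq_real_def half_gt_zero)
  qed
  also have "\<dots> = ennreal e" using e by (simp add: ennreal_plus[symmetric] del: ennreal_plus)
  finally have "bdry_L2 \<Omega> (%x. \<phi> x + \<psi> x) < ennreal e" .
  moreover have "norm (zext \<Omega> (%x. \<phi> x + \<psi> x) - fst (u + v)) < e"
    unfolding za[OF p(1) q(1)] fst_add by (rule tri[OF p(2) q(2)])
  moreover have "norm (zext \<Omega> (pd i (%x. \<phi> x + \<psi> x)) - snd (u + v) $ i) < e" for i
    unfolding d za[OF test_fun_dir_deriv[OF p(1)] test_fun_dir_deriv[OF q(1)]] snd_add vector_add_component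
    by (rule tri) (use p(3) q(3) in simp_all)
  ultimately show "\<exists>\<phi>\<in>test_fun UNIV. norm (zext \<Omega> \<phi> - fst (u + v)) < e \<and>
    (\<forall>i. norm (zext \<Omega> (pd i \<phi>) - snd (u + v) $ i) < e) \<and> bdry_L2 \<Omega> \<phi> < ennreal e"
    using test_fun_add[OF p(1) q(1)] by (intro bexI[of _ "%x. \<phi> x + \<psi> x"] conjI allI)
qed

lemma zero_trace_cscale:
  assumes \<Omega>: "open \<Omega>" and u: "zero_trace \<Omega> u"
  shows "zero_trace \<Omega> (cscale c (fst u), \<chi> i. cscale c (snd u $ i))"
  unfolding zero_trace_def
proof (intro allI impI)
  fix e :: real assume e: "e > 0"
  have \<Omega>m: "\<Omega> \<in> sets lebesgue" using \<Omega> by simp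
  \<comment> \<open>One tolerance e / D serves the norms, which scale with |c|, and the boundary
    integral, which scales with |c|^2; the summand 1 covers c = 0.\<close>
  define D where "D = 1 + cmod c + (cmod c)\<^sup>2"
  have D: "D > 0" "cmod c * (e / D) < e" "(cmod c)\<^sup>2 * (e / D) < e"
  proof -
    show "D > 0" by (simp add: D_def add_pos_nonneg)
    then show "cmod c * (e / D) < e" "(cmod c)\<^sup>2 * (e / D) < e" using e
      by (simp_all add: field_simps) (simp_all add: D_def add_pos_nonneg add_nonneg_pos algebra_simps)
  qed
  have eD: "e / D > 0" using e D by simp
  obtain \<phi> where p: "\<phi> \<in> test_fun UNIV" "norm (zext \<Omega> \<phi> - fst u) < e/D"
    "\<forall>i. norm (zext \<Omega> (pd i \<phi>) - snd u $ i) < e/D" "bdry_L2 \<Omega> \<phi> < ennreal (e/D)"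
    using u[unfolded zero_trace_def, rule_format, OF eD] by (elim bexE conjE)
  have t: "(%x. c * \<phi> x) \<in> test_fun UNIV" by (rule test_fun_mult_left[OF smooth_const p(1)])
  have za: "zext \<Omega> (%x. c * f x) = cscale c (zext \<Omega> f)" if f: "f \<in> test_fun UNIV" for f
  proof -
    have "zext \<Omega> f = abs_l2 (%x. if x \<in> \<Omega> then f x else 0)" by (simp add: zext_def)
    moreover have "(%x. if x \<in> \<Omega> then c * f x else 0) = (%x. c * (if x \<in> \<Omega> then f x else 0))" by auto
    ultimately show ?thesis using cscale_abs_l2[OF proj_abs_l2(2)[OF \<Omega>m is_L2_test_fun[OF f]]] by (simp add: zext_def)
  qed
  have d: "pd i (%x. c * \<phi> x) = (%x. c * pd i \<phi> x)" for i
    by (rule ext) (simp add: dir_deriv_mult[OF smooth_const test_fun_smooth[OF p(1)]] frechet_derivative_const)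
  have cs: "norm (cscale c a - cscale c b) < e" if "norm (a - b) < e / D" for a b
  proof -
    have "norm (cscale c a - cscale c b) \<le> cmod c * norm (a - b)"
      using norm_cscale_le[of c "a - b"] by (simp add: linear_diff[OF bounded_linear.linear[OF bounded_linear_cscale]])
    also have "\<dots> \<le> cmod c * (e / D)" using that by (intro mult_left_mono) auto
    finally show ?thesis using D(2) by simp
  qed
  have [measurable]: "\<phi> \<in> borel_measurable borel" using borel_measurable_smooth test_fun_smooth p(1) by blast
  have "bdry_L2 \<Omega> (%x. c * \<phi> x) = ennreal ((cmod c)\<^sup>2) * bdry_L2 \<Omega> \<phi>"
    unfolding bdry_L2_def
    by (subst nn_integral_cmult[symmetric]) (auto simp: norm_mult power_mult_distrib ennreal_mult mult.assoc measurable_boundary_density)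
  also have "\<dots> \<le> ennreal ((cmod c)\<^sup>2) * ennreal (e / D)" using p(4) by (intro mult_left_mono) auto
  also have "\<dots> = ennreal ((cmod c)\<^sup>2 * (e / D))" by (rule ennreal_mult'[symmetric]) simp
  also have "\<dots> < ennreal e" using D e by (intro ennreal_lessI) auto
  finally show "\<exists>\<phi>\<in>test_fun UNIV. norm (zext \<Omega> \<phi> - fst (cscale c (fst u), \<chi> i. cscale c (snd u $ i))) < e \<and>
    (\<forall>i. norm (zext \<Omega> (pd i \<phi>) - snd (cscale c (fst u), \<chi> i. cscale c (snd u $ i)) $ i) < e) \<and> bdry_L2 \<Omega> \<phi> < ennreal e"
    using p by (intro bexI[OF _ t]) (simp add: d za[OF p(1)] za[OF test_fun_dir_deriv[OF p(1)]] cs)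
qed

lemma zero_trace_closed: "closed {u. zero_trace \<Omega> u}"
  unfolding closed_sequential_limits
proof (intro allI impI, elim conjE)
  fix U u assume U: "\<forall>n. U n \<in> {u. zero_trace \<Omega> u}" and lim: "U \<longlonglongrightarrow> u"
  show "u \<in> {u. zero_trace \<Omega> u}" unfolding mem_Collect_eq zero_trace_def
  proof (intro allI impI)
    fix e :: real assume e: "e > 0"
    then have e2: "e/2 > 0" by simp
    obtain n where n: "dist (U n) u < e/2" using tendstoD[OF lim e2] eventually_happens'[OF sequentially_bot] by blast
    have ft: "norm (fst (U n) - fst u) < e/2" using dist_fst_le[of "U n" u] n by (simp add: dist_norm)
    have sd: "norm (snd (U n) $ i - snd u $ i) < e/2" for i
    proof -
      have "norm (snd (U n) $ i - snd u $ i) \<le> norm (snd (U n) - snd u)" using Finite_Cartesian_Product.norm_nth_le[of "snd (U n) - snd u" i] by simp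
      then show ?thesis using dist_snd_le[of "U n" u] n by (simp add: dist_norm)
    qed
    have zt: "zero_trace \<Omega> (U n)" using U by simp
    obtain \<phi> where p: "\<phi> \<in> test_fun UNIV" "norm (zext \<Omega> \<phi> - fst (U n)) < e/2"
      "\<forall>i. norm (zext \<Omega> (pd i \<phi>) - snd (U n) $ i) < e/2" "bdry_L2 \<Omega> \<phi> < ennreal (e/2)"
      using zt[unfolded zero_trace_def, rule_format, OF e2] by (elim bexE conjE)
    have tri: "norm (a - c) < e" if "norm (a - b) < e/2" "norm (b - c) < e/2" for a b c :: l2
      using norm_triangle_ineq[of "a - b" "b - c"] that by simp
    have "bdry_L2 \<Omega> \<phi> < ennreal e" using p(4) ennreal_leI[of "e/2" e] e by (simp add: less_le_trans)
    then show "\<exists>\<phi>\<in>test_fun UNIV. norm (zext \<Omega> \<phi> - fst u) < e \<and>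
      (\<forall>i. norm (zext \<Omega> (pd i \<phi>) - snd u $ i) < e) \<and> bdry_L2 \<Omega> \<phi> < ennreal e"
      using tri[OF p(2) ft] tri[OF spec[OF p(3)] sd] by (intro bexI[OF _ p(1)] conjI allI)
  qed
qed

lemma H1_norm_zext:
  assumes "open U" "H1_fun U f"
  shows "H1_norm U f = sqrt ((norm (zext U f))\<^sup>2 + (\<Sum>i\<in>UNIV. (norm (zext U (weak_deriv U i f)))\<^sup>2))"
proof -
  have U: "U \<in> sets lebesgue" using assms(1) by simp
  show ?thesis unfolding H1_norm_def
    using assms(2) by (simp add: zext_norm[OF U] H1_weak_deriv(1)[OF assms] H1_fun_def)
qed

lemma H1_norm_bounds:
  assumes "open U" "H1_fun U f"
  shows "norm (zext U f) \<le> H1_norm U f" "norm (zext U (weak_deriv U i f)) \<le> H1_norm U f"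
proof -
  have "norm (zext U f) = sqrt ((norm (zext U f))\<^sup>2)" by simp
  also have "\<dots> \<le> H1_norm U f" unfolding H1_norm_zext[OF assms] by (intro real_sqrt_le_mono) (simp add: sum_nonneg)
  finally show "norm (zext U f) \<le> H1_norm U f" .
  have "(norm (zext U (weak_deriv U i f)))\<^sup>2 \<le> (\<Sum>i\<in>UNIV. (norm (zext U (weak_deriv U i f)))\<^sup>2)"
    by (rule member_le_sum) auto
  then have "sqrt ((norm (zext U (weak_deriv U i f)))\<^sup>2) \<le> H1_norm U f"
    unfolding H1_norm_zext[OF assms] by (intro real_sqrt_le_mono) (simp add: add_increasing)
  then show "norm (zext U (weak_deriv U i f)) \<le> H1_norm U f" by simp
qed

lemma H1_fun_diff:
  assumes "open U" "H1_fun U f" "H1_fun U g"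
  shows "H1_fun U (%x. f x - g x)" "zext U (%x. f x - g x) = zext U f - zext U g"
    "zext U (weak_deriv U i (%x. f x - g x)) = zext U (weak_deriv U i f) - zext U (weak_deriv U i g)"
proof -
  have U: "U \<in> sets lebesgue" using assms(1) by simp
  have L: "L2_fun U f" "L2_fun U g" using assms by (auto simp: H1_fun_def)
  note z = zext_diff[OF U L]
  show "zext U (%x. f x - g x) = zext U f - zext U g" by (rule z(2))
  have w: "weakly_diff U i (zext U (%x. f x - g x)) (zext U (weak_deriv U i f) - zext U (weak_deriv U i g))" for i
    using H1_weak_deriv(2)[OF assms(1,2), of i] H1_weak_deriv(2)[OF assms(1,3), of i]
    unfolding weakly_diff_def z(2) by (simp add: bounded_bilinear.diff_left[OF bounded_bilinear_pair])
  note H = H1_fun_zextI[OF assms(1) z(1) w]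
  show "H1_fun U (%x. f x - g x)" by (rule H(1))
  show "zext U (weak_deriv U i (%x. f x - g x)) = zext U (weak_deriv U i f) - zext U (weak_deriv U i g)"
    unfolding H(2) using linear_diff[OF bounded_linear.linear[OF bounded_linear_proj[OF U]]]
    by (simp add: proj_zext[OF U H1_weak_deriv(1)[OF assms(1,2)]] proj_zext[OF U H1_weak_deriv(1)[OF assms(1,3)]])
qed

lemma H1_fun_test_fun:
  assumes "open U" "\<phi> \<in> test_fun UNIV"
  shows "H1_fun U \<phi>" "zext U (weak_deriv U i \<phi>) = zext U (pd i \<phi>)"
proof -
  have U: "U \<in> sets lebesgue" using assms(1) by simp
  have w: "weakly_diff U i (zext U \<phi>) (zext U (pd i \<phi>))" for i
    unfolding zext_test_fun_UNIV[OF assms(2) U] zext_test_fun_UNIV[OF test_fun_dir_deriv[OF assms(2)] U] weakly_diff_proj[OF U]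
    by (rule weakly_diff_test_fun[OF assms(2)])
  note H = H1_fun_zextI[OF assms(1) L2_fun_test_fun[OF assms(2) U] w]
  show "H1_fun U \<phi>" by (rule H(1))
  show "zext U (weak_deriv U i \<phi>) = zext U (pd i \<phi>)"
    unfolding H(2) by (rule proj_zext[OF U L2_fun_test_fun[OF test_fun_dir_deriv[OF assms(2)] U]])
qed

lemma has_trace_0_iff:
  assumes \<Omega>: "open \<Omega>" and w: "H1_fun \<Omega> w"
  shows "has_trace \<Omega> w (%x. 0) \<longleftrightarrow> zero_trace \<Omega> (zext \<Omega> w, \<chi> i. zext \<Omega> (weak_deriv \<Omega> i w))"
proof
  have norms: "norm (zext \<Omega> \<phi> - zext \<Omega> w) \<le> H1_norm \<Omega> (%x. \<phi> x - w x)"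
      "norm (zext \<Omega> (pd i \<phi>) - zext \<Omega> (weak_deriv \<Omega> i w)) \<le> H1_norm \<Omega> (%x. \<phi> x - w x)"
      "H1_norm \<Omega> (%x. \<phi> x - w x) = sqrt ((norm (zext \<Omega> \<phi> - zext \<Omega> w))\<^sup>2
        + (\<Sum>i\<in>UNIV. (norm (zext \<Omega> (pd i \<phi>) - zext \<Omega> (weak_deriv \<Omega> i w)))\<^sup>2))"
    if p: "\<phi> \<in> test_fun UNIV" for \<phi> i
  proof -
    note t = H1_fun_test_fun[OF \<Omega> p]
    note d = H1_fun_diff[OF \<Omega> t(1) w]
    show "norm (zext \<Omega> \<phi> - zext \<Omega> w) \<le> H1_norm \<Omega> (%x. \<phi> x - w x)" using H1_norm_bounds(1)[OF \<Omega> d(1)] unfolding d(2) .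
    show "norm (zext \<Omega> (pd i \<phi>) - zext \<Omega> (weak_deriv \<Omega> i w)) \<le> H1_norm \<Omega> (%x. \<phi> x - w x)"
      using H1_norm_bounds(2)[OF \<Omega> d(1), of i] unfolding d(3) t(2) .
    show "H1_norm \<Omega> (%x. \<phi> x - w x) = sqrt ((norm (zext \<Omega> \<phi> - zext \<Omega> w))\<^sup>2
        + (\<Sum>i\<in>UNIV. (norm (zext \<Omega> (pd i \<phi>) - zext \<Omega> (weak_deriv \<Omega> i w)))\<^sup>2))"
      unfolding H1_norm_zext[OF \<Omega> d(1)] d(2,3) t(2) ..
  qed
  {
    assume "has_trace \<Omega> w (%x. 0)"
    then obtain \<phi> where \<phi>0: "(\<forall>n. \<phi> n \<in> test_fun UNIV) \<and> (%n. H1_norm \<Omega> (%x. \<phi> n x - w x)) \<longlonglongrightarrow> 0 \<and>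
       (%n. \<integral>\<^sup>+x\<in>frontier \<Omega>. ennreal ((cmod (\<phi> n x - 0))\<^sup>2) \<partial>surface_measure) \<longlonglongrightarrow> 0"
      unfolding has_trace_def by (elim conjE exE) (rule that, intro conjI)
    then have \<phi>: "\<And>n. \<phi> n \<in> test_fun UNIV" "(%n. H1_norm \<Omega> (%x. \<phi> n x - w x)) \<longlonglongrightarrow> 0"
       "(%n. bdry_L2 \<Omega> (\<phi> n)) \<longlonglongrightarrow> 0" by (simp_all add: bdry_L2_def)
    show "zero_trace \<Omega> (zext \<Omega> w, \<chi> i. zext \<Omega> (weak_deriv \<Omega> i w))"
    proof (rule zero_traceI[OF \<phi>(1) _ _ \<phi>(3)])
      show "(%n. zext \<Omega> (\<phi> n)) \<longlonglongrightarrow> fst (zext \<Omega> w, \<chi> i. zext \<Omega> (weak_deriv \<Omega> i w))"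
        unfolding fst_conv by (rule LIM_zero_cancel, rule Lim_null_comparison[OF always_eventually \<phi>(2)]) (use norms(1) \<phi>(1) in blast)
      show "(%n. zext \<Omega> (pd i (\<phi> n))) \<longlonglongrightarrow> snd (zext \<Omega> w, \<chi> i. zext \<Omega> (weak_deriv \<Omega> i w)) $ i" for i
        unfolding snd_conv vec_lambda_beta
        by (rule LIM_zero_cancel, rule Lim_null_comparison[OF always_eventually \<phi>(2)]) (use norms(2) \<phi>(1) in blast)
    qed
  }
  assume "zero_trace \<Omega> (zext \<Omega> w, \<chi> i. zext \<Omega> (weak_deriv \<Omega> i w))"
  from zero_traceD[OF this] obtain \<phi> where \<phi>0: "(\<forall>n. \<phi> n \<in> test_fun UNIV) \<and> (%n. zext \<Omega> (\<phi> n)) \<longlonglongrightarrow> zext \<Omega> w \<and>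
    (\<forall>i. (%n. zext \<Omega> (pd i (\<phi> n))) \<longlonglongrightarrow> zext \<Omega> (weak_deriv \<Omega> i w)) \<and> (%n. bdry_L2 \<Omega> (\<phi> n)) \<longlonglongrightarrow> 0"
    unfolding fst_conv snd_conv vec_lambda_beta by (elim exE)
  then have \<phi>: "\<And>n. \<phi> n \<in> test_fun UNIV" "(%n. zext \<Omega> (\<phi> n)) \<longlonglongrightarrow> zext \<Omega> w"
    "\<And>i. (%n. zext \<Omega> (pd i (\<phi> n))) \<longlonglongrightarrow> zext \<Omega> (weak_deriv \<Omega> i w)" "(%n. bdry_L2 \<Omega> (\<phi> n)) \<longlonglongrightarrow> 0" by simp_all
  have "(%n. H1_norm \<Omega> (%x. \<phi> n x - w x)) \<longlonglongrightarrow> sqrt (0\<^sup>2 + (\<Sum>i\<in>(UNIV::3 set). 0\<^sup>2))"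
    unfolding norms(3)[OF \<phi>(1)]
    by (intro tendsto_real_sqrt tendsto_add tendsto_sum tendsto_power tendsto_norm_zero LIM_zero \<phi>)
  then have "(%n. H1_norm \<Omega> (%x. \<phi> n x - w x)) \<longlonglongrightarrow> 0" by simp
  then show "has_trace \<Omega> w (%x. 0)"
    unfolding has_trace_def using w \<phi>(1,4) by (intro conjI exI[of _ \<phi>]) (simp_all add: bdry_L2_def)
qed

subsection \<open>The cosine transform of decaying functions\<close>

lemmas HK_integral_diff = Henstock_Kurzweil_Integration.integral_diff
  and HK_integral_sum = Henstock_Kurzweil_Integration.integral_sum
  and HK_integral_add = Henstock_Kurzweil_Integration.integral_add
  and HK_integral_cong = Henstock_Kurzweil_Integration.integral_cong
  and HK_integral_combine = Henstock_Kurzweil_Integration.integral_combine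
  and HK_integral_mult_right = Henstock_Kurzweil_Integration.integral_mult_right

text \<open>The integral is a limit of Riemann sums, and these stay in the subspace. It is applied
  to the subspace of zero-trace pairs.\<close>

lemma integral_in_closed_subspace:
  fixes F :: "real => 'a::banach"
  assumes F: "continuous_on {a..b} F" and S: "closed S" "subspace S" and FS: "\<And>t. t \<in> {a..b} ==> F t \<in> S"
  shows "integral {a..b} F \<in> S"
proof (rule ccontr)
  assume "integral {a..b} F \<notin> S"
  then have "integral {a..b} F \<in> - S" "open (- S)" using S(1) by auto
  then obtain e where e: "e > 0" "ball (integral {a..b} F) e \<subseteq> - S" using open_contains_ball by blast
  have "(F has_integral integral {a..b} F) {a..b}" by (intro integrable_integral integrable_continuous_interval F)
  from has_integral_real[THEN iffD1, rule_format, OF this e(1)]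
  obtain \<gamma> where \<gamma>: "gauge \<gamma>" "\<forall>D. D tagged_division_of {a..b} \<and> \<gamma> fine D -->
      norm ((\<Sum>(x,k)\<in>D. measure lborel k *\<^sub>R F x) - integral {a..b} F) < e"
    by (elim exE conjE)
  obtain D where D: "D tagged_division_of {a..b}" "\<gamma> fine D" by (rule fine_division_exists_real[OF \<gamma>(1)])
  have "(\<Sum>(x,k)\<in>D. measure lborel k *\<^sub>R F x) \<in> S"
  proof (rule subspace_sum[OF S(2)])
    fix y assume y: "y \<in> D"
    obtain x k where xk: "y = (x, k)" by (cases y)
    then have "x \<in> {a..b}" using tagged_division_ofD(2,3)[OF D(1)] y by blast
    then show "(case y of (x, k) => measure lborel k *\<^sub>R F x) \<in> S" using FS subspace_scale[OF S(2)] by (simp add: xk)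
  qed
  moreover have "(\<Sum>(x,k)\<in>D. measure lborel k *\<^sub>R F x) \<in> ball (integral {a..b} F) e"
    using spec[OF \<gamma>(2), of D] D by (simp add: dist_norm norm_minus_commute)
  ultimately show False using e(2) by blast
qed

definition decay :: "real => (real => 'a::real_normed_vector) => bool"
  where "decay d g \<longleftrightarrow> continuous_on {0..} g \<and> (\<exists>C. \<forall>t\<ge>0. norm (g t) \<le> C * exp (- d * t))"

text \<open>The local energy decay is available for positive times only; the value at time 0 is
  absorbed into the constant.\<close>

lemma decayI:
  assumes "continuous_on {0..} g" "\<And>t. t > 0 ==> norm (g t) \<le> C * exp (- d * t)"
  shows "decay d g"
  unfolding decay_def
proof (intro conjI exI allI impI)
  fix t :: real assume t: "t \<ge> 0"
  show "norm (g t) \<le> (\<bar>C\<bar> + norm (g 0)) * exp (- d * t)"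
  proof (cases "t = 0")
    case False
    then have "norm (g t) \<le> C * exp (- d * t)" using assms(2) t by simp
    also have "\<dots> \<le> (\<bar>C\<bar> + norm (g 0)) * exp (- d * t)"
      by (rule mult_right_mono) (use norm_ge_zero[of "g 0"] in linarith, simp)
    finally show ?thesis .
  qed simp
qed (rule assms)

lemma decay_continuous: "decay d g ==> continuous_on {0..} g" by (simp add: decay_def)

lemma decayE:
  assumes "decay d g" obtains C where "C > 0" "\<And>t. t \<ge> 0 ==> norm (g t) \<le> C * exp (- d * t)"
proof -
  obtain C where C: "\<forall>t\<ge>0. norm (g t) \<le> C * exp (- d * t)" using assms by (auto simp: decay_def)
  show thesis
  proof (rule that[of "\<bar>C\<bar> + 1"])
    fix t :: real assume "t \<ge> 0"
    then have "norm (g t) \<le> C * exp (- d * t)" using C by simp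
    also have "\<dots> \<le> (\<bar>C\<bar> + 1) * exp (- d * t)" by (rule mult_right_mono) auto
    finally show "norm (g t) \<le> (\<bar>C\<bar> + 1) * exp (- d * t)" .
  qed simp
qed

lemma decay_bounded_linear:
  assumes h: "bounded_linear h" and g: "decay d g"
  shows "decay d (%t. h (g t))"
proof -
  obtain K where K: "K > 0" "\<And>x. norm (h x) \<le> norm x * K" using bounded_linear.pos_bounded[OF h] by blast
  obtain C where C: "\<And>t. t \<ge> 0 ==> norm (g t) \<le> C * exp (- d * t)" using decayE[OF g] by metis
  show ?thesis
  proof (rule decayI[of _ "C * K"])
    show "continuous_on {0..} (%t. h (g t))" by (rule bounded_linear.continuous_on[OF h decay_continuous[OF g]])
    fix t :: real assume t: "t > 0"
    have "norm (h (g t)) \<le> norm (g t) * K" by (rule K(2))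
    also have "\<dots> \<le> (C * exp (- d * t)) * K" using C[of t] t K(1) by (intro mult_right_mono) auto
    finally show "norm (h (g t)) \<le> C * K * exp (- d * t)" by (simp add: algebra_simps)
  qed
qed

lemma decay_add:
  assumes "decay d f" "decay d g" shows "decay d (%t. f t + g t)"
proof -
  obtain C where C: "\<And>t. t \<ge> 0 ==> norm (f t) \<le> C * exp (- d * t)" using decayE[OF assms(1)] by metis
  obtain D where D: "\<And>t. t \<ge> 0 ==> norm (g t) \<le> D * exp (- d * t)" using decayE[OF assms(2)] by metis
  show ?thesis
  proof (rule decayI[of _ "C + D"])
    show "continuous_on {0..} (%t. f t + g t)" by (intro continuous_on_add decay_continuous[OF assms(1)] decay_continuous[OF assms(2)])
    fix t :: real assume t: "t > 0"
    show "norm (f t + g t) \<le> (C + D) * exp (- d * t)"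
      using norm_triangle_ineq[of "f t" "g t"] C[of t] D[of t] t by (simp add: distrib_right)
  qed
qed

lemma decay_uminus: "decay d f ==> decay d (%t. - f t)"
  by (rule decay_bounded_linear[OF bounded_linear_minus[OF bounded_linear_ident]])

lemma decay_diff: "decay d f ==> decay d g ==> decay d (%t. f t - g t)"
  using decay_add[OF _ decay_uminus, of d f g] by simp

lemma decay_zero: "decay d (%t. 0)" by (rule decayI[of _ 0]) auto

lemma decay_sum: "(\<And>i. i \<in> I ==> decay d (f i)) ==> decay d (%t. \<Sum>i\<in>I. f i t)"
  by (induction I rule: infinite_finite_induct) (simp_all add: decay_zero decay_add)

lemma integral_exp_le:
  fixes g :: "real => 'a::banach"
  assumes g: "continuous_on {a..b} g" and ab: "a \<le> b" and e: "e > 0"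
    and le: "\<And>t. t \<in> {a..b} ==> norm (g t) \<le> C * exp (- e * t)"
  shows "norm (integral {a..b} g) \<le> C / e * exp (- e * a)"
proof -
  have "0 \<le> C * exp (- e * a)" using order_trans[OF norm_ge_zero le[of a]] ab by simp
  then have C: "0 \<le> C" by (simp add: zero_le_mult_iff)
  have hi: "((%t. C * exp (- e * t)) has_integral (- C / e * exp (- e * b)) - (- C / e * exp (- e * a))) {a..b}"
    by (rule fundamental_theorem_of_calculus[OF ab])
      (use e in \<open>auto intro!: derivative_eq_intros simp: has_real_derivative_iff_has_vector_derivative[symmetric]\<close>)
  have "norm (integral {a..b} g) \<le> integral {a..b} (%t. C * exp (- e * t))"
    by (rule integral_norm_bound_integral[OF integrable_continuous_interval[OF g] has_integral_integrable[OF hi] le])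
  also have "\<dots> = C / e * exp (- e * a) - C / e * exp (- e * b)" using integral_unique[OF hi] by simp
  also have "\<dots> \<le> C / e * exp (- e * a)" using C e by simp
  finally show ?thesis .
qed

text \<open>A limit along the integers; the integrands decay exponentially, so this is the integral
  over the half line, with an explicit rate of convergence in \<open>improper_bound\<close>.\<close>

definition improper :: "(real => 'a::banach) => 'a" where "improper g = lim (%n. integral {0..real n} g)"

lemma improper_bound:
  fixes g :: "real => 'a::banach"
  assumes g: "continuous_on {0..} g" and e: "e > 0" and le: "\<And>t. t \<ge> 0 ==> norm (g t) \<le> C * exp (- e * t)"
  shows "(%n. integral {0..real n} g) \<longlonglongrightarrow> improper g"
    and "norm (integral {0..real n} g - improper g) \<le> C / e * exp (- e * real n)"
proof -
  let ?I = "%n. integral {0..real n} g" and ?b = "%n::nat. C / e * exp (- e * real n)"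
  have gc: "continuous_on {a..b} g" if "0 \<le> a" for a b by (rule continuous_on_subset[OF g]) (use that in auto)
  have d: "norm (?I n - ?I m) \<le> ?b n" if nm: "n \<le> m" for n m
  proof -
    have "?I n + integral {real n..real m} g = ?I m"
      by (rule HK_integral_combine) (use nm gc in \<open>auto intro: integrable_continuous_interval\<close>)
    then have "?I n - ?I m = - integral {real n..real m} g" by (simp add: algebra_simps)
    then show ?thesis using integral_exp_le[OF gc _ e, of "real n" "real m" C] le nm by simp
  qed
  have b0: "?b \<longlonglongrightarrow> 0" using e by real_asymp
  have "Cauchy ?I"
  proof (rule CauchyI)
    fix \<epsilon> :: real assume \<epsilon>: "\<epsilon> > 0"
    then obtain M where M: "?b M < \<epsilon> / 2"
      using order_tendstoD(2)[OF b0, of "\<epsilon> / 2"] eventually_happens'[OF sequentially_bot] by auto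
    show "\<exists>M. \<forall>m\<ge>M. \<forall>n\<ge>M. norm (?I m - ?I n) < \<epsilon>"
    proof (intro exI allI impI)
      fix m n assume mn: "M \<le> m" "M \<le> n"
      have "?I m - ?I n = (?I M - ?I n) - (?I M - ?I m)" by simp
      then have "norm (?I m - ?I n) \<le> norm (?I M - ?I n) + norm (?I M - ?I m)" by (metis norm_triangle_ineq4)
      then show "norm (?I m - ?I n) < \<epsilon>" using d[OF mn(1)] d[OF mn(2)] M by linarith
    qed
  qed
  then show lim: "?I \<longlonglongrightarrow> improper g" unfolding improper_def using Cauchy_convergent convergent_LIMSEQ_iff by blast
  have "(%m. norm (?I n - ?I m)) \<longlonglongrightarrow> norm (?I n - improper g)" by (intro tendsto_intros lim)
  then show "norm (?I n - improper g) \<le> ?b n"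
    by (rule tendsto_upperbound) (rule eventually_sequentiallyI[of n], erule d, simp)
qed

lemma improper_limit:
  fixes g :: "real => 'a::banach"
  assumes "decay e g" "e > 0" shows "(%n. integral {0..real n} g) \<longlonglongrightarrow> improper g"
proof -
  obtain C where C: "\<And>t. t \<ge> 0 ==> norm (g t) \<le> C * exp (- e * t)" using decayE[OF assms(1)] by metis
  show ?thesis by (rule improper_bound(1)[OF decay_continuous[OF assms(1)] assms(2) C])
qed

lemma improperI: "(%n. integral {0..real n} g) \<longlonglongrightarrow> L ==> improper g = L"
  unfolding improper_def by (rule limI)

lemma decay_integrable: "decay e (g :: real => 'a::banach) ==> 0 \<le> a ==> g integrable_on {a..b}"
  by (rule integrable_continuous_interval[OF continuous_on_subset[OF decay_continuous]]) auto

lemma improper_bounded_linear: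
  assumes g: "decay e g" "e > 0" and h: "bounded_linear h"
  shows "improper (%t. h (g t)) = h (improper g)"
proof (rule improperI)
  have "integral {0..real n} (%t. h (g t)) = h (integral {0..real n} g)" for n
    using integral_linear[OF decay_integrable[OF g(1)] h] by (simp add: o_def)
  then show "(%n. integral {0..real n} (%t. h (g t))) \<longlonglongrightarrow> h (improper g)"
    using bounded_linear.tendsto[OF h improper_limit[OF g]] by simp
qed

lemma improper_sum:
  assumes "\<And>i. i \<in> I ==> decay e (g i)" "e > 0" "finite I"
  shows "improper (%t. \<Sum>i\<in>I. g i t) = (\<Sum>i\<in>I. improper (g i))"
proof (rule improperI)
  have "integral {0..real n} (%t. \<Sum>i\<in>I. g i t) = (\<Sum>i\<in>I. integral {0..real n} (g i))" for n
    by (rule HK_integral_sum[OF assms(3)]) (rule decay_integrable[OF assms(1)], simp_all)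
  then show "(%n. integral {0..real n} (%t. \<Sum>i\<in>I. g i t)) \<longlonglongrightarrow> (\<Sum>i\<in>I. improper (g i))"
    using tendsto_sum[OF improper_limit[OF assms(1,2)], of I] by simp
qed

lemma cmod_cos_sin_le: "cmod (cos z) \<le> exp \<bar>Im z\<bar>" "cmod (sin z) \<le> exp \<bar>Im z\<bar>"
proof -
  have avg: "x \<le> (a + b) / 2 ==> b \<le> X ==> a \<le> X ==> x \<le> X" for x a b X :: real by simp
  have e: "exp (Im z) \<le> exp \<bar>Im z\<bar>" "exp (- Im z) \<le> exp \<bar>Im z\<bar>" by auto
  have "cmod (cos z) \<le> (cmod (exp (\<i> * z)) + cmod (exp (- (\<i> * z)))) / 2"
    unfolding cos_exp_eq norm_divide using norm_triangle_ineq[of "exp (\<i> * z)" "exp (- (\<i> * z))"] by simp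
  then have "cmod (cos z) \<le> (exp (- Im z) + exp (Im z)) / 2" by (simp add: norm_exp_eq_Re)
  then show "cmod (cos z) \<le> exp \<bar>Im z\<bar>" by (rule avg[OF _ e])
  have "cmod (sin z) \<le> (cmod (exp (\<i> * z)) + cmod (exp (- (\<i> * z)))) / 2"
    unfolding sin_exp_eq norm_divide using norm_triangle_ineq4[of "exp (\<i> * z)" "exp (- (\<i> * z))"] by (simp add: norm_mult)
  then have "cmod (sin z) \<le> (exp (- Im z) + exp (Im z)) / 2" by (simp add: norm_exp_eq_Re)
  then show "cmod (sin z) \<le> exp \<bar>Im z\<bar>" by (rule avg[OF _ e])
qed

lemma cmod_cos_sin_le': "0 \<le> t ==> cmod (cos (\<tau> * complex_of_real t)) \<le> exp (\<bar>Im \<tau>\<bar> * t)"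
  "0 \<le> t ==> cmod (sin (\<tau> * complex_of_real t)) \<le> exp (\<bar>Im \<tau>\<bar> * t)"
  using cmod_cos_sin_le[of "\<tau> * complex_of_real t"] by (simp_all add: abs_mult)

lemma continuous_on_cos_complex: "continuous_on S (%t. cos (\<tau> * complex_of_real t))"
  by (intro continuous_intros)

text \<open>The cosine grows at most like exp (|Im \<tau>| t), which leaves the rate d - |Im
  \<tau>|. The bilinear operation is a parameter so that scalar and \<open>l2\<close>-valued
  functions are covered together.\<close>

lemma decay_cos:
  assumes op: "bounded_bilinear op" and f: "decay d f"
  shows "decay (d - \<bar>Im \<tau>\<bar>) (%t. op (cos (\<tau> * complex_of_real t)) (f t))"
proof -
  obtain K where K: "K > 0" "\<And>a b. norm (op a b) \<le> norm a * norm b * K" using bounded_bilinear.pos_bounded[OF op] by blast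
  obtain C where C: "C > 0" "\<And>t. t \<ge> 0 ==> norm (f t) \<le> C * exp (- d * t)" using decayE[OF f] by metis
  show ?thesis
  proof (rule decayI[of _ "C * K"])
    show "continuous_on {0..} (%t. op (cos (\<tau> * complex_of_real t)) (f t))"
      by (rule bounded_bilinear.continuous_on[OF op continuous_on_cos_complex decay_continuous[OF f]])
    fix t :: real assume t: "t > 0"
    have "norm (op (cos (\<tau> * complex_of_real t)) (f t)) \<le> cmod (cos (\<tau> * complex_of_real t)) * norm (f t) * K" by (rule K(2))
    also have "\<dots> \<le> exp (\<bar>Im \<tau>\<bar> * t) * (C * exp (- d * t)) * K"
      using t K(1) C by (intro mult_right_mono mult_mono cmod_cos_sin_le') auto
    also have "\<dots> = C * K * exp (- (d - \<bar>Im \<tau>\<bar>) * t)" by (simp add: exp_add[symmetric] algebra_simps exp_diff[symmetric])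
    finally show "norm (op (cos (\<tau> * complex_of_real t)) (f t)) \<le> C * K * exp (- (d - \<bar>Im \<tau>\<bar>) * t)" .
  qed
qed

lemma bounded_bilinear_cscale: "bounded_bilinear cscale"
proof
  fix a b :: complex and u v :: l2 and r :: real
  obtain f where f: "is_L2 f" "u = abs_l2 f" by (cases u)
  note s = abs_l2_simps[OF is_L2_cmult[OF f(1)] is_L2_cmult[OF f(1)]]
  show "cscale (a + b) u = cscale a u + cscale b u"
    unfolding f(2) cscale_abs_l2[OF f(1)] s by (simp add: distrib_right)
  show "cscale a (u + v) = cscale a u + cscale a v"
    by (rule linear_add[OF bounded_linear.linear[OF bounded_linear_cscale]])
  show "cscale a (r *\<^sub>R u) = r *\<^sub>R cscale a u"
    by (rule linear_scale[OF bounded_linear.linear[OF bounded_linear_cscale]])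
  show "cscale (r *\<^sub>R a) u = r *\<^sub>R cscale a u"
    unfolding f(2) cscale_abs_l2[OF f(1)] s by simp
  show "\<exists>K. \<forall>a b. norm (cscale a b) \<le> norm a * norm b * K"
    by (intro exI[of _ 1]) (simp add: norm_cscale_le)
qed

definition cosine_transform :: "(real => complex) => complex => complex"
  where "cosine_transform p \<tau> = improper (%t. cos (\<tau> * complex_of_real t) * p t)"

definition cosine_l2 :: "(real => l2) => complex => l2"
  where "cosine_l2 f \<tau> = improper (%t. cscale (cos (\<tau> * complex_of_real t)) (f t))"

lemmas decay_cos_mult = decay_cos[OF bounded_bilinear_mult]
lemmas decay_cos_cscale = decay_cos[OF bounded_bilinear_cscale]

text \<open>Bounded complex linear functionals commute with the transform. Through this rule
  statements about the \<open>l2\<close>-valued transform reduce to scalar ones.\<close>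

lemma cosine_l2_linear:
  assumes f: "decay d f" "\<bar>Im \<tau>\<bar> < d" and h: "bounded_linear h" "\<And>c u. h (cscale c u) = c * h u"
  shows "h (cosine_l2 f \<tau>) = cosine_transform (%t. h (f t)) \<tau>"
  using improper_bounded_linear[OF decay_cos_cscale[OF f(1)] _ h(1), of \<tau>] f(2)
  by (simp add: cosine_l2_def cosine_transform_def h(2))

text \<open>Two integrations by parts are packed into one antiderivative W of the difference of the
  integrands. The boundary term at 0 vanishes because P 0 = 0 and sin 0 = 0, whatever p 0 is, and
  the one at infinity vanishes by decay.\<close>

lemma cosine_transform_wave:
  assumes dec: "decay d p" "decay d P" "decay d Q" and \<tau>: "\<bar>Im \<tau>\<bar> < d"
    and deriv: "\<And>t. t \<ge> 0 ==> (p has_vector_derivative P t) (at t within {0..})"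
    and PQ: "\<And>t. t \<ge> 0 ==> P t = - integral {0..t} Q"
  shows "cosine_transform Q \<tau> = \<tau>\<^sup>2 * cosine_transform p \<tau>"
proof -
  let ?c = "%t. cos (\<tau> * complex_of_real t)" and ?s = "%t. sin (\<tau> * complex_of_real t)"
  define W where "W t = ?c t * P t + \<tau> * ?s t * p t" for t
  have W: "integral {0..real n} (%t. \<tau>\<^sup>2 * (?c t * p t) - ?c t * Q t) = W (real n)" for n
  proof -
    have "((%t. \<tau>\<^sup>2 * (?c t * p t) - ?c t * Q t) has_integral (W (real n) - W 0)) {0..real n}"
    proof (rule fundamental_theorem_of_calculus)
      fix t assume t: "t \<in> {0..real n}"
      have c: "(?c has_vector_derivative - sin (\<tau> * complex_of_real t) * \<tau>) (at t within {0..real n})"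
        by (rule has_vector_derivative_real_field) (auto intro!: derivative_eq_intros)
      have s: "((%t. \<tau> * ?s t) has_vector_derivative \<tau> * (cos (\<tau> * complex_of_real t) * \<tau>)) (at t within {0..real n})"
        by (rule has_vector_derivative_real_field[of "%z. \<tau> * sin (\<tau> * z)"]) (auto intro!: derivative_eq_intros)
      have Qc: "continuous_on {0..real n} Q" by (rule continuous_on_subset[OF decay_continuous[OF dec(3)]]) auto
      have "((%u. - integral {0..u} Q) has_vector_derivative - Q t) (at t within {0..real n})"
        by (intro has_vector_derivative_minus integral_has_vector_derivative[OF Qc t])
      then have P: "(P has_vector_derivative - Q t) (at t within {0..real n})"
        by (rule has_vector_derivative_transform[OF t, rotated]) (simp add: PQ)
      have p: "(p has_vector_derivative P t) (at t within {0..real n})"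
        by (rule has_vector_derivative_within_subset[OF deriv]) (use t in auto)
      show "(W has_vector_derivative \<tau>\<^sup>2 * (?c t * p t) - ?c t * Q t) (at t within {0..real n})"
        unfolding W_def
        by (rule has_vector_derivative_eq_rhs[OF has_vector_derivative_add[OF has_vector_derivative_mult[OF c P] has_vector_derivative_mult[OF s p]]])
          (simp add: power2_eq_square algebra_simps)
    qed simp
    note hi = integral_unique[OF this]
    have "W 0 = 0" using PQ[of 0] by (simp add: W_def)
    then show ?thesis unfolding hi by simp
  qed
  have e: "d - \<bar>Im \<tau>\<bar> > 0" using \<tau> by simp
  note D = decay_cos_mult[OF dec(1), of \<tau>] decay_cos_mult[OF dec(3), of \<tau>]
  have diffW: "\<tau>\<^sup>2 * integral {0..real n} (%t. ?c t * p t) - integral {0..real n} (%t. ?c t * Q t) = W (real n)" for n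
  proof -
    have i: "(%t. ?c t * p t) integrable_on {0..real n}" "(%t. ?c t * Q t) integrable_on {0..real n}"
      using decay_integrable[OF D(1)] decay_integrable[OF D(2)] by simp_all
    have i2: "(%t. \<tau>\<^sup>2 * (?c t * p t)) integrable_on {0..real n}" by (rule integrable_on_mult_right[OF i(1)])
    show ?thesis unfolding W[symmetric] HK_integral_diff[OF i2 i(2)] by simp
  qed
  have "(%n. \<tau>\<^sup>2 * integral {0..real n} (%t. ?c t * p t) - integral {0..real n} (%t. ?c t * Q t))
      \<longlonglongrightarrow> \<tau>\<^sup>2 * cosine_transform p \<tau> - cosine_transform Q \<tau>"
    unfolding cosine_transform_def by (intro tendsto_intros improper_limit[OF D(1) e] improper_limit[OF D(2) e])
  then have lim1: "(%n. W (real n)) \<longlonglongrightarrow> \<tau>\<^sup>2 * cosine_transform p \<tau> - cosine_transform Q \<tau>"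
    unfolding diffW .
  have "(%n. W (real n)) \<longlonglongrightarrow> 0"
  proof -
    obtain C1 where C1: "C1 > 0" "\<And>t. t \<ge> 0 ==> norm (P t) \<le> C1 * exp (- d * t)" using decayE[OF dec(2)] by metis
    obtain C2 where C2: "C2 > 0" "\<And>t. t \<ge> 0 ==> norm (p t) \<le> C2 * exp (- d * t)" using decayE[OF dec(1)] by metis
    define e where "e = d - \<bar>Im \<tau>\<bar>"
    have e0: "e > 0" using e by (simp add: e_def)
    have "norm (W t) \<le> (C1 + cmod \<tau> * C2) * exp (- e * t)" if t: "t \<ge> 0" for t
    proof -
      have "norm (W t) \<le> cmod (?c t) * norm (P t) + cmod \<tau> * cmod (?s t) * norm (p t)"
        unfolding W_def by (rule order_trans[OF norm_triangle_ineq]) (simp add: norm_mult)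
      also have "\<dots> \<le> exp (\<bar>Im \<tau>\<bar> * t) * (C1 * exp (- d * t)) + cmod \<tau> * exp (\<bar>Im \<tau>\<bar> * t) * (C2 * exp (- d * t))"
        using t C1 C2 by (intro add_mono mult_mono mult_left_mono cmod_cos_sin_le') auto
      also have "\<dots> = (C1 + cmod \<tau> * C2) * (exp (\<bar>Im \<tau>\<bar> * t) * exp (- d * t))" by (simp add: algebra_simps)
      also have "exp (\<bar>Im \<tau>\<bar> * t) * exp (- d * t) = exp (- e * t)" by (simp add: exp_add[symmetric] e_def algebra_simps)
      finally show ?thesis .
    qed
    then have "\<forall>n. norm (W (real n)) \<le> (C1 + cmod \<tau> * C2) * exp (- e * real n)" by simp
    moreover have "(%n. (C1 + cmod \<tau> * C2) * exp (- e * real n)) \<longlonglongrightarrow> 0" using e0 by real_asymp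
    ultimately show ?thesis by (rule Lim_null_comparison[OF always_eventually])
  qed
  from LIMSEQ_unique[OF lim1 this] have "\<tau>\<^sup>2 * cosine_transform p \<tau> - cosine_transform Q \<tau> = 0" .
  then show ?thesis by simp
qed

lemma cosine_transform_holomorphic:
  assumes p: "decay d p" shows "cosine_transform p holomorphic_on {\<tau>. \<bar>Im \<tau>\<bar> < d}"
proof (rule holomorphic_uniform_sequence)
  let ?f = "%n \<tau>. integral {0..real n} (%t. cos (\<tau> * complex_of_real t) * p t)"
  show "open {\<tau>. \<bar>Im \<tau>\<bar> < d}" by (intro open_Collect_less continuous_intros)
  have pc: "continuous_on {0..real n} p" for n by (rule continuous_on_subset[OF decay_continuous[OF p]]) auto
  show "?f n holomorphic_on {\<tau>. \<bar>Im \<tau>\<bar> < d}" for n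
  proof (rule holomorphic_on_subset)
    have "(%\<tau>. integral (cbox 0 (real n)) (%t. cos (\<tau> * complex_of_real t) * p t)) holomorphic_on UNIV"
    proof (rule leibniz_rule_holomorphic[where fx="%x t. - (sin (x * complex_of_real t) * complex_of_real t) * p t"])
      show "((%x. cos (x * complex_of_real t) * p t) has_field_derivative - (sin (x * complex_of_real t) * complex_of_real t) * p t) (at x within UNIV)" for x t
        by (auto intro!: derivative_eq_intros)
      show "(%t. cos (x * complex_of_real t) * p t) integrable_on cbox 0 (real n)" for x
        by (intro integrable_continuous continuous_intros) (use pc in simp)
      have "continuous_on (UNIV \<times> cbox 0 (real n)) (%z::complex \<times> real. p (snd z))"
        by (rule continuous_on_compose2[OF pc continuous_on_snd[OF continuous_on_id]]) auto
      then show "continuous_on (UNIV \<times> cbox 0 (real n)) (%(x, t). - (sin (x * complex_of_real t) * complex_of_real t) * p t)"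
        unfolding case_prod_beta by (intro continuous_intros)
    qed simp
    then show "?f n holomorphic_on UNIV" by simp
  qed simp
  fix x assume x: "x \<in> {\<tau>. \<bar>Im \<tau>\<bar> < d}"
  \<comment> \<open>Half the distance to the edge of the strip: on the disc of this radius the
    integrands still decay at the uniform rate r.\<close>
  define r where "r = (d - \<bar>Im x\<bar>) / 2"
  have r: "r > 0" using x by (simp add: r_def)
  have Im: "\<bar>Im y\<bar> \<le> d - r" if "y \<in> cball x r" for y
  proof -
    have "\<bar>Im (y - x)\<bar> \<le> r" using abs_Im_le_cmod[of "y - x"] that by (simp add: dist_norm norm_minus_commute)
    then have "\<bar>Im y\<bar> \<le> \<bar>Im x\<bar> + r" by simp
    moreover have "d - r = \<bar>Im x\<bar> + r" by (simp add: r_def field_simps)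
    ultimately show ?thesis by simp
  qed
  obtain C where C: "C > 0" "\<And>t. t \<ge> 0 ==> norm (p t) \<le> C * exp (- d * t)" using decayE[OF p] by metis
  have le: "norm (?f n y - cosine_transform p y) \<le> C / r * exp (- r * real n)" if y: "y \<in> cball x r" for n y
    unfolding cosine_transform_def
  proof (rule improper_bound(2)[OF decay_continuous[OF decay_cos_mult[OF p]] r])
    fix t :: real assume t: "t \<ge> 0"
    have "norm (cos (y * complex_of_real t) * p t) \<le> exp (\<bar>Im y\<bar> * t) * (C * exp (- d * t))"
      unfolding norm_mult using t C by (intro mult_mono cmod_cos_sin_le') auto
    also have "\<dots> \<le> exp ((d - r) * t) * (C * exp (- d * t))"
      using Im[OF y] t C(1) by (intro mult_right_mono) (auto intro: mult_right_mono)
    also have "\<dots> = C * (exp ((d - r) * t) * exp (- d * t))" by simp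
    also have "exp ((d - r) * t) * exp (- d * t) = exp (- r * t)" by (simp add: exp_add[symmetric] algebra_simps)
    finally show "norm (cos (y * complex_of_real t) * p t) \<le> C * exp (- r * t)" .
  qed
  have lim: "(%n. C / r * exp (- r * real n)) \<longlonglongrightarrow> 0" using r by real_asymp
  have "uniform_limit (cball x r) ?f (cosine_transform p) sequentially"
  proof (rule uniform_limitI)
    fix e :: real assume "e > 0"
    then have "\<forall>\<^sub>F n in sequentially. C / r * exp (- r * real n) < e" using order_tendstoD(2)[OF lim] by simp
    then show "\<forall>\<^sub>F n in sequentially. \<forall>y\<in>cball x r. dist (?f n y) (cosine_transform p y) < e"
    proof eventually_elim
      case (elim n)
      show ?case using le_less_trans[OF le elim] by (simp add: dist_norm)
    qed
  qed
  moreover have "cball x r \<subseteq> {\<tau>. \<bar>Im \<tau>\<bar> < d}" using Im r by fastforce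
  ultimately show "\<exists>r>0. cball x r \<subseteq> {\<tau>. \<bar>Im \<tau>\<bar> < d} \<and> uniform_limit (cball x r) ?f (cosine_transform p) sequentially"
    using r by blast
qed

text \<open>Products of cosines are sums of cosines, so the hypothesis extends to integrals of p
  against polynomials in cos (\<zeta> t). On [0, N] such functions approximate p, while beyond N
  they stay bounded and p is exponentially small. Testing p with the approximation bounds the
  integral of p^2 over [0, N].\<close>

lemma cosine_integrals_zero_imp_0:
  fixes p :: "real => real"
  assumes pc: "continuous_on {0..} p" and d: "d > 0" and le: "\<And>t. t \<ge> 0 ==> \<bar>p t\<bar> \<le> C * exp (- d * t)" and C: "C > 0"
    and zero: "\<And>\<xi>. (%n. integral {0..real n} (%t. cos (\<xi> * t) * p t)) \<longlonglongrightarrow> 0" and t0: "t0 \<ge> 0"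
  shows "p t0 = 0"
proof -
  have pc': "continuous_on {a..b} p" if "0 \<le> a" for a b by (rule continuous_on_subset[OF pc]) (use that in auto)
  have pb: "\<bar>p t\<bar> \<le> C" if "t \<ge> 0" for t
  proof -
    have "C * exp (- d * t) \<le> C * 1" using that d C by (intro mult_left_mono) auto
    then show ?thesis using le[OF that] by simp
  qed
  \<comment> \<open>The additional cosine factor is what the induction needs: one factor cos
    (\<zeta> t) is merged with it by the product formula, which shifts the frequency \<eta> by
    \<zeta> in both directions.\<close>
  have A: "(%n. integral {0..real n} (%t. cos (\<eta> * t) * cos (\<zeta> * t) ^ k * p t)) \<longlonglongrightarrow> 0" for \<eta> \<zeta> k
  proof (induction k arbitrary: \<eta>)
    case 0 then show ?case using zero by simp
  next
    case (Suc k)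
    let ?F = "%\<eta> t. cos (\<eta> * t) * cos (\<zeta> * t) ^ k * p t"
    have i: "?F \<eta> integrable_on {0..real n}" for \<eta> n
      by (intro integrable_continuous_interval continuous_intros pc') simp
    have eq: "integral {0..real n} (%t. cos (\<eta> * t) * cos (\<zeta> * t) ^ Suc k * p t)
      = (1/2) * (integral {0..real n} (?F (\<eta> + \<zeta>)) + integral {0..real n} (?F (\<eta> - \<zeta>)))" for n
    proof -
      have "cos (\<eta> * t) * cos (\<zeta> * t) ^ Suc k * p t = (1/2) * (?F (\<eta> + \<zeta>) t + ?F (\<eta> - \<zeta>) t)" for t
      proof -
        have "cos (\<eta> * t) * cos (\<zeta> * t) = (1/2) * (cos ((\<eta> + \<zeta>) * t) + cos ((\<eta> - \<zeta>) * t))"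
          by (simp add: distrib_right left_diff_distrib cos_add cos_diff)
        then have "cos (\<eta> * t) * cos (\<zeta> * t) ^ Suc k * p t = ((1/2) * (cos ((\<eta> + \<zeta>) * t) + cos ((\<eta> - \<zeta>) * t))) * (cos (\<zeta> * t) ^ k * p t)"
          by (metis mult.assoc power_Suc)
        moreover have "((1/2) * (X + Y)) * (Z * w) = (1/2) * (X * Z * w + Y * Z * w)" for X Y Z w :: real by (simp add: algebra_simps)
        ultimately show ?thesis by metis
      qed
      then have key: "(%t. cos (\<eta> * t) * cos (\<zeta> * t) ^ Suc k * p t) = (%t. (1/2) * (?F (\<eta> + \<zeta>) t + ?F (\<eta> - \<zeta>) t))" by (rule ext)
      show ?thesis unfolding key HK_integral_mult_right
        HK_integral_add[OF i[of "\<eta> + \<zeta>" n] i[of "\<eta> - \<zeta>" n]] ..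
    qed
    have "(%n. (1/2) * (integral {0..real n} (?F (\<eta> + \<zeta>)) + integral {0..real n} (?F (\<eta> - \<zeta>)))) \<longlonglongrightarrow> (1/2) * (0 + 0)"
      by (intro tendsto_intros Suc.IH)
    then show ?case unfolding eq by simp
  qed
  have B: "(%n. integral {0..real n} (%t. q (cos (\<zeta> * t)) * p t)) \<longlonglongrightarrow> 0" if q: "real_polynomial_function q" for q \<zeta>
  proof -
    obtain a m where q: "q = (%x. \<Sum>i\<le>m. a i * x ^ i)" using q by (auto simp: real_polynomial_function_iff_sum)
    have i: "(%t. a i * (cos (0 * t) * cos (\<zeta> * t) ^ i * p t)) integrable_on {0..real n}" for i n
      by (intro integrable_continuous_interval continuous_intros pc') simp
    have "integral {0..real n} (%t. q (cos (\<zeta> * t)) * p t) = (\<Sum>i\<le>m. a i * integral {0..real n} (%t. cos (0 * t) * cos (\<zeta> * t) ^ i * p t))" for n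
    proof -
      have "integral {0..real n} (%t. q (cos (\<zeta> * t)) * p t) = integral {0..real n} (%t. \<Sum>i\<le>m. a i * (cos (0 * t) * cos (\<zeta> * t) ^ i * p t))"
        by (rule arg_cong[where f="integral _"]) (simp add: q sum_distrib_right mult.assoc)
      also have "\<dots> = (\<Sum>i\<le>m. integral {0..real n} (%t. a i * (cos (0 * t) * cos (\<zeta> * t) ^ i * p t)))"
        by (rule HK_integral_sum[OF finite_atMost i])
      finally show ?thesis by simp
    qed
    moreover have "(%n. \<Sum>i\<le>m. a i * integral {0..real n} (%t. cos (0 * t) * cos (\<zeta> * t) ^ i * p t)) \<longlonglongrightarrow> (\<Sum>i\<le>m. a i * 0)"
      by (intro tendsto_sum tendsto_mult tendsto_const A)
    ultimately show ?thesis by simp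
  qed
  have main: "integral {0..real N} (%t. p t * p t) \<le> e * C / d + (C + e) * C / d * exp (- d * real N)" if N: "N > 0" and e: "e > 0" for N :: nat and e
  proof -
    \<comment> \<open>In the variable y = cos (pi t / N) the interval [0, N] becomes [-1, 1], so a
      polynomial approximation in y is a cosine polynomial in t with base frequency pi / N.\<close>
    have "continuous_on {-1..1} (%y. p (real N / pi * arccos y))"
    proof (rule continuous_on_compose2[OF pc'[of 0 "real N"]])
      show "continuous_on {-1..1} (%y. real N / pi * arccos y)" by (intro continuous_intros) auto
      show "(%y. real N / pi * arccos y) ` {-1..1} \<subseteq> {0..real N}"
        using N arccos_lbound arccos_ubound by (auto simp: field_simps intro!: mult_left_mono mult_nonneg_nonneg)
    qed simp
    then obtain q where q: "real_polynomial_function q" "\<And>y. y \<in> {-1..1} ==> \<bar>p (real N / pi * arccos y) - q y\<bar> < e"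
      using Stone_Weierstrass_real_polynomial_function[OF compact_Icc _ e] by metis
    define Q where "Q t = q (cos (pi / real N * t))" for t
    have "continuous_on UNIV q" by (intro continuous_at_imp_continuous_on ballI continuous_real_polymonial_function q(1))
    then have Qc: "continuous_on S Q" for S unfolding Q_def
      by (rule continuous_on_compose2) (use N in \<open>auto intro!: continuous_intros\<close>)
    have Q1: "\<bar>p t - Q t\<bar> \<le> e" if t: "t \<in> {0..real N}" for t
    proof -
      have "pi / real N * t \<le> pi" using t N by (simp add: field_simps)
      then have "arccos (cos (pi / real N * t)) = pi / real N * t" using t by (intro arccos_cos) auto
      then have "real N / pi * arccos (cos (pi / real N * t)) = t" using N by simp
      then show ?thesis using q(2)[of "cos (pi / real N * t)"] by (simp add: Q_def)
    qed
    \<comment> \<open>The bound holds on the whole half line: the argument of q never leaves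
      [-1, 1], where q is within e of values of p.\<close>
    have Q2: "\<bar>Q t\<bar> \<le> C + e" for t
    proof -
      have y: "cos (pi / real N * t) \<in> {-1..1}" by simp
      have "0 \<le> arccos (cos (pi / real N * t))" using y by (intro arccos_lbound) auto
      then have "\<bar>p (real N / pi * arccos (cos (pi / real N * t)))\<bar> \<le> C" by (intro pb) simp
      then show ?thesis using q(2)[OF y] by (simp add: Q_def)
    qed
    have i: "(%t. Q t * p t) integrable_on {a..b}" "(%t. p t * p t) integrable_on {a..b}" "(%t. (p t - Q t) * p t) integrable_on {a..b}" if "0 \<le> a" for a b
      by (intro integrable_continuous_interval continuous_intros Qc pc' that)+
    have 1: "\<bar>integral {0..real N} (%t. (p t - Q t) * p t)\<bar> \<le> (e * C) / d * exp (- d * 0)"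
      unfolding real_norm_def[symmetric]
    proof (rule integral_exp_le[OF _ _ d])
      show "continuous_on {0..real N} (%t. (p t - Q t) * p t)" by (intro continuous_intros Qc pc') simp_all
      fix t assume t: "t \<in> {0..real N}"
      have "\<bar>(p t - Q t) * p t\<bar> \<le> e * (C * exp (- d * t))" unfolding abs_mult
        using Q1[OF t] le[of t] t e by (intro mult_mono) auto
      then show "norm ((p t - Q t) * p t) \<le> e * C * exp (- d * t)" by simp
    qed simp_all
    have 2: "integral {0..real N} (%t. p t * p t) - e * C / d - (C + e) * C / d * exp (- d * real N) \<le> integral {0..real n} (%t. Q t * p t)" if n: "n \<ge> N" for n
    proof -
      have "\<bar>integral {real N..real n} (%t. Q t * p t)\<bar> \<le> ((C + e) * C) / d * exp (- d * real N)"
        unfolding real_norm_def[symmetric]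
      proof (rule integral_exp_le[OF _ _ d])
        show "continuous_on {real N..real n} (%t. Q t * p t)" by (intro continuous_intros Qc pc') simp
        fix t assume t: "t \<in> {real N..real n}"
        have "\<bar>Q t * p t\<bar> \<le> (C + e) * (C * exp (- d * t))" unfolding abs_mult
          using Q2[of t] le[of t] t e C by (intro mult_mono) auto
        then show "norm (Q t * p t) \<le> (C + e) * C * exp (- d * t)" by simp
      qed (use n in simp)
      moreover have "integral {0..real N} (%t. Q t * p t) + integral {real N..real n} (%t. Q t * p t) = integral {0..real n} (%t. Q t * p t)"
        by (rule HK_integral_combine) (use n i in auto)
      moreover have "integral {0..real N} (%t. p t * p t) - integral {0..real N} (%t. Q t * p t) = integral {0..real N} (%t. (p t - Q t) * p t)"
        by (subst HK_integral_diff[symmetric]) (use i in \<open>auto simp: left_diff_distrib\<close>)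
      ultimately show ?thesis using 1 by simp
    qed
    have "integral {0..real N} (%t. p t * p t) - e * C / d - (C + e) * C / d * exp (- d * real N) \<le> 0"
      by (rule tendsto_lowerbound[OF B[OF q(1), of "pi / real N", folded Q_def]]) (rule eventually_sequentiallyI[of N], erule 2, simp)
    then show ?thesis by simp
  qed
  \<comment> \<open>For fixed N the approximation error e tends to 0. The bound that is left tends
    to 0 as N grows, which forces the integral of p^2 over a fixed interval to vanish.\<close>
  have N1: "integral {0..real N} (%t. p t * p t) \<le> C * C / d * exp (- d * real N)" if N: "N > 0" for N :: nat
  proof (rule field_le_epsilon)
    fix \<epsilon> :: real assume \<epsilon>: "\<epsilon> > 0"
    define e where "e = \<epsilon> * d / (2 * C)"
    have e: "e > 0" using \<epsilon> d C by (simp add: e_def)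
    have "e * C / d = \<epsilon> / 2" using d C by (simp add: e_def)
    moreover have "(C + e) * C / d * exp (- d * real N) \<le> C * C / d * exp (- d * real N) + \<epsilon> / 2"
    proof -
      have "e * C / d * exp (- d * real N) \<le> e * C / d * 1" using e C d by (intro mult_left_mono) auto
      also have "\<dots> = \<epsilon> / 2" using \<open>e * C / d = \<epsilon> / 2\<close> by simp
      finally have x: "e * C / d * exp (- d * real N) \<le> \<epsilon> / 2" .
      have eq: "(C + e) * C / d * X = C * C / d * X + e * C / d * X" for X by (simp add: distrib_right add_divide_distrib)
      show ?thesis unfolding eq by (rule add_left_mono[OF x])
    qed
    moreover have "A = \<epsilon> / 2 ==> Y \<le> Z + \<epsilon> / 2 ==> X \<le> A + Y ==> X \<le> Z + \<epsilon>" for A X Y Z :: real by simp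
    ultimately show "integral {0..real N} (%t. p t * p t) \<le> C * C / d * exp (- d * real N) + \<epsilon>"
      using main[OF N e] by blast
  qed
  have i: "(%t. p t * p t) integrable_on {a..b}" if "0 \<le> a" for a b
    by (intro integrable_continuous_interval continuous_intros pc' that)
  have "integral {0..t0 + 1} (%t. p t * p t) \<le> 0"
  proof (rule tendsto_lowerbound)
    show "(%N. C * C / d * exp (- d * real N)) \<longlonglongrightarrow> 0" using d by real_asymp
    have "integral {0..t0 + 1} (%t. p t * p t) \<le> C * C / d * exp (- d * real N)" if "N \<ge> nat \<lceil>t0 + 1\<rceil>" for N
    proof -
      have N: "t0 + 1 \<le> real N" using that by linarith
      have "integral {0..t0 + 1} (%t. p t * p t) \<le> integral {0..real N} (%t. p t * p t)"
        by (rule integral_subset_le) (use N i in auto)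
      then show ?thesis using N1[of N] N t0 by (cases "N = 0") auto
    qed
    then show "\<forall>\<^sub>F N in sequentially. integral {0..t0 + 1} (%t. p t * p t) \<le> C * C / d * exp (- d * real N)"
      by (rule eventually_sequentiallyI)
  qed simp
  moreover have "0 \<le> integral {0..t0 + 1} (%t. p t * p t)" by (rule integral_nonneg[OF i]) simp_all
  ultimately have "integral {0..t0 + 1} (%t. p t * p t) = 0" by simp
  then have "((%t. p t * p t) has_integral 0) (cbox 0 (t0 + 1))" using integrable_integral[OF i[of 0 "t0 + 1"]] by simp
  then have "p t0 * p t0 = 0"
  proof (rule has_integral_0_cbox_imp_0[rotated 2])
    show "continuous_on (cbox 0 (t0 + 1)) (%t. p t * p t)" unfolding box_real by (intro continuous_intros pc') simp_all
  qed (use t0 in auto)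
  then show ?thesis by simp
qed

lemma cosine_transform_inject:
  assumes p: "decay d p" and d: "d > 0" and zero: "\<And>\<xi>. cosine_transform p (complex_of_real \<xi>) = 0" and t: "t \<ge> 0"
  shows "p t = 0"
proof -
  obtain C where C: "C > 0" "\<And>t. t \<ge> 0 ==> norm (p t) \<le> C * exp (- d * t)" using decayE[OF p] by metis
  have lim: "(%n. integral {0..real n} (%t. cos (complex_of_real \<xi> * complex_of_real t) * p t)) \<longlonglongrightarrow> 0" for \<xi>
    using improper_limit[OF decay_cos_mult[OF p, of "complex_of_real \<xi>"]] zero[of \<xi>] d by (simp add: cosine_transform_def)
  have part: "h (p t) = 0" if h: "bounded_linear h" "\<And>c z. h (complex_of_real c * z) = c * h z" "\<And>z. \<bar>h z\<bar> \<le> cmod z" for h :: "complex => real"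
  proof (rule cosine_integrals_zero_imp_0[OF _ d _ C(1) _ t])
    show "continuous_on {0..} (%t. h (p t))" by (rule bounded_linear.continuous_on[OF h(1) decay_continuous[OF p]])
    show "\<bar>h (p t)\<bar> \<le> C * exp (- d * t)" if "t \<ge> 0" for t using h(3)[of "p t"] C(2)[OF that] by simp
    show "(%n. integral {0..real n} (%t. cos (\<xi> * t) * h (p t))) \<longlonglongrightarrow> 0" for \<xi>
    proof -
      have "integral {0..real n} (%t. cos (\<xi> * t) * h (p t)) = h (integral {0..real n} (%t. cos (complex_of_real \<xi> * complex_of_real t) * p t))" for n
      proof -
        have "(%t. cos (\<xi> * t) * h (p t)) = h \<circ> (%t. cos (complex_of_real \<xi> * complex_of_real t) * p t)"
          by (rule ext) (simp add: h(2)[symmetric] cos_of_real flip: of_real_mult)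
        then show ?thesis
          using integral_linear[OF decay_integrable[OF decay_cos_mult[OF p, of "complex_of_real \<xi>"]] h(1), of 0 "real n"] by simp
      qed
      then show ?thesis using bounded_linear.tendsto[OF h(1) lim[of \<xi>]] linear_0[OF bounded_linear.linear[OF h(1)]] by simp
    qed
  qed
  have "Re (p t) = 0" by (rule part[OF bounded_linear_Re]) (simp_all add: abs_Re_le_cmod)
  moreover have "Im (p t) = 0" by (rule part[OF bounded_linear_Im]) (simp_all add: abs_Im_le_cmod)
  ultimately show ?thesis by (simp add: complex_eq_iff)
qed

subsection \<open>The wave equation\<close>

lemma weakly_diff_cnj:
  assumes "weakly_diff U i F G" shows "weakly_diff U i (cnjL F) (cnjL G)"
  unfolding weakly_diff_def
proof
  fix \<phi> assume \<phi>: "\<phi> \<in> test_fun U"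
  note t = is_L2_test_fun[OF \<phi>] is_L2_test_fun[OF test_fun_dir_deriv[OF \<phi>, of "axis i 1"]]
  have d: "pd i (%x. cnj (\<phi> x)) = (%x. cnj (pd i \<phi> x))"
    by (rule ext) (rule smooth_compose_left(2)[OF bounded_linear_cnj test_fun_smooth[OF \<phi>]])
  have p: "pair (cnjL u) v = cnj (pair u (cnjL v))" for u v using pair_cnjL[of u "cnjL v"] by simp
  show "pair (cnjL F) (abs_l2 (pd i \<phi>)) = - pair (cnjL G) (abs_l2 \<phi>)"
    using bspec[OF assms[unfolded weakly_diff_def] test_fun_compose_cnj[OF \<phi>]]
    unfolding p d abs_l2_simps(7)[OF t(1) t(1)] abs_l2_simps(7)[OF t(2) t(2)]
    by (simp add: p abs_l2_simps[OF t(1) t(1)] abs_l2_simps[OF t(2) t(2)])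
qed

definition coef :: "(real^3 => real^3^3) => 3 => 3 => real^3 => complex"
  where "coef a i j = (%x. complex_of_real (a x $ i $ j))"

definition wt :: "(real^3 => real) => real^3 => complex"
  where "wt c = (%x. complex_of_real (inverse ((c x)\<^sup>2)))"

lemma inner_mulL_real:
  assumes m: "ae_bounded (%x. complex_of_real (m x)) M"
  shows "inner (mulL (%x. complex_of_real (m x)) u) v = inner u (mulL (%x. complex_of_real (m x)) v)"
proof -
  obtain f where f: "is_L2 f" "v = abs_l2 f" by (cases v)
  have mf: "is_L2 (%x. complex_of_real (m x) * f x)" by (rule is_L2_mult[OF m f(1)])
  have "mulL (%x. complex_of_real (m x)) (cnjL v) = cnjL (mulL (%x. complex_of_real (m x)) v)"
    unfolding f(2) mulL_abs_l2[OF m f(1)] using abs_l2_simps[OF f(1) f(1)] abs_l2_simps[OF mf mf] mulL_abs_l2[OF m is_L2_cnj[OF f(1)]] by simp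
  then show ?thesis unfolding inner_l2_def pair_mulL[OF m] by simp
qed

lemma bounded_linear_pair_mulL: "ae_bounded m M ==> bounded_linear (%u. pair (mulL m u) \<phi>)"
  by (rule bounded_linear_compose[OF bounded_linear_pair_left bounded_linear_mulL])

lemma pair_mulL_abs:
  assumes "ae_bounded m M" "is_L2 f" "is_L2 g"
  shows "pair (mulL m (abs_l2 f)) (abs_l2 g) = (LINT x|lebesgue. m x * f x * g x)"
    "integrable lebesgue (%x. m x * f x * g x)"
  using is_L2_mult[OF assms(1,2)] is_L2_mult_integrable[OF is_L2_mult[OF assms(1,2)] assms(3)]
    abs_l2_simps[OF is_L2_mult[OF assms(1,2)] assms(3)]
  by (simp_all add: mulL_abs_l2[OF assms(1,2)])

text \<open>Ellipticity concerns real vectors. The real part of the Hermitian expression splits into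
  the quadratic form of the real parts of the P i and that of the imaginary parts.\<close>

lemma coefficient_form_nonneg:
  assumes bnd: "\<And>i j. ae_bounded (coef a i j) MA"
    and ell: "\<And>x \<xi>. 0 \<le> (\<Sum>i\<in>UNIV. \<Sum>j\<in>UNIV. a x $ i $ j * \<xi> $ i * \<xi> $ j)"
  shows "0 \<le> (\<Sum>i\<in>UNIV. \<Sum>j\<in>UNIV. inner (mulL (coef a i j) (P j)) (P i))"
proof -
  define p where "p i = rep_l2 (P i)" for i
  have p: "is_L2 (p i)" "P i = abs_l2 (p i)" for i by (simp_all add: p_def rep_l2 abs_rep_l2)
  define f where "f i j x = coef a i j x * p j x * cnj (p i x)" for i j x
  have c: "cnjL (abs_l2 (p i)) = abs_l2 (%x. cnj (p i x))" for i using abs_l2_simps[OF p(1)[of i] p(1)[of i]] by simp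
  note q = pair_mulL_abs[OF bnd p(1) is_L2_cnj[OF p(1)]]
  have int: "integrable lebesgue (f i j)" for i j unfolding f_def by (rule q(2))
  have eq: "inner (mulL (coef a i j) (P j)) (P i) = (LINT x|lebesgue. Re (f i j x))" for i j
  proof -
    have "inner (mulL (coef a i j) (P j)) (P i) = Re (LINT x|lebesgue. f i j x)"
      unfolding inner_l2_def p(2) c f_def by (rule arg_cong[where f=Re]) (rule q(1))
    then show ?thesis using integral_Re[OF int[of i j]] by simp
  qed
  have int': "integrable lebesgue (%x. Re (f i j x))" for i j by (rule integrable_Re[OF int])
  have pos: "0 \<le> (\<Sum>i\<in>UNIV. \<Sum>j\<in>UNIV. Re (f i j x))" for x
  proof -
    have "Re (f i j x) = a x $ i $ j * (\<chi> i. Re (p i x)) $ i * (\<chi> i. Re (p i x)) $ j + a x $ i $ j * (\<chi> i. Im (p i x)) $ i * (\<chi> i. Im (p i x)) $ j" for i j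
      by (simp add: f_def coef_def algebra_simps)
    then have "(\<Sum>i\<in>UNIV. \<Sum>j\<in>UNIV. Re (f i j x)) = (\<Sum>i\<in>UNIV. \<Sum>j\<in>UNIV. a x $ i $ j * (\<chi> i. Re (p i x)) $ i * (\<chi> i. Re (p i x)) $ j)
      + (\<Sum>i\<in>UNIV. \<Sum>j\<in>UNIV. a x $ i $ j * (\<chi> i. Im (p i x)) $ i * (\<chi> i. Im (p i x)) $ j)"
      by (simp only: sum.distrib)
    then show ?thesis using ell[where x=x and \<xi>="\<chi> i. Re (p i x)"] ell[where x=x and \<xi>="\<chi> i. Im (p i x)"] by linarith
  qed
  have "(\<Sum>i\<in>UNIV. \<Sum>j\<in>UNIV. inner (mulL (coef a i j) (P j)) (P i)) = (\<Sum>i\<in>UNIV. LINT x|lebesgue. (\<Sum>j\<in>UNIV. Re (f i j x)))"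
    unfolding eq by (rule sum.cong[OF refl]) (rule Bochner_Integration.integral_sum[symmetric], rule int')
  also have "\<dots> = (LINT x|lebesgue. (\<Sum>i\<in>UNIV. \<Sum>j\<in>UNIV. Re (f i j x)))"
    by (rule Bochner_Integration.integral_sum[symmetric]) (rule Bochner_Integration.integrable_sum, rule int')
  also have "\<dots> \<ge> 0" by (rule Bochner_Integration.integral_nonneg) (rule pos)
  finally show ?thesis .
qed

text \<open>The energy is the weighted square of X plus the coefficient form of J, where J is the
  time integral of the gradient Z. By the symmetry of both forms its derivative is twice the left
  side of \<open>eq\<close>, so it stays 0; the first term is coercive and the second
  nonnegative.\<close>

lemma energy_uniqueness:
  fixes X Y :: "real => l2" and J Z :: "3 => real => l2"
  assumes bnd: "\<And>i j. ae_bounded (coef a i j) MA" and sym: "\<And>x i j. a x $ i $ j = a x $ j $ i"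
    and ell: "\<And>x \<xi>. 0 \<le> (\<Sum>i\<in>UNIV. \<Sum>j\<in>UNIV. a x $ i $ j * \<xi> $ i * \<xi> $ j)"
    and q: "ae_bounded (wt c) MC" and r: "r > 0" "\<And>u. r * (inner u u) \<le> inner (mulL (wt c) u) u"
    and X: "\<And>t. t \<ge> 0 ==> (X has_vector_derivative Y t) (at t within {0..})" "X 0 = 0"
    and J: "\<And>j t. t \<ge> 0 ==> (J j has_vector_derivative Z j t) (at t within {0..})" "\<And>j. J j 0 = 0"
    and eq: "\<And>t. t \<ge> 0 ==> inner (mulL (wt c) (Y t)) (X t) + (\<Sum>i\<in>UNIV. \<Sum>j\<in>UNIV. inner (mulL (coef a i j) (J j t)) (Z i t)) = 0"
    and t: "t \<ge> 0"
  shows "X t = 0"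
proof -
  define e where "e t = inner (mulL (wt c) (X t)) (X t) + (\<Sum>i\<in>UNIV. \<Sum>j\<in>UNIV. inner (mulL (coef a i j) (J j t)) (J i t))" for t
  have cs: "inner (mulL (coef a i j) u) v = inner u (mulL (coef a i j) v)" for i j u v
    using inner_mulL_real[OF bnd[of i j, unfolded coef_def]] by (simp add: coef_def)
  have ws: "inner (mulL (wt c) u) v = inner u (mulL (wt c) v)" for u v
    using inner_mulL_real[OF q[unfolded wt_def]] by (simp add: wt_def)
  have csym: "coef a i j = coef a j i" for i j by (rule ext) (simp add: coef_def sym[of _ i j])
  have cz: "inner (mulL (coef a i j) u) v = inner (mulL (coef a j i) v) u" for i j u v
    unfolding csym[of j i] cs[of i j v u] by (rule inner_commute)
  have D: "(e has_vector_derivative 0) (at t within {0..})" if t: "t \<in> {0..}" for t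
  proof -
    have t0: "t \<ge> 0" using t by simp
    have dJ: "((%t. inner (mulL (coef a i j) (J j t)) (J i t)) has_vector_derivative
        (inner (mulL (coef a i j) (J j t)) (Z i t) + inner (mulL (coef a i j) (Z j t)) (J i t))) (at t within {0..})" for i j
      by (rule bounded_bilinear.has_vector_derivative[OF bounded_bilinear_inner
            bounded_linear.has_vector_derivative[OF bounded_linear_mulL[OF bnd] J(1)[OF t0]] J(1)[OF t0]])
    have dX: "((%t. inner (mulL (wt c) (X t)) (X t)) has_vector_derivative
        (inner (mulL (wt c) (X t)) (Y t) + inner (mulL (wt c) (Y t)) (X t))) (at t within {0..})"
      by (rule bounded_bilinear.has_vector_derivative[OF bounded_bilinear_inner
            bounded_linear.has_vector_derivative[OF bounded_linear_mulL[OF q] X(1)[OF t0]] X(1)[OF t0]])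
    let ?S = "\<Sum>i\<in>UNIV. \<Sum>j\<in>UNIV. inner (mulL (coef a i j) (J j t)) (Z i t)"
    have swap: "(\<Sum>i\<in>UNIV. \<Sum>j\<in>UNIV. inner (mulL (coef a i j) (Z j t)) (J i t)) = ?S"
    proof -
      have "(\<Sum>i\<in>UNIV. \<Sum>j\<in>UNIV. inner (mulL (coef a i j) (Z j t)) (J i t)) = (\<Sum>j\<in>UNIV. \<Sum>i\<in>UNIV. inner (mulL (coef a i j) (Z j t)) (J i t))"
        by (rule sum.swap)
      also have "\<dots> = ?S"
        by (intro sum.cong refl) (rule cz)
      finally show ?thesis .
    qed
    have "inner (mulL (wt c) (X t)) (Y t) = inner (mulL (wt c) (Y t)) (X t)" unfolding ws[of "Y t"] by (rule inner_commute)
    then have "(inner (mulL (wt c) (X t)) (Y t) + inner (mulL (wt c) (Y t)) (X t)) +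
      (\<Sum>i\<in>UNIV. \<Sum>j\<in>UNIV. (inner (mulL (coef a i j) (J j t)) (Z i t) + inner (mulL (coef a i j) (Z j t)) (J i t))) = 0"
      unfolding sum.distrib swap using eq[OF t0] by simp
    moreover have "(e has_vector_derivative ((inner (mulL (wt c) (X t)) (Y t) + inner (mulL (wt c) (Y t)) (X t)) +
      (\<Sum>i\<in>UNIV. \<Sum>j\<in>UNIV. (inner (mulL (coef a i j) (J j t)) (Z i t) + inner (mulL (coef a i j) (Z j t)) (J i t))))) (at t within {0..})"
      unfolding e_def by (intro has_vector_derivative_add dX has_vector_derivative_sum dJ)
    ultimately show ?thesis by simp
  qed
  obtain k where k: "\<And>t. t \<in> {0..} ==> e t = k"
    using has_vector_derivative_zero_constant[of "{0..}" e] D by (metis convex_real_interval(1))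
  have z: "mulL (wt c) 0 = 0" "mulL (coef a i j) 0 = 0" for i j
    using linear_0[OF bounded_linear.linear[OF bounded_linear_mulL[OF q]]] linear_0[OF bounded_linear.linear[OF bounded_linear_mulL[OF bnd]]] by auto
  have "e 0 = 0" by (simp add: e_def X(2) J(2) z)
  then have "e t = 0" using k[of 0] k[of t] t by simp
  then have "inner (mulL (wt c) (X t)) (X t) \<le> 0"
    using coefficient_form_nonneg[OF bnd ell, of "%i. J i t"] by (simp add: e_def)
  then have "r * inner (X t) (X t) \<le> 0" using r(2)[of "X t"] by simp
  then have "inner (X t) (X t) \<le> 0" using r(1) by (simp add: mult_le_0_iff)
  then have "inner (X t) (X t) = 0" by (rule antisym[OF _ inner_ge_zero])
  then show ?thesis by simp
qed

text \<open>A bridge from the Lebesgue integral over the open half line in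
  \<open>wave_solution\<close> to the integral over a compact interval, where the fundamental
  theorem of calculus applies.\<close>

lemma integral_positive_half_line:
  fixes g :: "real => complex"
  assumes g: "continuous_on {0..T} g" and l: "0 < l" and z: "\<And>t. t \<notin> {l..T} ==> g t = 0"
  shows "(LINT t|lebesgue_on {0<..}. g t) = integral {0..T} g"
proof -
  have "(LINT t|lebesgue_on {0<..}. g t) = (LINT t|lebesgue. indicator {0<..} t *\<^sub>R g t)"
    by (rule integral_restrict_space) simp
  also have "\<dots> = (LINT t|lebesgue. indicator {0..T} t *\<^sub>R g t)"
  proof (rule Bochner_Integration.integral_cong[OF refl])
    fix t :: real
    show "indicator {0<..} t *\<^sub>R g t = indicator {0..T} t *\<^sub>R g t"
      using z[of t] l by (cases "t \<in> {l..T}") (auto simp: indicator_def)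
  qed
  also have "\<dots> = (LINT t|lebesgue_on {0..T}. g t)"
    by (rule integral_restrict_space[symmetric]) simp
  also have "\<dots> = integral {0..T} g"
    by (rule lebesgue_integral_eq_integral[OF continuous_imp_integrable_real[OF g]]) simp
  finally show ?thesis .
qed

lemma vector_derivative_imp_continuous_on:
  "(\<And>t. t \<in> S ==> (f has_vector_derivative f' t) (at t within S)) ==> continuous_on S f"
  unfolding continuous_on_eq_continuous_within using has_vector_derivative_continuous by blast

lemma dir_deriv_linear:
  assumes "smooth f" shows "dir_deriv (r *\<^sub>R v) f x = r *\<^sub>R dir_deriv v f x" "dir_deriv 0 f x = 0"
  using linear_scale[OF bounded_linear.linear[OF has_derivative_bounded_linear[OF smooth_has_derivative[OF assms]]]]
    linear_0[OF bounded_linear.linear[OF has_derivative_bounded_linear[OF smooth_has_derivative[OF assms]]]] by auto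

lemma smooth_has_vector_derivative:
  fixes f :: "real => 'b::real_normed_vector"
  assumes "smooth f" shows "(f has_vector_derivative dir_deriv 1 f t) (at t within S)"
proof -
  have "(%v. dir_deriv v f t) = (%v. v *\<^sub>R dir_deriv 1 f t)"
  proof
    fix v show "dir_deriv v f t = v *\<^sub>R dir_deriv 1 f t"
      using dir_deriv_linear(1)[OF assms, where r=v and v=1 and x=t] by (simp only: real_scaleR_def mult_1_right)
  qed
  then show ?thesis unfolding has_vector_derivative_def
    by (rule has_derivative_eq_rhs[OF has_derivative_at_withinI[OF smooth_has_derivative[OF assms]]])
qed

lemma dir_deriv_eq_0_outside:
  fixes f :: "'a::euclidean_space => 'b::real_normed_vector"
  assumes f: "\<And>x. x \<notin> K ==> f x = 0" and K: "closed K" and x: "x \<notin> K"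
  shows "dir_deriv v f x = 0"
  using dir_deriv_transform_open[of "- K" x "%x. 0" f v] f K x by (simp add: smooth_const open_Compl frechet_derivative_const)

lemma mollifier_average:
  fixes H :: "real => complex"
  assumes k: "mollifier k s r" and sub: "cball s r \<subseteq> {0..T}" and H: "continuous_on {0..T} H"
    and le: "\<And>t. t \<in> cball s r ==> cmod (H t - H s) \<le> e"
  shows "cmod (integral {0..T} (%t. complex_of_real (k t) * H t) - H s) \<le> e"
proof -
  have ks: "smooth k" "\<And>t. 0 \<le> k t" "\<And>t. t \<notin> cball s r ==> k t = 0" "(LINT t|lebesgue. k t) = 1"
    using k unfolding mollifier_def by auto
  have kc: "continuous_on {0..T} k" by (rule smooth_continuous[OF ks(1)])
  have "integral {0..T} k = integral UNIV (%t. if t \<in> {0..T} then k t else 0)" by (rule integral_restrict_UNIV[symmetric])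
  also have "(%t. if t \<in> {0..T} then k t else 0) = k" using ks(3) sub by fastforce
  also have "integral UNIV k = 1"
    using lebesgue_integral_eq_integral[of UNIV k] mollifier_integrable[OF k] ks(4) by (simp add: lebesgue_on_UNIV_eq)
  finally have k1: "integral {0..T} k = 1" .
  have i: "(%t. complex_of_real (k t) * H t) integrable_on {0..T}" "(%t. complex_of_real (k t) * H s) integrable_on {0..T}"
    "(%t. complex_of_real (k t) * (H t - H s)) integrable_on {0..T}" "(%t. k t * e) integrable_on {0..T}" "k integrable_on {0..T}"
    by (intro integrable_continuous_interval continuous_intros kc H)+
  have k1c: "integral {0..T} (%t. complex_of_real (k t)) = 1"
    using integral_linear[OF i(5) bounded_linear_of_real, where 'a1=complex] by (simp add: o_def k1)
  have kh: "integral {0..T} (%t. complex_of_real (k t) * H s) = H s" by (simp add: k1c)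
  have "integral {0..T} (%t. complex_of_real (k t) * H t) - H s = integral {0..T} (%t. complex_of_real (k t) * (H t - H s))"
    using HK_integral_diff[OF i(1,2)] by (simp add: k1c right_diff_distrib)
  also have "cmod \<dots> \<le> integral {0..T} (%t. k t * e)"
  proof (rule integral_norm_bound_integral[OF i(3,4)])
    fix t
    show "cmod (complex_of_real (k t) * (H t - H s)) \<le> k t * e"
    proof (cases "t \<in> cball s r")
      case True then show ?thesis using le[OF True] ks(2)[of t] by (simp add: norm_mult mult_left_mono)
    next
      case False then show ?thesis using ks(3) by simp
    qed
  qed
  also have "\<dots> = e" by (simp add: k1)
  finally show ?thesis .
qed

text \<open>A du Bois-Reymond argument for H, the sum of W and the time integral of B. An f with
  compact support in the open half line and integral 0 is the derivative of an admissible \<theta>,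
  and then f is orthogonal to H. Differences of two mollifiers are such f, so H is constant for
  positive times; continuity and W 0 = 0 make the constant 0.\<close>

lemma weak_second_derivative:
  fixes U W B :: "real => complex"
  assumes U: "\<And>t. t \<ge> 0 ==> (U has_vector_derivative W t) (at t within {0..})"
    and Wc: "continuous_on {0..} W" and Bc: "continuous_on {0..} B" and W0: "W 0 = 0"
    and weak: "\<And>\<theta> l T. smooth \<theta> ==> 0 < l ==> l \<le> T ==> (\<And>t. t \<notin> {l..T} ==> \<theta> t = 0) ==>
      (LINT t|lebesgue_on {0<..}. complex_of_real (dir_deriv 1 (dir_deriv 1 \<theta>) t) * U t + complex_of_real (\<theta> t) * B t) = 0"
    and t: "t \<ge> 0"
  shows "W t = - integral {0..t} B"
proof -
  define G where "G t = integral {0..t} B" for t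
  define H where "H t = W t + G t" for t
  have sub: "continuous_on {0..T} f" if "continuous_on {0..} f" for f :: "real => complex" and T
    by (rule continuous_on_subset[OF that]) auto
  have Uc: "continuous_on {0..} U"
    using U by (intro vector_derivative_imp_continuous_on) auto
  have G': "(G has_vector_derivative B t) (at t within {0..T})" if "t \<in> {0..T}" for t T
    unfolding G_def by (rule integral_has_vector_derivative[OF sub[OF Bc] that])
  have GcT: "continuous_on {0..T} G" for T
    using G' by (intro vector_derivative_imp_continuous_on) auto
  have Gc: "continuous_on {0..} G"
    unfolding continuous_on_eq_continuous_within
  proof
    fix t :: real assume t: "t \<in> {0..}"
    have "continuous (at t within {0..t+1}) G" using GcT[of "t+1"] t by (simp add: continuous_on_eq_continuous_within)
    moreover have "at t within {0..t+1} = at t within {0..}"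
      by (rule at_within_nhd[of _ "{t - 1<..<t + 1}"]) (use t in auto)
    ultimately show "continuous (at t within {0..}) G" by simp
  qed
  have Hc: "continuous_on {0..} H" unfolding H_def by (intro continuous_on_add Wc Gc)
  have step: "integral {0..T+1} (%t. complex_of_real (f t) * H t) = 0"
    if f: "smooth f" "\<And>t. t \<notin> {l..T} ==> f t = 0" "0 < l" "l \<le> T" "(LINT t|lebesgue. f t) = 0" for f l T
  proof -
    have "\<exists>s. smooth s \<and> (\<forall>t. (s has_vector_derivative f t) (at t)) \<and> (\<forall>t\<le>l. s t = 0) \<and>
      (\<forall>t\<ge>T. s t = (LINT x|lebesgue. f x)) \<and> (\<forall>t. s t = integral {l - 1..t} f)"
      by (rule smooth_antiderivative_real[OF f(1) _ f(4)]) (rule f(2))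
    then obtain s where s: "smooth s" "\<forall>t. (s has_vector_derivative f t) (at t)" "\<forall>t\<le>l. s t = 0"
      "\<forall>t\<ge>T. s t = (LINT x|lebesgue. f x)" by (elim exE conjE)
    have s1: "smooth s" "\<And>t. (s has_vector_derivative f t) (at t)" "\<And>t. t \<le> l ==> s t = 0" "\<And>t. t \<ge> T ==> s t = 0"
      using s f(5) by simp_all
    have s0: "s t = 0" if "t \<notin> {l..T}" for t using s1(3,4)[of t] that by auto
    have ds: "dir_deriv 1 s = f"
    proof
      fix x show "dir_deriv 1 s x = f x" using dir_derivI[OF s1(2)[of x, unfolded has_vector_derivative_def], where v=1] by simp
    qed
    \<comment> \<open>The end point T + 1 lies outside {l..T}, so f and s vanish there by
      hypothesis, and so do the boundary terms.\<close>
    let ?f' = "dir_deriv 1 f" and ?T = "T + 1"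
    have f'0: "?f' t = 0" if "t \<notin> {l..T}" for t by (rule dir_deriv_eq_0_outside[of "{l..T}" f]) (use f(2) that in auto)
    have cont: "continuous_on {0..?T} ?f'" "continuous_on {0..?T} f" "continuous_on {0..?T} s"
      by (intro smooth_continuous smooth_dir_deriv f(1) s1(1))+
    define g where "g t = complex_of_real (?f' t) * U t + complex_of_real (s t) * B t" for t
    have gc: "continuous_on {0..?T} g" unfolding g_def by (intro continuous_intros cont sub[OF Uc] sub[OF Bc])
    have "integral {0..?T} g = (LINT t|lebesgue_on {0<..}. g t)"
    proof (rule integral_positive_half_line[symmetric, OF gc f(3)])
      fix t assume "t \<notin> {l..?T}"
      then have "t \<notin> {l..T}" by auto
      then show "g t = 0" unfolding g_def f'0[OF \<open>t \<notin> {l..T}\<close>] s0[OF \<open>t \<notin> {l..T}\<close>] by simp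
    qed
    also have "\<dots> = 0"
    proof -
      have "(LINT t|lebesgue_on {0<..}. complex_of_real (dir_deriv 1 (dir_deriv 1 s) t) * U t + complex_of_real (s t) * B t) = 0"
        by (rule weak[OF s1(1) f(3,4)]) (rule s0)
      then show ?thesis by (simp only: ds g_def)
    qed
    finally have g0: "integral {0..?T} g = 0" .
    \<comment> \<open>By the product rule D is an antiderivative of g + f H, since f is the
      derivative of s; it is 0 at both ends.\<close>
    define D where "D t = complex_of_real (f t) * U t + complex_of_real (s t) * G t" for t
    have "((%t. g t + complex_of_real (f t) * H t) has_integral (D ?T - D 0)) {0..?T}"
    proof (rule fundamental_theorem_of_calculus)
      show "0 \<le> ?T" using f(3,4) by simp
      fix t assume t: "t \<in> {0..?T}"
      have U': "(U has_vector_derivative W t) (at t within {0..?T})"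
        by (rule has_vector_derivative_within_subset[OF U]) (use t in auto)
      have F': "((%t. complex_of_real (f t)) has_vector_derivative complex_of_real (?f' t)) (at t within {0..?T})"
        by (rule bounded_linear.has_vector_derivative[OF bounded_linear_of_real smooth_has_vector_derivative[OF f(1)]])
      have S': "((%t. complex_of_real (s t)) has_vector_derivative complex_of_real (f t)) (at t within {0..?T})"
        by (rule bounded_linear.has_vector_derivative[OF bounded_linear_of_real has_vector_derivative_at_within[OF s1(2)]])
      show "(D has_vector_derivative g t + complex_of_real (f t) * H t) (at t within {0..?T})"
        unfolding D_def
        by (rule has_vector_derivative_eq_rhs[OF has_vector_derivative_add[OF has_vector_derivative_mult[OF F' U'] has_vector_derivative_mult[OF S' G'[OF t]]]])
          (simp add: g_def H_def algebra_simps)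
    qed
    moreover have "D ?T = 0" "D 0 = 0" using f(2)[of ?T] f(2)[of 0] s0[of ?T] s0[of 0] f(3) by (auto simp: D_def)
    ultimately have "integral {0..?T} (%t. g t + complex_of_real (f t) * H t) = 0" by (simp add: integral_unique)
    then show ?thesis
      using HK_integral_add[of g "{0..?T}" "%t. complex_of_real (f t) * H t"] g0
        integrable_continuous_interval[OF gc] integrable_continuous_interval[of 0 ?T "%t. complex_of_real (f t) * H t"]
        continuous_on_mult[OF continuous_on_of_real[OF cont(2)] sub[OF Hc]] by simp
  qed
  have const: "H t1 = H t2" if t12: "0 < t1" "0 < t2" for t1 t2
  proof -
    have "cmod (H t1 - H t2) \<le> 0 + e" if e: "e > 0" for e
    proof -
      have e2: "e / 2 > 0" using e by simp
      obtain d1 where d1: "d1 > 0" "\<And>s. s \<in> {0..} ==> dist s t1 < d1 ==> dist (H s) (H t1) < e/2"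
        using Hc[unfolded continuous_on_iff, rule_format, of t1 "e/2"] t12 e2 by auto
      obtain d2 where d2: "d2 > 0" "\<And>s. s \<in> {0..} ==> dist s t2 < d2 ==> dist (H s) (H t2) < e/2"
        using Hc[unfolded continuous_on_iff, rule_format, of t2 "e/2"] t12 e2 by auto
      define r where "r = min (min d1 d2) (min t1 t2) / 2"
      define l where "l = min t1 t2 / 2"
      define T where "T = max t1 t2 + r"
      have r: "r > 0" "r < d1" "r < d2" "l > 0" "l \<le> T" "t1 - r \<ge> l" "t2 - r \<ge> l" "t1 + r \<le> T" "t2 + r \<le> T"
        using d1(1) d2(1) t12 by (auto simp: r_def l_def T_def min_def max_def)
      obtain k1 where k1: "mollifier k1 t1 r" using mollifier_exists[OF r(1)] by blast
      obtain k2 where k2: "mollifier k2 t2 r" using mollifier_exists[OF r(1)] by blast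
      have cb: "cball t1 r \<subseteq> {l..T}" "cball t2 r \<subseteq> {l..T}" using r by (auto simp: dist_real_def abs_le_iff)
      have z: "k1 t = 0" "k2 t = 0" if "t \<notin> {l..T}" for t
        using k1 k2 that cb unfolding mollifier_def by blast+
      have sm: "smooth k1" "smooth k2" using k1 k2 by (simp_all add: mollifier_def)
      have "integral {0..T+1} (%t. complex_of_real (k1 t - k2 t) * H t) = 0"
      proof (rule step[OF smooth_diff[OF sm] _ r(4,5)])
        show "(LINT t|lebesgue. k1 t - k2 t) = 0"
          using k1 k2 mollifier_integrable[OF k1] mollifier_integrable[OF k2] by (simp add: mollifier_def)
      qed (simp add: z)
      moreover have "(%t. complex_of_real (k1 t) * H t) integrable_on {0..T+1}" "(%t. complex_of_real (k2 t) * H t) integrable_on {0..T+1}"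
        by (intro integrable_continuous_interval continuous_intros smooth_continuous sm sub[OF Hc])+
      ultimately have eq: "integral {0..T+1} (%t. complex_of_real (k1 t) * H t) = integral {0..T+1} (%t. complex_of_real (k2 t) * H t)"
        by (simp add: left_diff_distrib HK_integral_diff)
      have cb': "cball t1 r \<subseteq> {0..T+1}" "cball t2 r \<subseteq> {0..T+1}" using cb r(4) by auto
      have 1: "cmod (integral {0..T+1} (%t. complex_of_real (k1 t) * H t) - H t1) \<le> e/2"
      proof (rule mollifier_average[OF k1 cb'(1) sub[OF Hc]])
        fix t assume "t \<in> cball t1 r"
        then have "t \<in> {0..}" "dist t t1 < d1" using cb'(1) r(2) by (auto simp: dist_commute)
        then show "cmod (H t - H t1) \<le> e/2" using d1(2) by (simp add: dist_norm less_imp_le)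
      qed
      have 2: "cmod (integral {0..T+1} (%t. complex_of_real (k2 t) * H t) - H t2) \<le> e/2"
      proof (rule mollifier_average[OF k2 cb'(2) sub[OF Hc]])
        fix t assume "t \<in> cball t2 r"
        then have "t \<in> {0..}" "dist t t2 < d2" using cb'(2) r(3) by (auto simp: dist_commute)
        then show "cmod (H t - H t2) \<le> e/2" using d2(2) by (simp add: dist_norm less_imp_le)
      qed
      define I where "I = integral {0..T+1} (%t. complex_of_real (k2 t) * H t)"
      have "H t1 - H t2 = (I - H t2) - (I - H t1)" by simp
      then have "cmod (H t1 - H t2) \<le> cmod (I - H t2) + cmod (I - H t1)" by (metis norm_triangle_ineq4)
      then show ?thesis using 1 2 unfolding eq I_def[symmetric] by linarith
    qed
    then have "cmod (H t1 - H t2) \<le> 0" by (rule field_le_epsilon)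
    then show ?thesis by simp
  qed
  have "H t = 0"
  proof (cases "t = 0")
    case False
    then have tp: "t > 0" using t by simp
    have "(%n. 1 / (real n + 1)) \<longlonglongrightarrow> 0" by real_asymp
    then have "(%n. H (1 / (real n + 1))) \<longlonglongrightarrow> H 0"
      by (rule continuous_on_tendsto_compose[OF Hc]) auto
    moreover have "(%n. H (1 / (real n + 1))) = (%n. H t)" by (rule ext) (rule const, use tp in auto)
    ultimately have "H t = H 0" using LIMSEQ_unique tendsto_const by metis
    then show ?thesis by (simp add: H_def G_def W0)
  qed (simp add: H_def G_def W0)
  then show ?thesis by (simp add: H_def G_def add_eq_0_iff)
qed

text \<open>Tested with products of this form, the space-time equation becomes, for each fixed
  \<psi>, a scalar weak differential equation in time.\<close>

definition tensor :: "(real => real) => (real^3 => complex) => real \<times> (real^3) => complex"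
  where "tensor \<theta> \<psi> p = complex_of_real (\<theta> (fst p)) * \<psi> (snd p)"

lemma tensor_smooth:
  assumes \<theta>: "smooth \<theta>" and \<psi>: "smooth \<psi>"
  shows "smooth (tensor \<theta> \<psi>)"
    "dir_deriv (1, 0) (tensor \<theta> \<psi>) = tensor (dir_deriv 1 \<theta>) \<psi>"
    "dir_deriv (0, e) (tensor \<theta> \<psi>) = tensor \<theta> (dir_deriv e \<psi>)"
proof -
  note f0 = smooth_compose_affine[OF bounded_linear_fst \<theta>, where c=0, unfolded add_0_right]
  note f = smooth_compose_left[OF bounded_linear_of_real f0(1)]
  note s = smooth_compose_affine[OF bounded_linear_snd \<psi>, where c=0, unfolded add_0_right]
  have T: "tensor \<theta> \<psi> = (%p. complex_of_real (\<theta> (fst p)) * \<psi> (snd p))" by (rule ext) (simp add: tensor_def)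
  show "smooth (tensor \<theta> \<psi>)" unfolding T by (rule smooth_mult[OF f(1) s(1)])
  have d: "dir_deriv v (tensor \<theta> \<psi>) p = complex_of_real (dir_deriv (fst v) \<theta> (fst p)) * \<psi> (snd p)
      + complex_of_real (\<theta> (fst p)) * dir_deriv (snd v) \<psi> (snd p)" for v p
    unfolding T by (simp add: dir_deriv_mult[OF f(1) s(1)] f(2) f0(2) s(2))
  show "dir_deriv (1, 0) (tensor \<theta> \<psi>) = tensor (dir_deriv 1 \<theta>) \<psi>"
    by (rule ext) (simp add: d dir_deriv_linear(2)[OF \<psi>] tensor_def)
  show "dir_deriv (0, e) (tensor \<theta> \<psi>) = tensor \<theta> (dir_deriv e \<psi>)"
    by (rule ext) (simp add: d dir_deriv_linear(2)[OF \<theta>] tensor_def)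
qed

lemma tensor_test_fun:
  assumes \<theta>: "smooth \<theta>" "0 < l" "\<And>t. t \<notin> {l..T} ==> \<theta> t = 0" and \<psi>: "\<psi> \<in> test_fun UNIV"
  shows "tensor \<theta> \<psi> \<in> test_fun ({0<..} \<times> UNIV)"
proof (rule test_funI[OF tensor_smooth(1)[OF \<theta>(1) test_fun_smooth[OF \<psi>]]])
  let ?K = "closure {x. \<psi> x \<noteq> 0}"
  show "compact ({l..T} \<times> ?K)" using \<psi> by (intro compact_Times) (auto simp: test_fun_def)
  show "{l..T} \<times> ?K \<subseteq> {0<..} \<times> UNIV" using \<theta>(2) by auto
  fix p :: "real \<times> (real^3)" assume p: "p \<notin> {l..T} \<times> ?K"
  then have "fst p \<notin> {l..T} \<or> snd p \<notin> ?K" by (cases p) auto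
  then show "tensor \<theta> \<psi> p = 0"
    using \<theta>(3)[of "fst p"] closure_subset[of "{x. \<psi> x \<noteq> 0}"] by (auto simp: tensor_def)
qed

text \<open>The complement of the essential support is a union of possibly uncountably many open
  sets; Lindelof's theorem replaces it by a countable union, for which null sets may be
  collected.\<close>

lemma ess_supp_AE: "AE x in lebesgue. x \<notin> ess_supp f --> f x = 0"
proof -
  let ?F = "{U. open U \<and> (AE x in lebesgue. x \<in> U --> f x = 0)}"
  obtain F' where F': "F' \<subseteq> ?F" "countable F'" "\<Union>F' = \<Union>?F"
    by (rule Lindelof[of ?F]) auto
  have "AE x in lebesgue. \<forall>U\<in>F'. x \<in> U --> f x = 0"
    using F'(1) by (subst AE_ball_countable[OF F'(2)]) blast
  then show ?thesis
  proof eventually_elim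
    case (elim x)
    show ?case
    proof
      assume "x \<notin> ess_supp f"
      then have "x \<in> \<Union>F'" unfolding F'(3) ess_supp_def by blast
      then show "f x = 0" using elim by blast
    qed
  qed
qed

lemma AE_not_frontier:
  assumes "lipschitz_domain \<Omega>" shows "AE x in lebesgue. x \<notin> frontier \<Omega>"
  by (rule AE_not_in) (rule null_sets_completionI[OF haus2_finite_null[OF frontier_closed frontier_haus2_finite[OF assms]]])

text \<open>The support condition speaks of the closure of \<Omega>. The difference to \<Omega> is
  the frontier, a null set because its two-dimensional measure is finite.\<close>

lemma AE_zero_outside:
  assumes "lipschitz_domain \<Omega>" "ess_supp f \<subseteq> closure \<Omega>"
  shows "AE x in lebesgue. x \<notin> \<Omega> --> f x = 0"
  using ess_supp_AE[of f] AE_not_frontier[OF assms(1)]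
proof eventually_elim
  case (elim x)
  then show ?case using assms(2) closure_Un_frontier[of \<Omega>] by blast
qed

lemma eventually_within_nonneg: "(\<And>s. s \<ge> 0 ==> P s) ==> \<forall>\<^sub>F s in at t within {0..}. P (s::real)"
  unfolding eventually_at_filter by (intro always_eventually allI impI) simp

lemma norm_abs_l2_UNIV: "L2_fun UNIV f ==> norm (abs_l2 f) = L2_norm UNIV f"
  using zext_norm[of UNIV f] by (simp add: zext_UNIV)

section \<open>Wave solutions as differentiable curves in \<open>l2\<close>\<close>

definition cl :: "(real => real^3 => complex) => real => l2" where "cl w t = abs_l2 (w t)"

definition gr :: "(real => real^3 => complex) => 3 => real => l2"
  where "gr w j t = abs_l2 (weak_deriv UNIV j (w t))"

lemma wave_position:
  assumes W: "wave_solution a c f g w w'" and t: "t \<ge> 0"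
  shows "H1_fun UNIV (w t)" "((%s. H1_norm UNIV (%x. w s x - w t x)) \<longlongrightarrow> 0) (at t within {0..})"
proof -
  have "\<forall>t\<ge>0. H1_fun UNIV (w t) \<and> ((%s. H1_norm UNIV (%x. w s x - w t x)) \<longlongrightarrow> 0) (at t within {0..})"
    using W unfolding wave_solution_def by (elim conjE)
  note this[rule_format, OF t]
  from conjunct1[OF this] conjunct2[OF this]
  show "H1_fun UNIV (w t)" "((%s. H1_norm UNIV (%x. w s x - w t x)) \<longlongrightarrow> 0) (at t within {0..})" by - assumption+
qed

lemma wave_velocity:
  assumes W: "wave_solution a c f g w w'" and t: "t \<ge> 0"
  shows "L2_fun UNIV (w' t)" "((%s. L2_norm UNIV (%x. w' s x - w' t x)) \<longlongrightarrow> 0) (at t within {0..})"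
    "((%s. L2_norm UNIV (%x. (w s x - w t x) / of_real (s - t) - w' t x)) \<longlongrightarrow> 0) (at t within {0..})"
proof -
  have "\<forall>t\<ge>0. L2_fun UNIV (w' t) \<and>
       ((%s. L2_norm UNIV (%x. w' s x - w' t x)) \<longlongrightarrow> 0) (at t within {0..}) \<and>
       ((%s. L2_norm UNIV (%x. (w s x - w t x) / of_real (s - t) - w' t x)) \<longlongrightarrow> 0) (at t within {0..})"
    using W unfolding wave_solution_def by (elim conjE)
  note this[rule_format, OF t]
  from conjunct1[OF this] conjunct1[OF conjunct2[OF this]] conjunct2[OF conjunct2[OF this]]
  show "L2_fun UNIV (w' t)" "((%s. L2_norm UNIV (%x. w' s x - w' t x)) \<longlongrightarrow> 0) (at t within {0..})"
    "((%s. L2_norm UNIV (%x. (w s x - w t x) / of_real (s - t) - w' t x)) \<longlongrightarrow> 0) (at t within {0..})" by - assumption+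
qed

lemmas wave_H1 = wave_position(1)
lemmas wave_velocity_L2 = wave_velocity(1)

lemma H1_UNIV:
  assumes "H1_fun UNIV f"
  shows "is_L2 f" "is_L2 (weak_deriv UNIV j f)" "weakly_diff UNIV j (abs_l2 f) (abs_l2 (weak_deriv UNIV j f))"
  using H1_weak_deriv[OF open_UNIV assms, of j] assms unfolding zext_UNIV H1_fun_def by simp_all

lemma wave_weakly_diff: "wave_solution a c f g w w' ==> t \<ge> 0 ==> weakly_diff UNIV j (cl w t) (gr w j t)"
  unfolding cl_def gr_def by (rule H1_UNIV(3)[OF wave_H1])

lemma wave_velocity_continuous:
  assumes W: "wave_solution a c f g w w'" shows "continuous_on {0..} (cl w')"
  unfolding continuous_on_def
proof
  fix t :: real assume "t \<in> {0..}"
  then have t: "t \<ge> 0" by simp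
  have lim: "((%s. L2_norm UNIV (%x. w' s x - w' t x)) \<longlongrightarrow> 0) (at t within {0..})"
    by (rule wave_velocity(2)[OF W t])
  have "norm (cl w' s - cl w' t) \<le> L2_norm UNIV (%x. w' s x - w' t x)" if s: "s \<ge> 0" for s
  proof -
    note L = wave_velocity_L2[OF W s] wave_velocity_L2[OF W t]
    note z = zext_diff[OF _ L]
    have "cl w' s - cl w' t = abs_l2 (%x. w' s x - w' t x)" using z(2) by (simp add: zext_UNIV cl_def)
    then show ?thesis using norm_abs_l2_UNIV[OF z(1)] by simp
  qed
  then show "(cl w' \<longlongrightarrow> cl w' t) (at t within {0..})"
    by (rule LIM_zero_cancel[OF Lim_null_comparison[OF eventually_within_nonneg lim]])
qed

lemma wave_gradient_continuous:
  assumes W: "wave_solution a c f g w w'" shows "continuous_on {0..} (gr w j)"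
  unfolding continuous_on_def
proof
  fix t :: real assume "t \<in> {0..}"
  then have t: "t \<ge> 0" by simp
  have lim: "((%s. H1_norm UNIV (%x. w s x - w t x)) \<longlongrightarrow> 0) (at t within {0..})"
    by (rule wave_position(2)[OF W t])
  have "norm (gr w j s - gr w j t) \<le> H1_norm UNIV (%x. w s x - w t x)" if s: "s \<ge> 0" for s
  proof -
    note d = H1_fun_diff[OF open_UNIV wave_H1[OF W s] wave_H1[OF W t]]
    have "gr w j s - gr w j t = zext UNIV (weak_deriv UNIV j (%x. w s x - w t x))"
      unfolding d(3) by (simp add: zext_UNIV gr_def)
    then show ?thesis using H1_norm_bounds(2)[OF open_UNIV d(1)] by simp
  qed
  then show "(gr w j \<longlongrightarrow> gr w j t) (at t within {0..})"
    by (rule LIM_zero_cancel[OF Lim_null_comparison[OF eventually_within_nonneg lim]])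
qed

lemma wave_derivative:
  assumes W: "wave_solution a c f g w w'" and t: "t \<ge> 0"
  shows "(cl w has_vector_derivative cl w' t) (at t within {0..})"
  unfolding has_vector_derivative_def has_derivative_iff_norm
proof
  have lim: "((%s. L2_norm UNIV (%x. (w s x - w t x) / of_real (s - t) - w' t x)) \<longlongrightarrow> 0) (at t within {0..})"
    by (rule wave_velocity(3)[OF W t])
  have eq: "norm (cl w s - cl w t - (s - t) *\<^sub>R cl w' t) / norm (s - t) \<le> L2_norm UNIV (%x. (w s x - w t x) / of_real (s - t) - w' t x)"
    if s: "s \<ge> 0" for s
  proof (cases "s = t")
    case False
    define k where "k = 1 / (s - t)"
    have k: "k * (s - t) = 1" using False by (simp add: k_def)
    note L = H1_UNIV(1)[OF wave_H1[OF W s]] H1_UNIV(1)[OF wave_H1[OF W t]] wave_velocity_L2[OF W t]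
    note d = is_L2_diff[OF L(1,2)]
    note e = is_L2_scaleR[OF d, of k]
    note m = is_L2_diff[OF e L(3)]
    have "k *\<^sub>R (cl w s - cl w t) - cl w' t = abs_l2 (%x. k *\<^sub>R (w s x - w t x) - w' t x)"
      unfolding cl_def using abs_l2_simps[OF L(1,2)] abs_l2_simps[OF d d] abs_l2_simps[OF e L(3)] by simp
    moreover have "(%x. k *\<^sub>R (w s x - w t x) - w' t x) = (%x. (w s x - w t x) / of_real (s - t) - w' t x)"
      by (rule ext) (simp add: k_def scaleR_conv_of_real)
    moreover have "L2_fun UNIV (%x. k *\<^sub>R (w s x - w t x) - w' t x)" by (rule m)
    ultimately have "norm (k *\<^sub>R (cl w s - cl w t) - cl w' t) = L2_norm UNIV (%x. (w s x - w t x) / of_real (s - t) - w' t x)"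
      using norm_abs_l2_UNIV by metis
    moreover have "k *\<^sub>R (cl w s - cl w t) - cl w' t = k *\<^sub>R (cl w s - cl w t - (s - t) *\<^sub>R cl w' t)"
      by (simp add: scaleR_diff_right k)
    ultimately show ?thesis by (simp add: k_def divide_inverse mult.commute)
  next
    case True
    then show ?thesis by (simp add: L2_norm_def)
  qed
  show "((%y. norm (cl w y - cl w t - (y - t) *\<^sub>R cl w' t) / norm (y - t)) \<longlongrightarrow> 0) (at t within {0..})"
    by (rule Lim_null_comparison[OF eventually_within_nonneg lim]) (use eq in simp)
qed (rule bounded_linear_scaleR_left)

lemma wave_initial:
  assumes W: "wave_solution a c f g w w'" and f: "is_L2 f" and g: "is_L2 g"
  shows "cl w 0 = abs_l2 f" "cl w' 0 = abs_l2 g"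
proof -
  have ae: "AE x in lebesgue. w 0 x = f x" "AE x in lebesgue. w' 0 x = g x"
    using W unfolding wave_solution_def by - (elim conjE, assumption)+
  show "cl w 0 = abs_l2 f" unfolding cl_def
    by (rule abs_l2_cong[OF H1_UNIV(1)[OF wave_H1[OF W order_refl]] f ae(1)])
  show "cl w' 0 = abs_l2 g" unfolding cl_def
    by (rule abs_l2_cong[OF wave_velocity_L2[OF W order_refl] g ae(2)])
qed

text \<open>The wave equation integrated once in time, \<open>weak_second_derivative\<close> being
  applied for each \<psi>; the vanishing initial velocity fixes the constant of integration. Only
  the velocity and the time integral of the gradient remain, and both are continuous in L2.\<close>

lemma wave_weak_div:
  assumes W: "wave_solution a c f (%x. 0) w w'" and f: "is_L2 f" and q: "ae_bounded (wt c) MC"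
    and bnd: "\<And>i j. ae_bounded (coef a i j) MA" and t: "t \<ge> 0"
  shows "weak_div (mulL (wt c) (cl w' t)) (%i. \<Sum>j\<in>UNIV. mulL (coef a i j) (integral {0..t} (gr w j)))"
  unfolding weak_div_def
proof
  fix \<psi> :: "real^3 => complex" assume \<psi>: "\<psi> \<in> test_fun UNIV"
  let ?d = "%i. pd i \<psi>"
  note p = is_L2_test_fun[OF \<psi>] is_L2_test_fun[OF test_fun_dir_deriv[OF \<psi>]]
  define B where "B s = (\<Sum>i\<in>UNIV. \<Sum>j\<in>UNIV. pair (mulL (coef a i j) (gr w j s)) (abs_l2 (?d i)))" for s
  note blq = bounded_linear_pair_mulL[OF q, of "abs_l2 \<psi>"]
  note blc = bounded_linear_pair_mulL[OF bnd]
  have main: "pair (mulL (wt c) (cl w' t)) (abs_l2 \<psi>) = - integral {0..t} B"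
  proof (rule weak_second_derivative[where U="%s. pair (mulL (wt c) (cl w s)) (abs_l2 \<psi>)" and W="%s. pair (mulL (wt c) (cl w' s)) (abs_l2 \<psi>)", OF _ _ _ _ _ t])
    show "((%s. pair (mulL (wt c) (cl w s)) (abs_l2 \<psi>)) has_vector_derivative pair (mulL (wt c) (cl w' s)) (abs_l2 \<psi>)) (at s within {0..})" if "s \<ge> 0" for s
      by (rule bounded_linear.has_vector_derivative[OF blq wave_derivative[OF W that]])
    show "continuous_on {0..} (%s. pair (mulL (wt c) (cl w' s)) (abs_l2 \<psi>))"
      by (rule bounded_linear.continuous_on[OF blq wave_velocity_continuous[OF W]])
    show "continuous_on {0..} B" unfolding B_def
      by (intro continuous_on_sum) (rule bounded_linear.continuous_on[OF blc wave_gradient_continuous[OF W]])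
    show "pair (mulL (wt c) (cl w' 0)) (abs_l2 \<psi>) = 0"
      using linear_0[OF bounded_linear.linear[OF blq]] wave_initial(2)[OF W f is_L2_0] by (simp add: zero_l2_eq[symmetric])
    fix \<theta> :: "real => real" and l T :: real
    assume \<theta>: "smooth \<theta>" "0 < l" "l \<le> T" "\<And>t. t \<notin> {l..T} ==> \<theta> t = 0"
    let ?\<theta> = "dir_deriv 1 (dir_deriv 1 \<theta>)"
    note sm = \<theta>(1) test_fun_smooth[OF \<psi>]
    have tt: "tensor \<theta> \<psi> \<in> test_fun ({0<..} \<times> UNIV)" by (rule tensor_test_fun[OF \<theta>(1,2) _ \<psi>]) (rule \<theta>(4))
    have all: "\<forall>\<phi>\<in>test_fun ({0<..} \<times> UNIV).
       (LINT t|lebesgue_on {0<..}. LINT x|lebesgue.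
          of_real (inverse ((c x)\<^sup>2)) * w t x * dir_deriv (1, 0) (dir_deriv (1, 0) \<phi>) (t, x)
          + (\<Sum>i\<in>UNIV. \<Sum>j\<in>UNIV. of_real (a x $ i $ j) * weak_deriv UNIV j (w t) x
                                   * dir_deriv (0, axis i 1) \<phi> (t, x))) = 0"
      using W unfolding wave_solution_def by (elim conjE)
    have "(LINT t|lebesgue_on {0<..}. complex_of_real (?\<theta> t) * pair (mulL (wt c) (cl w t)) (abs_l2 \<psi>) + complex_of_real (\<theta> t) * B t)
      = (LINT t|lebesgue_on {0<..}. LINT x|lebesgue.
          of_real (inverse ((c x)\<^sup>2)) * w t x * dir_deriv (1, 0) (dir_deriv (1, 0) (tensor \<theta> \<psi>)) (t, x)
          + (\<Sum>i\<in>UNIV. \<Sum>j\<in>UNIV. of_real (a x $ i $ j) * weak_deriv UNIV j (w t) x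
                                   * dir_deriv (0, axis i 1) (tensor \<theta> \<psi>) (t, x)))"
    proof (rule Bochner_Integration.integral_cong[OF refl])
      fix s :: real assume "s \<in> space (lebesgue_on {0<..})"
      then have s: "s \<ge> 0" by simp
      note H = H1_UNIV[OF wave_H1[OF W s]]
      define f0 where "f0 x = wt c x * w s x * \<psi> x" for x
      define F where "F i j x = coef a i j x * weak_deriv UNIV j (w s) x * ?d i x" for i j x
      note P0 = pair_mulL_abs[OF q H(1) p(1), folded f0_def]
      have PF: "pair (mulL (coef a i j) (gr w j s)) (abs_l2 (?d i)) = (LINT x|lebesgue. F i j x)" "integrable lebesgue (F i j)" for i j
        using pair_mulL_abs[OF bnd[of i j] H(2)[of j] p(2)[of "axis i 1"]] unfolding gr_def F_def by auto
      have i1: "integrable lebesgue (%x. complex_of_real (?\<theta> s) * f0 x)" using P0(2) by simp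
      have i2: "integrable lebesgue (%x. \<Sum>i\<in>UNIV. \<Sum>j\<in>UNIV. F i j x)" by (intro Bochner_Integration.integrable_sum PF(2))
      then have i3: "integrable lebesgue (%x. complex_of_real (\<theta> s) * (\<Sum>i\<in>UNIV. \<Sum>j\<in>UNIV. F i j x))" by simp
      have "(LINT x|lebesgue. (\<Sum>i\<in>UNIV. \<Sum>j\<in>UNIV. F i j x)) = (\<Sum>i\<in>UNIV. LINT x|lebesgue. (\<Sum>j\<in>UNIV. F i j x))"
        by (rule Bochner_Integration.integral_sum) (intro Bochner_Integration.integrable_sum PF(2))
      also have "\<dots> = (\<Sum>i\<in>UNIV. \<Sum>j\<in>UNIV. LINT x|lebesgue. F i j x)"
        by (rule sum.cong[OF refl]) (rule Bochner_Integration.integral_sum, rule PF(2))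
      also have "\<dots> = B s" by (simp add: B_def PF(1))
      finally have BB: "(LINT x|lebesgue. (\<Sum>i\<in>UNIV. \<Sum>j\<in>UNIV. F i j x)) = B s" .
      have "(LINT x|lebesgue. complex_of_real (?\<theta> s) * f0 x + complex_of_real (\<theta> s) * (\<Sum>i\<in>UNIV. \<Sum>j\<in>UNIV. F i j x))
        = complex_of_real (?\<theta> s) * (LINT x|lebesgue. f0 x) + complex_of_real (\<theta> s) * B s"
        unfolding Bochner_Integration.integral_add[OF i1 i3] by (simp add: BB)
      moreover have "complex_of_real (?\<theta> s) * f0 x + complex_of_real (\<theta> s) * (\<Sum>i\<in>UNIV. \<Sum>j\<in>UNIV. F i j x) =
          of_real (inverse ((c x)\<^sup>2)) * w s x * dir_deriv (1, 0) (dir_deriv (1, 0) (tensor \<theta> \<psi>)) (s, x)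
          + (\<Sum>i\<in>UNIV. \<Sum>j\<in>UNIV. of_real (a x $ i $ j) * weak_deriv UNIV j (w s) x
                                   * dir_deriv (0, axis i 1) (tensor \<theta> \<psi>) (s, x))" for x
      proof -
        have "dir_deriv (1, 0) (dir_deriv (1, 0) (tensor \<theta> \<psi>)) = tensor ?\<theta> \<psi>"
          unfolding tensor_smooth(2)[OF sm] by (rule tensor_smooth(2)[OF smooth_dir_deriv[OF sm(1)] sm(2)])
        note t2 = fun_cong[OF this, of "(s, x)"]
        have t3: "dir_deriv (0, e) (tensor \<theta> \<psi>) (s, x) = tensor \<theta> (dir_deriv e \<psi>) (s, x)" for e
          by (rule fun_cong[OF tensor_smooth(3)[OF sm]])
        show ?thesis unfolding t2 t3 by (simp add: f0_def F_def wt_def coef_def tensor_def sum_distrib_left algebra_simps)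
      qed
      ultimately show "complex_of_real (?\<theta> s) * pair (mulL (wt c) (cl w s)) (abs_l2 \<psi>) + complex_of_real (\<theta> s) * B s = (LINT x|lebesgue.
          of_real (inverse ((c x)\<^sup>2)) * w s x * dir_deriv (1, 0) (dir_deriv (1, 0) (tensor \<theta> \<psi>)) (s, x)
          + (\<Sum>i\<in>UNIV. \<Sum>j\<in>UNIV. of_real (a x $ i $ j) * weak_deriv UNIV j (w s) x
                                   * dir_deriv (0, axis i 1) (tensor \<theta> \<psi>) (s, x)))"
        unfolding cl_def P0(1) by simp
    qed
    also have "\<dots> = 0" by (rule bspec[OF all tt])
    finally show "(LINT t|lebesgue_on {0<..}. complex_of_real (?\<theta> t) * pair (mulL (wt c) (cl w t)) (abs_l2 \<psi>) + complex_of_real (\<theta> t) * B t) = 0" .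
  qed
  have gi: "gr w j integrable_on {0..t}" for j
    by (rule integrable_continuous_interval[OF continuous_on_subset[OF wave_gradient_continuous[OF W]]]) auto
  have li: "integral {0..t} (%s. pair (mulL (coef a i j) (gr w j s)) (abs_l2 (?d i))) = pair (mulL (coef a i j) (integral {0..t} (gr w j))) (abs_l2 (?d i))"
    "(%s. pair (mulL (coef a i j) (gr w j s)) (abs_l2 (?d i))) integrable_on {0..t}" for i j
    using integral_linear[OF gi blc] integrable_linear[OF gi blc] by (auto simp: o_def)
  have "integral {0..t} B = (\<Sum>i\<in>UNIV. integral {0..t} (%s. \<Sum>j\<in>UNIV. pair (mulL (coef a i j) (gr w j s)) (abs_l2 (?d i))))"
    unfolding B_def by (rule HK_integral_sum) (simp, intro integrable_sum li(2), simp)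
  also have "\<dots> = (\<Sum>i\<in>UNIV. \<Sum>j\<in>UNIV. pair (mulL (coef a i j) (integral {0..t} (gr w j))) (abs_l2 (?d i)))"
    unfolding li(1)[symmetric] by (rule sum.cong[OF refl]) (rule HK_integral_sum, simp, rule li(2))
  finally show "pair (mulL (wt c) (cl w' t)) (abs_l2 \<psi>) +
      (\<Sum>i\<in>UNIV. pair (\<Sum>j\<in>UNIV. mulL (coef a i j) (integral {0..t} (gr w j))) (abs_l2 (?d i))) = 0"
    unfolding main by (simp add: bounded_bilinear.sum_left[OF bounded_bilinear_pair])
qed

lemma weak_div_diff:
  assumes "weak_div h F" "weak_div h' F'" shows "weak_div (h - h') (%i. F i - F' i)"
  unfolding weak_div_def
proof
  fix \<phi> :: "real^3 => complex" assume \<phi>: "\<phi> \<in> test_fun UNIV"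
  note 1 = bspec[OF assms(1)[unfolded weak_div_def] \<phi>] and 2 = bspec[OF assms(2)[unfolded weak_div_def] \<phi>]
  have e: "(X - X') + (S - S') = (X + S) - (X' + S')" for X X' S S' :: complex by simp
  show "pair (h - h') (abs_l2 \<phi>) + (\<Sum>i\<in>UNIV. pair (F i - F' i) (abs_l2 (pd i \<phi>))) = 0"
    unfolding bounded_bilinear.diff_left[OF bounded_bilinear_pair] sum_subtractf e 1 2 by simp
qed

lemma H1_fun_restrict:
  assumes U: "open U" and f: "H1_fun UNIV f"
  shows "H1_fun U f" "zext U f = proj U (abs_l2 f)" "zext U (weak_deriv U i f) = proj U (abs_l2 (weak_deriv UNIV i f))"
proof -
  have Um: "U \<in> sets lebesgue" using U by simp
  have L: "L2_fun UNIV f" using f by (simp add: H1_fun_def)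
  show z: "zext U f = proj U (abs_l2 f)" by (rule zext_proj[OF L Um])
  have w: "weakly_diff U i (zext U f) (proj U (abs_l2 (weak_deriv UNIV i f)))" for i
    unfolding z weakly_diff_proj[OF Um]
    unfolding weakly_diff_def by (rule ballI) (rule bspec[OF H1_UNIV(3)[OF f, unfolded weakly_diff_def] test_fun_UNIV])
  note H = H1_fun_zextI[OF U L2_fun_subset[OF L Um] w]
  show "H1_fun U f" by (rule H(1))
  show "zext U (weak_deriv U i f) = proj U (abs_l2 (weak_deriv UNIV i f))"
    unfolding H(2) by (simp add: proj_proj[OF Um Um])
qed

lemma proj_UNIV: "proj UNIV u = u"
proof -
  have "(indicator UNIV :: real^3 => complex) = (%x. 1)" by auto
  then show ?thesis by (simp add: proj_def mulL_one)
qed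

lemma weakly_diff_0: "weakly_diff UNIV i 0 G ==> G = 0"
  using test_functions_separate[OF open_UNIV, of G]
  by (simp add: weakly_diff_def proj_UNIV bounded_bilinear.zero_left[OF bounded_bilinear_pair])

lemma integral_derivative_atLeast:
  fixes f :: "real => 'a::banach"
  assumes f: "continuous_on {0..} f" and t: "t \<ge> 0"
  shows "((%u. integral {0..u} f) has_vector_derivative f t) (at t within {0..})"
proof -
  have "((%u. integral {0..u} f) has_vector_derivative f t) (at t within {0..t+1})"
    by (rule integral_has_vector_derivative[OF continuous_on_subset[OF f]]) (use t in auto)
  moreover have "at t within {0..t+1} = at t within {0..}"
    by (rule at_within_nhd[of _ "{t - 1<..<t + 1}"]) (use t in auto)
  ultimately show ?thesis by simp
qed

subsection \<open>Two solutions with the same boundary values\<close>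

text \<open>The coercivity constant \<open>r\<close> belongs to c1: the energy is taken outside
  \<Omega>, where the two weights coincide, and is measured there with the weight of c1.\<close>

locale two_waves =
  fixes a :: "real^3 => real^3^3" and \<Omega> :: "(real^3) set" and c1 c2 :: "real^3 => real" and f1 f2 :: "real^3 => complex"
    and u1 u1' u2 u2' :: "real => real^3 => complex" and MA M1 M2 r :: real
  assumes bnd: "\<And>i j. ae_bounded (coef a i j) MA" and sym: "\<And>x i j. a x $ i $ j = a x $ j $ i"
    and ell: "\<And>x \<xi>. 0 \<le> (\<Sum>i\<in>UNIV. \<Sum>j\<in>UNIV. a x $ i $ j * \<xi> $ i * \<xi> $ j)"
    and q1: "ae_bounded (wt c1) M1" and q2: "ae_bounded (wt c2) M2"
    and r: "r > 0" "\<And>u. r * (inner u u) \<le> inner (mulL (wt c1) u) u"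
    and lip: "lipschitz_domain \<Omega>"
    and f: "is_L2 f1" "is_L2 f2" "AE x in lebesgue. x \<notin> \<Omega> --> f1 x = 0" "AE x in lebesgue. x \<notin> \<Omega> --> f2 x = 0"
    and c12: "AE x in lebesgue. x \<notin> \<Omega> --> c1 x = c2 x"
    and W1: "wave_solution a c1 f1 (%x. 0) u1 u1'" and W2: "wave_solution a c2 f2 (%x. 0) u2 u2'"
    and bdry: "\<And>t. t > 0 ==> eq_on_boundary \<Omega> (u1 t) (u2 t)"
begin

lemma \<Omega>: "open \<Omega>" "bounded \<Omega>" "\<Omega> \<in> sets lebesgue"
  using lip unfolding lipschitz_domain_def by auto

abbreviation D where "D t \<equiv> cl u1 t - cl u2 t"
abbreviation D' where "D' t \<equiv> cl u1' t - cl u2' t"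
abbreviation DG where "DG i t \<equiv> gr u1 i t - gr u2 i t"
abbreviation DI where "DI i t \<equiv> integral {0..t} (gr u1 i) - integral {0..t} (gr u2 i)"

lemma D_derivative: "t \<ge> 0 ==> (D has_vector_derivative D' t) (at t within {0..})"
  by (intro has_vector_derivative_diff wave_derivative[OF W1] wave_derivative[OF W2])

lemma D_continuous: "continuous_on {0..} D"
  by (rule vector_derivative_imp_continuous_on[OF D_derivative]) simp

lemma DG_continuous: "continuous_on {0..} (DG i)"
  by (intro continuous_on_diff wave_gradient_continuous[OF W1] wave_gradient_continuous[OF W2])

text \<open>The boundary condition is given for positive times. At time 0 it follows from the
  continuity of the solutions in H1 and the closedness of the set of zero-trace pairs.\<close>

lemma D_zero_trace:
  assumes "t \<ge> 0" shows "zero_trace \<Omega> (proj \<Omega> (D t), \<chi> i. proj \<Omega> (DG i t))"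
proof -
  let ?u = "%t. (proj \<Omega> (D t), \<chi> i. proj \<Omega> (DG i t))"
  have pos: "zero_trace \<Omega> (?u t)" if t: "t > 0" for t
  proof -
    have t0: "t \<ge> 0" using t by simp
    let ?w = "%x. u1 t x - u2 t x"
    note d = H1_fun_diff[OF open_UNIV wave_H1[OF W1 t0] wave_H1[OF W2 t0], unfolded zext_UNIV]
    note R = H1_fun_restrict[OF \<Omega>(1) d(1)]
    have "has_trace \<Omega> ?w (%x. 0)" using bdry[OF t] by (simp add: eq_on_boundary_def)
    then show ?thesis unfolding has_trace_0_iff[OF \<Omega>(1) R(1)] R(2,3) d(2,3) by (simp add: cl_def gr_def)
  qed
  have cont: "continuous_on {0..} ?u"
    by (intro continuous_on_Pair continuous_on_vec_lambda bounded_linear.continuous_on[OF bounded_linear_proj[OF \<Omega>(3)]] D_continuous DG_continuous)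
  have "(%n. t + 1 / (real n + 1)) \<longlonglongrightarrow> t" by real_asymp
  then have "(%n. ?u (t + 1 / (real n + 1))) \<longlonglongrightarrow> ?u t"
    by (rule continuous_on_tendsto_compose[OF cont]) (use assms in auto)
  then have "?u t \<in> {u. zero_trace \<Omega> u}"
    by (rule closed_sequentially[OF zero_trace_closed, rotated]) (use pos assms in \<open>simp add: add_nonneg_pos\<close>)
  then show ?thesis by simp
qed

text \<open>The projection onto functions living outside \<Omega>, where both solutions satisfy the
  same equation.\<close>

definition co :: "l2 => l2" where "co u = u - proj \<Omega> u"

lemma bounded_linear_co: "bounded_linear co"
  unfolding co_def[abs_def] by (intro bounded_linear_sub bounded_linear_ident bounded_linear_proj \<Omega>)

lemmas co_linear = bounded_linear.linear[OF bounded_linear_co]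

lemma co_co: "co (co u) = co u"
  using linear_diff[OF bounded_linear.linear[OF bounded_linear_proj[OF \<Omega>(3)]]] by (simp add: co_def proj_proj[OF \<Omega>(3) \<Omega>(3)])

lemma inner_co: "inner u (co v) = inner (co u) (co v)"
proof -
  have "(indicator \<Omega> :: real^3 => complex) = (%x. complex_of_real (indicator \<Omega> x))" by (rule ext) (simp add: indicator_def)
  then have "inner (proj \<Omega> u) v = inner u (proj \<Omega> v)" for u v
    unfolding proj_def using inner_mulL_real[of "indicator \<Omega>" 1 u v] ae_bounded_indicator[OF \<Omega>(3)] by simp
  then have "inner (co u) v = inner u (co v)" for u v by (simp add: co_def inner_diff_left inner_diff_right)
  then show ?thesis by (simp add: co_co)
qed

lemma co_mulL: "ae_bounded m M ==> co (mulL m u) = mulL m (co u)"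
  unfolding co_def proj_def using linear_diff[OF bounded_linear.linear[OF bounded_linear_mulL]]
  by (simp add: mulL_mulL[OF _ ae_bounded_indicator[OF \<Omega>(3)]] mulL_mulL[OF ae_bounded_indicator[OF \<Omega>(3)]] mult.commute)

lemma co_abs_l2: "is_L2 g ==> co (abs_l2 g) = abs_l2 (%x. g x - (if x \<in> \<Omega> then g x else 0))"
  unfolding co_def using proj_abs_l2[OF \<Omega>(3), of g] abs_l2_simps[of g "%x. if x \<in> \<Omega> then g x else 0"] by simp

lemma co_abs_l2_0:
  assumes "is_L2 g" "AE x in lebesgue. x \<notin> \<Omega> --> g x = 0" shows "co (abs_l2 g) = 0"
  unfolding co_abs_l2[OF assms(1)] zero_l2_eq
proof (rule abs_l2_cong[OF is_L2_diff[OF assms(1) proj_abs_l2(2)[OF \<Omega>(3) assms(1)]] is_L2_0])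
  show "AE x in lebesgue. g x - (if x \<in> \<Omega> then g x else 0) = 0" using assms(2) by eventually_elim auto
qed

lemma wt_co: "mulL (wt c2) (co u) = mulL (wt c1) (co u)"
proof -
  obtain g where g: "is_L2 g" "u = abs_l2 g" by (cases u)
  note g' = is_L2_diff[OF g(1) proj_abs_l2(2)[OF \<Omega>(3) g(1)]]
  show ?thesis unfolding g(2) co_abs_l2[OF g(1)] mulL_abs_l2[OF q1 g'] mulL_abs_l2[OF q2 g']
  proof (rule abs_l2_cong[OF is_L2_mult[OF q2 g'] is_L2_mult[OF q1 g']])
    show "AE x in lebesgue. wt c2 x * (g x - (if x \<in> \<Omega> then g x else 0)) = wt c1 x * (g x - (if x \<in> \<Omega> then g x else 0))"
      using c12 by eventually_elim (auto simp: wt_def)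
  qed
qed

text \<open>The once-integrated equation of the difference reads H = div F. Inside \<Omega> the
  weights may differ, so H is a multiple of the velocity difference only outside; the coefficients
  in F are common to both solutions.\<close>

definition H where "H t = mulL (wt c1) (cl u1' t) - mulL (wt c2) (cl u2' t)"
definition F where "F t i = (\<Sum>j\<in>UNIV. mulL (coef a i j) (integral {0..t} (gr u1 j))) - (\<Sum>j\<in>UNIV. mulL (coef a i j) (integral {0..t} (gr u2 j)))"

lemma weak_div_HF: "t \<ge> 0 ==> weak_div (H t) (F t)"
  unfolding H_def F_def[abs_def] by (intro weak_div_diff wave_weak_div[OF W1 f(1) q1 bnd] wave_weak_div[OF W2 f(2) q2 bnd])

lemma co_H: "co (H t) = mulL (wt c1) (co (D' t))"
  unfolding H_def linear_diff[OF co_linear] co_mulL[OF q1] co_mulL[OF q2] wt_co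
  by (rule linear_diff[OF bounded_linear.linear[OF bounded_linear_mulL[OF q1]], symmetric])

lemma co_F: "co (F t i) = (\<Sum>j\<in>UNIV. mulL (coef a i j) (co (DI j t)))"
  unfolding F_def linear_diff[OF co_linear] linear_sum[OF co_linear] co_mulL[OF bnd] sum_subtractf[symmetric]
  by (simp add: linear_diff[OF bounded_linear.linear[OF bounded_linear_mulL[OF bnd]]])

text \<open>The difference D is weakly differentiable on the whole space, and by its zero trace so
  is its part in \<Omega> continued by zero. Subtracting the two leaves the exterior part.\<close>

lemma co_weakly_diff:
  assumes t: "t \<ge> 0" shows "weakly_diff UNIV i (co (D t)) (co (DG i t))"
proof -
  have 1: "weakly_diff UNIV i (proj \<Omega> (D t)) (proj \<Omega> (DG i t))"
    using zero_trace_extension[OF \<Omega>(1,2) frontier_haus2_finite[OF lip] D_zero_trace[OF t], of i] by simp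
  show ?thesis using 1 wave_weakly_diff[OF W1 t, of i] wave_weakly_diff[OF W2 t, of i]
    unfolding weakly_diff_def co_def by (simp add: bounded_bilinear.diff_left[OF bounded_bilinear_pair])
qed

text \<open>The exterior part of D may be tested in the equation on the whole space. Such a test
  sees only the exterior parts of H and F, which involve the common weight, so the energy argument
  closes and gives D. The gradient, the velocity and the time integrals then vanish outside as
  consequences.\<close>

lemma exterior_zero:
  assumes t: "t \<ge> 0"
  shows "co (D t) = 0" "co (DG i t) = 0" "co (D' t) = 0" "co (DI i t) = 0"
proof -
  have X0: "co (D t) = 0" if "t \<ge> 0" for t
  proof (rule energy_uniqueness[OF bnd sym ell q1 r, where X="%t. co (D t)" and Y="%t. co (D' t)" and J="%j t. co (DI j t)" and Z="%j t. co (DG j t)", OF _ _ _ _ _ that])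
    show "((%t. co (D t)) has_vector_derivative co (D' t)) (at t within {0..})" if "t \<ge> 0" for t
      by (rule bounded_linear.has_vector_derivative[OF bounded_linear_co D_derivative[OF that]])
    show "co (D 0) = 0"
      unfolding wave_initial(1)[OF W1 f(1) is_L2_0] wave_initial(1)[OF W2 f(2) is_L2_0] linear_diff[OF co_linear]
      by (simp add: co_abs_l2_0 f)
    show "((%t. co (DI j t)) has_vector_derivative co (DG j t)) (at t within {0..})" if "t \<ge> 0" for j t
      by (rule bounded_linear.has_vector_derivative[OF bounded_linear_co])
        (intro has_vector_derivative_diff integral_derivative_atLeast that wave_gradient_continuous[OF W1] wave_gradient_continuous[OF W2])
    show "co (DI j 0) = 0" for j by (simp add: linear_0[OF co_linear])
    fix t :: real assume t: "t \<ge> 0"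
    \<comment> \<open>Testing with conjugates makes the real part of the bilinear identity an
      identity of inner products, as the energy argument requires.\<close>
    have "pair (H t) (cnjL (co (D t))) + (\<Sum>i\<in>UNIV. pair (F t i) (cnjL (co (DG i t)))) = 0"
      by (rule weak_div_test_UNIV[OF weak_div_HF[OF t]]) (rule weakly_diff_cnj[OF co_weakly_diff[OF t]])
    then have "Re (pair (H t) (cnjL (co (D t))) + (\<Sum>i\<in>UNIV. pair (F t i) (cnjL (co (DG i t))))) = 0" by simp
    then have "inner (H t) (co (D t)) + (\<Sum>i\<in>UNIV. inner (F t i) (co (DG i t))) = 0" by (simp add: inner_l2_def)
    then show "inner (mulL (wt c1) (co (D' t))) (co (D t)) + (\<Sum>i\<in>UNIV. \<Sum>j\<in>UNIV. inner (mulL (coef a i j) (co (DI j t))) (co (DG i t))) = 0"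
      unfolding inner_co[of "H t"] inner_co[of "F t _"] co_H co_F inner_sum_left .
  qed
  then show "co (D t) = 0" using t .
  have G0: "co (DG i t) = 0" if "t \<ge> 0" for t i
    using weakly_diff_0[OF co_weakly_diff[OF that, of i, unfolded X0[OF that]]] .
  then show "co (DG i t) = 0" using t .
  have "((%t. 0::l2) has_vector_derivative co (D' t)) (at t within cbox 0 (t + 1))"
  proof (rule has_vector_derivative_transform)
    show "((%t. co (D t)) has_vector_derivative co (D' t)) (at t within cbox 0 (t + 1))"
      by (rule has_vector_derivative_within_subset[OF bounded_linear.has_vector_derivative[OF bounded_linear_co D_derivative[OF t]]]) auto
  qed (use t X0 in auto)
  then show "co (D' t) = 0"
    using vector_derivative_unique_within_closed_interval[of 0 "t + 1" t "%t. 0::l2"] t by (simp add: has_vector_derivative_const)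
  have "gr u1 i integrable_on {0..t}" "gr u2 i integrable_on {0..t}"
    by (rule integrable_continuous_interval[OF continuous_on_subset[OF wave_gradient_continuous[OF W1]]],
        rule subsetI, simp, rule integrable_continuous_interval[OF continuous_on_subset[OF wave_gradient_continuous[OF W2]]], rule subsetI, simp)
  then have "DI i t = integral {0..t} (DG i)" by (simp add: HK_integral_diff)
  also have "co \<dots> = integral {0..t} (%s. co (DG i s))"
    using integral_linear[OF integrable_continuous_interval[OF continuous_on_subset[OF DG_continuous]] bounded_linear_co, of 0 t i] by (simp add: o_def)
  also have "\<dots> = integral {0..t} (%s. 0)" by (rule HK_integral_cong) (simp add: G0)
  finally show "co (DI i t) = 0" by simp
qed

text \<open>By \<open>exterior_zero\<close> both H and F live on \<Omega>, so functions of
  H1(\<Omega>) with arbitrary boundary values may be tested. This is the equality of the conormal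
  derivatives, integrated once in time.\<close>

theorem interior_equation:
  assumes t: "t \<ge> 0" and v: "\<And>i. weakly_diff \<Omega> i v (V i)"
  shows "pair (H t) v + (\<Sum>i\<in>UNIV. pair (F t i) (V i)) = 0"
proof (rule weak_div_test_Lipschitz[OF lip weak_div_HF[OF t] _ _ v])
  have "mulL m 0 = 0" if "ae_bounded m M" for m M using linear_0[OF bounded_linear.linear[OF bounded_linear_mulL[OF that]]] .
  note m0 = this[OF q1] this[OF bnd]
  have "co (H t) = 0" by (simp add: co_H exterior_zero[OF t] m0)
  then show "proj \<Omega> (H t) = H t" by (simp add: co_def)
  have "co (F t i) = 0" for i by (simp add: co_F exterior_zero[OF t] m0)
  then show "proj \<Omega> (F t i) = F t i" for i by (simp add: co_def)
qed

end

section \<open>Bounds on the coefficients and decay inside \<Omega>\<close>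

lemma coef_bounded:
  assumes a: "Ck_fun 1 a" and out: "\<And>x. norm x > R1 ==> a x = mat 1"
  shows "\<exists>M. \<forall>i j. ae_bounded (coef a i j) M"
proof -
  have c: "continuous_on UNIV a" by (rule Ck_fun_imp_continuous_on[OF a])
  have "compact (a ` cball 0 R1)" by (intro compact_continuous_image continuous_on_subset[OF c] compact_cball) simp
  then have "bounded (a ` cball 0 R1)" by (rule compact_imp_bounded)
  then obtain M where M: "\<forall>y\<in>a ` cball 0 R1. norm y \<le> M" unfolding bounded_iff by (elim exE)
  have "cmod (coef a i j x) \<le> max M 1" for i j x
  proof (cases "norm x \<le> R1")
    case True
    then have "norm (a x) \<le> M" using M by simp
    moreover have "norm (a x $ i $ j) \<le> norm (a x)"
      by (rule order_trans[OF Finite_Cartesian_Product.norm_nth_le Finite_Cartesian_Product.norm_nth_le])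
    ultimately show ?thesis by (simp add: coef_def)
  next
    case False
    then show ?thesis using out[of x] by (simp add: coef_def mat_def le_max_iff_disj)
  qed
  moreover have "coef a i j \<in> borel_measurable lebesgue" for i j
  proof -
    have "continuous_on UNIV (coef a i j)" unfolding coef_def by (intro continuous_intros c)
    then have "coef a i j \<in> borel_measurable lborel" by (simp add: borel_measurable_continuous_onI)
    then show ?thesis by (rule measurable_completion)
  qed
  ultimately show ?thesis unfolding ae_bounded_def by (intro exI[of _ "max M 1"]) simp
qed

lemma inner_mulL_abs:
  assumes "ae_bounded (%x. complex_of_real (m x)) M" "is_L2 f"
  shows "inner (mulL (%x. complex_of_real (m x)) (abs_l2 f)) (abs_l2 f) = (LINT x|lebesgue. m x * (cmod (f x))\<^sup>2)"
    "integrable lebesgue (%x. m x * (cmod (f x))\<^sup>2)"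
proof -
  have eq: "(%x. complex_of_real (m x) * f x * cnj (f x)) = (%x. complex_of_real (m x * (cmod (f x))\<^sup>2))"
    by (rule ext) (simp only: of_real_mult complex_norm_square mult.assoc)
  note p = pair_mulL_abs[OF assms is_L2_cnj[OF assms(2)], unfolded eq]
  have c: "cnjL (abs_l2 f) = abs_l2 (%x. cnj (f x))" using abs_l2_simps[OF assms(2) assms(2)] by simp
  show "inner (mulL (%x. complex_of_real (m x)) (abs_l2 f)) (abs_l2 f) = (LINT x|lebesgue. m x * (cmod (f x))\<^sup>2)"
    unfolding inner_l2_def c p(1) integral_complex_of_real by simp
  show "integrable lebesgue (%x. m x * (cmod (f x))\<^sup>2)" using integrable_Re[OF p(2)] by simp
qed

lemma wt_bounds:
  assumes c: "Linfty_fun c" and r1: "r1 > 0" "AE x in lebesgue. c x \<ge> r1"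
  shows "ae_bounded (wt c) (inverse (r1\<^sup>2))" "\<exists>r>0. \<forall>u. r * inner u u \<le> inner (mulL (wt c) u) u"
proof -
  have [measurable]: "c \<in> borel_measurable lebesgue" using c by (simp add: Linfty_fun_def)
  obtain M where M: "AE x in lebesgue. \<bar>c x\<bar> \<le> M" using c by (auto simp: Linfty_fun_def)
  show b: "ae_bounded (wt c) (inverse (r1\<^sup>2))" unfolding ae_bounded_def
  proof
    show "wt c \<in> borel_measurable lebesgue" unfolding wt_def by measurable
    show "AE x in lebesgue. cmod (wt c x) \<le> inverse (r1\<^sup>2)" using r1(2)
    proof eventually_elim
      case (elim x)
      have "inverse ((c x)\<^sup>2) \<le> inverse (r1\<^sup>2)" using elim r1(1) by (intro le_imp_inverse_le power_mono) auto
      moreover have "cmod (wt c x) = inverse ((c x)\<^sup>2)" unfolding wt_def norm_of_real by simp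
      ultimately show ?case by simp
    qed
  qed
  define K where "K = inverse ((max M 1)\<^sup>2)"
  have K: "K > 0" by (simp add: K_def)
  have "K * inner u u \<le> inner (mulL (wt c) u) u" for u
  proof -
    obtain f where f: "is_L2 f" "u = abs_l2 f" by (cases u)
    have o: "ae_bounded (%x. complex_of_real 1) 1" using ae_bounded_const[of 1] by simp
    note 1 = inner_mulL_abs[OF o f(1)]
    note 2 = inner_mulL_abs[OF b[unfolded wt_def] f(1)]
    have "inner u u = (LINT x|lebesgue. 1 * (cmod (f x))\<^sup>2)" using 1(1) by (simp add: f(2) mulL_one)
    then have "K * inner u u = (LINT x|lebesgue. K * (1 * (cmod (f x))\<^sup>2))" by simp
    also have "\<dots> \<le> (LINT x|lebesgue. inverse ((c x)\<^sup>2) * (cmod (f x))\<^sup>2)"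
    proof (rule integral_mono_AE[OF _ 2(2)])
      show "integrable lebesgue (%x. K * (1 * (cmod (f x))\<^sup>2))" using 1(2) by (rule Bochner_Integration.integrable_mult_right)
      show "AE x in lebesgue. K * (1 * (cmod (f x))\<^sup>2) \<le> inverse ((c x)\<^sup>2) * (cmod (f x))\<^sup>2" using M r1(2)
      proof eventually_elim
        case (elim x)
        have "(c x)\<^sup>2 \<le> (max M 1)\<^sup>2" using elim r1(1) by (intro power_mono) auto
        moreover have "0 < (c x)\<^sup>2" using elim r1(1) by simp
        ultimately have "K \<le> inverse ((c x)\<^sup>2)" unfolding K_def by (intro le_imp_inverse_le)
        then show ?case by (simp add: mult_right_mono)
      qed
    qed
    also have "\<dots> = inner (mulL (wt c) u) u" using 2(1) by (simp add: f(2) wt_def)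
    finally show ?thesis .
  qed
  then show "\<exists>r>0. \<forall>u. r * inner u u \<le> inner (mulL (wt c) u) u" using K by blast
qed

text \<open>The norms over the ball in the decay hypothesis dominate the L2 norms over \<Omega> of
  the solution, its gradient and its velocity, because the ball contains \<Omega>.\<close>

lemma exp_decay_proj:
  assumes W: "wave_solution a c f (%x. 0) w w'" and dec: "exp_decay a \<Omega> c R0 C \<delta>"
    and f: "H1_fun UNIV f" "ess_supp f \<subseteq> closure \<Omega>" and sub: "closure \<Omega> \<subseteq> ball 0 R0" and \<Omega>: "open \<Omega>"
  shows "decay \<delta> (%t. proj \<Omega> (cl w t))" "decay \<delta> (%t. proj \<Omega> (gr w j t))" "decay \<delta> (%t. proj \<Omega> (cl w' t))"
proof -
  let ?B = "ball 0 R0 :: (real^3) set"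
  have m: "\<Omega> \<in> sets lebesgue" "?B \<in> sets lebesgue" using \<Omega> by simp_all
  define K where "K = C * (H1_norm UNIV f + L2_norm UNIV (%x. 0))"
  have "ess_supp (%x. 0 :: complex) = {}"
  proof -
    have "(UNIV :: (real^3) set) \<in> {U. open U \<and> (AE x in lebesgue. x \<in> U --> (0::complex) = 0)}" by simp
    then show ?thesis unfolding ess_supp_def by blast
  qed
  then have es: "ess_supp f \<union> ess_supp (%x. 0 :: complex) \<subseteq> closure \<Omega>" using f(2) by simp
  have le: "H1_norm ?B (w t) + L2_norm ?B (w' t) \<le> K * exp (- \<delta> * t)" if t: "t > 0" for t
  proof -
    have "H1_norm ?B (w t) + L2_norm ?B (w' t) \<le> C * exp (- \<delta> * t) * (H1_norm UNIV f + L2_norm UNIV (%x. 0))"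
      by (rule dec[unfolded exp_decay_def, rule_format, OF f(1) is_L2_0 es W t])
    then show ?thesis by (simp add: K_def mult.commute mult.left_commute)
  qed
  have sub': "\<Omega> \<inter> ?B = \<Omega>" using sub closure_subset by blast
  have P: "norm (proj \<Omega> u) \<le> norm (proj ?B u)" for u
    using norm_proj_le[OF m(1), of "proj ?B u"] by (simp add: proj_proj[OF m] sub')
  have B: "norm (proj \<Omega> (cl w t)) \<le> K * exp (- \<delta> * t)" "norm (proj \<Omega> (gr w j t)) \<le> K * exp (- \<delta> * t)"
    "norm (proj \<Omega> (cl w' t)) \<le> K * exp (- \<delta> * t)" if t: "t > 0" for t
  proof -
    have t0: "t \<ge> 0" using t by simp
    note R = H1_fun_restrict[OF open_ball wave_H1[OF W t0], of 0 R0]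
    note L = L2_fun_subset[OF wave_velocity_L2[OF W t0] m(2)]
    have 1: "norm (proj ?B (cl w t)) \<le> H1_norm ?B (w t)" using H1_norm_bounds(1)[OF open_ball R(1)] unfolding R(2) cl_def .
    have 2: "norm (proj ?B (gr w j t)) \<le> H1_norm ?B (w t)" using H1_norm_bounds(2)[OF open_ball R(1), of j] unfolding R(3) gr_def .
    have 3: "norm (proj ?B (cl w' t)) = L2_norm ?B (w' t)"
      using zext_norm[OF m(2) L] zext_proj[OF wave_velocity_L2[OF W t0] m(2)] by (simp add: cl_def)
    have h0: "0 \<le> H1_norm ?B (w t)" by (rule order_trans[OF norm_ge_zero 1])
    have l0: "0 \<le> L2_norm ?B (w' t)" unfolding 3[symmetric] by (rule norm_ge_zero)
    show "norm (proj \<Omega> (cl w t)) \<le> K * exp (- \<delta> * t)" using P[of "cl w t"] 1 le[OF t] l0 by linarith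
    show "norm (proj \<Omega> (gr w j t)) \<le> K * exp (- \<delta> * t)" using P[of "gr w j t"] 2 le[OF t] l0 by linarith
    show "norm (proj \<Omega> (cl w' t)) \<le> K * exp (- \<delta> * t)" using P[of "cl w' t"] 3 le[OF t] h0 by linarith
  qed
  have wc: "continuous_on {0..} (cl w)" by (rule vector_derivative_imp_continuous_on[OF wave_derivative[OF W]]) simp
  note pc = bounded_linear.continuous_on[OF bounded_linear_proj[OF m(1)]]
  show "decay \<delta> (%t. proj \<Omega> (cl w t))" by (rule decayI[OF pc[OF wc] B(1)])
  show "decay \<delta> (%t. proj \<Omega> (gr w j t))" by (rule decayI[OF pc[OF wave_gradient_continuous[OF W]] B(2)])
  show "decay \<delta> (%t. proj \<Omega> (cl w' t))" by (rule decayI[OF pc[OF wave_velocity_continuous[OF W]] B(3)])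
qed

section \<open>Cosine transforms of solutions and their elliptic equations\<close>

lemma proj_mulL: "U \<in> sets lebesgue ==> ae_bounded m M ==> proj U (mulL m u) = mulL m (proj U u)"
  unfolding proj_def by (simp add: mulL_mulL[OF ae_bounded_indicator] mulL_mulL[OF _ ae_bounded_indicator] mult.commute)

lemma proj_cscale: "U \<in> sets lebesgue ==> proj U (cscale c u) = cscale c (proj U u)"
  unfolding proj_def by (rule mulL_cscale[OF ae_bounded_indicator])

lemma pair_mulL_proj:
  assumes "U \<in> sets lebesgue" "ae_bounded m M" "proj U v = v"
  shows "pair (mulL m (proj U x)) v = pair (mulL m x) v"
proof -
  have "pair (mulL m (proj U x)) v = pair (mulL m x) (proj U v)"
    unfolding proj_mulL[OF assms(1,2), symmetric] by (rule pair_proj[OF assms(1)])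
  then show ?thesis unfolding assms(3) .
qed

lemma pair_mulL_cscale: "ae_bounded m M ==> pair (mulL m (cscale c u)) v = c * pair (mulL m u) v"
  by (simp add: mulL_cscale pair_cscale)

lemma proj_cosine_l2:
  assumes "U \<in> sets lebesgue" "decay d f" "\<bar>Im \<tau>\<bar> < d" "\<And>t. proj U (f t) = f t"
  shows "proj U (cosine_l2 f \<tau>) = cosine_l2 f \<tau>"
  using improper_bounded_linear[OF decay_cos_cscale[OF assms(2)] _ bounded_linear_proj[OF assms(1)], of \<tau>] assms(3)
  by (simp add: cosine_l2_def proj_cscale[OF assms(1)] assms(4))

lemma improper_diff:
  assumes "decay e f" "decay e g" "e > 0"
  shows "improper (%t. f t - g t) = improper f - improper g"
proof (rule improperI)
  have "integral {0..real n} (%t. f t - g t) = integral {0..real n} f - integral {0..real n} g" for n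
    by (rule HK_integral_diff[OF decay_integrable[OF assms(1)] decay_integrable[OF assms(2)]]) simp_all
  then show "(%n. integral {0..real n} (%t. f t - g t)) \<longlonglongrightarrow> improper f - improper g"
    using tendsto_diff[OF improper_limit[OF assms(1,3)] improper_limit[OF assms(2,3)]] by simp
qed

lemma cosine_transform_diff:
  assumes "decay d p" "decay d q" "\<bar>Im \<tau>\<bar> < d"
  shows "cosine_transform (%t. p t - q t) \<tau> = cosine_transform p \<tau> - cosine_transform q \<tau>"
  unfolding cosine_transform_def right_diff_distrib
  by (rule improper_diff[OF decay_cos_mult[OF assms(1)] decay_cos_mult[OF assms(2)]]) (use assms(3) in simp)

lemma cosine_l2_diff:
  assumes "decay d p" "decay d q" "\<bar>Im \<tau>\<bar> < d"
  shows "cosine_l2 (%t. p t - q t) \<tau> = cosine_l2 p \<tau> - cosine_l2 q \<tau>"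
  unfolding cosine_l2_def linear_diff[OF bounded_linear.linear[OF bounded_linear_cscale]]
  by (rule improper_diff[OF decay_cos_cscale[OF assms(1)] decay_cos_cscale[OF assms(2)]]) (use assms(3) in simp)

lemma cosine_transform_sum:
  assumes "\<And>i. i \<in> I ==> decay d (p i)" "\<bar>Im \<tau>\<bar> < d" "finite I"
  shows "cosine_transform (%t. \<Sum>i\<in>I. p i t) \<tau> = (\<Sum>i\<in>I. cosine_transform (p i) \<tau>)"
  unfolding cosine_transform_def sum_distrib_left
  by (rule improper_sum[OF decay_cos_mult[OF assms(1)] _ assms(3)]) (use assms(2) in simp_all)

lemma cosine_transform_cong:
  assumes "\<And>t. t \<ge> 0 ==> p t = q t" shows "cosine_transform p \<tau> = cosine_transform q \<tau>"
proof -
  have "integral {0..real n} (%t. cos (\<tau> * complex_of_real t) * p t) = integral {0..real n} (%t. cos (\<tau> * complex_of_real t) * q t)" for n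
    by (rule HK_integral_cong) (simp add: assms)
  then show ?thesis by (simp add: cosine_transform_def improper_def)
qed

text \<open>Collects, for one solution and one test pair v, V living on \<Omega>, what
  \<open>cosine_transform_wave\<close> asks for apart from the identity linking P and Q. That
  identity has two sources: the wave equation itself when v is a test function on \<Omega>, and
  \<open>interior_equation\<close> for the difference of two solutions and general v.\<close>

lemma wave_transform:
  assumes W: "wave_solution a c f (%x. 0) w w'" and bnd: "\<And>i j. ae_bounded (coef a i j) MA" and q: "ae_bounded (wt c) MC"
    and m: "\<Omega> \<in> sets lebesgue"
    and dec: "decay \<delta> (%t. proj \<Omega> (cl w t))" "\<And>j. decay \<delta> (%t. proj \<Omega> (gr w j t))" "decay \<delta> (%t. proj \<Omega> (cl w' t))"
    and \<tau>: "\<bar>Im \<tau>\<bar> < \<delta>" and v: "proj \<Omega> v = v" "\<And>i. proj \<Omega> (V i) = V i"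
    and p: "p = (%t. pair (mulL (wt c) (proj \<Omega> (cl w t))) v)"
    and P: "P = (%t. pair (mulL (wt c) (proj \<Omega> (cl w' t))) v)"
    and Q: "Q = (%t. \<Sum>i\<in>UNIV. \<Sum>j\<in>UNIV. pair (mulL (coef a i j) (proj \<Omega> (gr w j t))) (V i))"
  shows "decay \<delta> p" "decay \<delta> P" "decay \<delta> Q"
    "t \<ge> 0 ==> (p has_vector_derivative P t) (at t within {0..})"
    "t \<ge> 0 ==> P t = pair (mulL (wt c) (cl w' t)) v"
    "t \<ge> 0 ==> integral {0..t} Q = (\<Sum>i\<in>UNIV. pair (\<Sum>j\<in>UNIV. mulL (coef a i j) (integral {0..t} (gr w j))) (V i))"
    "cosine_transform p \<tau> = pair (mulL (wt c) (cosine_l2 (%t. proj \<Omega> (cl w t)) \<tau>)) v"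
    "cosine_transform Q \<tau> = (\<Sum>i\<in>UNIV. \<Sum>j\<in>UNIV. pair (mulL (coef a i j) (cosine_l2 (%t. proj \<Omega> (gr w j t)) \<tau>)) (V i))"
proof -
  note blq = bounded_linear_pair_mulL[OF q, of v] and blc = bounded_linear_pair_mulL[OF bnd]
  show "decay \<delta> p" unfolding p by (rule decay_bounded_linear[OF blq dec(1)])
  show "decay \<delta> P" unfolding P by (rule decay_bounded_linear[OF blq dec(3)])
  have dQ: "decay \<delta> (%t. pair (mulL (coef a i j) (proj \<Omega> (gr w j t))) (V i))" for i j
    by (rule decay_bounded_linear[OF blc dec(2)])
  then show "decay \<delta> Q" unfolding Q by (intro decay_sum)
  show "(p has_vector_derivative P t) (at t within {0..})" if "t \<ge> 0" unfolding p P
    by (rule bounded_linear.has_vector_derivative[OF blq bounded_linear.has_vector_derivative[OF bounded_linear_proj[OF m] wave_derivative[OF W that]]])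
  show "P t = pair (mulL (wt c) (cl w' t)) v" unfolding P by (rule pair_mulL_proj[OF m q v(1)])
  show "integral {0..t} Q = (\<Sum>i\<in>UNIV. pair (\<Sum>j\<in>UNIV. mulL (coef a i j) (integral {0..t} (gr w j))) (V i))"
  proof -
    have gi: "gr w j integrable_on {0..t}" for j
      by (rule integrable_continuous_interval[OF continuous_on_subset[OF wave_gradient_continuous[OF W]]]) auto
    have li: "integral {0..t} (%s. pair (mulL (coef a i j) (gr w j s)) (V i)) = pair (mulL (coef a i j) (integral {0..t} (gr w j))) (V i)"
      "(%s. pair (mulL (coef a i j) (gr w j s)) (V i)) integrable_on {0..t}" for i j
      using integral_linear[OF gi blc] integrable_linear[OF gi blc] by (auto simp: o_def)
    have "integral {0..t} Q = (\<Sum>i\<in>UNIV. integral {0..t} (%s. \<Sum>j\<in>UNIV. pair (mulL (coef a i j) (gr w j s)) (V i)))"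
      unfolding Q pair_mulL_proj[OF m bnd v(2)]
      by (rule HK_integral_sum) (simp, intro integrable_sum li(2), simp)
    also have "\<dots> = (\<Sum>i\<in>UNIV. \<Sum>j\<in>UNIV. pair (mulL (coef a i j) (integral {0..t} (gr w j))) (V i))"
      unfolding li(1)[symmetric] by (rule sum.cong[OF refl]) (rule HK_integral_sum, simp, rule li(2))
    finally show ?thesis by (simp add: bounded_bilinear.sum_left[OF bounded_bilinear_pair])
  qed
  show "cosine_transform p \<tau> = pair (mulL (wt c) (cosine_l2 (%t. proj \<Omega> (cl w t)) \<tau>)) v"
    unfolding p by (rule cosine_l2_linear[OF dec(1) \<tau> blq, symmetric]) (rule pair_mulL_cscale[OF q])
  have "cosine_transform Q \<tau> = (\<Sum>i\<in>UNIV. cosine_transform (%t. \<Sum>j\<in>UNIV. pair (mulL (coef a i j) (proj \<Omega> (gr w j t))) (V i)) \<tau>)"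
    unfolding Q by (rule cosine_transform_sum[OF decay_sum[OF dQ] \<tau>]) simp
  also have "\<dots> = (\<Sum>i\<in>UNIV. \<Sum>j\<in>UNIV. cosine_transform (%t. pair (mulL (coef a i j) (proj \<Omega> (gr w j t))) (V i)) \<tau>)"
    by (rule sum.cong[OF refl]) (rule cosine_transform_sum[OF dQ \<tau>], simp)
  also have "\<dots> = (\<Sum>i\<in>UNIV. \<Sum>j\<in>UNIV. pair (mulL (coef a i j) (cosine_l2 (%t. proj \<Omega> (gr w j t)) \<tau>)) (V i))"
    by (intro sum.cong refl) (rule cosine_l2_linear[OF dec(2) \<tau> blc pair_mulL_cscale[OF bnd], symmetric])
  finally show "cosine_transform Q \<tau> = (\<Sum>i\<in>UNIV. \<Sum>j\<in>UNIV. pair (mulL (coef a i j) (cosine_l2 (%t. proj \<Omega> (gr w j t)) \<tau>)) (V i))" .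
qed

lemma zext_pair_mulL:
  assumes U: "U \<in> sets lebesgue" and m: "ae_bounded m M" and f: "L2_fun U f" and g: "L2_fun U g"
  shows "(LINT x|lebesgue_on U. m x * f x * g x) = pair (mulL m (zext U f)) (zext U g)"
    "integrable (lebesgue_on U) (%x. m x * f x * g x)"
proof -
  have eq: "(%x. indicator U x *\<^sub>R (m x * f x * g x)) = (%x. m x * (if x \<in> U then f x else 0) * (if x \<in> U then g x else 0))"
    by (rule ext) (simp add: indicator_def)
  have Us: "U \<inter> space lebesgue \<in> sets lebesgue" using U by simp
  note p = pair_mulL_abs[OF m L2_fun_iff[OF U, THEN iffD1, OF f] L2_fun_iff[OF U, THEN iffD1, OF g]]
  show "(LINT x|lebesgue_on U. m x * f x * g x) = pair (mulL m (zext U f)) (zext U g)"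
    unfolding integral_restrict_space[OF Us] eq zext_def p(1) ..
  show "integrable (lebesgue_on U) (%x. m x * f x * g x)"
    unfolding integrable_restrict_space[OF Us] eq by (rule p(2))
qed

lemma coef_form:
  assumes bnd: "\<And>i j. ae_bounded (coef a i j) MA" and U: "open U" and w: "H1_fun U w" and g: "\<And>i. L2_fun U (g i)"
  shows "(LINT x|lebesgue_on U. (\<Sum>i\<in>UNIV. \<Sum>j\<in>UNIV. complex_of_real (a x $ i $ j) * weak_deriv U j w x * g i x))
    = (\<Sum>i\<in>UNIV. \<Sum>j\<in>UNIV. pair (mulL (coef a i j) (zext U (weak_deriv U j w))) (zext U (g i)))"
proof -
  have Um: "U \<in> sets lebesgue" using U by simp
  note z = zext_pair_mulL[OF Um bnd H1_weak_deriv(1)[OF U w] g]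
  have "(LINT x|lebesgue_on U. (\<Sum>i\<in>UNIV. \<Sum>j\<in>UNIV. complex_of_real (a x $ i $ j) * weak_deriv U j w x * g i x))
    = (LINT x|lebesgue_on U. (\<Sum>i\<in>UNIV. \<Sum>j\<in>UNIV. coef a i j x * weak_deriv U j w x * g i x))"
    by (simp add: coef_def)
  also have "\<dots> = (\<Sum>i\<in>UNIV. LINT x|lebesgue_on U. (\<Sum>j\<in>UNIV. coef a i j x * weak_deriv U j w x * g i x))"
    by (rule Bochner_Integration.integral_sum) (rule Bochner_Integration.integrable_sum, rule z(2))
  also have "\<dots> = (\<Sum>i\<in>UNIV. \<Sum>j\<in>UNIV. LINT x|lebesgue_on U. coef a i j x * weak_deriv U j w x * g i x)"
    by (rule sum.cong[OF refl]) (rule Bochner_Integration.integral_sum, rule z(2))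
  finally show ?thesis unfolding z(1) .
qed

lemma elliptic_eq_iff:
  assumes bnd: "\<And>i j. ae_bounded (coef a i j) MA" and U: "open U" and w: "H1_fun U w" and h: "L2_fun U h"
  shows "elliptic_eq a U w h \<longleftrightarrow> (\<forall>\<phi>\<in>test_fun U. (\<Sum>i\<in>UNIV. \<Sum>j\<in>UNIV.
    pair (mulL (coef a i j) (zext U (weak_deriv U j w))) (abs_l2 (pd i \<phi>))) = pair (zext U h) (abs_l2 \<phi>))"
  unfolding elliptic_eq_def
proof (rule ball_cong[OF refl])
  fix \<phi> :: "real^3 => complex" assume \<phi>: "\<phi> \<in> test_fun U"
  have Um: "U \<in> sets lebesgue" using U by simp
  note d = test_fun_dir_deriv[OF \<phi>]
  have 1: "(LINT x|lebesgue_on U. (\<Sum>i\<in>UNIV. \<Sum>j\<in>UNIV. complex_of_real (a x $ i $ j) * weak_deriv U j w x * pd i \<phi> x))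
    = (\<Sum>i\<in>UNIV. \<Sum>j\<in>UNIV. pair (mulL (coef a i j) (zext U (weak_deriv U j w))) (abs_l2 (pd i \<phi>)))"
    unfolding coef_form[OF bnd U w L2_fun_test_fun[OF d Um]] zext_test_fun[OF d] ..
  have 2: "(LINT x|lebesgue_on U. h x * \<phi> x) = pair (zext U h) (abs_l2 \<phi>)"
    unfolding zext_pair[OF Um h L2_fun_test_fun[OF \<phi> Um], symmetric] zext_test_fun[OF \<phi>] ..
  show "(LINT x|lebesgue_on U. (\<Sum>i\<in>UNIV. \<Sum>j\<in>UNIV. complex_of_real (a x $ i $ j) * weak_deriv U j w x * pd i \<phi> x))
      = (LINT x|lebesgue_on U. h x * \<phi> x) \<longleftrightarrow> (\<Sum>i\<in>UNIV. \<Sum>j\<in>UNIV.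
    pair (mulL (coef a i j) (zext U (weak_deriv U j w))) (abs_l2 (pd i \<phi>))) = pair (zext U h) (abs_l2 \<phi>)"
    unfolding 1 2 ..
qed

text \<open>\<open>elliptic_op\<close> is an arbitrary choice, but the equation determines its class
  on U, so any known right-hand side may be inserted in Green's formula.\<close>

lemma conormal_deriv_eq:
  assumes bnd: "\<And>i j. ae_bounded (coef a i j) MA" and U: "open U" and w: "H1_fun U w" and v: "H1_fun U v"
    and h: "L2_fun U h" and eq: "elliptic_eq a U w h"
  shows "conormal_deriv a U w v = (\<Sum>i\<in>UNIV. \<Sum>j\<in>UNIV. pair (mulL (coef a i j) (zext U (weak_deriv U j w))) (zext U (weak_deriv U i v)))
    - pair (zext U h) (zext U v)"
proof -
  have Um: "U \<in> sets lebesgue" using U by simp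
  have "L2_fun U (elliptic_op a U w) \<and> elliptic_eq a U w (elliptic_op a U w)"
    unfolding elliptic_op_def by (rule someI[of "%h. L2_fun U h \<and> elliptic_eq a U w h" h]) (use h eq in simp)
  then have h': "L2_fun U (elliptic_op a U w)" "elliptic_eq a U w (elliptic_op a U w)" by simp_all
  have "proj U (zext U (elliptic_op a U w) - zext U h) = 0"
  proof (rule test_functions_separate[OF U])
    fix \<phi> :: "real^3 => complex" assume \<phi>: "\<phi> \<in> test_fun U"
    have "pair (zext U (elliptic_op a U w)) (abs_l2 \<phi>) = pair (zext U h) (abs_l2 \<phi>)"
      using bspec[OF elliptic_eq_iff[OF bnd U w h'(1), THEN iffD1, OF h'(2)] \<phi>]
        bspec[OF elliptic_eq_iff[OF bnd U w h, THEN iffD1, OF eq] \<phi>] by simp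
    then show "pair (zext U (elliptic_op a U w) - zext U h) (abs_l2 \<phi>) = 0"
      by (simp add: bounded_bilinear.diff_left[OF bounded_bilinear_pair])
  qed
  then have z: "zext U (elliptic_op a U w) = zext U h"
    by (simp add: linear_diff[OF bounded_linear.linear[OF bounded_linear_proj[OF Um]]] proj_zext[OF Um h'(1)] proj_zext[OF Um h])
  have Lv: "L2_fun U v" using v by (simp add: H1_fun_def)
  show ?thesis unfolding conormal_deriv_def coef_form[OF bnd U w H1_weak_deriv(1)[OF U v]]
    unfolding zext_pair[OF Um h'(1) Lv, symmetric] z ..
qed

text \<open>The transform is a class in \<open>l2\<close>, and \<open>rep_l2\<close> selects a
  function for it. Pairings with test functions commute with the transform, so the transformed
  gradient is the gradient of the transform; the elliptic equation is the transformed wave equation,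
  tested with functions supported in \<Omega>.\<close>

lemma transform_solution:
  assumes W: "wave_solution a c f (%x. 0) w w'" and f: "is_L2 f" and bnd: "\<And>i j. ae_bounded (coef a i j) MA"
    and q: "ae_bounded (wt c) MC" and \<Omega>: "open \<Omega>"
    and dec: "decay \<delta> (%t. proj \<Omega> (cl w t))" "\<And>j. decay \<delta> (%t. proj \<Omega> (gr w j t))" "decay \<delta> (%t. proj \<Omega> (cl w' t))"
    and \<tau>: "\<bar>Im \<tau>\<bar> < \<delta>"
    and E: "E = cosine_l2 (%t. proj \<Omega> (cl w t)) \<tau>" and G: "G = (%j. cosine_l2 (%t. proj \<Omega> (gr w j t)) \<tau>)"
    and h: "h = (%x. \<tau>\<^sup>2 * of_real (inverse ((c x)\<^sup>2)) * rep_l2 E x)"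
  shows "H1_fun \<Omega> (rep_l2 E)" "zext \<Omega> (rep_l2 E) = E" "zext \<Omega> (weak_deriv \<Omega> j (rep_l2 E)) = G j"
    "L2_fun \<Omega> h" "zext \<Omega> h = cscale (\<tau>\<^sup>2) (mulL (wt c) E)" "elliptic_eq a \<Omega> (rep_l2 E) h"
proof -
  have m: "\<Omega> \<in> sets lebesgue" using \<Omega> by simp
  have pp: "proj \<Omega> (proj \<Omega> u) = proj \<Omega> u" for u by (simp add: proj_proj[OF m m])
  have pE: "proj \<Omega> E = E" unfolding E by (rule proj_cosine_l2[OF m dec(1) \<tau> pp])
  have pG: "proj \<Omega> (G j) = G j" for j unfolding G by (rule proj_cosine_l2[OF m dec(2) \<tau> pp])
  show zE: "zext \<Omega> (rep_l2 E) = E" unfolding zext_proj[OF rep_l2 m] abs_rep_l2 by (rule pE)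
  have wd: "weakly_diff \<Omega> j E (G j)" for j unfolding weakly_diff_def
  proof
    fix \<phi> :: "real^3 => complex" assume \<phi>: "\<phi> \<in> test_fun \<Omega>"
    let ?d = "pd j \<phi>"
    have pt: "pair (proj \<Omega> (cl w t)) (abs_l2 ?d) = - pair (proj \<Omega> (gr w j t)) (abs_l2 \<phi>)" if "t \<ge> 0" for t
    proof -
      have "weakly_diff \<Omega> j (cl w t) (gr w j t)"
        unfolding weakly_diff_def by (rule ballI) (rule bspec[OF wave_weakly_diff[OF W that, unfolded weakly_diff_def] test_fun_UNIV])
      then have "weakly_diff \<Omega> j (proj \<Omega> (cl w t)) (proj \<Omega> (gr w j t))" by (simp add: weakly_diff_proj[OF m])
      then show ?thesis using \<phi> by (simp add: weakly_diff_def)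
    qed
    have "pair E (abs_l2 ?d) = cosine_transform (%t. pair (proj \<Omega> (cl w t)) (abs_l2 ?d)) \<tau>"
      unfolding E by (rule cosine_l2_linear[OF dec(1) \<tau> bounded_linear_pair_left pair_cscale(1)])
    also have "\<dots> = cosine_transform (%t. - pair (proj \<Omega> (gr w j t)) (abs_l2 \<phi>)) \<tau>" by (rule cosine_transform_cong) (rule pt)
    also have "\<dots> = - pair (G j) (abs_l2 \<phi>)"
      unfolding G by (rule cosine_l2_linear[OF dec(2) \<tau> bounded_linear_minus[OF bounded_linear_pair_left], symmetric]) (simp add: pair_cscale)
    finally show "pair E (abs_l2 ?d) = - pair (G j) (abs_l2 \<phi>)" .
  qed
  note H = H1_fun_zextI[OF \<Omega> L2_fun_subset[OF rep_l2 m], of E G, unfolded zE, OF wd]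
  show HE: "H1_fun \<Omega> (rep_l2 E)" by (rule H(1))
  show zG: "zext \<Omega> (weak_deriv \<Omega> j (rep_l2 E)) = G j" for j unfolding H(2) by (rule pG)
  have m1: "is_L2 (%x. wt c x * rep_l2 E x)" by (rule is_L2_mult[OF q rep_l2])
  have heq: "h = (%x. \<tau>\<^sup>2 * (wt c x * rep_l2 E x))" by (simp add: h wt_def mult.assoc)
  have hL: "is_L2 h" unfolding heq by (rule is_L2_cmult[OF m1])
  show hL': "L2_fun \<Omega> h" by (rule L2_fun_subset[OF hL m])
  have "abs_l2 h = cscale (\<tau>\<^sup>2) (mulL (wt c) (abs_l2 (rep_l2 E)))"
    unfolding heq mulL_abs_l2[OF q rep_l2] cscale_abs_l2[OF m1] ..
  then show zh: "zext \<Omega> h = cscale (\<tau>\<^sup>2) (mulL (wt c) E)"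
    unfolding zext_proj[OF hL m] abs_rep_l2 by (simp add: proj_cscale[OF m] proj_mulL[OF m q] pE)
  show "elliptic_eq a \<Omega> (rep_l2 E) h"
    unfolding elliptic_eq_iff[OF bnd \<Omega> HE hL'] zG zh
  proof
    fix \<phi> :: "real^3 => complex" assume \<phi>: "\<phi> \<in> test_fun \<Omega>"
    let ?V = "%i. abs_l2 (pd i \<phi>)"
    have pv: "proj \<Omega> (abs_l2 \<psi>) = abs_l2 \<psi>" if "\<psi> \<in> test_fun \<Omega>" for \<psi>
      using proj_zext[OF m L2_fun_test_fun[OF that m]] by (simp add: zext_test_fun[OF that])
    note T = wave_transform[OF W bnd q m dec \<tau> pv[OF \<phi>] pv[OF test_fun_dir_deriv[OF \<phi>]] refl refl refl]
    have PQ: "pair (mulL (wt c) (cl w' t)) (abs_l2 \<phi>) = - (\<Sum>i\<in>UNIV. pair (\<Sum>j\<in>UNIV. mulL (coef a i j) (integral {0..t} (gr w j))) (?V i))" if "t \<ge> 0" for t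
      using bspec[OF wave_weak_div[OF W f q bnd that, unfolded weak_div_def] test_fun_UNIV[OF \<phi>]] by (simp add: add_eq_0_iff)
    have "cosine_transform (%t. \<Sum>i\<in>UNIV. \<Sum>j\<in>UNIV. pair (mulL (coef a i j) (proj \<Omega> (gr w j t))) (?V i)) \<tau>
      = \<tau>\<^sup>2 * cosine_transform (%t. pair (mulL (wt c) (proj \<Omega> (cl w t))) (abs_l2 \<phi>)) \<tau>"
    proof (rule cosine_transform_wave[OF T(1) T(2) T(3) \<tau> T(4)])
      fix t :: real assume t: "t \<ge> 0"
      show "pair (mulL (wt c) (proj \<Omega> (cl w' t))) (abs_l2 \<phi>) = - integral {0..t} (%t. \<Sum>i\<in>UNIV. \<Sum>j\<in>UNIV. pair (mulL (coef a i j) (proj \<Omega> (gr w j t))) (?V i))"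
        unfolding T(5)[OF t] T(6)[OF t] by (rule PQ[OF t])
    qed
    then show "(\<Sum>i\<in>UNIV. \<Sum>j\<in>UNIV. pair (mulL (coef a i j) (G j)) (?V i)) = pair (cscale (\<tau>\<^sup>2) (mulL (wt c) E)) (abs_l2 \<phi>)"
      unfolding T(7,8) by (simp add: E G pair_cscale)
  qed
qed

lemma cscale_of_real: "cscale (complex_of_real r) u = r *\<^sub>R u"
proof -
  have "cscale (r *\<^sub>R 1) u = r *\<^sub>R cscale 1 u" by (rule bounded_bilinear.scaleR_left[OF bounded_bilinear_cscale])
  moreover have "cscale 1 u = u" by (simp add: cscale_def mulL_one)
  ultimately show ?thesis by (simp add: scaleR_conv_of_real)
qed

lemma zero_trace_subspace: assumes "open \<Omega>" shows "subspace {u. zero_trace \<Omega> u}"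
proof (rule subspaceI)
  show "0 \<in> {u. zero_trace \<Omega> u}" by (simp add: zero_trace_0)
  show "u + v \<in> {u. zero_trace \<Omega> u}" if "u \<in> {u. zero_trace \<Omega> u}" "v \<in> {u. zero_trace \<Omega> u}" for u v
    using zero_trace_add[OF assms] that by simp
  fix c :: real and u :: "l2 \<times> (l2^3)" assume u: "u \<in> {u. zero_trace \<Omega> u}"
  have "(cscale (complex_of_real c) (fst u), \<chi> i. cscale (complex_of_real c) (snd u $ i)) = c *\<^sub>R u"
    unfolding cscale_of_real by (simp add: prod_eq_iff vec_eq_iff)
  then show "c *\<^sub>R u \<in> {u. zero_trace \<Omega> u}" using zero_trace_cscale[OF assms, of u "complex_of_real c"] u by simp
qed

locale decaying_waves = two_waves +
  fixes \<delta> :: real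
  assumes \<delta>: "\<delta> > 0"
    and dec1: "decay \<delta> (%t. proj \<Omega> (cl u1 t))" "\<And>j. decay \<delta> (%t. proj \<Omega> (gr u1 j t))" "decay \<delta> (%t. proj \<Omega> (cl u1' t))"
    and dec2: "decay \<delta> (%t. proj \<Omega> (cl u2 t))" "\<And>j. decay \<delta> (%t. proj \<Omega> (gr u2 j t))" "decay \<delta> (%t. proj \<Omega> (cl u2' t))"
begin

definition E1 where "E1 \<tau> = cosine_l2 (%t. proj \<Omega> (cl u1 t)) \<tau>"
definition E2 where "E2 \<tau> = cosine_l2 (%t. proj \<Omega> (cl u2 t)) \<tau>"
definition G1 where "G1 \<tau> = (%j. cosine_l2 (%t. proj \<Omega> (gr u1 j t)) \<tau>)"
definition G2 where "G2 \<tau> = (%j. cosine_l2 (%t. proj \<Omega> (gr u2 j t)) \<tau>)"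

text \<open>At each time the difference with its gradient, multiplied by the cosine, is in the
  closed subspace of zero-trace pairs; so are the integrals over [0, n] and their limit.\<close>

lemma transform_zero_trace:
  assumes \<tau>: "\<bar>Im \<tau>\<bar> < \<delta>"
  shows "zero_trace \<Omega> (E1 \<tau> - E2 \<tau>, \<chi> i. G1 \<tau> i - G2 \<tau> i)"
proof -
  let ?c = "%t. cos (\<tau> * complex_of_real t)"
  define K where "K t = (cscale (?c t) (proj \<Omega> (D t)), \<chi> i. cscale (?c t) (proj \<Omega> (DG i t)))" for t
  have e: "\<delta> - \<bar>Im \<tau>\<bar> > 0" using \<tau> by simp
  have pd: "proj \<Omega> (u - v) = proj \<Omega> u - proj \<Omega> v" for u v
    by (rule linear_diff[OF bounded_linear.linear[OF bounded_linear_proj[OF \<Omega>(3)]]])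
  have dD: "decay \<delta> (%t. proj \<Omega> (D t))" "decay \<delta> (%t. proj \<Omega> (DG i t))" for i
    unfolding pd by (intro decay_diff dec1 dec2)+
  note dc = decay_cos_cscale[OF dD(1), of \<tau>] decay_cos_cscale[OF dD(2), of \<tau>]
  have Kc: "continuous_on {0..} K" unfolding K_def
    by (intro continuous_on_Pair continuous_on_vec_lambda decay_continuous[OF dc(1)] decay_continuous[OF dc(2)])
  have Kc': "continuous_on {0..real n} K" for n by (rule continuous_on_subset[OF Kc]) auto
  note Ki = integrable_continuous_interval[OF Kc']
  let ?I = "%n. integral {0..real n} K"
  have K0: "zero_trace \<Omega> (K t)" if "t \<ge> 0" for t
    using zero_trace_cscale[OF \<Omega>(1) D_zero_trace[OF that], of "?c t"] by (simp add: K_def)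
  have In: "?I n \<in> {u. zero_trace \<Omega> u}" for n
    by (rule integral_in_closed_subspace[OF Kc' zero_trace_closed zero_trace_subspace[OF \<Omega>(1)]]) (simp add: K0)
  have f: "fst (?I n) = integral {0..real n} (%t. cscale (?c t) (proj \<Omega> (D t)))" for n
    using integral_linear[OF Ki[of n] bounded_linear_fst] by (simp add: o_def K_def)
  have bl: "bounded_linear (%u::l2 \<times> (l2^3). snd u $ i)" for i
    by (rule bounded_linear_compose[OF bounded_linear_vec_nth bounded_linear_snd])
  have s: "snd (?I n) $ i = integral {0..real n} (%t. cscale (?c t) (proj \<Omega> (DG i t)))" for n i
    using integral_linear[OF Ki[of n] bl[of i]] by (simp add: o_def K_def)
  have "improper (%t. cscale (?c t) (proj \<Omega> (D t))) = E1 \<tau> - E2 \<tau>"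
    using cosine_l2_diff[OF dec1(1) dec2(1) \<tau>] unfolding E1_def E2_def pd cosine_l2_def .
  then have lf: "(%n. fst (?I n)) \<longlonglongrightarrow> E1 \<tau> - E2 \<tau>" unfolding f using improper_limit[OF dc(1) e] by simp
  have "improper (%t. cscale (?c t) (proj \<Omega> (DG i t))) = G1 \<tau> i - G2 \<tau> i" for i
    using cosine_l2_diff[OF dec1(2) dec2(2) \<tau>, of i i] unfolding G1_def G2_def pd cosine_l2_def .
  then have ls: "(%n. snd (?I n)) \<longlonglongrightarrow> (\<chi> i. G1 \<tau> i - G2 \<tau> i)"
    by (intro vec_tendstoI) (use improper_limit[OF dc(2) e] s in simp)
  have "(%n. (fst (?I n), snd (?I n))) \<longlonglongrightarrow> (E1 \<tau> - E2 \<tau>, \<chi> i. G1 \<tau> i - G2 \<tau> i)" by (rule tendsto_Pair[OF lf ls])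
  then have "?I \<longlonglongrightarrow> (E1 \<tau> - E2 \<tau>, \<chi> i. G1 \<tau> i - G2 \<tau> i)" by simp
  then have "(E1 \<tau> - E2 \<tau>, \<chi> i. G1 \<tau> i - G2 \<tau> i) \<in> {u. zero_trace \<Omega> u}"
    by (rule closed_sequentially[OF zero_trace_closed In])
  then show ?thesis by simp
qed

theorem transform_transmission_eigenvalue:
  assumes \<tau>: "\<bar>Im \<tau>\<bar> < \<delta>" and nz: "E1 \<tau> \<noteq> 0"
  shows "transmission_eigenvalue a \<Omega> c1 c2 \<tau>"
proof -
  note S1 = transform_solution[OF W1 f(1) bnd q1 \<Omega>(1) dec1 \<tau> E1_def G1_def refl]
  note S2 = transform_solution[OF W2 f(2) bnd q2 \<Omega>(1) dec2 \<tau> E2_def G2_def refl]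
  have nonzero: "\<not> (AE x in lebesgue_on \<Omega>. rep_l2 (E1 \<tau>) x = 0 \<and> rep_l2 (E2 \<tau>) x = 0)"
  proof
    assume "AE x in lebesgue_on \<Omega>. rep_l2 (E1 \<tau>) x = 0 \<and> rep_l2 (E2 \<tau>) x = 0"
    then have "AE x in lebesgue_on \<Omega>. rep_l2 (E1 \<tau>) x = 0" by eventually_elim simp
    then have "zext \<Omega> (rep_l2 (E1 \<tau>)) = zext \<Omega> (%x. 0)"
      using zext_eq_iff[OF \<Omega>(3) L2_fun_subset[OF rep_l2 \<Omega>(3)] L2_fun_subset[OF is_L2_0 \<Omega>(3)]] by simp
    moreover have "zext \<Omega> (%x. 0) = 0" by (simp add: zext_def zero_l2_eq)
    ultimately show False using nz S1(2) by simp
  qed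
  have boundary: "eq_on_boundary \<Omega> (rep_l2 (E1 \<tau>)) (rep_l2 (E2 \<tau>))"
  proof -
    note d = H1_fun_diff[OF \<Omega>(1) S1(1) S2(1)]
    show ?thesis unfolding eq_on_boundary_def has_trace_0_iff[OF \<Omega>(1) d(1)] d(2,3) S1(2,3) S2(2,3)
      by (rule transform_zero_trace[OF \<tau>])
  qed
  have conormal: "conormal_deriv a \<Omega> (rep_l2 (E1 \<tau>)) v = conormal_deriv a \<Omega> (rep_l2 (E2 \<tau>)) v" if v: "H1_fun \<Omega> v" for v
  proof -
    let ?v = "zext \<Omega> v" and ?V = "%i. zext \<Omega> (weak_deriv \<Omega> i v)"
    have Lv: "L2_fun \<Omega> v" using v by (simp add: H1_fun_def)
    have pv: "proj \<Omega> ?v = ?v" by (rule proj_zext[OF \<Omega>(3) Lv])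
    have pV: "proj \<Omega> (?V i) = ?V i" for i by (rule proj_zext[OF \<Omega>(3) H1_weak_deriv(1)[OF \<Omega>(1) v]])
    define p1 where "p1 = (%t. pair (mulL (wt c1) (proj \<Omega> (cl u1 t))) ?v)"
    define p2 where "p2 = (%t. pair (mulL (wt c2) (proj \<Omega> (cl u2 t))) ?v)"
    define P1 where "P1 = (%t. pair (mulL (wt c1) (proj \<Omega> (cl u1' t))) ?v)"
    define P2 where "P2 = (%t. pair (mulL (wt c2) (proj \<Omega> (cl u2' t))) ?v)"
    define Q1 where "Q1 = (%t. \<Sum>i\<in>UNIV. \<Sum>j\<in>UNIV. pair (mulL (coef a i j) (proj \<Omega> (gr u1 j t))) (?V i))"
    define Q2 where "Q2 = (%t. \<Sum>i\<in>UNIV. \<Sum>j\<in>UNIV. pair (mulL (coef a i j) (proj \<Omega> (gr u2 j t))) (?V i))"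
    note T1 = wave_transform[OF W1 bnd q1 \<Omega>(3) dec1 \<tau> pv pV p1_def P1_def Q1_def]
    note T2 = wave_transform[OF W2 bnd q2 \<Omega>(3) dec2 \<tau> pv pV p2_def P2_def Q2_def]
    \<comment> \<open>For a general v each solution alone would contribute its conormal derivative
      at the boundary; only the difference satisfies the tested identity, by
      \<open>interior_equation\<close>.\<close>
    have "cosine_transform (%t. Q1 t - Q2 t) \<tau> = \<tau>\<^sup>2 * cosine_transform (%t. p1 t - p2 t) \<tau>"
    proof (rule cosine_transform_wave[OF decay_diff[OF T1(1) T2(1)] decay_diff[OF T1(2) T2(2)] decay_diff[OF T1(3) T2(3)] \<tau>])
      fix t :: real assume t: "t \<ge> 0"
      show "((%t. p1 t - p2 t) has_vector_derivative P1 t - P2 t) (at t within {0..})"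
        by (intro has_vector_derivative_diff T1(4) T2(4) t)
      have "P1 t - P2 t = pair (H t) ?v"
        unfolding T1(5)[OF t] T2(5)[OF t] H_def by (simp add: bounded_bilinear.diff_left[OF bounded_bilinear_pair])
      moreover have "integral {0..t} (%t. Q1 t - Q2 t) = (\<Sum>i\<in>UNIV. pair (F t i) (?V i))"
      proof -
        have "integral {0..t} (%t. Q1 t - Q2 t) = integral {0..t} Q1 - integral {0..t} Q2"
          by (rule HK_integral_diff[OF decay_integrable[OF T1(3)] decay_integrable[OF T2(3)]]) simp_all
        then show ?thesis unfolding T1(6)[OF t] T2(6)[OF t] F_def
          by (simp add: bounded_bilinear.diff_left[OF bounded_bilinear_pair] sum_subtractf)
      qed
      ultimately show "P1 t - P2 t = - integral {0..t} (%t. Q1 t - Q2 t)"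
        using interior_equation[OF t H1_weak_deriv(2)[OF \<Omega>(1) v]] by (simp add: add_eq_0_iff)
    qed
    then have eq: "cosine_transform Q1 \<tau> - cosine_transform Q2 \<tau> = \<tau>\<^sup>2 * (cosine_transform p1 \<tau> - cosine_transform p2 \<tau>)"
      by (simp add: cosine_transform_diff[OF T1(3) T2(3) \<tau>] cosine_transform_diff[OF T1(1) T2(1) \<tau>])
    have 1: "conormal_deriv a \<Omega> (rep_l2 (E1 \<tau>)) v = cosine_transform Q1 \<tau> - \<tau>\<^sup>2 * cosine_transform p1 \<tau>"
      unfolding conormal_deriv_eq[OF bnd \<Omega>(1) S1(1) v S1(4) S1(6)] S1(3,5) T1(7,8) by (simp add: E1_def G1_def pair_cscale)
    have 2: "conormal_deriv a \<Omega> (rep_l2 (E2 \<tau>)) v = cosine_transform Q2 \<tau> - \<tau>\<^sup>2 * cosine_transform p2 \<tau>"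
      unfolding conormal_deriv_eq[OF bnd \<Omega>(1) S2(1) v S2(4) S2(6)] S2(3,5) T2(7,8) by (simp add: E2_def G2_def pair_cscale)
    show ?thesis unfolding 1 2 using eq by (simp add: algebra_simps)
  qed
  show ?thesis unfolding transmission_eigenvalue_def
    by (intro exI[of _ "rep_l2 (E1 \<tau>)"] exI[of _ "rep_l2 (E2 \<tau>)"] conjI allI impI S1(1) S2(1) nonzero S1(6) S2(6) boundary conormal)
qed

text \<open>Pairing with a fixed \<psi> reduces analytic continuation to scalar holomorphic
  functions. At a limit point of the set inside the strip every such function vanishes identically,
  and injectivity of the cosine transform is evaluated at time 0, where the solution is f1.\<close>

theorem NTE_sparse:
  assumes nz: "\<not> (AE x in lebesgue. f1 x = 0)"
  shows "NTE a \<Omega> c1 c2 \<delta> sparse_in {\<tau>. Im \<tau> \<in> {-\<delta><..<\<delta>}}"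
proof -
  let ?S = "{\<tau>. Im \<tau> \<in> {-\<delta><..<\<delta>}}"
  have S: "?S = {\<tau>. \<bar>Im \<tau>\<bar> < \<delta>}" by auto
  have So: "open ?S" unfolding S by (intro open_Collect_less continuous_intros)
  have Sc: "connected ?S"
  proof -
    have eq: "?S = {\<tau>. Im \<tau> > - \<delta>} \<inter> {\<tau>. Im \<tau> < \<delta>}" by auto
    show ?thesis unfolding eq by (intro convex_connected convex_Int convex_halfspace_Im_gt convex_halfspace_Im_lt)
  qed
  have nl: "\<not> y islimpt NTE a \<Omega> c1 c2 \<delta>" if y: "y \<in> ?S" for y
  proof
    assume lp: "y islimpt NTE a \<Omega> c1 c2 \<delta>"
    have E0: "E1 \<tau> = 0" if "\<tau> \<in> NTE a \<Omega> c1 c2 \<delta>" for \<tau>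
    proof (rule ccontr)
      assume "E1 \<tau> \<noteq> 0"
      moreover have "\<bar>Im \<tau>\<bar> < \<delta>" "\<not> transmission_eigenvalue a \<Omega> c1 c2 \<tau>" using that by (auto simp: NTE_def)
      ultimately show False using transform_transmission_eigenvalue by blast
    qed
    have "pair (proj \<Omega> (cl u1 0)) \<psi> = 0" for \<psi>
    proof -
      let ?p = "%t. pair (proj \<Omega> (cl u1 t)) \<psi>"
      have dp: "decay \<delta> ?p" by (rule decay_bounded_linear[OF bounded_linear_pair_left dec1(1)])
      have hol: "cosine_transform ?p holomorphic_on ?S" unfolding S by (rule cosine_transform_holomorphic[OF dp])
      have z: "cosine_transform ?p \<tau> = 0" if t: "\<tau> \<in> NTE a \<Omega> c1 c2 \<delta>" for \<tau>
      proof -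
        have "\<bar>Im \<tau>\<bar> < \<delta>" using t by (auto simp: NTE_def)
        from cosine_l2_linear[OF dec1(1) this bounded_linear_pair_left pair_cscale(1)] E0[OF t]
        show ?thesis by (simp add: E1_def bounded_bilinear.zero_left[OF bounded_bilinear_pair])
      qed
      \<comment> \<open>The real axis lies in the strip because \<delta> > 0, and it is the
        vanishing there that the injectivity of the transform refers to.\<close>
      have "cosine_transform ?p (complex_of_real \<xi>) = 0" for \<xi>
        by (rule analytic_continuation[OF hol So Sc _ y lp z]) (use \<delta> in \<open>auto simp: NTE_def\<close>)
      then show ?thesis by (rule cosine_transform_inject[OF dp \<delta>]) simp
    qed
    then have "proj \<Omega> (cl u1 0) = 0" by (rule pair_eq_0_imp)
    then have "proj \<Omega> (abs_l2 f1) = 0" using wave_initial(1)[OF W1 f(1) is_L2_0] by simp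
    moreover have "co (abs_l2 f1) = 0" by (rule co_abs_l2_0[OF f(1,3)])
    ultimately have "abs_l2 f1 = 0" by (simp add: co_def)
    then have "AE x in lebesgue. f1 x = 0" unfolding zero_l2_eq abs_l2_eq_iff[OF f(1) is_L2_0] .
    then show False using nz by simp
  qed
  show ?thesis unfolding sparse_in_def
    by (intro ballI exI[of _ ?S] conjI; (assumption | rule So | erule nl))
qed

end

theorem theorem7p1:
  fixes a :: "real^3 \<Rightarrow> real^3^3" and \<Omega> :: "(real^3) set" and R0 R1 \<delta> :: real
    and c1 c2 :: "real^3 \<Rightarrow> real" and f1 f2 :: "real^3 \<Rightarrow> complex"
    and u1 u1' u2 u2' :: "real \<Rightarrow> real^3 \<Rightarrow> complex"
  assumes "Ck_fun 1 a"
    and "\<And>x i j. a x $ i $ j = a x $ j $ i"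
    and "uniformly_elliptic a"
    and "R1 > 0" and "\<And>x. norm x > R1 \<Longrightarrow> a x = mat 1"
    and "lipschitz_domain \<Omega>"
    and "R0 > 0" and "closure \<Omega> \<subseteq> ball 0 R0"
    and "H1_fun UNIV f1" and "H1_fun UNIV f2"
    and "\<not> (AE x in lebesgue. f1 x = 0)" and "\<not> (AE x in lebesgue. f2 x = 0)"
    and "admissible a \<Omega> R0 c1" and "admissible a \<Omega> R0 c2"
    and "ess_supp f1 \<union> ess_supp (\<lambda>x. c1 x - c2 x) \<subseteq> closure \<Omega>"
    and "ess_supp f2 \<union> ess_supp (\<lambda>x. c1 x - c2 x) \<subseteq> closure \<Omega>"
    and "constant_outside \<Omega> c1" and "constant_outside \<Omega> c2"
    and "wave_solution a c1 f1 (\<lambda>x. 0) u1 u1'"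
    and "wave_solution a c2 f2 (\<lambda>x. 0) u2 u2'"
    and "\<And>t. t > 0 \<Longrightarrow> eq_on_boundary \<Omega> (u1 t) (u2 t)"
    and "\<delta> > 0"
    and "\<exists>C>0. exp_decay a \<Omega> c1 R0 C \<delta>" and "\<exists>C>0. exp_decay a \<Omega> c2 R0 C \<delta>"
  shows "NTE a \<Omega> c1 c2 \<delta> sparse_in {\<tau>. Im \<tau> \<in> {-\<delta><..<\<delta>}}"
proof -
  have "\<exists>M. \<forall>i j. ae_bounded (coef a i j) M" by (rule coef_bounded[OF assms(1)]) (rule assms(5))
  then obtain MA where MA: "\<forall>i j. ae_bounded (coef a i j) MA" by (elim exE)
  obtain r1 where r1: "r1 > 0" "AE x in lebesgue. c1 x \<ge> r1" and L1: "Linfty_fun c1"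
    using assms(13) unfolding admissible_def by (elim conjE exE)
  obtain r2 where r2: "r2 > 0" "AE x in lebesgue. c2 x \<ge> r2" and L2: "Linfty_fun c2"
    using assms(14) unfolding admissible_def by (elim conjE exE)
  obtain r where r: "r > 0" "\<forall>u. r * inner u u \<le> inner (mulL (wt c1) u) u" using wt_bounds(2)[OF L1 r1] by (elim exE conjE)
  obtain b where b: "b > 0" "\<forall>x \<xi>. (\<Sum>i\<in>UNIV. \<Sum>j\<in>UNIV. a x $ i $ j * \<xi> $ i * \<xi> $ j) \<ge> b * (norm \<xi>)\<^sup>2"
    using assms(3) unfolding uniformly_elliptic_def by (elim exE conjE)
  have ell: "0 \<le> (\<Sum>i\<in>UNIV. \<Sum>j\<in>UNIV. a x $ i $ j * \<xi> $ i * \<xi> $ j)" for x \<xi>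
  proof -
    have "0 \<le> b * (norm \<xi>)\<^sup>2" using b(1) by simp
    then show ?thesis using spec[OF spec[OF b(2), of x], of \<xi>] by (rule order_trans)
  qed
  have es: "ess_supp f1 \<subseteq> closure \<Omega>" "ess_supp f2 \<subseteq> closure \<Omega>" "ess_supp (\<lambda>x. c1 x - c2 x) \<subseteq> closure \<Omega>"
    using assms(15,16) by simp_all
  have c12: "AE x in lebesgue. x \<notin> \<Omega> \<longrightarrow> c1 x = c2 x"
    using AE_zero_outside[OF assms(6) es(3)] by eventually_elim simp
  have open_\<Omega>: "open \<Omega>" using assms(6) by (simp add: lipschitz_domain_def)
  obtain C1 where C1: "exp_decay a \<Omega> c1 R0 C1 \<delta>" using assms(23) by (elim exE conjE)
  obtain C2 where C2: "exp_decay a \<Omega> c2 R0 C2 \<delta>" using assms(24) by (elim exE conjE)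
  interpret two_waves a \<Omega> c1 c2 f1 f2 u1 u1' u2 u2' MA "inverse (r1\<^sup>2)" "inverse (r2\<^sup>2)" r
  proof
    show "ae_bounded (coef a i j) MA" for i j using MA by simp
    show "a x $ i $ j = a x $ j $ i" for x i j by (rule assms(2))
    show "0 \<le> (\<Sum>i\<in>UNIV. \<Sum>j\<in>UNIV. a x $ i $ j * \<xi> $ i * \<xi> $ j)" for x \<xi> by (rule ell)
    show "ae_bounded (wt c1) (inverse (r1\<^sup>2))" by (rule wt_bounds(1)[OF L1 r1])
    show "ae_bounded (wt c2) (inverse (r2\<^sup>2))" by (rule wt_bounds(1)[OF L2 r2])
    show "r > 0" by (rule r(1))
    show "r * inner u u \<le> inner (mulL (wt c1) u) u" for u using r(2) by simp
    show "lipschitz_domain \<Omega>" by (rule assms(6))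
    show "is_L2 f1" "is_L2 f2" using assms(9,10) by (simp_all add: H1_fun_def)
    show "AE x in lebesgue. x \<notin> \<Omega> \<longrightarrow> f1 x = 0" by (rule AE_zero_outside[OF assms(6) es(1)])
    show "AE x in lebesgue. x \<notin> \<Omega> \<longrightarrow> f2 x = 0" by (rule AE_zero_outside[OF assms(6) es(2)])
    show "AE x in lebesgue. x \<notin> \<Omega> \<longrightarrow> c1 x = c2 x" by (rule c12)
    show "wave_solution a c1 f1 (\<lambda>x. 0) u1 u1'" by (rule assms(19))
    show "wave_solution a c2 f2 (\<lambda>x. 0) u2 u2'" by (rule assms(20))
    show "eq_on_boundary \<Omega> (u1 t) (u2 t)" if "t > 0" for t by (rule assms(21)[OF that])
  qed
  interpret decaying_waves a \<Omega> c1 c2 f1 f2 u1 u1' u2 u2' MA "inverse (r1\<^sup>2)" "inverse (r2\<^sup>2)" r \<delta>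
    by unfold_locales (rule assms(22) exp_decay_proj[OF assms(19) C1 assms(9) es(1) assms(8) open_\<Omega>]
        exp_decay_proj[OF assms(20) C2 assms(10) es(2) assms(8) open_\<Omega>])+
  show ?thesis by (rule NTE_sparse[OF assms(11)])
qed

end
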